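(* Let $\alpha\in(0,1)$, $J\ge J_0$ with $2^J\le n$, and consider the linear inverse problem with $f_0\in B^s_{\infty,\infty}$, a sieve prior $\Pi_\beta$ on $\mathbb R^{2^J}$, the weight sequence $w$, and the Castillo–Nickl band $\mathcal C_w(\hat f_\infty,\hat R_\alpha)$ described in the context. Put $X=\Sigma^{-1/2}\mathrm{diag}\{\kappa_{l,k}:(l,k)\in\mathcal I(J)\}$ and assume that for some $C_1>0$ $$\pi(\beta_0)\ge\sqrt{\det(X^\top X)}\,n^{-C_12^J}\quad\text{and}\quad\phi_{\Pi_\beta}(1/\sqrt n)\le1/2 .$$ Then there exist positive constants $c_1,c_2$ depending only on $C_1$, $K$ and $\{\psi_{l,k}:(l,k)\in\mathcal I_\infty\}$ such that the following hold. For $n\ge2$, $$|\mathbb P(f_0\in\mathcal C_w(\hat f_\infty,\hat R_\alpha))-(1-\alpha)|\le\phi_{\Pi_\beta}\big(c_1\sqrt{2^J\log n}\big)+c_1n^{-c_22^J}+\mathbb P(Y\notin\tilde H_3).$$ In addition, there exist positive constants $c_3,c_4$ depending only on $\alpha$, $K$ and $\{\psi_{l,k}:(l,k)\in\mathcal I_\infty\}$ such that the following hold. Assume that the right-hand side above except $\mathbb P(Y\notin\tilde H_3)$, that is $\phi_{\Pi_\beta}(c_1\sqrt{2^J\log n})+c_1n^{-c_22^J}$, is smaller than $\min\{\alpha/2,(1-\alpha)/2\}$. Then $$\mathbb P(Y\notin\tilde H_3)\le c_3\Big(e^{-c_4J\{J/(\overline\kappa_J\overline w_J)^2\}u_J^2}+n^{-c_22^J}\Big)$$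 for sufficiently large $J$ depending only on $\alpha$, $\{w_l\}$, $K$ and $\{\psi_{l,k}:(l,k)\in\mathcal I_\infty\}$; and, for any $B>0$, the $L^\infty$-diameter of $\mathcal C_w^B(\hat f_\infty,\hat R_\alpha):=\mathcal C_w(\hat f_\infty,\hat R_\alpha)\cap\{f:\|f\|_{B^s_{\infty,\infty}}\le B\}$ satisfies $$\sup_{f,g\in\mathcal C_w^B(\hat f_\infty,\hat R_\alpha)}\|f-g\|_\infty\le c_3\Big(v_J\sqrt{\frac{2^JJ}{\underline\kappa_J^2n}}+2^{-Js}B\Big)$$ with probability at least $1-c_1n^{-c_22^J}$.
   Context: Model: $dY(t)=K(f_0)(t)dt+n^{-1/2}dW(t)$, $t\in[0,1]$, with $K$ a known linear operator and $dW$ canonical white noise. $\mathbb P$ refers to this true distribution; $\|\cdot\|$ is the Euclidean norm and $\|\cdot\|_\infty$ the supremum norm. Wavelets and function space (fixed throughout): $s>0$, $S>s$ an integer, $J_0=J_0(S)$ sufficiently large, $\{\phi_{J_0,k}:0\le k\le2^{J_0}-1\}\cup\{\psi_{l,k}:l\ge J_0,0\le k\le2^l-1\}$ an $S$-regular wavelet basis of $L^2[0,1]$ (Cohen–Daubechies–Vial), with the convention $\psi_{J_0-1,k}:=\phi_{J_0,k}$ for $0\le k\le2^{J_0}-1$. $\langle\cdot,\cdot\rangle$ is the $L^2[0,1]$ inner product. $\|f\|_{B^s_{\infty,\infty}}=\max_{0\le k\le 2^{J_0}-1}|\langle\phi_{J_0,k},f\rangle|+\sup_{l\ge J_0,0\le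 k\le2^l-1}2^{l(s+1/2)}|\langle\psi_{l,k},f\rangle|$ and $B^s_{\infty,\infty}=\{f:\|f\|_{B^s_{\infty,\infty}}<\infty\}$. At level $l=J_0-1$ the index $k$ ranges over $0\le k\le2^{J_0}-1$. $\mathcal I(J)=\{(l,k):J_0\le l\le J-1,0\le k\le2^l-1\}\cup\{(J_0-1,k):0\le k\le2^{J_0}-1\}$ (so $|\mathcal I(J)|=2^J$) and $\mathcal I_\infty=\bigcup_J\mathcal I(J)$. Wavelet–vaguelette decomposition of $K$: $\{\psi_{l,k},v^{(1)}_{l,k},v^{(2)}_{l,k},\kappa_{l,k}:(l,k)\in\mathcal I_\infty\}$, with quasi-singular values $\kappa_{l,k}>0$, $K\psi_{l,k}=\kappa_{l,k}v^{(2)}_{l,k}$, $\langle v^{(1)}_{l,k},v^{(2)}_{l',k'}\rangle=1$ if $(l,k)=(l',k')$ and $0$ otherwise, and $\{v^{(1)}_{l,k}\}$, $\{v^{(2)}_{l,k}\}$ near-orthogonal (i.e. for $i=1,2$, $\|\sum a_{l,k}v^{(i)}_{l,k}\|_{L^2}^2$ is bounded above and below by positive constants times $\sum a_{l,k}^2$). Hence $\tilde Y_{l,k}:=\int v^{(1)}_{l,k}dY=\kappa_{l,k}\langle f_0,\psi_{l,k}\rangle+n^{-1/2}\int v^{(1)}_{l,k}dW$. The problem may be mildly ill-posed ($\kappa_{l,k}\sim2^{-rl}$ for some $r>0$) or severely ill-posed ($\kappa_{l,k}\sim e^{-r2^l}$ for some $r>0$). $\Sigma$ is the $2^J\times2^J$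 covariance matrix of $(\tilde Y_{l,k})_{(l,k)\in\mathcal I(J)}$. Sieve prior and quasi-posterior: $\Pi_\beta(d\beta)=\pi(\beta)d\beta$ on $\mathbb R^{2^J}$ induces a prior on $f$ via $\beta\mapsto\sum_{(l,k)\in\mathcal I(J)}\beta_{l,k}\psi_{l,k}$. $\Pi_\beta(\cdot\mid Y)$ is the quasi-posterior based on the truncated indirect Gaussian sequence model $\tilde Y_{l,k}=\kappa_{l,k}\beta_{l,k}+n^{-1/2}\int v^{(1)}_{l,k}dW$, $(l,k)\in\mathcal I(J)$; i.e. its density is proportional to $\pi(\beta)\exp\{-\tfrac12\|\Sigma^{-1/2}\tilde Y_{\mathcal I(J)}-X\beta\|^2\}$, where $\tilde Y_{\mathcal I(J)}=(\tilde Y_{l,k})_{(l,k)\in\mathcal I(J)}$ and $X=\Sigma^{-1/2}\mathrm{diag}\{\kappa_{l,k}:(l,k)\in\mathcal I(J)\}$. Let $\beta_0=(\langle f_0,\psi_{l,k}\rangle)_{(l,k)\in\mathcal I(J)}$, $B(R)=\{\beta:\|X(\beta-\beta_0)\|\le R\}$, $\phi_{\Pi_\beta}(R)=1-\inf_{\beta,\tilde\beta\in B(R)}\{\pi(\tilde\beta)/\pi(\beta)\}$. Weights: $w=(w_1,w_2,\dots)$ is positive with $\min_{0\le k\le2^l-1}\kappa_{l,k}w_l/\sqrt l\uparrow\infty$ as $l\to\infty$. $\overline w_J=\max_{J_0-1\le l\le J-1}w_l$, $u_J=\inf_{J\le l,0\le k\le2^l-1}\kappa_{l,k}w_l/\sqrt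 l$, $v_J=\sup_{J_0\le l\le J-1,0\le k\le2^l-1}\kappa_{l,k}w_l/\sqrt l$, $\overline\kappa_J=\max_{(l,k)\in\mathcal I(J)}\kappa_{l,k}$, $\underline\kappa_J=\min_{(l,k)\in\mathcal I(J)}\kappa_{l,k}$. It is assumed that $1\le\{J^{1/2}/(\overline\kappa_J\overline w_J)\}u_J\uparrow\infty$ as $J\to\infty$. Band: $\hat f_\infty=\sum_{(l,k)\in\mathcal I_\infty}\psi_{l,k}\kappa_{l,k}^{-1}\int v^{(1)}_{l,k}dY$, i.e. the (possibly generalized) function with $\langle\hat f_\infty,\psi_{l,k}\rangle=\kappa_{l,k}^{-1}\tilde Y_{l,k}$. For a centering $\hat f$ and $R>0$, $\mathcal C_w(\hat f,R)=\{f:\sup_{(l,k)\in\mathcal I_\infty}|\langle f-\hat f,\psi_{l,k}\rangle|/w_l\le R\}$. $\hat R_\alpha$ is such that $\Pi_\beta(\mathcal C_w(\sum_{(l,k)\in\mathcal I(J)}\langle\hat f_\infty,\psi_{l,k}\rangle\psi_{l,k},\hat R_\alpha)\mid Y)=1-\alpha$. Finally $\tilde H_3=\{Y:\sup_{J\le l,0\le k\le2^l-1}|\langle f_0-\hat f_\infty,\psi_{l,k}\rangle|/w_l\le\hat R_\alpha\}$.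
   Formalization: The diameter bound, like the bound on P(Y∉H̃_3), is stated only for sufficiently large J depending on α, {w_l}, K and the wavelets (without this it fails: rescaling w changes v_J but not the band); K is taken to be a bounded linear operator on L²[0,1]. *)

theory Defs
  imports "HOL-Probability.Probability"
begin

section \<open>The space $L^2[0,1]$\<close>

text \<open>Elements of $L^2[0,1]$ are functions on the real line of which only the values on the unit
  interval matter, up to null sets.\<close>

abbreviation leb01 :: "real measure" where
  "leb01 \<equiv> lebesgue_on {0..1}"

definition L2 :: "(real \<Rightarrow> real) set" where
  "L2 = {f. f \<in> borel_measurable leb01 \<and> integrable leb01 (\<lambda>x. (f x)\<^sup>2)}"

definition ip :: "(real \<Rightarrow> real) \<Rightarrow> (real \<Rightarrow> real) \<Rightarrow> real" where
  "ip f g = (LINT x|leb01. f x * g x)"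

definition l2norm :: "(real \<Rightarrow> real) \<Rightarrow> real" where
  "l2norm f = sqrt (ip f f)"

text \<open>The essential supremum does not depend on the representative, and is the supremum norm of the
  continuous representative if there is one.\<close>

definition linfnorm :: "(real \<Rightarrow> real) \<Rightarrow> ereal" where
  "linfnorm f = esssup leb01 (\<lambda>x. ereal \<bar>f x\<bar>)"


section \<open>Boundary-corrected wavelet bases\<close>

definition idx :: "nat \<Rightarrow> nat \<Rightarrow> (nat \<times> nat) set" where
  "idx J0 J = {(l, k). J0 \<le> l \<and> l < J \<and> k < 2 ^ l} \<union> {(l, k). l = J0 - 1 \<and> k < 2 ^ J0}"

definition idx_inf :: "nat \<Rightarrow> (nat \<times> nat) set" where
  "idx_inf J0 = (\<Union>J. idx J0 J)"

definition Ck_on :: "nat \<Rightarrow> real set \<Rightarrow> (real \<Rightarrow> real) \<Rightarrow> bool" where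
  "Ck_on m A f \<longleftrightarrow> (\<exists>D :: nat \<Rightarrow> real \<Rightarrow> real. D 0 = f \<and>
     (\<forall>i<m. \<forall>x\<in>A. (D i has_real_derivative D (Suc i) x) (at x within A)) \<and>
     (\<forall>i\<le>m. continuous_on A (D i)))"

text \<open>A compactly supported orthonormal scaling function \<open>\<phi>\<close> and wavelet \<open>\<theta>\<close> on the real line with
  \<open>N\<close> vanishing moments and the minimal support $[1-N,N]$ (the Daubechies pair), \<open>S\<close> times
  continuously differentiable.\<close>

definition daubechies_pair :: "nat \<Rightarrow> nat \<Rightarrow> (real \<Rightarrow> real) \<Rightarrow> (real \<Rightarrow> real) \<Rightarrow> bool" where
  "daubechies_pair S N \<phi> \<theta> \<longleftrightarrow>
     1 \<le> N \<and> S \<le> N \<and> Ck_on S UNIV \<phi> \<and> Ck_on S UNIV \<theta> \<and>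
     (\<forall>x. x \<notin> {1 - real N..real N} \<longrightarrow> \<phi> x = 0 \<and> \<theta> x = 0) \<and>
     (LINT x|lborel. \<phi> x) = 1 \<and>
     (\<forall>m<N. (LINT x|lborel. x ^ m * \<theta> x) = 0) \<and>
     (\<forall>k::int. (LINT x|lborel. \<phi> x * \<phi> (x - of_int k)) = (if k = 0 then 1 else 0) \<and>
               (LINT x|lborel. \<theta> x * \<theta> (x - of_int k)) = (if k = 0 then 1 else 0) \<and>
               (LINT x|lborel. \<phi> x * \<theta> (x - of_int k)) = 0) \<and>
     (\<exists>h g :: int \<Rightarrow> real. \<forall>x.
        \<phi> x = sqrt 2 * (\<Sum>k = 1 - int N..int N. h k * \<phi> (2 * x - of_int k)) \<and>
        \<theta> x = sqrt 2 * (\<Sum>k = 1 - int N..int N. g k * \<phi> (2 * x - of_int k)))"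

text \<open>The \<open>2 ^ l\<close> functions at resolution level \<open>l\<close>: \<open>N\<close> left edge functions, the dilated translates
  of \<open>\<phi>\<close> supported in the interior, and \<open>N\<close> right edge functions (reflected to live at 0).\<close>

definition edge_dilate :: "nat \<Rightarrow> (real \<Rightarrow> real) \<Rightarrow> (nat \<Rightarrow> real \<Rightarrow> real) \<Rightarrow> (nat \<Rightarrow> real \<Rightarrow> real) \<Rightarrow>
    nat \<Rightarrow> nat \<Rightarrow> real \<Rightarrow> real" where
  "edge_dilate N \<phi> \<phi>L \<phi>R l k x = 2 powr (real l / 2) *
     (if k < N then \<phi>L k (2 ^ l * x)
      else if k < 2 ^ l - N then \<phi> (2 ^ l * x - real k)
      else \<phi>R (2 ^ l - 1 - k) (2 ^ l * (1 - x)))"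

text \<open>\<open>S\<close>-regular Cohen--Daubechies--Vial basis of $L^2[0,1]$ with coarsest level \<open>J0\<close>; the function
  with index \<open>(J0 - 1, k)\<close> is the scaling function $\phi_{J_0,k}$.  The last four clauses say:
  the spaces spanned by the scaling functions are nested and contain the wavelets of the level below,
  the coarsest one contains all polynomials of degree less than \<open>N\<close>, the family is orthonormal, and
  it is complete.\<close>

definition CDV_basis :: "nat \<Rightarrow> nat \<Rightarrow> (nat \<times> nat \<Rightarrow> real \<Rightarrow> real) \<Rightarrow> bool" where
  "CDV_basis S J0 \<psi> \<longleftrightarrow> 2 \<le> J0 \<and> (\<exists>N \<phi> \<theta> \<phi>L \<phi>R \<theta>L \<theta>R T.
     daubechies_pair S N \<phi> \<theta> \<and> 2 * N \<le> 2 ^ J0 \<and>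
     (\<forall>k<N. \<forall>\<eta>\<in>{\<phi>L k, \<phi>R k, \<theta>L k, \<theta>R k}. Ck_on S {0..} \<eta> \<and> (\<forall>x>T. \<eta> x = 0)) \<and>
     (\<forall>k<2 ^ J0. \<forall>x\<in>{0..1}. \<psi> (J0 - 1, k) x = edge_dilate N \<phi> \<phi>L \<phi>R J0 k x) \<and>
     (\<forall>l\<ge>J0. \<forall>k<2 ^ l. \<forall>x\<in>{0..1}. \<psi> (l, k) x = edge_dilate N \<theta> \<theta>L \<theta>R l k x) \<and>
     (\<forall>l\<ge>J0. \<forall>k<2 ^ l. \<forall>\<eta>\<in>{edge_dilate N \<phi> \<phi>L \<phi>R l k, edge_dilate N \<theta> \<theta>L \<theta>R l k}.
        \<exists>c. \<forall>x\<in>{0..1}. \<eta> x = (\<Sum>k'<2 ^ Suc l. c k' * edge_dilate N \<phi> \<phi>L \<phi>R (Suc l) k' x)) \<and>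
     (\<forall>m<N. \<exists>c. \<forall>x\<in>{0..1}. x ^ m = (\<Sum>k<2 ^ J0. c k * edge_dilate N \<phi> \<phi>L \<phi>R J0 k x))) \<and>
     (\<forall>i\<in>idx_inf J0. \<forall>j\<in>idx_inf J0. ip (\<psi> i) (\<psi> j) = (if i = j then 1 else 0)) \<and>
     (\<forall>f\<in>L2. (\<lambda>J. l2norm (\<lambda>x. f x - (\<Sum>i\<in>idx J0 J. ip f (\<psi> i) * \<psi> i x))) \<longlonglongrightarrow> 0)"

definition besov_norm :: "real \<Rightarrow> nat \<Rightarrow> (nat \<times> nat \<Rightarrow> real \<Rightarrow> real) \<Rightarrow> (real \<Rightarrow> real) \<Rightarrow> ereal" where
  "besov_norm s J0 \<psi> f = ereal (MAX k\<in>{..<2 ^ J0}. \<bar>ip (\<psi> (J0 - 1, k)) f\<bar>) +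
     (SUP (l, k)\<in>{(l, k). J0 \<le> l \<and> k < 2 ^ l}.
        ereal (2 powr (real l * (s + 1 / 2)) * \<bar>ip (\<psi> (l, k)) f\<bar>))"

definition besov_space :: "real \<Rightarrow> nat \<Rightarrow> (nat \<times> nat \<Rightarrow> real \<Rightarrow> real) \<Rightarrow> (real \<Rightarrow> real) set" where
  "besov_space s J0 \<psi> = {f \<in> L2. besov_norm s J0 \<psi> f < \<infinity>}"


section \<open>The operator and its wavelet--vaguelette decomposition\<close>

definition L2_operator :: "((real \<Rightarrow> real) \<Rightarrow> real \<Rightarrow> real) \<Rightarrow> bool" where
  "L2_operator K \<longleftrightarrow> (\<forall>f\<in>L2. K f \<in> L2) \<and>
     (\<forall>f\<in>L2. \<forall>g\<in>L2. \<forall>a b. AE x in leb01. K (\<lambda>y. a * f y + b * g y) x = a * K f x + b * K g x) \<and>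
     (\<exists>C. \<forall>f\<in>L2. l2norm (K f) \<le> C * l2norm f)"

definition near_orthogonal :: "nat \<Rightarrow> (nat \<times> nat \<Rightarrow> real \<Rightarrow> real) \<Rightarrow> bool" where
  "near_orthogonal J0 v \<longleftrightarrow> (\<exists>a>0. \<exists>b>0. \<forall>F c. finite F \<and> F \<subseteq> idx_inf J0 \<longrightarrow>
     a * (\<Sum>i\<in>F. (c i)\<^sup>2) \<le> (l2norm (\<lambda>x. \<Sum>i\<in>F. c i * v i x))\<^sup>2 \<and>
     (l2norm (\<lambda>x. \<Sum>i\<in>F. c i * v i x))\<^sup>2 \<le> b * (\<Sum>i\<in>F. (c i)\<^sup>2))"

definition WVD :: "nat \<Rightarrow> (nat \<times> nat \<Rightarrow> real \<Rightarrow> real) \<Rightarrow> ((real \<Rightarrow> real) \<Rightarrow> real \<Rightarrow> real) \<Rightarrow>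
    (nat \<times> nat \<Rightarrow> real \<Rightarrow> real) \<Rightarrow> (nat \<times> nat \<Rightarrow> real \<Rightarrow> real) \<Rightarrow> (nat \<times> nat \<Rightarrow> real) \<Rightarrow> bool" where
  "WVD J0 \<psi> K v1 v2 \<kappa> \<longleftrightarrow>
     (\<forall>i\<in>idx_inf J0. v1 i \<in> L2 \<and> v2 i \<in> L2 \<and> 0 < \<kappa> i \<and>
        (AE x in leb01. K (\<psi> i) x = \<kappa> i * v2 i x)) \<and>
     (\<forall>i\<in>idx_inf J0. \<forall>j\<in>idx_inf J0. ip (v1 i) (v2 j) = (if i = j then 1 else 0)) \<and>
     near_orthogonal J0 v1 \<and> near_orthogonal J0 v2"

definition mildly_ill_posed :: "nat \<Rightarrow> (nat \<times> nat \<Rightarrow> real) \<Rightarrow> bool" where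
  "mildly_ill_posed J0 \<kappa> \<longleftrightarrow> (\<exists>r>0. \<exists>a>0. \<exists>b>0. \<forall>(l, k)\<in>idx_inf J0.
     a * 2 powr (- r * real l) \<le> \<kappa> (l, k) \<and> \<kappa> (l, k) \<le> b * 2 powr (- r * real l))"

definition severely_ill_posed :: "nat \<Rightarrow> (nat \<times> nat \<Rightarrow> real) \<Rightarrow> bool" where
  "severely_ill_posed J0 \<kappa> \<longleftrightarrow> (\<exists>r>0. \<exists>a>0. \<exists>b>0. \<forall>(l, k)\<in>idx_inf J0.
     a * exp (- r * 2 ^ l) \<le> \<kappa> (l, k) \<and> \<kappa> (l, k) \<le> b * exp (- r * 2 ^ l))"


section \<open>The white noise model\<close>

definition normal_law :: "real \<Rightarrow> real \<Rightarrow> real measure" where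
  "normal_law \<mu> \<sigma> = (if \<sigma> = 0 then return borel \<mu> else density lborel (normal_density \<mu> \<sigma>))"

text \<open>Canonical white noise as the isonormal process on $L^2[0,1]$; \<open>W h\<close> is $\int h\,dW$.
  Linearity and the one-dimensional laws determine all joint laws.\<close>

definition white_noise :: "'w measure \<Rightarrow> ((real \<Rightarrow> real) \<Rightarrow> 'w \<Rightarrow> real) \<Rightarrow> bool" where
  "white_noise M W \<longleftrightarrow> prob_space M \<and>
     (\<forall>h\<in>L2. W h \<in> borel_measurable M \<and> distr M borel (W h) = normal_law 0 (l2norm h)) \<and>
     (\<forall>h\<in>L2. \<forall>g\<in>L2. \<forall>a b. AE \<omega> in M. W (\<lambda>x. a * h x + b * g x) \<omega> = a * W h \<omega> + b * W g \<omega>)"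

text \<open>The observation tested against \<open>h\<close>, that is $\int h\,dY$ for $dY = g\,dt + n^{-1/2}dW$.\<close>

definition obs :: "(real \<Rightarrow> real) \<Rightarrow> nat \<Rightarrow> ((real \<Rightarrow> real) \<Rightarrow> 'w \<Rightarrow> real) \<Rightarrow>
    (real \<Rightarrow> real) \<Rightarrow> 'w \<Rightarrow> real" where
  "obs g n W h \<omega> = ip g h + real n powr (- 1 / 2) * W h \<omega>"

definition Ytilde :: "((real \<Rightarrow> real) \<Rightarrow> real \<Rightarrow> real) \<Rightarrow> (nat \<times> nat \<Rightarrow> real \<Rightarrow> real) \<Rightarrow>
    (real \<Rightarrow> real) \<Rightarrow> nat \<Rightarrow> ((real \<Rightarrow> real) \<Rightarrow> 'w \<Rightarrow> real) \<Rightarrow> nat \<times> nat \<Rightarrow> 'w \<Rightarrow> real" where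
  "Ytilde K v1 f0 n W i = obs (K f0) n W (v1 i)"

definition cov_mat :: "'w measure \<Rightarrow> ('i \<Rightarrow> 'w \<Rightarrow> real) \<Rightarrow> 'i \<Rightarrow> 'i \<Rightarrow> real" where
  "cov_mat M Z i j =
     (LINT \<omega>|M. (Z i \<omega> - (LINT \<omega>'|M. Z i \<omega>')) * (Z j \<omega> - (LINT \<omega>'|M. Z j \<omega>')))"


section \<open>Matrices indexed by a finite set\<close>

text \<open>The dimension $2^J$ varies, so vectors and matrices are functions on a finite index set \<open>I\<close>;
  the Euclidean norm of a vector \<open>b\<close> is \<open>L2_set b I\<close>.\<close>

definition mat_vec :: "'i set \<Rightarrow> ('i \<Rightarrow> 'i \<Rightarrow> real) \<Rightarrow> ('i \<Rightarrow> real) \<Rightarrow> 'i \<Rightarrow> real" where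
  "mat_vec I A b i = (\<Sum>j\<in>I. A i j * b j)"

definition mat_mul :: "'i set \<Rightarrow> ('i \<Rightarrow> 'i \<Rightarrow> real) \<Rightarrow> ('i \<Rightarrow> 'i \<Rightarrow> real) \<Rightarrow> 'i \<Rightarrow> 'i \<Rightarrow> real" where
  "mat_mul I A B i j = (\<Sum>k\<in>I. A i k * B k j)"

definition mat_transpose :: "('i \<Rightarrow> 'i \<Rightarrow> real) \<Rightarrow> 'i \<Rightarrow> 'i \<Rightarrow> real" where
  "mat_transpose A i j = A j i"

definition mat_det :: "'i set \<Rightarrow> ('i \<Rightarrow> 'i \<Rightarrow> real) \<Rightarrow> real" where
  "mat_det I A = (\<Sum>p | p permutes I. of_int (sign p) * (\<Prod>i\<in>I. A i (p i)))"

text \<open>\<open>A\<close> is $\Sigma^{-1/2}$, the unique symmetric positive definite matrix whose square is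
  $\Sigma^{-1}$.\<close>

definition is_inv_sqrt :: "'i set \<Rightarrow> ('i \<Rightarrow> 'i \<Rightarrow> real) \<Rightarrow> ('i \<Rightarrow> 'i \<Rightarrow> real) \<Rightarrow> bool" where
  "is_inv_sqrt I Sig A \<longleftrightarrow>
     (\<forall>i\<in>I. \<forall>j\<in>I. A i j = A j i) \<and>
     (\<forall>b. (\<exists>i\<in>I. b i \<noteq> 0) \<longrightarrow> 0 < (\<Sum>i\<in>I. b i * mat_vec I A b i)) \<and>
     (\<forall>i\<in>I. \<forall>j\<in>I. mat_mul I (mat_mul I A A) Sig i j = (if i = j then 1 else 0))"

definition design :: "('i \<Rightarrow> 'i \<Rightarrow> real) \<Rightarrow> ('i \<Rightarrow> real) \<Rightarrow> 'i \<Rightarrow> 'i \<Rightarrow> real" where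
  "design A \<kappa> i j = A i j * \<kappa> j"


section \<open>Prior and quasi-posterior\<close>

definition leb_on_idx :: "'i set \<Rightarrow> ('i \<Rightarrow> real) measure" where
  "leb_on_idx I = (\<Pi>\<^sub>M i\<in>I. lborel)"

definition prior_density :: "'i set \<Rightarrow> (('i \<Rightarrow> real) \<Rightarrow> real) \<Rightarrow> bool" where
  "prior_density I \<pi> \<longleftrightarrow> \<pi> \<in> borel_measurable (leb_on_idx I) \<and>
     (\<forall>\<beta>\<in>space (leb_on_idx I). 0 \<le> \<pi> \<beta>) \<and> (\<integral>\<^sup>+ \<beta>. ennreal (\<pi> \<beta>) \<partial>leb_on_idx I) = 1"

definition beta0 :: "nat \<Rightarrow> (nat \<times> nat \<Rightarrow> real \<Rightarrow> real) \<Rightarrow> nat \<Rightarrow> (real \<Rightarrow> real) \<Rightarrow> nat \<times> nat \<Rightarrow> real" where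
  "beta0 J0 \<psi> J f0 = (\<lambda>i\<in>idx J0 J. ip f0 (\<psi> i))"

definition Bset :: "'i set \<Rightarrow> ('i \<Rightarrow> 'i \<Rightarrow> real) \<Rightarrow> ('i \<Rightarrow> real) \<Rightarrow> real \<Rightarrow> ('i \<Rightarrow> real) set" where
  "Bset I X b0 R = {\<beta> \<in> space (leb_on_idx I). L2_set (mat_vec I X (\<lambda>i. \<beta> i - b0 i)) I \<le> R}"

text \<open>Division by zero is harmless here: if \<open>\<pi> b0 > 0\<close> and \<open>\<pi>\<close> vanishes somewhere on \<open>Bset I X b0 R\<close>,
  the infimum is 0 under any convention.\<close>

definition flatness :: "'i set \<Rightarrow> ('i \<Rightarrow> 'i \<Rightarrow> real) \<Rightarrow> ('i \<Rightarrow> real) \<Rightarrow> (('i \<Rightarrow> real) \<Rightarrow> real) \<Rightarrow> real \<Rightarrow> real" where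
  "flatness I X b0 \<pi> R = 1 - (INF (\<beta>, \<beta>')\<in>Bset I X b0 R \<times> Bset I X b0 R. \<pi> \<beta>' / \<pi> \<beta>)"

text \<open>\<open>y\<close> is the observed vector, \<open>A\<close> is $\Sigma^{-1/2}$ and \<open>X\<close> the design matrix.\<close>

definition quasi_lik :: "'i set \<Rightarrow> ('i \<Rightarrow> 'i \<Rightarrow> real) \<Rightarrow> ('i \<Rightarrow> 'i \<Rightarrow> real) \<Rightarrow> ('i \<Rightarrow> real) \<Rightarrow> ('i \<Rightarrow> real) \<Rightarrow> real" where
  "quasi_lik I A X y \<beta> = exp (- (1 / 2) * (L2_set (\<lambda>i. mat_vec I A y i - mat_vec I X \<beta> i) I)\<^sup>2)"

definition quasi_posterior :: "'i set \<Rightarrow> ('i \<Rightarrow> 'i \<Rightarrow> real) \<Rightarrow> ('i \<Rightarrow> 'i \<Rightarrow> real) \<Rightarrow> (('i \<Rightarrow> real) \<Rightarrow> real) \<Rightarrow>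
    ('i \<Rightarrow> real) \<Rightarrow> ('i \<Rightarrow> real) measure" where
  "quasi_posterior I A X \<pi> y = density (leb_on_idx I) (\<lambda>\<beta>. ennreal (\<pi> \<beta> * quasi_lik I A X y \<beta> /
     (LINT \<beta>'|leb_on_idx I. \<pi> \<beta>' * quasi_lik I A X y \<beta>')))"


section \<open>Weights and bands\<close>

definition wbar :: "nat \<Rightarrow> (nat \<Rightarrow> real) \<Rightarrow> nat \<Rightarrow> real" where
  "wbar J0 w J = (MAX l\<in>{J0 - 1..J - 1}. w l)"

definition uJ :: "(nat \<times> nat \<Rightarrow> real) \<Rightarrow> (nat \<Rightarrow> real) \<Rightarrow> nat \<Rightarrow> real" where
  "uJ \<kappa> w J = (INF (l, k)\<in>{(l, k). J \<le> l \<and> k < 2 ^ l}. \<kappa> (l, k) * w l / sqrt (real l))"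

text \<open>Only meaningful for \<open>J0 < J\<close>, as the supremum is otherwise over the empty set.\<close>

definition vJ :: "nat \<Rightarrow> (nat \<times> nat \<Rightarrow> real) \<Rightarrow> (nat \<Rightarrow> real) \<Rightarrow> nat \<Rightarrow> real" where
  "vJ J0 \<kappa> w J = (SUP (l, k)\<in>{(l, k). J0 \<le> l \<and> l < J \<and> k < 2 ^ l}. \<kappa> (l, k) * w l / sqrt (real l))"

definition kmax :: "nat \<Rightarrow> (nat \<times> nat \<Rightarrow> real) \<Rightarrow> nat \<Rightarrow> real" where
  "kmax J0 \<kappa> J = (MAX i\<in>idx J0 J. \<kappa> i)"

definition kmin :: "nat \<Rightarrow> (nat \<times> nat \<Rightarrow> real) \<Rightarrow> nat \<Rightarrow> real" where
  "kmin J0 \<kappa> J = (MIN i\<in>idx J0 J. \<kappa> i)"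

definition increases_to_infinity :: "nat \<Rightarrow> (nat \<Rightarrow> real) \<Rightarrow> bool" where
  "increases_to_infinity m a \<longleftrightarrow> mono_on {m..} a \<and> filterlim a at_top sequentially"

definition admissible_weights :: "nat \<Rightarrow> (nat \<times> nat \<Rightarrow> real) \<Rightarrow> (nat \<Rightarrow> real) \<Rightarrow> bool" where
  "admissible_weights J0 \<kappa> w \<longleftrightarrow> (\<forall>l\<ge>1. 0 < w l) \<and>
     increases_to_infinity J0 (\<lambda>l. MIN k\<in>{..<2 ^ l}. \<kappa> (l, k) * w l / sqrt (real l)) \<and>
     (\<forall>J\<ge>J0. 1 \<le> sqrt (real J) / (kmax J0 \<kappa> J * wbar J0 w J) * uJ \<kappa> w J) \<and>
     increases_to_infinity J0 (\<lambda>J. sqrt (real J) / (kmax J0 \<kappa> J * wbar J0 w J) * uJ \<kappa> w J)"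

text \<open>The centering of a band may be a generalized function, which enters only through its wavelet
  coefficients \<open>c\<close>.\<close>

definition band :: "nat \<Rightarrow> (nat \<times> nat \<Rightarrow> real \<Rightarrow> real) \<Rightarrow> (nat \<Rightarrow> real) \<Rightarrow> (nat \<times> nat \<Rightarrow> real) \<Rightarrow> real \<Rightarrow>
    (real \<Rightarrow> real) set" where
  "band J0 \<psi> w c R = {f \<in> L2. (SUP (l, k)\<in>idx_inf J0. ereal (\<bar>ip f (\<psi> (l, k)) - c (l, k)\<bar> / w l)) \<le> ereal R}"

definition fhat :: "(nat \<times> nat \<Rightarrow> real) \<Rightarrow> (nat \<times> nat \<Rightarrow> real) \<Rightarrow> nat \<times> nat \<Rightarrow> real" where
  "fhat \<kappa> y i = y i / \<kappa> i"

definition wav_sum :: "(nat \<times> nat \<Rightarrow> real \<Rightarrow> real) \<Rightarrow> (nat \<times> nat) set \<Rightarrow> (nat \<times> nat \<Rightarrow> real) \<Rightarrow> real \<Rightarrow> real" where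
  "wav_sum \<psi> I c x = (\<Sum>i\<in>I. c i * \<psi> i x)"

text \<open>\<open>R\<close> is a credible radius of level \<open>1 - \<alpha>\<close> given the data \<open>y\<close>.\<close>

definition credible_radius :: "nat \<Rightarrow> (nat \<times> nat \<Rightarrow> real \<Rightarrow> real) \<Rightarrow> (nat \<times> nat \<Rightarrow> real) \<Rightarrow> (nat \<Rightarrow> real) \<Rightarrow> nat \<Rightarrow>
    (nat \<times> nat \<Rightarrow> nat \<times> nat \<Rightarrow> real) \<Rightarrow> ((nat \<times> nat \<Rightarrow> real) \<Rightarrow> real) \<Rightarrow> real \<Rightarrow>
    (nat \<times> nat \<Rightarrow> real) \<Rightarrow> real \<Rightarrow> bool" where
  "credible_radius J0 \<psi> \<kappa> w J A \<pi> \<alpha> y R \<longleftrightarrow>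
     measure (quasi_posterior (idx J0 J) A (design A \<kappa>) \<pi> y)
       {\<beta> \<in> space (leb_on_idx (idx J0 J)). wav_sum \<psi> (idx J0 J) \<beta> \<in>
          band J0 \<psi> w (\<lambda>i. ip (wav_sum \<psi> (idx J0 J) (fhat \<kappa> y)) (\<psi> i)) R} = 1 - \<alpha>"

definition H3 :: "nat \<Rightarrow> (nat \<times> nat \<Rightarrow> real \<Rightarrow> real) \<Rightarrow> (nat \<times> nat \<Rightarrow> real) \<Rightarrow> (nat \<Rightarrow> real) \<Rightarrow> (real \<Rightarrow> real) \<Rightarrow>
    'w measure \<Rightarrow> (nat \<times> nat \<Rightarrow> 'w \<Rightarrow> real) \<Rightarrow> ('w \<Rightarrow> real) \<Rightarrow> 'w set" where
  "H3 J \<psi> \<kappa> w f0 M Y R = {\<omega> \<in> space M.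
     (SUP (l, k)\<in>{(l, k). J \<le> l \<and> k < 2 ^ l}.
        ereal (\<bar>ip f0 (\<psi> (l, k)) - fhat \<kappa> (\<lambda>i. Y i \<omega>) (l, k)\<bar> / w l)) \<le> ereal (R \<omega>)}"

end

theory Submission
  imports Defs
begin

text \<open>
  On the levels below \<open>J\<close> the whitened observations satisfy \<open>A Y = X b0 + eps\<close> with a standard Gaussian vector \<open>eps\<close>.  If the
  prior were constant, \<open>X (\<beta> - b0) - eps\<close> would be exactly standard Gaussian under the quasi-posterior.  The posterior law of
  \<open>\<beta> - fhat\<close> would then coincide with the sampling law of \<open>fhat - b0\<close> up to sign, and the credible radius would be the
  \<open>1 - \<alpha>\<close> quantile of the statistic \<open>T\<close>, the weighted supremum error of \<open>fhat\<close> on these levels.  The truth lies in the band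
  iff \<open>T\<close> is at most the radius and the corresponding inequalities hold on the levels from \<open>J\<close> on, which is the event \<open>H3\<close>.
  The coverage error has three sources: the oscillation of the prior density on a ball, the masses outside that ball, and the
  failure of \<open>H3\<close>.

  The Gaussian approximation is \<open>quasi_posterior_close\<close>.  The posterior is a Gaussian law tilted by the prior density,
  and \<open>tilted_measure_close\<close> bounds the effect of the tilt by the flatness with factor one.  The posterior mass outside the
  ball is small relative to the evidence, and \<open>evidence_lower_bound\<close> shows that the evidence is at least a power
  \<open>n powr (- const 2 ^ J)\<close>: the determinant in the hypothesis on the prior compensates the volume of the small ball, up to a
  factor that near-orthogonality of the vaguelettes controls.  A ball radius of order \<open>sqrt (2 ^ J ln n)\<close>, with a constant
  large compared with that exponent, makes all masses outside of order \<open>n powr (- 2 ^ J)\<close>, so \<open>c2 = 1\<close> works.  The law of \<open>eps\<close>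
  is found from characteristic functions in \<open>distr_eps\<close>.  For this the uniqueness theorem on the line is lifted to boxes one
  coordinate at a time (\<open>partial_box_uniqueness\<close>).

  The radius depends on the same data as \<open>T\<close>.  This does not matter: \<open>credible_radius_quantile\<close> shows that, outside an event of small
  probability, the distribution function of \<open>T\<close> at the radius is close to \<open>1 - \<alpha>\<close>, and \<open>coverage_of_approximate_quantile\<close> turns
  this into a statement on the event \<open>T \<le> Rhat\<close> without any independence.

  The remaining claims need two-sided bounds for the radius, that is, for quantiles of \<open>T\<close>.  From below, \<open>white_noise_small_ball\<close>
  shows that \<open>2 ^ J\<close> coordinates of the noise are rarely all below a multiple of \<open>sqrt J\<close>; biorthogonality provides just enough
  independence.  Hence the radius is at least of order \<open>sqrt J / (sqrt n kmax wbar)\<close>, and a union bound over the levels beyond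
  \<open>J\<close> gives the bound for the complement of \<open>H3\<close> (\<open>H3_complement_bound\<close>).  From above, the radius is at most \<open>D / sqrt n\<close> with \<open>D\<close>
  depending on the weights (\<open>uniform_tail_radius\<close>).  For the diameter, \<open>D\<close> must not survive in the constant.  Charging level \<open>J - 1\<close> to
  the Besov ball leaves only weights below that level in the band part (\<open>band_besov_diameter\<close>), and \<open>D\<close> is dominated by the rate
  \<open>weight_rate\<close> at \<open>J - 1\<close>, which tends to infinity (\<open>diameter_bound\<close>).
\<close>

section \<open>Determinants of matrices with a finite index set\<close>

text \<open>Composition with the transposition of \<open>a\<close> and \<open>b\<close> flips the sign of a permutation and leaves the product unchanged,
  so the sum equals its own negative.\<close>

lemma mat_det_rows_equal:
  assumes I: "finite I" and g: "a \<in> I" "b \<in> I" "a \<noteq> b" "g a = g b"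
  shows "(\<Sum>p | p permutes I. real_of_int (sign p) * (\<Prod>i\<in>I. B (g i) (p i))) = 0"
proof -
  let ?t = "Transposition.transpose a b"
  let ?P = "{p. p permutes I}"
  let ?D = "\<Sum>p\<in>?P. real_of_int (sign p) * (\<Prod>i\<in>I. B (g i) (p i))"
  have t: "?t permutes I" by (rule permutes_swap_id[OF g(1,2)])
  have tt: "?t \<circ> ?t = id" by (rule transpose_comp_involutory)
  have bij: "bij_betw (\<lambda>p. p \<circ> ?t) ?P ?P"
    by (rule bij_betwI[where g="\<lambda>p. p \<circ> ?t"])
      (simp_all add: permutes_compose[OF t] comp_assoc tt)
  have "?D = (\<Sum>p\<in>?P. real_of_int (sign (p \<circ> ?t)) * (\<Prod>i\<in>I. B (g i) ((p \<circ> ?t) i)))"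
    by (rule sum.reindex_bij_betw[OF bij, symmetric])
  also have "\<dots> = (\<Sum>p\<in>?P. - (real_of_int (sign p) * (\<Prod>i\<in>I. B (g i) (p i))))"
  proof (rule sum.cong[OF refl])
    fix p assume p: "p \<in> ?P"
    then have "permutation p" using I by (auto simp: permutation_permutes)
    then have s: "sign (p \<circ> ?t) = - sign p"
      using g(3) sign_compose[OF \<open>permutation p\<close> permutation_swap_id[of a b]] by (simp add: sign_swap_id)
    have "(\<Prod>i\<in>I. B (g i) ((p \<circ> ?t) i)) = (\<Prod>i\<in>I. B (g (?t i)) ((p \<circ> ?t) (?t i)))"
      using prod.permute[OF t, of "\<lambda>i. B (g i) ((p \<circ> ?t) i)"] unfolding o_def .
    also have "\<dots> = (\<Prod>i\<in>I. B (g i) (p i))"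
    proof (rule prod.cong[OF refl])
      fix i
      have "g (?t i) = g i" using g(4)
        by (cases "i = a \<or> i = b") (auto simp: transpose_apply_other)
      then show "B (g (?t i)) ((p \<circ> ?t) (?t i)) = B (g i) (p i)" by simp
    qed
    finally show "real_of_int (sign (p \<circ> ?t)) * (\<Prod>i\<in>I. B (g i) ((p \<circ> ?t) i))
        = - (real_of_int (sign p) * (\<Prod>i\<in>I. B (g i) (p i)))"
      by (simp add: s)
  qed
  also have "\<dots> = - ?D" by (rule sum_negf)
  finally have "?D = - ?D" .
  moreover have "x = - x \<Longrightarrow> x = 0" for x :: real by simp
  ultimately show ?thesis by blast
qed

lemma mat_det_permute_rows:
  assumes I: "finite I" and q: "q permutes I"
  shows "(\<Sum>p | p permutes I. real_of_int (sign p) * (\<Prod>i\<in>I. B (q i) (p i)))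
    = real_of_int (sign q) * mat_det I B"
proof -
  let ?P = "{p. p permutes I}"
  have bij: "bij_betw (\<lambda>p. p \<circ> q) ?P ?P"
    by (rule bij_betwI[where g="\<lambda>p. p \<circ> inv q"])
      (simp_all add: permutes_compose[OF q] permutes_compose[OF permutes_inv[OF q]] comp_assoc
        permutes_inv_o[OF q])
  have pq: "permutation q" using I q by (auto simp: permutation_permutes)
  have "(\<Sum>p\<in>?P. real_of_int (sign p) * (\<Prod>i\<in>I. B (q i) (p i)))
      = (\<Sum>p\<in>?P. real_of_int (sign (p \<circ> q)) * (\<Prod>i\<in>I. B (q i) ((p \<circ> q) i)))"
    by (rule sum.reindex_bij_betw[OF bij, symmetric])
  also have "\<dots> = (\<Sum>p\<in>?P. real_of_int (sign q) * (real_of_int (sign p) * (\<Prod>i\<in>I. B i (p i))))"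
  proof (rule sum.cong[OF refl])
    fix p assume p: "p \<in> ?P"
    then have "permutation p" using I by (auto simp: permutation_permutes)
    then have s: "sign (p \<circ> q) = sign p * sign q" using pq by (simp add: sign_compose)
    have "(\<Prod>i\<in>I. B (q i) ((p \<circ> q) i)) = (\<Prod>i\<in>I. B i (p i))"
      using prod.permute[OF q, of "\<lambda>i. B i (p i)"] by (simp add: o_def)
    then show "real_of_int (sign (p \<circ> q)) * (\<Prod>i\<in>I. B (q i) ((p \<circ> q) i))
        = real_of_int (sign q) * (real_of_int (sign p) * (\<Prod>i\<in>I. B i (p i)))"
      by (simp add: s)
  qed
  finally show ?thesis by (simp add: mat_det_def sum_distrib_left)
qed

text \<open>Expanding the entries of the product turns the Leibniz sum into a sum over all maps \<open>g\<close> from \<open>I\<close> to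
  itself of the determinant of \<open>B\<close> with rows chosen by \<open>g\<close>.  A map that is not injective selects a row twice and contributes
  nothing; a permutation contributes its sign times the determinant of \<open>B\<close>.\<close>

lemma mat_det_mul:
  assumes I: "finite I"
  shows "mat_det I (mat_mul I A B) = mat_det I A * mat_det I B"
proof -
  let ?P = "{p. p permutes I}"
  let ?G = "I \<rightarrow>\<^sub>E I"
  let ?D = "\<lambda>g. \<Sum>p\<in>?P. real_of_int (sign p) * (\<Prod>i\<in>I. B (g i) (p i))"
  have "mat_det I (mat_mul I A B)
      = (\<Sum>p\<in>?P. real_of_int (sign p) * (\<Sum>g\<in>?G. \<Prod>i\<in>I. A i (g i) * B (g i) (p i)))"
    unfolding mat_det_def mat_mul_def using I by (subst prod_sum_PiE) auto
  also have "\<dots> = (\<Sum>g\<in>?G. (\<Prod>i\<in>I. A i (g i)) * ?D g)"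
    by (simp add: sum_distrib_left prod.distrib mult.left_commute sum.swap[of _ ?G ?P])
  also have "\<dots> = (\<Sum>g\<in>(\<lambda>q. restrict q I) ` ?P. (\<Prod>i\<in>I. A i (g i)) * ?D g)"
  proof (rule sum.mono_neutral_right)
    show "finite ?G" using I by (simp add: finite_PiE)
    show "(\<lambda>q. restrict q I) ` ?P \<subseteq> ?G" by (auto simp: permutes_in_image)
    show "\<forall>g\<in>?G - (\<lambda>q. restrict q I) ` ?P. (\<Prod>i\<in>I. A i (g i)) * ?D g = 0"
    proof
      fix g assume g: "g \<in> ?G - (\<lambda>q. restrict q I) ` ?P"
      have "\<not> inj_on g I"
      proof
        assume inj: "inj_on g I"
        define q where "q = (\<lambda>i. if i \<in> I then g i else i)"
        have "g ` I \<subseteq> I" using g by auto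
        then have "g ` I = I" using inj I by (simp add: card_image card_subset_eq)
        then have "bij_betw q I I" using inj by (simp add: bij_betw_def q_def cong: inj_on_cong)
        then have "q permutes I" by (rule bij_imp_permutes) (simp add: q_def)
        moreover have "g = restrict q I" using g by (auto simp: q_def fun_eq_iff PiE_def extensional_def)
        ultimately show False using g by auto
      qed
      then obtain a b where "a \<in> I" "b \<in> I" "a \<noteq> b" "g a = g b" by (auto simp: inj_on_def)
      then show "(\<Prod>i\<in>I. A i (g i)) * ?D g = 0" using mat_det_rows_equal[OF I, of a b g B] by simp
    qed
  qed
  also have "\<dots> = (\<Sum>q\<in>?P. (\<Prod>i\<in>I. A i (q i)) * ?D q)"
  proof (subst sum.reindex)
    show "inj_on (\<lambda>q. restrict q I) ?P"
    proof (rule inj_onI)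
      fix p q assume pq: "p \<in> ?P" "q \<in> ?P" "restrict p I = restrict q I"
      show "p = q"
      proof
        fix i show "p i = q i"
          using pq by (cases "i \<in> I") (metis restrict_apply', metis mem_Collect_eq permutes_not_in)
      qed
    qed
    show "(\<Sum>q\<in>?P. ((\<lambda>g. (\<Prod>i\<in>I. A i (g i)) * ?D g) \<circ> (\<lambda>q. restrict q I)) q) = (\<Sum>q\<in>?P. (\<Prod>i\<in>I. A i (q i)) * ?D q)"
      by (intro sum.cong refl) (simp add: o_def)
  qed
  also have "\<dots> = (\<Sum>q\<in>?P. (real_of_int (sign q) * (\<Prod>i\<in>I. A i (q i))) * mat_det I B)"
    by (intro sum.cong refl) (simp add: mat_det_permute_rows[OF I])
  also have "\<dots> = mat_det I A * mat_det I B"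
    by (simp add: mat_det_def sum_distrib_right)
  finally show ?thesis .
qed

lemma mat_det_cong:
  assumes "\<And>i j. i \<in> I \<Longrightarrow> j \<in> I \<Longrightarrow> A i j = B i j"
  shows "mat_det I A = mat_det I B"
  unfolding mat_det_def
  by (intro sum.cong prod.cong refl arg_cong2[where f="(*)"]) (auto simp: assms permutes_in_image)

lemma mat_det_identity:
  assumes "finite I"
  shows "mat_det I (\<lambda>i j. if i = j then 1 else 0) = 1"
proof -
  let ?f = "\<lambda>p. real_of_int (sign p) * (\<Prod>i\<in>I. if i = p i then 1 else (0::real))"
  have "mat_det I (\<lambda>i j. if i = j then 1 else 0) = (\<Sum>p\<in>{p. p permutes I}. ?f p)"
    by (simp add: mat_det_def)
  also have "\<dots> = (\<Sum>p\<in>{id}. ?f p)"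
  proof (rule sum.mono_neutral_right)
    show "finite {p. p permutes I}" using assms by (rule finite_permutations)
    show "{id} \<subseteq> {p. p permutes I}" by (simp add: permutes_id)
    show "\<forall>p\<in>{p. p permutes I} - {id}. ?f p = 0"
    proof
      fix p assume p: "p \<in> {p. p permutes I} - {id}"
      then obtain i where "p i \<noteq> i" by (auto simp: fun_eq_iff)
      moreover from this p have "i \<in> I" by (auto simp: permutes_not_in)
      ultimately have "(\<Prod>i\<in>I. if i = p i then 1 else (0::real)) = 0"
        using assms by (intro prod_zero) (auto intro!: bexI[of _ i])
      then show "?f p = 0" by simp
    qed
  qed
  also have "\<dots> = 1" by simp
  finally show ?thesis .
qed

text \<open>A crude replacement for Hadamard's inequality.  The factor \<open>fact (card I)\<close> is harmless where this is
  used, because there the entries of the matrix are of order \<open>1 / card I\<close>.\<close>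

lemma mat_det_bound:
  assumes I: "finite I" and B: "\<And>i j. i \<in> I \<Longrightarrow> j \<in> I \<Longrightarrow> \<bar>B i j\<bar> \<le> m"
  shows "\<bar>mat_det I B\<bar> \<le> fact (card I) * m ^ card I"
proof -
  have "\<bar>mat_det I B\<bar> \<le> (\<Sum>p | p permutes I. \<bar>real_of_int (sign p) * (\<Prod>i\<in>I. B i (p i))\<bar>)"
    unfolding mat_det_def by (rule sum_abs)
  also have "\<dots> \<le> (\<Sum>p | p permutes I. m ^ card I)"
  proof (rule sum_mono)
    fix p assume p: "p \<in> {p. p permutes I}"
    have "\<bar>real_of_int (sign p) * (\<Prod>i\<in>I. B i (p i))\<bar> = (\<Prod>i\<in>I. \<bar>B i (p i)\<bar>)"
      by (simp add: abs_mult abs_prod sign_def)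
    also have "\<dots> \<le> (\<Prod>i\<in>I. m)"
      using p by (intro prod_mono) (auto simp: permutes_in_image intro: B)
    finally show "\<bar>real_of_int (sign p) * (\<Prod>i\<in>I. B i (p i))\<bar> \<le> m ^ card I" by simp
  qed
  also have "\<dots> = fact (card I) * m ^ card I"
    using card_permutations[OF refl I] by simp
  finally show ?thesis .
qed

lemma mat_det_scale:
  assumes "finite I"
  shows "mat_det I (\<lambda>i j. c i * B i j * e j) = (\<Prod>i\<in>I. c i) * (\<Prod>i\<in>I. e i) * mat_det I B"
proof -
  have "(\<Prod>i\<in>I. c i * B i (p i) * e (p i)) = (\<Prod>i\<in>I. c i) * (\<Prod>i\<in>I. e i) * (\<Prod>i\<in>I. B i (p i))"
    if "p permutes I" for p
    using prod.permute[OF that, of e, symmetric] by (simp add: prod.distrib o_def)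
  then show ?thesis
    unfolding mat_det_def sum_distrib_left by (intro sum.cong refl) (simp add: mult.left_commute)
qed

section \<open>Joint characteristic functions and box probabilities\<close>

text \<open>Normalised to total mass one, the weights \<open>f1\<close> and \<open>f2\<close> give two new probability measures under which
  \<open>Z1\<close> and \<open>Z2\<close> have the same characteristic function, so that Levy's uniqueness theorem on the real line applies.
  The bounds on the weights keep the normalising constant positive and everything integrable.\<close>

lemma tilted_Levy_uniqueness:
  fixes Z1 f1 :: "'a \<Rightarrow> real" and Z2 f2 :: "'b \<Rightarrow> real"
  assumes M1: "prob_space M1" and M2: "prob_space M2"
    and meas[measurable]: "Z1 \<in> borel_measurable M1" "f1 \<in> borel_measurable M1"
      "Z2 \<in> borel_measurable M2" "f2 \<in> borel_measurable M2"
    and f1: "\<And>\<omega>. 1 \<le> f1 \<omega> \<and> f1 \<omega> \<le> 3" and f2: "\<And>\<omega>. 1 \<le> f2 \<omega> \<and> f2 \<omega> \<le> 3"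
    and char: "\<And>t. (\<integral>\<omega>. iexp (t * Z1 \<omega>) * complex_of_real (f1 \<omega>) \<partial>M1)
      = (\<integral>\<omega>. iexp (t * Z2 \<omega>) * complex_of_real (f2 \<omega>) \<partial>M2)"
    and A[measurable]: "A \<in> sets borel"
  shows "(\<integral>\<omega>. indicator A (Z1 \<omega>) * f1 \<omega> \<partial>M1) = (\<integral>\<omega>. indicator A (Z2 \<omega>) * f2 \<omega> \<partial>M2)"
proof -
  define m where "m = (\<integral>\<omega>. f1 \<omega> \<partial>M1)"
  have m2: "m = (\<integral>\<omega>. f2 \<omega> \<partial>M2)"
    using char[of 0] by (simp add: m_def integral_complex_of_real)
  let ?N = "\<lambda>M Z f. distr (density M (\<lambda>\<omega>. ennreal (f \<omega> / m))) borel Z"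
  have *: "real_distribution (?N M Z f) \<and> char (?N M Z f) t = (\<integral>\<omega>. iexp (t * Z \<omega>) * complex_of_real (f \<omega>) \<partial>M) / m
      \<and> measure (?N M Z f) A = (\<integral>\<omega>. indicator A (Z \<omega>) * f \<omega> \<partial>M) / m \<and> 0 < m"
    if M: "prob_space M" and [measurable]: "Z \<in> borel_measurable M" "f \<in> borel_measurable M"
      and f: "\<And>\<omega>. 1 \<le> f \<omega> \<and> f \<omega> \<le> 3" and mm: "m = (\<integral>\<omega>. f \<omega> \<partial>M)" for M :: "'c measure" and Z f t
  proof -
    interpret prob_space M by fact
    have fnn[simp]: "0 \<le> f \<omega>" "\<bar>f \<omega>\<bar> \<le> 3" "f \<omega> \<le> 3" for \<omega> using f[of \<omega>] by auto
    have fi: "integrable M f" by (rule integrable_const_bound[of _ 3]) auto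
    have "1 \<le> m" unfolding mm using f fi integral_mono[of M "\<lambda>_. 1" f] by (auto simp: prob_space)
    then have m0: "0 < m" by simp
    have nn: "0 \<le> f \<omega> / m" for \<omega> using m0 by simp
    have "emeasure (density M (\<lambda>\<omega>. ennreal (f \<omega> / m))) (space M) = (\<integral>\<^sup>+\<omega>. ennreal (f \<omega> / m) \<partial>M)"
      by (subst emeasure_density) (auto intro!: nn_integral_cong)
    also have "\<dots> = ennreal (\<integral>\<omega>. f \<omega> / m \<partial>M)"
      using fi nn by (intro nn_integral_eq_integral) auto
    also have "\<dots> = 1" using m0 mm by simp
    finally have p: "prob_space (density M (\<lambda>\<omega>. ennreal (f \<omega> / m)))" by (intro prob_spaceI) simp
    then interpret D: prob_space "density M (\<lambda>\<omega>. ennreal (f \<omega> / m))" .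
    have "prob_space (?N M Z f)" by (rule D.prob_space_distr) simp
    then have rd: "real_distribution (?N M Z f)"
      by (simp add: real_distribution_def real_distribution_axioms_def)
    have ch: "char (?N M Z f) t = (\<integral>\<omega>. iexp (t * Z \<omega>) * complex_of_real (f \<omega>) \<partial>M) / m"
      unfolding char_def
      by (subst integral_distr, simp, simp, subst integral_density)
        (use nn in \<open>simp_all add: scaleR_conv_of_real mult.commute\<close>)
    have "measure (?N M Z f) A = (\<integral>x. indicator A x \<partial>?N M Z f)" by simp
    also have "\<dots> = (\<integral>\<omega>. indicator A (Z \<omega>) * f \<omega> \<partial>M) / m"
      by (subst integral_distr, simp, simp, subst integral_density)
        (use nn in \<open>simp_all add: mult.commute\<close>)
    finally show ?thesis using rd ch m0 by blast
  qed
  note N1 = *[OF M1 meas(1,2) f1 m_def] and N2 = *[OF M2 meas(3,4) f2 m2]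
  have "?N M1 Z1 f1 = ?N M2 Z2 f2"
  proof (rule Levy_uniqueness)
    show "char (?N M1 Z1 f1) = char (?N M2 Z2 f2)" using N1 N2 char by (simp add: fun_eq_iff)
  qed (use N1 N2 in auto)
  then have "measure (?N M1 Z1 f1) A = measure (?N M2 Z2 f2) A" by simp
  then show ?thesis using N1[of 0] N2[of 0] by simp
qed

text \<open>Signed weights are reduced to positive ones: \<open>2 + g\<close> has values between 1 and 3, and the
  contribution of the constant 2 is known from the unweighted identity.\<close>

lemma weighted_Levy_uniqueness:
  fixes Z1 g1 :: "'a \<Rightarrow> real" and Z2 g2 :: "'b \<Rightarrow> real"
  assumes M1: "prob_space M1" and M2: "prob_space M2"
    and meas[measurable]: "Z1 \<in> borel_measurable M1" "g1 \<in> borel_measurable M1"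
      "Z2 \<in> borel_measurable M2" "g2 \<in> borel_measurable M2"
    and g1: "\<And>\<omega>. \<bar>g1 \<omega>\<bar> \<le> 1" and g2: "\<And>\<omega>. \<bar>g2 \<omega>\<bar> \<le> 1"
    and char: "\<And>t. (\<integral>\<omega>. iexp (t * Z1 \<omega>) \<partial>M1) = (\<integral>\<omega>. iexp (t * Z2 \<omega>) \<partial>M2)"
    and charg: "\<And>t. (\<integral>\<omega>. iexp (t * Z1 \<omega>) * complex_of_real (g1 \<omega>) \<partial>M1)
      = (\<integral>\<omega>. iexp (t * Z2 \<omega>) * complex_of_real (g2 \<omega>) \<partial>M2)"
    and A[measurable]: "A \<in> sets borel"
  shows "(\<integral>\<omega>. indicator A (Z1 \<omega>) * g1 \<omega> \<partial>M1) = (\<integral>\<omega>. indicator A (Z2 \<omega>) * g2 \<omega> \<partial>M2)"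
proof -
  have ci: "(\<integral>\<omega>. iexp (t * Z \<omega>) * complex_of_real (2 + g \<omega>) \<partial>M)
      = 2 * (\<integral>\<omega>. iexp (t * Z \<omega>) \<partial>M) + (\<integral>\<omega>. iexp (t * Z \<omega>) * complex_of_real (g \<omega>) \<partial>M)"
    and ri: "(\<integral>\<omega>. indicator A (Z \<omega>) * (2 + g \<omega>) \<partial>M)
      = 2 * (\<integral>\<omega>. indicator A (Z \<omega>) * 1 \<partial>M) + (\<integral>\<omega>. indicator A (Z \<omega>) * g \<omega> \<partial>M)"
    if M: "prob_space M" and [measurable]: "Z \<in> borel_measurable M" "g \<in> borel_measurable M"
      and g: "\<And>\<omega>. \<bar>g \<omega>\<bar> \<le> 1" for M :: "'c measure" and Z g t
  proof -
    interpret prob_space M by fact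
    have i1: "integrable M (\<lambda>\<omega>. iexp (t * Z \<omega>))" by (rule integrable_const_bound[of _ 1]) auto
    have i2: "integrable M (\<lambda>\<omega>. iexp (t * Z \<omega>) * complex_of_real (g \<omega>))"
      by (rule integrable_const_bound[of _ 1]) (auto simp: norm_mult g)
    have i3: "integrable M (\<lambda>\<omega>. indicator A (Z \<omega>) * g \<omega>)"
      by (rule integrable_const_bound[of _ 1]) (auto simp: g split: split_indicator)
    have i4: "integrable M (\<lambda>\<omega>. indicator A (Z \<omega>) :: real)"
      by (rule integrable_const_bound[of _ 1]) auto
    have "(\<integral>\<omega>. iexp (t * Z \<omega>) * complex_of_real (2 + g \<omega>) \<partial>M)
      = (\<integral>\<omega>. 2 * iexp (t * Z \<omega>) + iexp (t * Z \<omega>) * complex_of_real (g \<omega>) \<partial>M)"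
      by (simp add: algebra_simps)
    also have "\<dots> = 2 * (\<integral>\<omega>. iexp (t * Z \<omega>) \<partial>M) + (\<integral>\<omega>. iexp (t * Z \<omega>) * complex_of_real (g \<omega>) \<partial>M)"
      using i1 i2 by (subst Bochner_Integration.integral_add) auto
    finally show "(\<integral>\<omega>. iexp (t * Z \<omega>) * complex_of_real (2 + g \<omega>) \<partial>M)
      = 2 * (\<integral>\<omega>. iexp (t * Z \<omega>) \<partial>M) + (\<integral>\<omega>. iexp (t * Z \<omega>) * complex_of_real (g \<omega>) \<partial>M)" .
    have "(\<integral>\<omega>. indicator A (Z \<omega>) * (2 + g \<omega>) \<partial>M)
      = (\<integral>\<omega>. 2 * indicator A (Z \<omega>) + indicator A (Z \<omega>) * g \<omega> \<partial>M)"
      by (simp add: algebra_simps)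
    also have "\<dots> = 2 * (\<integral>\<omega>. indicator A (Z \<omega>) * 1 \<partial>M) + (\<integral>\<omega>. indicator A (Z \<omega>) * g \<omega> \<partial>M)"
      using i3 i4 by (subst Bochner_Integration.integral_add) auto
    finally show "(\<integral>\<omega>. indicator A (Z \<omega>) * (2 + g \<omega>) \<partial>M)
      = 2 * (\<integral>\<omega>. indicator A (Z \<omega>) * 1 \<partial>M) + (\<integral>\<omega>. indicator A (Z \<omega>) * g \<omega> \<partial>M)" .
  qed
  have "(\<integral>\<omega>. indicator A (Z1 \<omega>) * (2 + g1 \<omega>) \<partial>M1) = (\<integral>\<omega>. indicator A (Z2 \<omega>) * (2 + g2 \<omega>) \<partial>M2)"
  proof (rule tilted_Levy_uniqueness[OF M1 M2 meas(1) _ meas(3)])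
    show "1 \<le> 2 + g1 \<omega> \<and> 2 + g1 \<omega> \<le> 3" for \<omega> using g1[of \<omega>] by auto
    show "1 \<le> 2 + g2 \<omega> \<and> 2 + g2 \<omega> \<le> 3" for \<omega> using g2[of \<omega>] by auto
  qed (simp_all only: ci[OF M1 meas(1,2) g1] ci[OF M2 meas(3,4) g2] char charg A, simp_all)
  moreover have "(\<integral>\<omega>. indicator A (Z1 \<omega>) * 1 \<partial>M1) = (\<integral>\<omega>. indicator A (Z2 \<omega>) * (1::real) \<partial>M2)"
    using char by (intro tilted_Levy_uniqueness[OF M1 M2 meas(1) _ meas(3)]) auto
  ultimately show ?thesis
    unfolding ri[OF M1 meas(1,2) g1] ri[OF M2 meas(3,4) g2] by simp
qed

text \<open>A joint law is determined by its characteristic function.  The proof replaces exponentials by indicators one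
  coordinate at a time: \<open>F\<close> collects the coordinates already localised to a set, \<open>R\<close> those that still enter through an
  exponential.  To localise one more coordinate, the remaining factor is treated as a weight; its real and imaginary parts,
  products of indicators with a cosine or a sine, are bounded by one.\<close>

lemma partial_box_uniqueness:
  fixes U1 :: "'i \<Rightarrow> 'a \<Rightarrow> real" and U2 :: "'i \<Rightarrow> 'b \<Rightarrow> real"
  assumes M1: "prob_space M1" and M2: "prob_space M2"
    and "finite F" "finite R" "F \<inter> R = {}"
    and meas: "\<And>i. i \<in> F \<union> R \<Longrightarrow> U1 i \<in> borel_measurable M1"
      "\<And>i. i \<in> F \<union> R \<Longrightarrow> U2 i \<in> borel_measurable M2"
    and A: "\<And>i. i \<in> F \<Longrightarrow> A i \<in> sets borel"
    and char: "\<And>t. (\<integral>\<omega>. iexp (\<Sum>i\<in>F \<union> R. t i * U1 i \<omega>) \<partial>M1) = (\<integral>\<omega>. iexp (\<Sum>i\<in>F \<union> R. t i * U2 i \<omega>) \<partial>M2)"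
  shows "(\<integral>\<omega>. complex_of_real (\<Prod>i\<in>F. indicator (A i) (U1 i \<omega>)) * iexp (\<Sum>i\<in>R. t i * U1 i \<omega>) \<partial>M1)
    = (\<integral>\<omega>. complex_of_real (\<Prod>i\<in>F. indicator (A i) (U2 i \<omega>)) * iexp (\<Sum>i\<in>R. t i * U2 i \<omega>) \<partial>M2)"
  using assms(3-)
proof (induction F arbitrary: R t rule: finite_induct)
  case empty
  then show ?case by simp
next
  case (insert j F)
  interpret M1: prob_space M1 by fact
  interpret M2: prob_space M2 by fact
  let ?R = "insert j R"
  have jR: "j \<notin> R" and FR: "insert j F \<union> R = F \<union> ?R" using insert.prems by auto
  note mU1 = insert.prems(3) and mU2 = insert.prems(4)
  have [measurable]: "U1 j \<in> borel_measurable M1" "U2 j \<in> borel_measurable M2" "A j \<in> sets borel"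
    using mU1 mU2 insert.prems(5) by auto
  let ?P1 = "\<lambda>\<omega>. \<Prod>i\<in>F. indicator (A i) (U1 i \<omega>) :: real"
  let ?P2 = "\<lambda>\<omega>. \<Prod>i\<in>F. indicator (A i) (U2 i \<omega>) :: real"
  let ?s1 = "\<lambda>\<omega>. \<Sum>i\<in>R. t i * U1 i \<omega>"
  let ?s2 = "\<lambda>\<omega>. \<Sum>i\<in>R. t i * U2 i \<omega>"
  have s1: "?s1 \<in> borel_measurable M1" and s2: "?s2 \<in> borel_measurable M2"
    using mU1 mU2 by (auto intro!: borel_measurable_sum)
  have P1: "?P1 \<in> borel_measurable M1" and P2: "?P2 \<in> borel_measurable M2"
    using mU1 mU2 insert.prems(5)
    by (auto intro!: borel_measurable_prod measurable_compose[OF _ borel_measurable_indicator])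
  note [measurable] = s1 s2 P1 P2
  have Pb: "\<bar>?P1 \<omega>\<bar> \<le> 1" "\<bar>?P2 \<omega>'\<bar> \<le> 1" for \<omega> \<omega>'
    unfolding abs_prod by (intro prod_le_1; simp)+
  have IH: "(\<integral>\<omega>. complex_of_real (?P1 \<omega>) * iexp (\<Sum>i\<in>?R. t i * U1 i \<omega>) \<partial>M1)
    = (\<integral>\<omega>. complex_of_real (?P2 \<omega>) * iexp (\<Sum>i\<in>?R. t i * U2 i \<omega>) \<partial>M2)" for t
    using insert.prems insert.hyps unfolding FR by (intro insert.IH) auto
  have IH': "(\<integral>\<omega>. iexp (z * U1 j \<omega> + c * ?s1 \<omega>) * complex_of_real (?P1 \<omega>) \<partial>M1)
    = (\<integral>\<omega>. iexp (z * U2 j \<omega> + c * ?s2 \<omega>) * complex_of_real (?P2 \<omega>) \<partial>M2)" for z c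
  proof -
    let ?t = "\<lambda>i. if i = j then z else c * t i"
    have "(\<Sum>i\<in>?R. ?t i * U i) = z * U j + c * (\<Sum>i\<in>R. t i * U i)" for U :: "'i \<Rightarrow> real"
    proof -
      have "(\<Sum>i\<in>R. ?t i * U i) = (\<Sum>i\<in>R. c * (t i * U i))"
        using jR by (intro sum.cong) auto
      then show ?thesis using jR insert.prems(1) by (simp add: sum_distrib_left)
    qed
    then show ?thesis using IH[of ?t] by (simp add: mult.commute)
  qed
  have char1: "(\<integral>\<omega>. iexp (z * U1 j \<omega>) \<partial>M1) = (\<integral>\<omega>. iexp (z * U2 j \<omega>) \<partial>M2)" for z
  proof -
    let ?t = "\<lambda>i. if i = j then z else 0"
    have "(\<Sum>i\<in>insert j F \<union> R. ?t i * U i) = z * U j" for U :: "'i \<Rightarrow> real"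
      using insert.prems(1) insert.hyps by (simp add: if_distrib[of "\<lambda>x. x * _"] cong: if_cong)
    then show ?thesis using insert.prems(6)[of ?t] by simp
  qed
  have ii: "integrable M (\<lambda>\<omega>. iexp (z * u \<omega> + c * s \<omega>) * complex_of_real (q \<omega>))"
    if M: "prob_space M" and [measurable]: "q \<in> borel_measurable M" "s \<in> borel_measurable M" "u \<in> borel_measurable M"
      and q: "\<And>\<omega>. \<bar>q \<omega>\<bar> \<le> 1" for M :: "'c measure" and q s u z c
  proof -
    interpret prob_space M by fact
    show ?thesis
      by (rule integrable_const_bound[of _ 1], rule AE_I2)
        (simp only: norm_mult norm_of_real norm_exp_i_times mult_1 q, measurable)
  qed
  have i1: "integrable M1 (\<lambda>\<omega>. iexp (z * U1 j \<omega> + c * ?s1 \<omega>) * complex_of_real (?P1 \<omega>))" for z c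
    by (rule ii[OF M1 P1 s1 _ Pb(1)]) simp
  have i2: "integrable M2 (\<lambda>\<omega>. iexp (z * U2 j \<omega> + c * ?s2 \<omega>) * complex_of_real (?P2 \<omega>))" for z c
    by (rule ii[OF M2 P2 s2 _ Pb(2)]) simp
  have cs: "iexp a * complex_of_real (p * cos s) = (iexp (a + 1 * s) * complex_of_real p + iexp (a + (-1) * s) * complex_of_real p) / 2"
    "iexp a * complex_of_real (p * sin s) = (iexp (a + 1 * s) * complex_of_real p - iexp (a + (-1) * s) * complex_of_real p) / (2 * \<i>)" for a p s
  proof -
    have c: "iexp x = cis x" for x by (simp add: cis_conv_exp)
    have d: "cis x = complex_of_real (cos x) + \<i> * complex_of_real (sin x)" for x by (simp add: complex_eq_iff)
    have e: "iexp (a + 1 * s) = iexp a * (complex_of_real (cos s) + \<i> * complex_of_real (sin s))"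
      "iexp (a + (-1) * s) = iexp a * (complex_of_real (cos s) - \<i> * complex_of_real (sin s))"
      unfolding c d by (simp_all add: complex_eq_iff cos_add sin_add cos_diff sin_diff)
    show "iexp a * complex_of_real (p * cos s) = (iexp (a + 1 * s) * complex_of_real p + iexp (a + (-1) * s) * complex_of_real p) / 2"
      unfolding e by (simp add: algebra_simps)
    show "iexp a * complex_of_real (p * sin s) = (iexp (a + 1 * s) * complex_of_real p - iexp (a + (-1) * s) * complex_of_real p) / (2 * \<i>)"
      unfolding e by (simp add: algebra_simps)
  qed
  have C: "(\<integral>\<omega>. indicator (A j) (U1 j \<omega>) * (?P1 \<omega> * cos (?s1 \<omega>)) \<partial>M1)
      = (\<integral>\<omega>. indicator (A j) (U2 j \<omega>) * (?P2 \<omega> * cos (?s2 \<omega>)) \<partial>M2)"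
  proof (rule weighted_Levy_uniqueness[OF M1 M2])
    show "\<bar>?P1 \<omega> * cos (?s1 \<omega>)\<bar> \<le> 1" "\<bar>?P2 \<omega>' * cos (?s2 \<omega>')\<bar> \<le> 1" for \<omega> \<omega>'
      unfolding abs_mult by (intro mult_le_one Pb; simp)+
    show "(\<integral>\<omega>. iexp (z * U1 j \<omega>) * complex_of_real (?P1 \<omega> * cos (?s1 \<omega>)) \<partial>M1)
      = (\<integral>\<omega>. iexp (z * U2 j \<omega>) * complex_of_real (?P2 \<omega> * cos (?s2 \<omega>)) \<partial>M2)" for z
      unfolding cs using IH'[of z 1] IH'[of z "-1"] i1[of z 1] i1[of z "-1"] i2[of z 1] i2[of z "-1"]
      by simp
  qed (use char1 in measurable)
  have S: "(\<integral>\<omega>. indicator (A j) (U1 j \<omega>) * (?P1 \<omega> * sin (?s1 \<omega>)) \<partial>M1)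
      = (\<integral>\<omega>. indicator (A j) (U2 j \<omega>) * (?P2 \<omega> * sin (?s2 \<omega>)) \<partial>M2)"
  proof (rule weighted_Levy_uniqueness[OF M1 M2])
    show "\<bar>?P1 \<omega> * sin (?s1 \<omega>)\<bar> \<le> 1" "\<bar>?P2 \<omega>' * sin (?s2 \<omega>')\<bar> \<le> 1" for \<omega> \<omega>'
      unfolding abs_mult by (intro mult_le_one Pb; simp)+
    show "(\<integral>\<omega>. iexp (z * U1 j \<omega>) * complex_of_real (?P1 \<omega> * sin (?s1 \<omega>)) \<partial>M1)
      = (\<integral>\<omega>. iexp (z * U2 j \<omega>) * complex_of_real (?P2 \<omega> * sin (?s2 \<omega>)) \<partial>M2)" for z
      unfolding cs using IH'[of z 1] IH'[of z "-1"] i1[of z 1] i1[of z "-1"] i2[of z 1] i2[of z "-1"]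
      by simp
  qed (use char1 in measurable)
  have split: "(\<integral>\<omega>. complex_of_real (q \<omega>) * iexp (s \<omega>) \<partial>M)
      = complex_of_real (\<integral>\<omega>. q \<omega> * cos (s \<omega>) \<partial>M) + \<i> * complex_of_real (\<integral>\<omega>. q \<omega> * sin (s \<omega>) \<partial>M)"
    if M: "prob_space M" and [measurable]: "q \<in> borel_measurable M" "s \<in> borel_measurable M"
      and q: "\<And>\<omega>. \<bar>q \<omega>\<bar> \<le> 1" for M :: "'c measure" and q s
  proof -
    interpret prob_space M by fact
    have j1: "integrable M (\<lambda>\<omega>. q \<omega> * cos (s \<omega>))" "integrable M (\<lambda>\<omega>. q \<omega> * sin (s \<omega>))"
      by (rule integrable_const_bound[of _ 1], auto simp: abs_mult q intro!: mult_le_one)+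
    have "(\<integral>\<omega>. complex_of_real (q \<omega>) * iexp (s \<omega>) \<partial>M)
      = (\<integral>\<omega>. complex_of_real (q \<omega> * cos (s \<omega>)) + \<i> * complex_of_real (q \<omega> * sin (s \<omega>)) \<partial>M)"
      by (intro Bochner_Integration.integral_cong refl) (simp add: exp_Euler cos_of_real sin_of_real algebra_simps)
    also have "\<dots> = (\<integral>\<omega>. complex_of_real (q \<omega> * cos (s \<omega>)) \<partial>M) + \<i> * (\<integral>\<omega>. complex_of_real (q \<omega> * sin (s \<omega>)) \<partial>M)"
      using j1 by (subst Bochner_Integration.integral_add) (simp_all del: of_real_mult)
    finally show ?thesis by (simp only: integral_complex_of_real)
  qed
  let ?Q1 = "\<lambda>\<omega>. indicator (A j) (U1 j \<omega>) * ?P1 \<omega>"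
  let ?Q2 = "\<lambda>\<omega>. indicator (A j) (U2 j \<omega>) * ?P2 \<omega>"
  have Q: "\<bar>?Q1 \<omega>\<bar> \<le> 1" "\<bar>?Q2 \<omega>'\<bar> \<le> 1" for \<omega> \<omega>'
    unfolding abs_mult by (intro mult_le_one Pb; simp)+
  have "(\<integral>\<omega>. complex_of_real (?Q1 \<omega>) * iexp (?s1 \<omega>) \<partial>M1) = (\<integral>\<omega>. complex_of_real (?Q2 \<omega>) * iexp (?s2 \<omega>) \<partial>M2)"
    by (subst split[OF M1 _ s1 Q(1)], measurable, subst split[OF M2 _ s2 Q(2)], measurable)
      (use C S in \<open>simp only: mult.assoc\<close>)
  then show ?case using insert.hyps by simp
qed

lemma box_uniqueness:
  fixes U1 :: "'i \<Rightarrow> 'a \<Rightarrow> real" and U2 :: "'i \<Rightarrow> 'b \<Rightarrow> real"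
  assumes M1: "prob_space M1" and M2: "prob_space M2" and I: "finite I"
    and meas: "\<And>i. i \<in> I \<Longrightarrow> U1 i \<in> borel_measurable M1" "\<And>i. i \<in> I \<Longrightarrow> U2 i \<in> borel_measurable M2"
    and A: "\<And>i. i \<in> I \<Longrightarrow> A i \<in> sets borel"
    and char: "\<And>t. (\<integral>\<omega>. iexp (\<Sum>i\<in>I. t i * U1 i \<omega>) \<partial>M1) = (\<integral>\<omega>. iexp (\<Sum>i\<in>I. t i * U2 i \<omega>) \<partial>M2)"
  shows "measure M1 {\<omega> \<in> space M1. \<forall>i\<in>I. U1 i \<omega> \<in> A i} = measure M2 {\<omega> \<in> space M2. \<forall>i\<in>I. U2 i \<omega> \<in> A i}"
proof -
  have *: "(\<integral>\<omega>. complex_of_real (\<Prod>i\<in>I. indicator (A i) (U i \<omega>)) \<partial>M) = complex_of_real (measure M {\<omega> \<in> space M. \<forall>i\<in>I. U i \<omega> \<in> A i})"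
    if "\<And>i. i \<in> I \<Longrightarrow> U i \<in> borel_measurable M" for U :: "'i \<Rightarrow> 'c \<Rightarrow> real" and M
  proof -
    have "(\<Prod>i\<in>I. indicator (A i) (U i \<omega>)) = (indicator {\<omega> \<in> space M. \<forall>i\<in>I. U i \<omega> \<in> A i} \<omega> :: real)"
      if "\<omega> \<in> space M" for \<omega>
      using I that by (auto simp: indicator_def intro: prod_zero)
    then have "(\<integral>\<omega>. (\<Prod>i\<in>I. indicator (A i) (U i \<omega>)) \<partial>M) = (\<integral>\<omega>. indicator {\<omega> \<in> space M. \<forall>i\<in>I. U i \<omega> \<in> A i} \<omega> \<partial>M :: real)"
      by (intro Bochner_Integration.integral_cong refl) simp
    also have "\<dots> = measure M {\<omega> \<in> space M. \<forall>i\<in>I. U i \<omega> \<in> A i}"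
      by (simp add: Int_absorb2 subset_eq)
    finally show ?thesis by (simp only: integral_complex_of_real)
  qed
  have "(\<integral>\<omega>. complex_of_real (\<Prod>i\<in>I. indicator (A i) (U1 i \<omega>)) * iexp (\<Sum>i\<in>{}. 0 * U1 i \<omega>) \<partial>M1)
    = (\<integral>\<omega>. complex_of_real (\<Prod>i\<in>I. indicator (A i) (U2 i \<omega>)) * iexp (\<Sum>i\<in>{}. 0 * U2 i \<omega>) \<partial>M2)"
    using assms by (intro partial_box_uniqueness) auto
  then show ?thesis using *[of U1 M1] *[of U2 M2] meas by simp
qed

section \<open>Lebesgue measure and linear maps\<close>

text \<open>Restriction to \<open>I\<close> keeps the values inside the product space \<open>leb_on_idx I\<close>, whose points are undefined outside \<open>I\<close>.\<close>

definition mat_map :: "'i set \<Rightarrow> ('i \<Rightarrow> 'i \<Rightarrow> real) \<Rightarrow> ('i \<Rightarrow> real) \<Rightarrow> 'i \<Rightarrow> real" where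
  "mat_map I A b = (\<lambda>i\<in>I. mat_vec I A b i)"

lemma space_leb_on_idx: "space (leb_on_idx I) = extensional I"
  by (simp add: leb_on_idx_def space_PiM PiE_def)

lemma measurable_into_leb_on_idx:
  assumes "\<And>i. i \<in> I \<Longrightarrow> (\<lambda>x. f x i) \<in> borel_measurable M"
  shows "(\<lambda>x. \<lambda>i\<in>I. f x i) \<in> measurable M (leb_on_idx I)"
  unfolding leb_on_idx_def using assms by (intro measurable_restrict) simp

lemma measurable_coordinate [measurable (raw)]:
  assumes "f \<in> measurable M (leb_on_idx I)" "i \<in> I"
  shows "(\<lambda>x. f x i) \<in> borel_measurable M"
  using measurable_compose[OF assms(1)[unfolded leb_on_idx_def] measurable_component_singleton[OF assms(2)]] by simp

lemma measurable_mat_vec: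
  assumes "f \<in> measurable M (leb_on_idx I)"
  shows "(\<lambda>x. mat_vec I A (f x) i) \<in> borel_measurable M"
  unfolding mat_vec_def using measurable_coordinate[OF assms] by (intro borel_measurable_sum) simp

lemma measurable_mat_map [measurable]: "mat_map I A \<in> measurable (leb_on_idx I) (leb_on_idx I)"
  unfolding mat_map_def by (intro measurable_into_leb_on_idx measurable_mat_vec) simp

lemma sigma_finite_leb_on_idx:
  assumes "finite I"
  shows "sigma_finite_measure (leb_on_idx I)"
proof -
  interpret product_sigma_finite "\<lambda>_::'a. lborel :: real measure" by standard
  show ?thesis unfolding leb_on_idx_def by (rule sigma_finite[OF assms])
qed

lemma emeasure_leb_on_idx:
  assumes "finite I" "\<And>i. i \<in> I \<Longrightarrow> A i \<in> sets borel"
  shows "emeasure (leb_on_idx I) (Pi\<^sub>E I A) = (\<Prod>i\<in>I. emeasure lborel (A i))"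
proof -
  interpret product_sigma_finite "\<lambda>_::'a. lborel :: real measure" by standard
  show ?thesis unfolding leb_on_idx_def using assms by (intro emeasure_PiM) auto
qed

lemma nn_integral_leb_on_idx_translate:
  assumes I: "finite I" and f: "f \<in> borel_measurable (leb_on_idx I)"
  shows "(\<integral>\<^sup>+x. f (\<lambda>i\<in>I. x i + v i) \<partial>leb_on_idx I) = (\<integral>\<^sup>+x. f x \<partial>leb_on_idx I)"
proof -
  interpret product_sigma_finite "\<lambda>_::'a. lborel :: real measure" by standard
  let ?L = "leb_on_idx I"
  let ?T = "\<lambda>x. \<lambda>i\<in>I. x i + v i"
  have T[measurable]: "?T \<in> measurable ?L ?L"
    by (rule measurable_into_leb_on_idx) (auto intro!: borel_measurable_add measurable_coordinate)
  have "distr ?L ?L ?T = PiM I (\<lambda>_. lborel)"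
  proof (rule PiM_eqI[OF I])
    show "sets (distr ?L ?L ?T) = sets (PiM I (\<lambda>_. lborel))" by (simp add: leb_on_idx_def)
    fix A assume A: "\<And>i. i \<in> I \<Longrightarrow> A i \<in> sets (lborel :: real measure)"
    let ?A = "\<lambda>i. (+) (v i) -` A i"
    have mA: "?A i \<in> sets borel" if "i \<in> I" for i
      using measurable_sets[of "(+) (v i)" borel borel "A i"] A[OF that] by simp
    have "Pi\<^sub>E I A \<in> sets ?L" unfolding leb_on_idx_def using A I by (intro sets_PiM_I_finite) auto
    then have "emeasure (distr ?L ?L ?T) (Pi\<^sub>E I A) = emeasure ?L (?T -` Pi\<^sub>E I A \<inter> space ?L)"
      by (intro emeasure_distr T)
    also have "?T -` Pi\<^sub>E I A \<inter> space ?L = Pi\<^sub>E I ?A"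
      by (auto simp: space_leb_on_idx PiE_def extensional_def Pi_def add.commute)
    also have "emeasure ?L (Pi\<^sub>E I ?A) = (\<Prod>i\<in>I. emeasure lborel (?A i))"
      by (rule emeasure_leb_on_idx[OF I mA])
    also have "\<dots> = (\<Prod>i\<in>I. emeasure lborel (A i))"
    proof (rule prod.cong[OF refl])
      fix i assume i: "i \<in> I"
      have "emeasure lborel (A i) = emeasure (distr lborel borel ((+) (v i))) (A i)"
        by (simp add: lborel_distr_plus)
      also have "\<dots> = emeasure lborel (?A i)" using A[OF i] by (subst emeasure_distr) auto
      finally show "emeasure lborel (?A i) = emeasure lborel (A i)" by simp
    qed
    finally show "emeasure (distr ?L ?L ?T) (Pi\<^sub>E I A) = (\<Prod>i\<in>I. emeasure lborel (A i))" .
  qed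
  then have "distr ?L ?L ?T = ?L" by (simp add: leb_on_idx_def)
  then have "(\<integral>\<^sup>+x. f x \<partial>?L) = (\<integral>\<^sup>+x. f x \<partial>distr ?L ?L ?T)" by simp
  also have "\<dots> = (\<integral>\<^sup>+x. f (?T x) \<partial>?L)" by (rule nn_integral_distr[OF T]) (use f in simp)
  finally show ?thesis by simp
qed

lemma mat_vec_add: "mat_vec I A (\<lambda>i. b i + c i) j = mat_vec I A b j + mat_vec I A c j"
  by (simp add: mat_vec_def sum.distrib ring_distribs)

lemma mat_vec_diff: "mat_vec I A (\<lambda>i. b i - c i) j = mat_vec I A b j - mat_vec I A c j"
  by (simp add: mat_vec_def sum_subtractf ring_distribs)

lemma mat_vec_cong: "(\<And>i. i \<in> I \<Longrightarrow> b i = c i) \<Longrightarrow> mat_vec I A b j = mat_vec I A c j"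
  by (simp add: mat_vec_def)

text \<open>An invertible linear map scales Lebesgue measure by a constant.  The value of the constant, an absolute
  determinant, never matters below because it cancels in the normalisation of the posterior; hence only translation invariance
  is used.  The classical uniqueness argument for Haar measure applies: multiply by \<open>1 = \<integral> g (y - X b) dy\<close> for the indicator
  \<open>g\<close> of a unit cube, exchange the integrals, shift \<open>b\<close> by \<open>V y\<close>, and exchange them again.  The constant is
  \<open>\<integral> g (- X b) db\<close>; it is finite since \<open>g (- X b) \<noteq> 0\<close> confines \<open>b\<close> to a bounded box.\<close>

lemma nn_integral_leb_on_idx_linear:
  assumes I: "finite I"
    and XV: "\<And>b i. i \<in> I \<Longrightarrow> mat_vec I X (mat_vec I V b) i = b i"
    and VX: "\<And>b i. i \<in> I \<Longrightarrow> mat_vec I V (mat_vec I X b) i = b i"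
  obtains c where "0 < c" "c < \<infinity>"
    "\<And>f. f \<in> borel_measurable (leb_on_idx I) \<Longrightarrow>
      (\<integral>\<^sup>+b. f (mat_map I X b) \<partial>leb_on_idx I) = c * (\<integral>\<^sup>+u. f u \<partial>leb_on_idx I)"
proof -
  let ?L = "leb_on_idx I"
  interpret L: sigma_finite_measure ?L by (rule sigma_finite_leb_on_idx[OF I])
  interpret LL: pair_sigma_finite ?L ?L ..
  define Q where "Q = (\<Pi>\<^sub>E i\<in>I. {0..1::real})"
  have Q[measurable]: "Q \<in> sets ?L" unfolding Q_def leb_on_idx_def using I by (intro sets_PiM_I_finite) auto
  have Q1: "emeasure ?L Q = 1" unfolding Q_def by (subst emeasure_leb_on_idx[OF I]) auto
  let ?g = "indicator Q :: ('a \<Rightarrow> real) \<Rightarrow> ennreal"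
  let ?n = "\<lambda>b. \<lambda>i\<in>I. - mat_vec I X b i"
  have n[measurable]: "?n \<in> measurable ?L ?L"
    by (intro measurable_into_leb_on_idx borel_measurable_uminus measurable_mat_vec) simp
  define c where "c = (\<integral>\<^sup>+b. ?g (?n b) \<partial>?L)"
  have main: "(\<integral>\<^sup>+b. f (mat_map I X b) \<partial>?L) = c * (\<integral>\<^sup>+u. f u \<partial>?L)"
    if f[measurable]: "f \<in> borel_measurable ?L" for f
  proof -
    let ?d = "\<lambda>y b. \<lambda>i\<in>I. y i + - mat_vec I X b i"
    let ?a = "\<lambda>b y. \<lambda>i\<in>I. y i + mat_vec I X b i"
    have d[measurable]: "case_prod (\<lambda>b y. ?d y b) \<in> measurable (?L \<Otimes>\<^sub>M ?L) ?L"
      unfolding split_beta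
      by (intro measurable_into_leb_on_idx borel_measurable_add borel_measurable_uminus
          measurable_mat_vec measurable_coordinate[where f=snd]) simp_all
    have a[measurable]: "case_prod (\<lambda>b y. ?a b y) \<in> measurable (?L \<Otimes>\<^sub>M ?L) ?L"
      unfolding split_beta
      by (intro measurable_into_leb_on_idx borel_measurable_add
          measurable_mat_vec measurable_coordinate[where f=snd]) simp_all
    have gd[measurable]: "(\<lambda>p. ?g (?d (snd p) (fst p))) \<in> borel_measurable (?L \<Otimes>\<^sub>M ?L)"
      using measurable_compose[OF d[unfolded split_beta], of ?g borel] by simp
    have fa[measurable]: "(\<lambda>p. f (?a (fst p) (snd p))) \<in> borel_measurable (?L \<Otimes>\<^sub>M ?L)"
      using measurable_compose[OF a[unfolded split_beta] f] by simp
    have fX[measurable]: "(\<lambda>p. f (mat_map I X (fst p))) \<in> borel_measurable (?L \<Otimes>\<^sub>M ?L)"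
      by measurable
    have sec: "(\<lambda>b. f (mat_map I X b) * ?g (?d y b)) \<in> borel_measurable ?L" if "y \<in> space ?L" for y
      using measurable_compose[OF measurable_Pair2'[OF that, of ?L] borel_measurable_times_ennreal[OF fX gd]]
        measurable_compose[OF measurable_Pair1'[OF that, of ?L] borel_measurable_times_ennreal[OF fX gd]]
      by simp
    have "(\<integral>\<^sup>+b. f (mat_map I X b) \<partial>?L) = (\<integral>\<^sup>+b. f (mat_map I X b) * (\<integral>\<^sup>+y. ?g y \<partial>?L) \<partial>?L)"
      by (simp add: Q1)
    also have "\<dots> = (\<integral>\<^sup>+b. f (mat_map I X b) * (\<integral>\<^sup>+y. ?g (?d y b) \<partial>?L) \<partial>?L)"
      by (intro nn_integral_cong arg_cong2[where f="(*)"] refl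
          nn_integral_leb_on_idx_translate[OF I borel_measurable_indicator[OF Q], symmetric])
    also have "\<dots> = (\<integral>\<^sup>+b. (\<integral>\<^sup>+y. f (mat_map I X b) * ?g (?d y b) \<partial>?L) \<partial>?L)"
    proof (intro nn_integral_cong nn_integral_cmult[symmetric])
      fix b assume "b \<in> space ?L"
      then show "(\<lambda>y. ?g (?d y b)) \<in> borel_measurable ?L"
        using measurable_compose[OF measurable_Pair1' gd] by simp
    qed
    also have "\<dots> = (\<integral>\<^sup>+y. (\<integral>\<^sup>+b. f (mat_map I X b) * ?g (?d y b) \<partial>?L) \<partial>?L)"
      by (rule LL.Fubini'[symmetric]) (use borel_measurable_times_ennreal[OF fX gd] in \<open>simp add: split_beta\<close>)
    also have "\<dots> = (\<integral>\<^sup>+y. (\<integral>\<^sup>+b. f (?a b y) * ?g (?n b) \<partial>?L) \<partial>?L)"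
    proof (rule nn_integral_cong)
      fix y assume y: "y \<in> space ?L"
      have "(\<integral>\<^sup>+b. f (mat_map I X b) * ?g (?d y b) \<partial>?L)
        = (\<integral>\<^sup>+b. f (mat_map I X (\<lambda>i\<in>I. b i + mat_vec I V y i)) * ?g (?d y (\<lambda>i\<in>I. b i + mat_vec I V y i)) \<partial>?L)"
        by (rule nn_integral_leb_on_idx_translate[OF I sec[OF y], symmetric])
      also have "\<dots> = (\<integral>\<^sup>+b. f (?a b y) * ?g (?n b) \<partial>?L)"
      proof (rule nn_integral_cong)
        fix b
        have *: "mat_vec I X (\<lambda>i\<in>I. b i + mat_vec I V y i) i = mat_vec I X b i + y i" if "i \<in> I" for i
          using XV[OF that, of y] mat_vec_add[of I X b "mat_vec I V y" i]
          by (simp cong: mat_vec_cong)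
        have "mat_map I X (\<lambda>i\<in>I. b i + mat_vec I V y i) = ?a b y"
          unfolding mat_map_def using * by (intro restrict_ext) (simp only: add.commute)
        moreover have "?d y (\<lambda>i\<in>I. b i + mat_vec I V y i) = ?n b"
          using * by (intro restrict_ext) simp
        ultimately show "f (mat_map I X (\<lambda>i\<in>I. b i + mat_vec I V y i)) * ?g (?d y (\<lambda>i\<in>I. b i + mat_vec I V y i)) = f (?a b y) * ?g (?n b)"
          by simp
      qed
      finally show "(\<integral>\<^sup>+b. f (mat_map I X b) * ?g (?d y b) \<partial>?L) = (\<integral>\<^sup>+b. f (?a b y) * ?g (?n b) \<partial>?L)" .
    qed
    also have "\<dots> = (\<integral>\<^sup>+b. (\<integral>\<^sup>+y. f (?a b y) * ?g (?n b) \<partial>?L) \<partial>?L)"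
    proof (rule LL.Fubini')
      have "(\<lambda>p. f (?a (fst p) (snd p)) * ?g (?n (fst p))) \<in> borel_measurable (?L \<Otimes>\<^sub>M ?L)"
        by (intro borel_measurable_times_ennreal fa measurable_compose[OF measurable_compose[OF measurable_fst n]]
            borel_measurable_indicator Q)
      then show "case_prod (\<lambda>b y. f (?a b y) * ?g (?n b)) \<in> borel_measurable (?L \<Otimes>\<^sub>M ?L)"
        by (simp add: split_beta)
    qed
    also have "\<dots> = (\<integral>\<^sup>+b. (\<integral>\<^sup>+y. f y \<partial>?L) * ?g (?n b) \<partial>?L)"
    proof (rule nn_integral_cong)
      fix b assume "b \<in> space ?L"
      then have "(\<integral>\<^sup>+y. f (?a b y) * ?g (?n b) \<partial>?L) = (\<integral>\<^sup>+y. f (?a b y) \<partial>?L) * ?g (?n b)"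
        using measurable_compose[OF measurable_Pair1' fa] by (intro nn_integral_multc) simp
      also have "(\<integral>\<^sup>+y. f (?a b y) \<partial>?L) = (\<integral>\<^sup>+y. f y \<partial>?L)"
        by (rule nn_integral_leb_on_idx_translate[OF I f])
      finally show "(\<integral>\<^sup>+y. f (?a b y) * ?g (?n b) \<partial>?L) = (\<integral>\<^sup>+y. f y \<partial>?L) * ?g (?n b)" .
    qed
    also have "\<dots> = (\<integral>\<^sup>+y. f y \<partial>?L) * c"
      unfolding c_def by (rule nn_integral_cmult) (rule measurable_compose[OF n borel_measurable_indicator[OF Q]])
    finally show ?thesis by (simp add: mult.commute)
  qed
  have "c \<noteq> 0"
  proof
    assume "c = 0"
    then have "(\<integral>\<^sup>+b. 1 \<partial>?L) = 0" using main[of "\<lambda>_. 1"] by simp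
    then have "emeasure ?L (space ?L) = 0" by simp
    moreover have "emeasure ?L Q \<le> emeasure ?L (space ?L)"
      using sets.sets_into_space[OF Q] by (intro emeasure_mono) auto
    ultimately show False using Q1 by simp
  qed
  moreover have "c < \<infinity>"
  proof -
    define m where "m i = (\<Sum>j\<in>I. \<bar>V i j\<bar>)" for i
    have m0: "0 \<le> m i" for i by (simp add: m_def sum_nonneg)
    let ?B = "\<Pi>\<^sub>E i\<in>I. {- m i..m i}"
    have B[measurable]: "?B \<in> sets ?L" unfolding leb_on_idx_def using I by (intro sets_PiM_I_finite) auto
    have "?g (?n b) \<le> indicator ?B b" if b: "b \<in> space ?L" for b
    proof (cases "?n b \<in> Q")
      case True
      have X: "\<bar>mat_vec I X b j\<bar> \<le> 1" if "j \<in> I" for j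
        using True that unfolding Q_def PiE_iff by (fastforce dest: bspec)
      have "\<bar>b i\<bar> \<le> m i" if "i \<in> I" for i
      proof -
        have "\<bar>b i\<bar> = \<bar>\<Sum>j\<in>I. V i j * mat_vec I X b j\<bar>"
          using VX[OF that, of b] by (simp add: mat_vec_def)
        also have "\<dots> \<le> (\<Sum>j\<in>I. \<bar>V i j\<bar> * \<bar>mat_vec I X b j\<bar>)"
          by (rule order_trans[OF sum_abs]) (simp add: abs_mult)
        also have "\<dots> \<le> (\<Sum>j\<in>I. \<bar>V i j\<bar> * 1)" by (intro sum_mono mult_left_mono X) auto
        finally show ?thesis by (simp add: m_def)
      qed
      then have "b \<in> ?B" using b by (auto simp: space_leb_on_idx PiE_def abs_le_iff) (smt (verit))
      then show ?thesis by (simp add: indicator_def)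
    qed simp
    then have "c \<le> (\<integral>\<^sup>+b. indicator ?B b \<partial>?L)" unfolding c_def by (rule nn_integral_mono)
    also have "\<dots> = emeasure ?L ?B" by simp
    also have "\<dots> = (\<Prod>i\<in>I. ennreal (m i - - m i))"
      using m0 by (subst emeasure_leb_on_idx[OF I]) (auto intro!: prod.cong simp: order_trans[of "- _" 0])
    also have "\<dots> < \<infinity>" using m0 by (subst prod_ennreal) auto
    finally show ?thesis .
  qed
  ultimately show ?thesis using main by (intro that[of c]) (auto simp: zero_less_iff_neq_zero)
qed

section \<open>Standard Gaussian vectors\<close>

definition std_gauss :: "'i set \<Rightarrow> ('i \<Rightarrow> real) measure" where
  "std_gauss I = (\<Pi>\<^sub>M i\<in>I. std_normal_distribution)"

lemma prob_space_std_normal: "prob_space std_normal_distribution"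
  using prob_space_normal_density by simp

lemma prob_space_std_gauss: "prob_space (std_gauss I)"
  unfolding std_gauss_def by (rule prob_space_PiM[OF prob_space_std_normal])

lemma sets_std_gauss [measurable_cong]: "sets (std_gauss I) = sets (leb_on_idx I)"
  unfolding std_gauss_def leb_on_idx_def by (intro sets_PiM_cong) auto

lemma space_std_gauss: "space (std_gauss I) = extensional I"
  using sets_eq_imp_space_eq[OF sets_std_gauss] space_leb_on_idx by metis

definition gauss_density :: "'i set \<Rightarrow> ('i \<Rightarrow> real) \<Rightarrow> real" where
  "gauss_density I u = (1 / sqrt (2 * pi)) ^ card I * exp (- (1 / 2) * (L2_set u I)\<^sup>2)"

lemma L2_set_square: "(L2_set u I)\<^sup>2 = (\<Sum>i\<in>I. (u i)\<^sup>2)"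
  by (simp add: L2_set_def sum_nonneg)

lemma gauss_density_prod:
  assumes "finite I"
  shows "(\<Prod>i\<in>I. std_normal_density (u i)) = gauss_density I u"
proof -
  have "(\<Prod>i\<in>I. std_normal_density (u i)) = (1 / sqrt (2 * pi)) ^ card I * (\<Prod>i\<in>I. exp (- (u i)\<^sup>2 / 2))"
    unfolding std_normal_density_def prod.distrib by simp
  also have "(\<Prod>i\<in>I. exp (- (u i)\<^sup>2 / 2)) = exp (\<Sum>i\<in>I. - (u i)\<^sup>2 / 2)"
    using assms by (simp only: exp_sum)
  also have "(\<Sum>i\<in>I. - (u i)\<^sup>2 / 2) = - (1 / 2) * (L2_set u I)\<^sup>2"
    by (simp add: L2_set_square sum_distrib_left flip: sum_negf)
  finally show ?thesis by (simp add: gauss_density_def)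
qed

lemma measurable_L2_set:
  assumes "finite I" "\<And>i. i \<in> I \<Longrightarrow> (\<lambda>x. f x i) \<in> borel_measurable M"
  shows "(\<lambda>x. L2_set (f x) I) \<in> borel_measurable M"
  unfolding L2_set_def using assms by measurable

lemma measurable_gauss_density [measurable]:
  "finite I \<Longrightarrow> gauss_density I \<in> borel_measurable (leb_on_idx I)"
  unfolding gauss_density_def[abs_def]
  by (intro borel_measurable_times borel_measurable_const borel_measurable_exp[THEN measurable_compose[rotated]]
      borel_measurable_power measurable_L2_set measurable_coordinate) auto

lemma std_gauss_eq_density:
  assumes I: "finite I"
  shows "std_gauss I = density (leb_on_idx I) (\<lambda>u. ennreal (gauss_density I u))"
proof -
  interpret N: product_prob_space "\<lambda>_::'a. std_normal_distribution"
    by (intro product_prob_spaceI prob_space_std_normal)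
  interpret L: product_sigma_finite "\<lambda>_::'a. lborel :: real measure" by standard
  show ?thesis
    unfolding std_gauss_def
  proof (rule N.PiM_eqI[OF I, symmetric])
    show "sets (density (leb_on_idx I) (\<lambda>u. ennreal (gauss_density I u))) = sets (PiM I (\<lambda>_. std_normal_distribution))"
      using sets_std_gauss[of I] by (simp add: std_gauss_def)
    fix A :: "'a \<Rightarrow> real set" assume "\<And>i. i \<in> I \<Longrightarrow> A i \<in> sets std_normal_distribution"
    then have A: "\<And>i. i \<in> I \<Longrightarrow> A i \<in> sets borel" by simp
    have m: "Pi\<^sub>E I A \<in> sets (leb_on_idx I)"
      unfolding leb_on_idx_def using A I by (intro sets_PiM_I_finite) auto
    have "emeasure (density (leb_on_idx I) (\<lambda>u. ennreal (gauss_density I u))) (Pi\<^sub>E I A)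
        = (\<integral>\<^sup>+u. ennreal (gauss_density I u) * indicator (Pi\<^sub>E I A) u \<partial>leb_on_idx I)"
      using I m by (intro emeasure_density) auto
    also have "\<dots> = (\<integral>\<^sup>+u. (\<Prod>i\<in>I. ennreal (std_normal_density (u i)) * indicator (A i) (u i)) \<partial>leb_on_idx I)"
    proof (rule nn_integral_cong)
      fix u assume "u \<in> space (leb_on_idx I)"
      then have "(indicator (Pi\<^sub>E I A) u :: ennreal) = (\<Prod>i\<in>I. indicator (A i) (u i))"
        using I by (auto simp: space_leb_on_idx indicator_def PiE_def Pi_def)
      then show "ennreal (gauss_density I u) * indicator (Pi\<^sub>E I A) u
          = (\<Prod>i\<in>I. ennreal (std_normal_density (u i)) * indicator (A i) (u i))"
        using I by (simp add: prod.distrib prod_ennreal gauss_density_prod)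
    qed
    also have "\<dots> = (\<Prod>i\<in>I. \<integral>\<^sup>+x. ennreal (std_normal_density x) * indicator (A i) x \<partial>lborel)"
      unfolding leb_on_idx_def using I A by (intro L.product_nn_integral_prod) auto
    also have "\<dots> = (\<Prod>i\<in>I. emeasure std_normal_distribution (A i))"
      using A by (intro prod.cong refl) (simp add: emeasure_density)
    finally show "emeasure (density (leb_on_idx I) (\<lambda>u. ennreal (gauss_density I u))) (Pi\<^sub>E I A)
        = (\<Prod>i\<in>I. emeasure std_normal_distribution (A i))" .
  qed
qed

text \<open>The integrand times the density is \<open>sqrt 2\<close> times the centred normal density with twice the variance.  Via
  Markov's inequality this gives Gaussian tail bounds for a single variable and, by independence, for the Euclidean norm.\<close>

lemma nn_integral_exp_square_normal:
  assumes s: "0 < \<sigma>"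
  shows "(\<integral>\<^sup>+x. ennreal (exp (x\<^sup>2 / (4 * \<sigma>\<^sup>2))) \<partial>density lborel (normal_density 0 \<sigma>)) = ennreal (sqrt 2)"
proof -
  have e: "normal_density 0 \<sigma> x * exp (x\<^sup>2 / (4 * \<sigma>\<^sup>2)) = sqrt 2 * normal_density 0 (sqrt 2 * \<sigma>) x" for x
  proof -
    have "- x\<^sup>2 / (2 * \<sigma>\<^sup>2) + x\<^sup>2 / (4 * \<sigma>\<^sup>2) = - x\<^sup>2 / (2 * (sqrt 2 * \<sigma>)\<^sup>2)"
      using s by (simp add: field_simps power_mult_distrib)
    then have "exp (- x\<^sup>2 / (2 * \<sigma>\<^sup>2)) * exp (x\<^sup>2 / (4 * \<sigma>\<^sup>2)) = exp (- x\<^sup>2 / (2 * (sqrt 2 * \<sigma>)\<^sup>2))"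
      by (metis exp_add)
    moreover have "1 / sqrt (2 * pi * \<sigma>\<^sup>2) = sqrt 2 * (1 / sqrt (2 * pi * (sqrt 2 * \<sigma>)\<^sup>2))"
      using s by (simp add: power_mult_distrib real_sqrt_mult field_simps)
    ultimately show ?thesis unfolding normal_density_def by (simp add: mult.assoc)
  qed
  have "(\<integral>\<^sup>+x. ennreal (exp (x\<^sup>2 / (4 * \<sigma>\<^sup>2))) \<partial>density lborel (normal_density 0 \<sigma>))
      = (\<integral>\<^sup>+x. ennreal (normal_density 0 \<sigma> x) * ennreal (exp (x\<^sup>2 / (4 * \<sigma>\<^sup>2))) \<partial>lborel)"
    by (intro nn_integral_density) auto
  also have "\<dots> = (\<integral>\<^sup>+x. ennreal (sqrt 2) * ennreal (normal_density 0 (sqrt 2 * \<sigma>) x) \<partial>lborel)"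
    by (intro nn_integral_cong) (simp add: e flip: ennreal_mult)
  also have "\<dots> = ennreal (sqrt 2) * (\<integral>\<^sup>+x. ennreal (normal_density 0 (sqrt 2 * \<sigma>) x) \<partial>lborel)"
    by (intro nn_integral_cmult) auto
  also have "(\<integral>\<^sup>+x. ennreal (normal_density 0 (sqrt 2 * \<sigma>) x) \<partial>lborel) = 1"
    using s by (subst nn_integral_eq_integral) auto
  finally show ?thesis by simp
qed

lemma std_gauss_norm_tail:
  assumes I: "finite I" and t: "0 \<le> t"
  shows "measure (std_gauss I) {u \<in> space (std_gauss I). t \<le> L2_set u I} \<le> sqrt 2 ^ card I * exp (- t\<^sup>2 / 4)"
proof -
  interpret N: product_prob_space "\<lambda>_::'a. std_normal_distribution"
    by (intro product_prob_spaceI prob_space_std_normal)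
  interpret G: prob_space "std_gauss I" by (rule prob_space_std_gauss)
  let ?E = "{u \<in> space (std_gauss I). t \<le> L2_set u I}"
  have mc: "(\<lambda>u. u i) \<in> borel_measurable (std_gauss I)" if "i \<in> I" for i
    using measurable_coordinate[of "\<lambda>x. x" "leb_on_idx I" I i] that measurable_cong_sets[OF sets_std_gauss refl] by auto
  have m: "(\<lambda>u. L2_set u I) \<in> borel_measurable (std_gauss I)"
    by (intro measurable_L2_set I mc)
  then have E: "?E \<in> sets (std_gauss I)" by measurable
  have "emeasure (std_gauss I) ?E = (\<integral>\<^sup>+u. indicator ?E u \<partial>std_gauss I)" using E by simp
  also have "\<dots> \<le> (\<integral>\<^sup>+u. ennreal (exp (- t\<^sup>2 / 4)) * (\<Prod>i\<in>I. ennreal (exp ((u i)\<^sup>2 / 4))) \<partial>std_gauss I)"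
  proof (rule nn_integral_mono)
    fix u
    show "indicator ?E u \<le> ennreal (exp (- t\<^sup>2 / 4)) * (\<Prod>i\<in>I. ennreal (exp ((u i)\<^sup>2 / 4)))"
    proof (cases "u \<in> ?E")
      case True
      then have "t\<^sup>2 \<le> (L2_set u I)\<^sup>2" using t by (intro power_mono) auto
      then have "1 \<le> exp (- t\<^sup>2 / 4 + (\<Sum>i\<in>I. (u i)\<^sup>2 / 4))"
        by (simp add: L2_set_square flip: sum_divide_distrib)
      also have "\<dots> = exp (- t\<^sup>2 / 4) * (\<Prod>i\<in>I. exp ((u i)\<^sup>2 / 4))"
        using I by (simp only: exp_add exp_sum)
      finally have "ennreal 1 \<le> ennreal (exp (- t\<^sup>2 / 4) * (\<Prod>i\<in>I. exp ((u i)\<^sup>2 / 4)))"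
        by (rule ennreal_leI)
      also have "\<dots> = ennreal (exp (- t\<^sup>2 / 4)) * (\<Prod>i\<in>I. ennreal (exp ((u i)\<^sup>2 / 4)))"
        by (subst ennreal_mult) (auto intro!: prod_nonneg simp: prod_ennreal)
      finally show ?thesis using True by simp
    qed simp
  qed
  also have "\<dots> = ennreal (exp (- t\<^sup>2 / 4)) * (\<integral>\<^sup>+u. (\<Prod>i\<in>I. ennreal (exp ((u i)\<^sup>2 / 4))) \<partial>std_gauss I)"
    by (intro nn_integral_cmult borel_measurable_prod_ennreal measurable_compose[OF mc]) measurable
  also have "(\<integral>\<^sup>+u. (\<Prod>i\<in>I. ennreal (exp ((u i)\<^sup>2 / 4))) \<partial>std_gauss I)
      = (\<Prod>i\<in>I. \<integral>\<^sup>+x. ennreal (exp (x\<^sup>2 / 4)) \<partial>std_normal_distribution)"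
    unfolding std_gauss_def using I by (intro N.product_nn_integral_prod) auto
  also have "\<dots> = ennreal (sqrt 2 ^ card I)"
    using nn_integral_exp_square_normal[of 1] by (simp add: ennreal_power)
  finally have "emeasure (std_gauss I) ?E \<le> ennreal (sqrt 2 ^ card I * exp (- t\<^sup>2 / 4))"
    by (simp add: ennreal_mult mult.commute)
  then show ?thesis by (simp add: G.emeasure_eq_measure)
qed

lemma prob_space_normal_law: "0 \<le> \<sigma> \<Longrightarrow> prob_space (normal_law 0 \<sigma>)"
  unfolding normal_law_def using prob_space_normal_density[of \<sigma> 0]
  by (auto intro: prob_space_return)

lemma sets_normal_law [simp]: "sets (normal_law 0 \<sigma>) = sets borel"
  by (simp add: normal_law_def)

lemma normal_law_tail:
  assumes s: "0 \<le> \<sigma>" "\<sigma>\<^sup>2 \<le> b" and b: "0 < b" and x: "0 \<le> x"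
  shows "measure (normal_law 0 \<sigma>) {y. x \<le> \<bar>y\<bar>} \<le> sqrt 2 * exp (- x\<^sup>2 / (4 * b))"
proof -
  interpret prob_space "normal_law 0 \<sigma>" by (rule prob_space_normal_law[OF s(1)])
  have E[measurable]: "{y::real. x \<le> \<bar>y\<bar>} \<in> sets borel" by measurable
  show ?thesis
  proof (cases "\<sigma> = 0")
    case True
    then have "measure (normal_law 0 \<sigma>) {y. x \<le> \<bar>y\<bar>} = indicator {y. x \<le> \<bar>y\<bar>} 0"
      by (simp add: normal_law_def measure_return)
    also have "\<dots> \<le> sqrt 2 * exp (- x\<^sup>2 / (4 * b))"
    proof (cases "x = 0")
      case True then show ?thesis by simp
    qed (use x in \<open>simp add: indicator_def\<close>)
    finally show ?thesis .
  next
    case False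
    with s have s0: "0 < \<sigma>" by simp
    have "emeasure (normal_law 0 \<sigma>) {y. x \<le> \<bar>y\<bar>} = (\<integral>\<^sup>+y. indicator {y. x \<le> \<bar>y\<bar>} y \<partial>normal_law 0 \<sigma>)" by simp
    also have "\<dots> \<le> (\<integral>\<^sup>+y. ennreal (exp (- x\<^sup>2 / (4 * b))) * ennreal (exp (y\<^sup>2 / (4 * \<sigma>\<^sup>2))) \<partial>normal_law 0 \<sigma>)"
    proof (rule nn_integral_mono)
      fix y
      show "indicator {y. x \<le> \<bar>y\<bar>} y \<le> ennreal (exp (- x\<^sup>2 / (4 * b))) * ennreal (exp (y\<^sup>2 / (4 * \<sigma>\<^sup>2)))"
      proof (cases "x \<le> \<bar>y\<bar>")
        case True
        have "x\<^sup>2 / (4 * b) \<le> x\<^sup>2 / (4 * \<sigma>\<^sup>2)" using s s0 b by (intro divide_left_mono) auto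
        also have "\<dots> \<le> y\<^sup>2 / (4 * \<sigma>\<^sup>2)" using True x by (intro divide_right_mono) (use power_mono[of x "\<bar>y\<bar>" 2] in auto)
        finally have "1 \<le> exp (- x\<^sup>2 / (4 * b) + y\<^sup>2 / (4 * \<sigma>\<^sup>2))" by simp
        then have "ennreal 1 \<le> ennreal (exp (- x\<^sup>2 / (4 * b)) * exp (y\<^sup>2 / (4 * \<sigma>\<^sup>2)))"
          unfolding exp_add by (rule ennreal_leI)
        then show ?thesis using True by (simp add: ennreal_mult)
      qed simp
    qed
    also have "\<dots> = ennreal (exp (- x\<^sup>2 / (4 * b))) * (\<integral>\<^sup>+y. ennreal (exp (y\<^sup>2 / (4 * \<sigma>\<^sup>2))) \<partial>normal_law 0 \<sigma>)"
      by (intro nn_integral_cmult) (simp add: normal_law_def)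
    also have "\<dots> = ennreal (exp (- x\<^sup>2 / (4 * b)) * sqrt 2)"
      using nn_integral_exp_square_normal[OF s0] s0 by (simp add: normal_law_def ennreal_mult)
    finally show ?thesis by (simp add: emeasure_eq_measure mult.commute)
  qed
qed

lemma char_normal_law:
  assumes s: "0 \<le> \<sigma>"
  shows "char (normal_law 0 \<sigma>) t = complex_of_real (exp (- (\<sigma> * t)\<^sup>2 / 2))"
proof (cases "\<sigma> = 0")
  case True
  have "char (normal_law 0 \<sigma>) t = (\<integral>x. iexp (t * x) \<partial>return borel 0)"
    using True by (simp add: char_def normal_law_def)
  also have "\<dots> = iexp (t * 0)" by (rule integral_return) auto
  finally show ?thesis using True by simp
next
  case False
  with s have s0: "0 < \<sigma>" by simp
  interpret N: prob_space std_normal_distribution by (rule prob_space_std_normal)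
  have d: "distributed std_normal_distribution lborel (\<lambda>x. x) std_normal_density"
    unfolding distributed_def by (auto intro!: measure_eqI simp: emeasure_distr)
  have "distributed std_normal_distribution lborel (\<lambda>x. 0 + \<sigma> * x) (normal_density (0 + \<sigma> * 0) (\<bar>\<sigma>\<bar> * 1))"
    using s0 by (intro N.normal_density_affine[OF d]) auto
  then have "distr std_normal_distribution lborel (\<lambda>x. \<sigma> * x) = normal_law 0 \<sigma>"
    using s0 by (simp add: distributed_def normal_law_def)
  then have "char (normal_law 0 \<sigma>) t = (\<integral>x. iexp (t * x) \<partial>distr std_normal_distribution lborel (\<lambda>x. \<sigma> * x))"
    by (simp add: char_def)
  also have "\<dots> = (\<integral>x. iexp (t * (\<sigma> * x)) \<partial>std_normal_distribution)"
    by (rule integral_distr) auto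
  also have "\<dots> = char std_normal_distribution (\<sigma> * t)"
    by (simp add: char_def mult_ac)
  finally show ?thesis by (simp add: char_std_normal_distribution)
qed

lemma integrable_iexp_std_normal: "integrable std_normal_distribution (\<lambda>x. iexp (c * x))"
proof -
  interpret prob_space std_normal_distribution by (rule prob_space_std_normal)
  show ?thesis by (rule integrable_const_bound[of _ 1]) auto
qed

lemma std_gauss_char:
  assumes I: "finite I"
  shows "(\<integral>u. iexp (\<Sum>i\<in>I. t i * u i) \<partial>std_gauss I) = complex_of_real (exp (- (\<Sum>i\<in>I. (t i)\<^sup>2) / 2))"
proof -
  interpret N: product_prob_space "\<lambda>_::'a. std_normal_distribution"
    by (intro product_prob_spaceI prob_space_std_normal)
  have "(\<integral>u. iexp (\<Sum>i\<in>I. t i * u i) \<partial>std_gauss I) = (\<integral>u. (\<Prod>i\<in>I. iexp (t i * u i)) \<partial>std_gauss I)"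
    using I by (intro Bochner_Integration.integral_cong refl) (simp add: sum_distrib_left flip: exp_sum)
  also have "\<dots> = (\<Prod>i\<in>I. \<integral>x. iexp (t i * x) \<partial>std_normal_distribution)"
    unfolding std_gauss_def
    by (intro N.product_integral_prod[OF I] integrable_iexp_std_normal)
  also have "\<dots> = (\<Prod>i\<in>I. complex_of_real (exp (- (t i)\<^sup>2 / 2)))"
    using char_std_normal_distribution by (intro prod.cong refl) (metis char_def)
  also have "\<dots> = complex_of_real (exp (- (\<Sum>i\<in>I. (t i)\<^sup>2) / 2))"
    using I by (simp only: of_real_prod[symmetric] exp_sum[symmetric] sum_negf[symmetric] sum_divide_distrib)
  finally show ?thesis .
qed

text \<open>Both laws have the same joint characteristic function, hence give the same mass to every box, and boxes determine a
  measure on the finite product space.\<close>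

lemma distr_eq_std_gauss:
  fixes \<xi> :: "'i \<Rightarrow> 'w \<Rightarrow> real"
  assumes M: "prob_space M" and I: "finite I"
    and meas: "\<And>i. i \<in> I \<Longrightarrow> \<xi> i \<in> borel_measurable M"
    and char: "\<And>t. (\<integral>\<omega>. iexp (\<Sum>i\<in>I. t i * \<xi> i \<omega>) \<partial>M) = complex_of_real (exp (- (\<Sum>i\<in>I. (t i)\<^sup>2) / 2))"
  shows "distr M (std_gauss I) (\<lambda>\<omega>. \<lambda>i\<in>I. \<xi> i \<omega>) = std_gauss I"
proof -
  interpret M: prob_space M by fact
  interpret G: prob_space "std_gauss I" by (rule prob_space_std_gauss)
  interpret N: product_prob_space "\<lambda>_::'i. std_normal_distribution"
    by (intro product_prob_spaceI prob_space_std_normal)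
  let ?f = "\<lambda>\<omega>. \<lambda>i\<in>I. \<xi> i \<omega>"
  have f[measurable]: "?f \<in> measurable M (std_gauss I)"
    unfolding measurable_cong_sets[OF refl sets_std_gauss] by (rule measurable_into_leb_on_idx[OF meas])
  have "distr M (std_gauss I) ?f = (\<Pi>\<^sub>M i\<in>I. std_normal_distribution)"
  proof (rule N.PiM_eqI[OF I])
    show "sets (distr M (std_gauss I) ?f) = sets (\<Pi>\<^sub>M i\<in>I. std_normal_distribution)"
      by (simp add: std_gauss_def)
    fix A :: "'i \<Rightarrow> real set" assume A0: "\<And>i. i \<in> I \<Longrightarrow> A i \<in> sets std_normal_distribution"
    then have A: "\<And>i. i \<in> I \<Longrightarrow> A i \<in> sets borel" by simp
    have m: "Pi\<^sub>E I A \<in> sets (std_gauss I)"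
      unfolding std_gauss_def using A I by (intro sets_PiM_I_finite) auto
    have mc: "(\<lambda>u. u i) \<in> borel_measurable (std_gauss I)" if "i \<in> I" for i
      using measurable_coordinate[of "\<lambda>x. x" "leb_on_idx I" I i] that measurable_cong_sets[OF sets_std_gauss refl] by auto
    have box: "{u \<in> space (std_gauss I). \<forall>i\<in>I. u i \<in> A i} = Pi\<^sub>E I A"
      by (simp add: set_eq_iff PiE_iff space_std_gauss conj_commute)
    have "emeasure (distr M (std_gauss I) ?f) (Pi\<^sub>E I A) = emeasure M (?f -` Pi\<^sub>E I A \<inter> space M)"
      by (rule emeasure_distr[OF f m])
    also have "?f -` Pi\<^sub>E I A \<inter> space M = {\<omega> \<in> space M. \<forall>i\<in>I. \<xi> i \<omega> \<in> A i}"
      by (simp add: set_eq_iff restrict_PiE_iff Pi_iff conj_commute)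
    also have "emeasure M \<dots> = ennreal (measure M {\<omega> \<in> space M. \<forall>i\<in>I. \<xi> i \<omega> \<in> A i})"
      by (rule M.emeasure_eq_measure)
    also have "measure M {\<omega> \<in> space M. \<forall>i\<in>I. \<xi> i \<omega> \<in> A i}
        = measure (std_gauss I) {u \<in> space (std_gauss I). \<forall>i\<in>I. u i \<in> A i}"
    proof (rule box_uniqueness[where ?U1.0=\<xi> and ?U2.0="\<lambda>i u. u i", OF M prob_space_std_gauss I meas mc A])
      fix t show "(\<integral>\<omega>. iexp (\<Sum>i\<in>I. t i * \<xi> i \<omega>) \<partial>M) = (\<integral>u. iexp (\<Sum>i\<in>I. t i * u i) \<partial>std_gauss I)"
        by (rule trans[OF char[of t] std_gauss_char[OF I, of t, symmetric]])
    qed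
    also have "ennreal \<dots> = emeasure (std_gauss I) (Pi\<^sub>E I A)"
      by (simp only: box G.emeasure_eq_measure)
    also have "\<dots> = (\<Prod>i\<in>I. emeasure std_normal_distribution (A i))"
      unfolding std_gauss_def by (rule N.emeasure_PiM[OF I A0])
    finally show "emeasure (distr M (std_gauss I) ?f) (Pi\<^sub>E I A) = (\<Prod>i\<in>I. emeasure std_normal_distribution (A i))" .
  qed
  then show ?thesis by (simp add: std_gauss_def)
qed

text \<open>The factorised characteristic function is that of the pair \<open>(U, Z)\<close> on the product of \<open>M\<close> with the standard
  normal law; the two models therefore agree on boxes.  The index type is extended by \<open>None\<close> to hold \<open>Z\<close>.\<close>

lemma independent_std_normal:
  fixes U :: "'i \<Rightarrow> 'w \<Rightarrow> real"
  assumes M: "prob_space M" and I: "finite I"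
    and U: "\<And>i. i \<in> I \<Longrightarrow> U i \<in> borel_measurable M" and Z[measurable]: "Z \<in> borel_measurable M"
    and char: "\<And>t z. (\<integral>\<omega>. iexp ((\<Sum>i\<in>I. t i * U i \<omega>) + z * Z \<omega>) \<partial>M)
      = (\<integral>\<omega>. iexp (\<Sum>i\<in>I. t i * U i \<omega>) \<partial>M) * complex_of_real (exp (- z\<^sup>2 / 2))"
    and A: "\<And>i. i \<in> I \<Longrightarrow> A i \<in> sets borel" and B[measurable]: "B \<in> sets borel"
  shows "measure M {\<omega> \<in> space M. (\<forall>i\<in>I. U i \<omega> \<in> A i) \<and> Z \<omega> \<in> B}
    = measure M {\<omega> \<in> space M. \<forall>i\<in>I. U i \<omega> \<in> A i} * measure std_normal_distribution B"
proof -
  interpret M: prob_space M by fact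
  interpret N: prob_space std_normal_distribution by (rule prob_space_std_normal)
  interpret P: pair_prob_space M std_normal_distribution ..
  let ?P = "M \<Otimes>\<^sub>M std_normal_distribution"
  let ?I = "insert None (Some ` I)"
  define U1 where "U1 = case_option Z U"
  define U2 where "U2 = case_option (\<lambda>p. snd p) (\<lambda>i p. U i (fst p))"
  define A' where "A' = case_option B A"
  have sI: "(\<Sum>i\<in>?I. t i * V i) = (\<Sum>i\<in>I. t (Some i) * V (Some i)) + t None * V None" for t V :: "'i option \<Rightarrow> real"
    using I by (subst sum.insert) (auto simp: sum.reindex o_def)
  have "measure M {\<omega> \<in> space M. \<forall>i\<in>?I. U1 i \<omega> \<in> A' i} = measure ?P {p \<in> space ?P. \<forall>i\<in>?I. U2 i p \<in> A' i}"
  proof (rule box_uniqueness[OF M])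
    show "prob_space ?P" by unfold_locales
    show "finite ?I" using I by simp
    fix i assume i: "i \<in> ?I"
    show "U1 i \<in> borel_measurable M" using i U by (auto simp: U1_def)
    show "U2 i \<in> borel_measurable ?P" using i U by (auto simp: U2_def intro: measurable_compose[OF measurable_fst])
    show "A' i \<in> sets borel" using i A by (auto simp: A'_def)
  next
    fix t :: "'i option \<Rightarrow> real"
    define s where "s = (\<lambda>\<omega>. \<Sum>i\<in>I. t (Some i) * U i \<omega>)"
    define e where "e = complex_of_real (exp (- (t None)\<^sup>2 / 2))"
    have s[measurable]: "s \<in> borel_measurable M" unfolding s_def using U by (intro borel_measurable_sum) auto
    have ch: "(\<integral>x. iexp (t None * x) \<partial>std_normal_distribution) = e"
      unfolding e_def using char_std_normal_distribution by (metis char_def)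
    have "(\<integral>p. iexp (\<Sum>i\<in>?I. t i * U2 i p) \<partial>?P)
        = (\<integral>p. iexp (s (fst p)) * iexp (t None * snd p) \<partial>?P)"
      unfolding sI by (intro Bochner_Integration.integral_cong refl) (simp add: U2_def s_def ring_distribs exp_add)
    also have "\<dots> = (\<integral>\<omega>. (\<integral>x. iexp (s \<omega>) * iexp (t None * x) \<partial>std_normal_distribution) \<partial>M)"
    proof (subst P.integral_fst'[symmetric])
      show "integrable ?P (\<lambda>p. iexp (s (fst p)) * iexp (t None * snd p))"
        by (rule P.integrable_const_bound[of _ 1]) (auto simp: norm_mult)
    qed simp
    also have "\<dots> = (\<integral>\<omega>. iexp (s \<omega>) * e \<partial>M)"
      by (simp only: integral_mult_right_zero ch)
    also have "\<dots> = (\<integral>\<omega>. iexp (s \<omega>) \<partial>M) * e"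
      by (rule integral_mult_left_zero)
    also have "\<dots> = (\<integral>\<omega>. iexp (\<Sum>i\<in>?I. t i * U1 i \<omega>) \<partial>M)"
      unfolding sI by (simp only: U1_def option.case char s_def e_def)
    finally show "(\<integral>\<omega>. iexp (\<Sum>i\<in>?I. t i * U1 i \<omega>) \<partial>M) = (\<integral>p. iexp (\<Sum>i\<in>?I. t i * U2 i p) \<partial>?P)" ..
  qed
  moreover have "{\<omega> \<in> space M. \<forall>i\<in>?I. U1 i \<omega> \<in> A' i} = {\<omega> \<in> space M. (\<forall>i\<in>I. U i \<omega> \<in> A i) \<and> Z \<omega> \<in> B}"
    by (auto simp: U1_def A'_def)
  moreover have "{p \<in> space ?P. \<forall>i\<in>?I. U2 i p \<in> A' i} = {\<omega> \<in> space M. \<forall>i\<in>I. U i \<omega> \<in> A i} \<times> B"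
    by (auto simp: U2_def A'_def space_pair_measure)
  moreover have "{\<omega> \<in> space M. \<forall>i\<in>I. U i \<omega> \<in> A i} \<in> sets M"
  proof (rule sets.sets_Collect_finite_All[OF _ I])
    fix i assume i: "i \<in> I"
    show "{\<omega> \<in> space M. U i \<omega> \<in> A i} \<in> sets M"
      using measurable_sets[OF U[OF i] A[OF i]] by (simp add: vimage_def Int_def conj_commute)
  qed
  ultimately show ?thesis
    by (simp add: measure_def N.emeasure_pair_measure_Times enn2real_mult)
qed

text \<open>The density on \<open>{t<..t + 1}\<close> is at least its value at \<open>t + 1\<close>, and \<open>(t + 1)\<^sup>2 \<le> 2 t\<^sup>2 + 2\<close>.\<close>

lemma std_normal_upper_tail:
  assumes t: "0 \<le> t"
  shows "exp (- t\<^sup>2 - 1) / sqrt (2 * pi) \<le> measure std_normal_distribution {t<..}"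
proof -
  interpret N: prob_space std_normal_distribution by (rule prob_space_std_normal)
  have "ennreal (exp (- t\<^sup>2 - 1) / sqrt (2 * pi)) = (\<integral>\<^sup>+x. ennreal (exp (- t\<^sup>2 - 1) / sqrt (2 * pi)) * indicator {t<..t+1} x \<partial>lborel)"
    by (simp add: nn_integral_cmult)
  also have "\<dots> \<le> (\<integral>\<^sup>+x. ennreal (std_normal_density x) * indicator {t<..} x \<partial>lborel)"
  proof (intro nn_integral_mono)
    fix x
    have "ennreal (exp (- t\<^sup>2 - 1) / sqrt (2 * pi)) \<le> ennreal (std_normal_density x)" if x: "x \<in> {t<..t+1}"
    proof -
      have "x\<^sup>2 \<le> (t + 1)\<^sup>2" using x t by (intro power_mono) auto
      also have "\<dots> \<le> 2 * t\<^sup>2 + 2" using sum_squares_bound[of t 1] by (simp add: power2_sum)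
      finally show ?thesis by (intro ennreal_leI) (simp add: std_normal_density_def divide_right_mono)
    qed
    then show "ennreal (exp (- t\<^sup>2 - 1) / sqrt (2 * pi)) * indicator {t<..t+1} x \<le> ennreal (std_normal_density x) * indicator {t<..} x"
      by (auto simp: indicator_def)
  qed
  also have "\<dots> = emeasure std_normal_distribution {t<..}" by (simp add: emeasure_density)
  finally show ?thesis by (simp add: N.emeasure_eq_measure)
qed

section \<open>The quasi-posterior and its Gaussian limit\<close>

text \<open>If a density oscillates by a factor of at most \<open>1 - \<phi>\<close> on \<open>B\<close>, then the tilted measure differs from the base measure by
  \<open>\<phi>\<close> plus the masses outside \<open>B\<close>.  The factor one in front of \<open>\<phi>\<close> comes from comparing the two measures of
  \<open>T \<inter> B\<close> through a double integral of \<open>p\<close> at two independent points, instead of comparing each of them with a reference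
  value of \<open>p\<close>.  The lower bound for \<open>S\<close> and for its complement together bound the absolute value.\<close>

lemma tilted_measure_close:
  assumes N: "prob_space N" and p[measurable]: "p \<in> borel_measurable N" and p0: "\<And>x. x \<in> space N \<Longrightarrow> 0 \<le> p x"
    and Q: "prob_space (density N (\<lambda>x. ennreal (p x)))"
    and B[measurable]: "B \<in> sets N" and \<phi>: "0 \<le> \<phi>" "\<phi> \<le> 1"
    and ratio: "\<And>x y. x \<in> B \<Longrightarrow> y \<in> B \<Longrightarrow> (1 - \<phi>) * p y \<le> p x"
    and S: "S \<in> sets N"
  defines "Q \<equiv> density N (\<lambda>x. ennreal (p x))"
  shows "\<bar>measure Q S - measure N S\<bar> \<le> \<phi> + measure Q (space N - B) + measure N (space N - B)"
proof -
  interpret N: prob_space N by fact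
  interpret Q: prob_space Q using Q unfolding Q_def .
  have sQ: "sets Q = sets N" "space Q = space N" by (simp_all add: Q_def)
  have ip: "integrable N p"
  proof (rule integrableI_nonneg)
    show "AE x in N. 0 \<le> p x" using p0 by auto
    have "(\<integral>\<^sup>+x. ennreal (p x) \<partial>N) = emeasure Q (space Q)"
      unfolding Q_def by (simp add: emeasure_density)
    then show "(\<integral>\<^sup>+x. ennreal (p x) \<partial>N) < \<infinity>" using Q.emeasure_space_1 by simp
  qed (rule p)
  have mQ: "measure Q C = (\<integral>x. indicator C x * p x \<partial>N)" if C[measurable]: "C \<in> sets N" for C
  proof -
    have "emeasure Q C = (\<integral>\<^sup>+x. ennreal (p x) * indicator C x \<partial>N)"
      unfolding Q_def by (rule emeasure_density) auto
    also have "\<dots> = (\<integral>\<^sup>+x. ennreal (indicator C x * p x) \<partial>N)"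
      by (intro nn_integral_cong) (auto split: split_indicator)
    also have "\<dots> = ennreal (\<integral>x. indicator C x * p x \<partial>N)"
      using ip p0 by (intro nn_integral_eq_integral integrable_real_mult_indicator[simplified mult.commute[of "indicator _ _"]]
          AE_I2) (auto simp: mult.commute intro: integrable_real_mult_indicator)
    finally show ?thesis using p0
      by (simp add: measure_def sum_nonneg)
  qed
  have one_side: "measure N T - measure Q T \<le> \<phi> + measure Q (space N - B) + measure N (space N - B)"
    if T[measurable]: "T \<in> sets N" for T
  proof -
    define m q b r where "m = measure N (T \<inter> B)" "q = measure Q (T \<inter> B)" "b = measure N B" "r = measure Q B"
    note defs = this
    have iC: "integrable N (\<lambda>x. indicator C x * p x)" if [measurable]: "C \<in> sets N" for C
      using integrable_real_mult_indicator[OF that ip] by (simp add: mult.commute)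
    have ic: "integrable N (\<lambda>x. indicator C x * c)" if [measurable]: "C \<in> sets N" for C and c :: real
      by (rule N.integrable_const_bound[of _ "\<bar>c\<bar>"]) (auto split: split_indicator)
    \<comment> \<open>Integrate the ratio bound over the first point with the second one fixed; the next step integrates over the second one.\<close>
    have key: "(1 - \<phi>) * p y * m \<le> q" if y: "y \<in> B" for y
    proof -
      have "(1 - \<phi>) * p y * m = (\<integral>x. indicator (T \<inter> B) x * ((1 - \<phi>) * p y) \<partial>N)"
        by (simp add: defs Int_absorb2 sets.sets_into_space)
      also have "\<dots> \<le> (\<integral>x. indicator (T \<inter> B) x * p x \<partial>N)"
        using ratio y by (intro integral_mono ic iC) (auto split: split_indicator)
      finally show ?thesis by (simp add: defs mQ)
    qed
    have "(1 - \<phi>) * m * r = (\<integral>y. (1 - \<phi>) * m * (indicator B y * p y) \<partial>N)"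
      by (simp add: defs mQ)
    also have "\<dots> \<le> (\<integral>y. indicator B y * q \<partial>N)"
      using key by (intro integral_mono ic iC integrable_mult_right) (auto split: split_indicator simp: mult_ac)
    also have "\<dots> = b * q" by (simp add: defs Int_absorb2 sets.sets_into_space)
    also have "\<dots> \<le> q" by (simp add: defs mult_left_le_one_le)
    finally have 1: "(1 - \<phi>) * m * r \<le> q" .
    have m1: "0 \<le> m" "m \<le> 1" and r1: "0 \<le> r" "r \<le> 1" by (simp_all add: defs)
    have "m - q \<le> \<phi> + (1 - r)"
    proof -
      have "m * (1 - (1 - \<phi>) * r) \<le> 1 * (1 - (1 - \<phi>) * r)"
        using m1 r1 \<phi> mult_le_one[of "1 - \<phi>" r] by (intro mult_right_mono) auto
      moreover have "\<phi> * r \<le> \<phi>" using r1 \<phi> by (simp add: mult_left_le)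
      ultimately show ?thesis using 1 by (simp add: algebra_simps)
    qed
    moreover have "measure N T \<le> m + measure N (space N - B)"
    proof -
      have "measure N T \<le> measure N ((T \<inter> B) \<union> (space N - B))"
        using sets.sets_into_space[OF T] by (intro N.finite_measure_mono) auto
      also have "\<dots> \<le> m + measure N (space N - B)" unfolding defs
        by (intro measure_Un_le) auto
      finally show ?thesis .
    qed
    moreover have "q \<le> measure Q T" unfolding defs using T sQ by (intro Q.finite_measure_mono) auto
    moreover have "1 - r = measure Q (space N - B)"
      using Q.prob_compl[of B] B sQ by (simp add: defs)
    ultimately show ?thesis by simp
  qed
  have "measure N (space N - S) - measure Q (space N - S) = measure Q S - measure N S"
    using Q.prob_compl[of S] N.prob_compl[of S] S sQ by simp
  then show ?thesis using one_side[OF S] one_side[of "space N - S"] S by (simp add: abs_le_iff)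
qed

lemma L2_set_triangle_diff:
  assumes "\<And>i. i \<in> I \<Longrightarrow> f i = g i + h i"
  shows "L2_set f I \<le> L2_set g I + L2_set h I"
  using L2_set_triangle_ineq[of g h I] L2_set_cong[OF refl assms, of I] by simp

lemma measurable_quasi_lik [measurable]:
  assumes "finite I"
  shows "quasi_lik I A X y \<in> borel_measurable (leb_on_idx I)"
proof -
  have "(\<lambda>\<beta>. L2_set (\<lambda>i. mat_vec I A y i - mat_vec I X \<beta> i) I) \<in> borel_measurable (leb_on_idx I)"
    by (intro measurable_L2_set assms borel_measurable_diff[OF borel_measurable_const measurable_mat_vec]) simp_all
  then show ?thesis unfolding quasi_lik_def[abs_def] by measurable
qed

lemma sets_Bset:
  assumes "finite I"
  shows "Bset I X b0 R \<in> sets (leb_on_idx I)"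
proof -
  have "(\<lambda>\<beta>. L2_set (mat_vec I X (\<lambda>i. \<beta> i - b0 i)) I) \<in> borel_measurable (leb_on_idx I)"
    unfolding mat_vec_diff[abs_def]
    by (intro measurable_L2_set assms borel_measurable_diff[OF measurable_mat_vec borel_measurable_const]) simp_all
  then show ?thesis unfolding Bset_def by measurable
qed

text \<open>A Bernstein--von Mises theorem with explicit error.  With \<open>u \<beta> = X (\<beta> - b0) - e\<close> the likelihood is
  \<open>exp (- \<parallel>u \<beta>\<parallel>\<^sup>2 / 2)\<close>.  Normalised, it is the density of the Gaussian law \<open>N\<close> of
  \<open>bk v = b0 + V (v + e)\<close> for a standard Gaussian vector \<open>v\<close>, and the quasi-posterior is \<open>N\<close> tilted by a multiple of
  the prior density.  On the ball \<open>Bset I X b0 R\<close> the tilt is nearly constant by assumption.  Outside this ball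
  \<open>\<parallel>u \<beta>\<parallel> \<ge> R - \<parallel>e\<parallel>\<close>, so that \<open>N\<close> has little mass there by the Gaussian tail, and the quasi-posterior because its
  unnormalised mass is at most \<open>exp (- (R - \<parallel>e\<parallel>)\<^sup>2 / 2)\<close> while the evidence \<open>Z\<close> is at least
  \<open>z exp (- (\<parallel>e\<parallel> + 1)\<^sup>2 / 2)\<close>, by integrating over the small ball of radius \<open>r\<close> alone.\<close>

lemma quasi_posterior_close:
  fixes I :: "'i set"
  assumes I: "finite I"
    and XV: "\<And>b i. i \<in> I \<Longrightarrow> mat_vec I X (mat_vec I V b) i = b i"
    and VX: "\<And>b i. i \<in> I \<Longrightarrow> mat_vec I V (mat_vec I X b) i = b i"
    and \<pi>: "prior_density I \<pi>"
    and model: "\<And>\<beta> i. i \<in> I \<Longrightarrow> mat_vec I A y i - mat_vec I X \<beta> i = e i - mat_vec I X (\<lambda>i. \<beta> i - b0 i) i"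
    and eR: "L2_set e I \<le> R"
    and \<phi>: "0 \<le> \<phi>" "\<phi> \<le> 1"
    and ratio: "\<And>\<beta> \<beta>'. \<beta> \<in> Bset I X b0 R \<Longrightarrow> \<beta>' \<in> Bset I X b0 R \<Longrightarrow> (1 - \<phi>) * \<pi> \<beta>' \<le> \<pi> \<beta>"
    and r: "r \<le> 1" and p0: "\<And>\<beta>. \<beta> \<in> Bset I X b0 r \<Longrightarrow> p0 \<le> \<pi> \<beta>"
    and z: "0 < z" "ennreal z \<le> ennreal p0 * emeasure (leb_on_idx I) (Bset I X b0 r)"
    and S[measurable]: "S \<in> sets (leb_on_idx I)"
  shows "prob_space (quasi_posterior I A X \<pi> y)"
    "\<bar>measure (quasi_posterior I A X \<pi> y) S
        - measure (std_gauss I) {v \<in> space (std_gauss I). (\<lambda>i\<in>I. b0 i + mat_vec I V (\<lambda>j. v j + e j) i) \<in> S}\<bar>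
      \<le> \<phi> + exp ((1 / 2) * (L2_set e I + 1)\<^sup>2 - (1 / 2) * (R - L2_set e I)\<^sup>2) / z
        + measure (std_gauss I) {v \<in> space (std_gauss I). R - L2_set e I \<le> L2_set v I}"
proof -
  let ?L = "leb_on_idx I" and ?G = "std_gauss I"
  interpret G: prob_space ?G by (rule prob_space_std_gauss)
  have "\<exists>c>0. c < \<infinity> \<and> (\<forall>f\<in>borel_measurable ?L. (\<integral>\<^sup>+b. f (mat_map I X b) \<partial>?L) = c * (\<integral>\<^sup>+u. f u \<partial>?L))"
    by (rule nn_integral_leb_on_idx_linear[OF I XV VX]) auto
  then obtain c where c: "0 < c" "c < \<infinity>"
    "\<And>f. f \<in> borel_measurable ?L \<Longrightarrow> (\<integral>\<^sup>+b. f (mat_map I X b) \<partial>?L) = c * (\<integral>\<^sup>+u. f u \<partial>?L)"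
    by blast
  \<comment> \<open>The Jacobian of \<open>X\<close>; it normalises \<open>N\<close> below.\<close>
  define c' where "c' = enn2real c"
  have c': "0 < c'" "ennreal c' = c" using c by (simp_all add: c'_def enn2real_positive_iff)
  define s where "s i = - mat_vec I X b0 i - e i" for i
  define u where "u \<beta> = (\<lambda>i\<in>I. mat_vec I X \<beta> i + s i)" for \<beta>
  define bk where "bk v = (\<lambda>i\<in>I. b0 i + mat_vec I V (\<lambda>j. v j + e j) i)" for v
  have u[measurable]: "u \<in> measurable ?L ?L" unfolding u_def
    by (intro measurable_into_leb_on_idx borel_measurable_add[OF measurable_mat_vec borel_measurable_const]) simp
  have bk_eq: "bk = (\<lambda>v. \<lambda>i\<in>I. mat_vec I V v i + (mat_vec I V e i + b0 i))"
    by (simp add: bk_def mat_vec_add fun_eq_iff restrict_def)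
  have bk[measurable]: "bk \<in> measurable ?L ?L" unfolding bk_eq
    by (intro measurable_into_leb_on_idx borel_measurable_add[OF measurable_mat_vec borel_measurable_const]) simp
  have bk_u: "bk (u \<beta>) = \<beta>" if \<beta>: "\<beta> \<in> space ?L" for \<beta>
  proof
    fix i
    show "bk (u \<beta>) i = \<beta> i"
    proof (cases "i \<in> I")
      case True
      have "mat_vec I V (\<lambda>j. u \<beta> j + e j) i = mat_vec I V (mat_vec I X (\<lambda>j. \<beta> j - b0 j)) i"
        by (rule mat_vec_cong) (simp add: u_def s_def mat_vec_diff)
      then show ?thesis using True VX[OF True] by (simp add: bk_def)
    qed (use \<beta> in \<open>simp add: bk_def space_leb_on_idx extensional_def\<close>)
  qed
  \<comment> \<open>Change of variables \<open>v = u \<beta>\<close>.\<close>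
  have nn_u: "(\<integral>\<^sup>+\<beta>. f (u \<beta>) \<partial>?L) = c * (\<integral>\<^sup>+v. f v \<partial>?L)" if f[measurable]: "f \<in> borel_measurable ?L" for f
  proof -
    let ?T = "\<lambda>x. \<lambda>i\<in>I. x i + s i"
    have T[measurable]: "?T \<in> measurable ?L ?L"
      by (intro measurable_into_leb_on_idx borel_measurable_add[OF measurable_coordinate borel_measurable_const]) auto
    have "(\<integral>\<^sup>+\<beta>. f (u \<beta>) \<partial>?L) = (\<integral>\<^sup>+\<beta>. f (?T (mat_map I X \<beta>)) \<partial>?L)"
      by (intro nn_integral_cong arg_cong[where f=f]) (auto simp: u_def mat_map_def)
    also have "\<dots> = c * (\<integral>\<^sup>+x. f (?T x) \<partial>?L)" by (rule c(3)) measurable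
    also have "(\<integral>\<^sup>+x. f (?T x) \<partial>?L) = (\<integral>\<^sup>+x. f x \<partial>?L)"
      by (rule nn_integral_leb_on_idx_translate[OF I f])
    finally show ?thesis .
  qed
  note gI[measurable] = measurable_gauss_density[OF I] and lI[measurable] = measurable_quasi_lik[OF I]
  have g0: "0 \<le> gauss_density I v" for v by (simp add: gauss_density_def)
  define N where "N = density ?L (\<lambda>\<beta>. ennreal (gauss_density I (u \<beta>) / c'))"
  have sN: "sets N = sets ?L" "space N = space ?L" by (simp_all add: N_def)
  have em_N: "emeasure N T = emeasure ?G (bk -` T \<inter> space ?G)" if T[measurable]: "T \<in> sets ?L" for T
  proof -
    have ic: "ennreal (gauss_density I v / c') = ennreal (1 / c') * ennreal (gauss_density I v)" for v
      using c' g0 by (simp flip: ennreal_mult)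
    have cc: "ennreal (1 / c') * c = 1" using c' by (simp flip: c'(2) ennreal_mult)
    have "emeasure N T = (\<integral>\<^sup>+\<beta>. ennreal (gauss_density I (u \<beta>) / c') * indicator T \<beta> \<partial>?L)"
      unfolding N_def by (rule emeasure_density) measurable
    also have "\<dots> = (\<integral>\<^sup>+\<beta>. (\<lambda>v. ennreal (gauss_density I v / c') * indicator T (bk v)) (u \<beta>) \<partial>?L)"
      by (intro nn_integral_cong) (simp add: bk_u)
    also have "\<dots> = c * (\<integral>\<^sup>+v. ennreal (gauss_density I v / c') * indicator T (bk v) \<partial>?L)"
      by (rule nn_u) measurable
    also have "\<dots> = (\<integral>\<^sup>+v. ennreal (gauss_density I v) * indicator (bk -` T \<inter> space ?L) v \<partial>?L)"
      unfolding ic mult.assoc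
      by (subst nn_integral_cmult, measurable, subst mult.assoc[symmetric], subst mult.commute[of c], subst cc)
        (auto intro!: nn_integral_cong split: split_indicator)
    also have "\<dots> = emeasure ?G (bk -` T \<inter> space ?L)"
      unfolding std_gauss_eq_density[OF I] by (rule emeasure_density[symmetric]) measurable
    finally show ?thesis by (simp add: space_std_gauss space_leb_on_idx)
  qed
  have N: "prob_space N"
  proof (rule prob_spaceI)
    have "bk -` space ?L \<inter> space ?G = space ?G"
      using measurable_space[OF bk] by (auto simp: space_std_gauss space_leb_on_idx)
    then show "emeasure N (space N) = 1" using em_N[of "space ?L"] sN G.emeasure_space_1 by simp
  qed
  then interpret N: prob_space N .
  have mN: "measure N T = measure ?G (bk -` T \<inter> space ?G)" if "T \<in> sets ?L" for T
    using em_N[OF that] by (simp add: measure_def)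
  have \<pi>m[measurable]: "\<pi> \<in> borel_measurable ?L" and \<pi>0: "\<And>\<beta>. \<beta> \<in> space ?L \<Longrightarrow> 0 \<le> \<pi> \<beta>"
    and \<pi>1: "(\<integral>\<^sup>+\<beta>. ennreal (\<pi> \<beta>) \<partial>?L) = 1"
    using \<pi> unfolding prior_density_def by auto
  let ?lik = "quasi_lik I A X y"
  define Z where "Z = (LINT \<beta>|?L. \<pi> \<beta> * ?lik \<beta>)"
  have lik_u: "?lik \<beta> = exp (- (1 / 2) * (L2_set (u \<beta>) I)\<^sup>2)" for \<beta>
  proof -
    have "L2_set (\<lambda>i. mat_vec I A y i - mat_vec I X \<beta> i) I = L2_set (\<lambda>i. - u \<beta> i) I"
      by (rule L2_set_cong) (simp_all add: model u_def s_def mat_vec_diff)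
    then show ?thesis by (simp add: quasi_lik_def L2_set_def)
  qed
  have lik01: "0 < ?lik \<beta>" "?lik \<beta> \<le> 1" for \<beta> unfolding lik_u by simp_all
  have ZI: "(\<integral>\<^sup>+\<beta>. ennreal (\<pi> \<beta> * ?lik \<beta>) \<partial>?L) = ennreal Z"
  proof -
    have "(\<integral>\<^sup>+\<beta>. ennreal (\<pi> \<beta> * ?lik \<beta>) \<partial>?L) \<le> (\<integral>\<^sup>+\<beta>. ennreal (\<pi> \<beta>) \<partial>?L)"
      using lik01 \<pi>0 by (intro nn_integral_mono ennreal_leI) (simp add: mult_left_le)
    then have "integrable ?L (\<lambda>\<beta>. \<pi> \<beta> * ?lik \<beta>)"
      using \<pi>1 \<pi>0 lik01 by (intro integrableI_nonneg AE_I2) (auto simp: less_imp_le le_less_trans)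
    then show ?thesis unfolding Z_def
      using \<pi>0 lik01 by (intro nn_integral_eq_integral AE_I2) (auto simp: less_imp_le)
  qed
  \<comment> \<open>A lower bound for the likelihood on the small ball, since \<open>\<parallel>u \<beta>\<parallel> \<le> r + \<parallel>e\<parallel> \<le> 1 + \<parallel>e\<parallel>\<close> there.\<close>
  define q where "q = exp (- (1 / 2) * (L2_set e I + 1)\<^sup>2)"
  have Xe: "L2_set (u \<beta>) I \<le> L2_set (mat_vec I X (\<lambda>i. \<beta> i - b0 i)) I + L2_set e I"
    "L2_set (mat_vec I X (\<lambda>i. \<beta> i - b0 i)) I \<le> L2_set (u \<beta>) I + L2_set e I" for \<beta>
  proof -
    have "L2_set (\<lambda>i. - e i) I = L2_set e I" by (simp add: L2_set_def)
    moreover have "L2_set (u \<beta>) I \<le> L2_set (mat_vec I X (\<lambda>i. \<beta> i - b0 i)) I + L2_set (\<lambda>i. - e i) I"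
      by (rule L2_set_triangle_diff) (simp add: u_def s_def mat_vec_diff)
    ultimately show "L2_set (u \<beta>) I \<le> L2_set (mat_vec I X (\<lambda>i. \<beta> i - b0 i)) I + L2_set e I" by simp
    show "L2_set (mat_vec I X (\<lambda>i. \<beta> i - b0 i)) I \<le> L2_set (u \<beta>) I + L2_set e I"
      by (rule L2_set_triangle_diff) (simp add: u_def s_def mat_vec_diff)
  qed
  note Bs[measurable] = sets_Bset[OF I, of X b0]
  have Zz: "z * q \<le> Z"
  proof -
    have "ennreal (z * q) \<le> ennreal p0 * emeasure ?L (Bset I X b0 r) * ennreal q"
      using z by (simp add: ennreal_mult q_def mult_right_mono)
    also have "\<dots> = (\<integral>\<^sup>+\<beta>. ennreal p0 * ennreal q * indicator (Bset I X b0 r) \<beta> \<partial>?L)"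
      by (subst nn_integral_cmult_indicator) (simp_all add: mult_ac)
    also have "\<dots> \<le> (\<integral>\<^sup>+\<beta>. ennreal (\<pi> \<beta> * ?lik \<beta>) \<partial>?L)"
    proof (rule nn_integral_mono)
      fix \<beta> assume \<beta>: "\<beta> \<in> space ?L"
      show "ennreal p0 * ennreal q * indicator (Bset I X b0 r) \<beta> \<le> ennreal (\<pi> \<beta> * ?lik \<beta>)"
      proof (cases "\<beta> \<in> Bset I X b0 r")
        case True
        have "L2_set (u \<beta>) I \<le> L2_set e I + 1" using Xe(1)[of \<beta>] True r by (simp add: Bset_def)
        then have "q \<le> ?lik \<beta>" unfolding lik_u q_def by (simp add: power_mono)
        then have "ennreal p0 * ennreal q \<le> ennreal (\<pi> \<beta>) * ennreal (?lik \<beta>)"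
          using p0[OF True] by (intro mult_mono ennreal_leI) auto
        then show ?thesis using True \<pi>0[OF \<beta>] lik01[of \<beta>] by (simp add: ennreal_mult less_imp_le)
      qed simp
    qed
    also have "\<dots> = ennreal Z" by (rule ZI)
    finally show ?thesis
      using z by (subst (asm) ennreal_le_iff2) (auto simp: q_def mult_le_0_iff not_le)
  qed
  have q0: "0 < q" by (simp add: q_def)
  have Z0: "0 < Z" using Zz z q0 by (meson less_le_trans mult_pos_pos)
  \<comment> \<open>The constant for which \<open>K \<pi>\<close> is the density of the quasi-posterior with respect to \<open>N\<close>.\<close>
  define K where "K = sqrt (2 * pi) ^ card I * c' / Z"
  have K0: "0 \<le> K" using c' Z0 by (simp add: K_def)
  have eqd: "gauss_density I (u \<beta>) / c' * (K * \<pi> \<beta>) = \<pi> \<beta> * ?lik \<beta> / Z" for \<beta>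
    using c' unfolding gauss_density_def lik_u K_def by (simp add: power_one_over field_simps)
  have post: "quasi_posterior I A X \<pi> y = density N (\<lambda>\<beta>. ennreal (K * \<pi> \<beta>))"
  proof -
    have "density N (\<lambda>\<beta>. ennreal (K * \<pi> \<beta>))
        = density ?L (\<lambda>\<beta>. ennreal (gauss_density I (u \<beta>) / c') * ennreal (K * \<pi> \<beta>))"
      unfolding N_def by (rule density_density_eq) measurable
    also have "\<dots> = density ?L (\<lambda>\<beta>. ennreal (\<pi> \<beta> * ?lik \<beta> / Z))"
    proof (rule density_cong)
      show "AE \<beta> in ?L. ennreal (gauss_density I (u \<beta>) / c') * ennreal (K * \<pi> \<beta>) = ennreal (\<pi> \<beta> * ?lik \<beta> / Z)"
      proof (rule AE_I2)
        fix \<beta> assume "\<beta> \<in> space ?L"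
        then show "ennreal (gauss_density I (u \<beta>) / c') * ennreal (K * \<pi> \<beta>) = ennreal (\<pi> \<beta> * ?lik \<beta> / Z)"
          using c' g0 K0 \<pi>0 by (subst ennreal_mult[symmetric]) (simp_all add: eqd del: times_divide_eq_left)
      qed
    qed measurable
    finally show ?thesis by (simp add: quasi_posterior_def Z_def)
  qed
  show Q: "prob_space (quasi_posterior I A X \<pi> y)"
  proof (rule prob_spaceI)
    have "emeasure (quasi_posterior I A X \<pi> y) (space (quasi_posterior I A X \<pi> y))
        = (\<integral>\<^sup>+\<beta>. ennreal (\<pi> \<beta> * ?lik \<beta> / Z) \<partial>?L)"
      unfolding quasi_posterior_def Z_def[symmetric] by (simp add: emeasure_density)
    also have "\<dots> = (\<integral>\<^sup>+\<beta>. ennreal (1 / Z) * ennreal (\<pi> \<beta> * ?lik \<beta>) \<partial>?L)"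
      using Z0 \<pi>0 lik01 by (intro nn_integral_cong) (simp add: less_imp_le flip: ennreal_mult)
    also have "\<dots> = ennreal (1 / Z) * ennreal Z"
      by (subst nn_integral_cmult) (simp_all add: ZI)
    also have "\<dots> = 1" using Z0 by (simp flip: ennreal_mult)
    finally show "emeasure (quasi_posterior I A X \<pi> y) (space (quasi_posterior I A X \<pi> y)) = 1" .
  qed
  then interpret Q: prob_space "quasi_posterior I A X \<pi> y" .
  let ?B = "Bset I X b0 R"
  have out: "R - L2_set e I \<le> L2_set (u \<beta>) I" if "\<beta> \<in> space ?L - ?B" for \<beta>
    using Xe(2)[of \<beta>] that by (auto simp: Bset_def)
  have muB: "measure (quasi_posterior I A X \<pi> y) (space ?L - ?B)
      \<le> exp ((1 / 2) * (L2_set e I + 1)\<^sup>2 - (1 / 2) * (R - L2_set e I)\<^sup>2) / z"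
  proof -
    define h where "h = exp (- (1 / 2) * (R - L2_set e I)\<^sup>2)"
    have "emeasure (quasi_posterior I A X \<pi> y) (space ?L - ?B)
        = (\<integral>\<^sup>+\<beta>. ennreal (\<pi> \<beta> * ?lik \<beta> / Z) * indicator (space ?L - ?B) \<beta> \<partial>?L)"
      unfolding quasi_posterior_def Z_def[symmetric] by (intro emeasure_density) measurable
    also have "\<dots> \<le> (\<integral>\<^sup>+\<beta>. ennreal (h / Z) * ennreal (\<pi> \<beta>) \<partial>?L)"
    proof (rule nn_integral_mono)
      fix \<beta> assume \<beta>: "\<beta> \<in> space ?L"
      show "ennreal (\<pi> \<beta> * ?lik \<beta> / Z) * indicator (space ?L - ?B) \<beta> \<le> ennreal (h / Z) * ennreal (\<pi> \<beta>)"
      proof (cases "\<beta> \<in> ?B")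
        case False
        have "(R - L2_set e I)\<^sup>2 \<le> (L2_set (u \<beta>) I)\<^sup>2"
          using out[of \<beta>] False \<beta> eR by (intro power_mono) auto
        then have "?lik \<beta> \<le> h" unfolding lik_u h_def by simp
        then have "\<pi> \<beta> * ?lik \<beta> / Z \<le> h / Z * \<pi> \<beta>"
          using divide_right_mono[OF mult_left_mono[OF _ \<pi>0[OF \<beta>]], of "?lik \<beta>" h Z] Z0 by (simp add: mult.commute)
        then show ?thesis using False \<beta> Z0 \<pi>0[OF \<beta>]
          by (subst ennreal_mult[symmetric]) (simp_all add: h_def ennreal_leI)
      qed simp
    qed
    also have "\<dots> = ennreal (h / Z)" by (subst nn_integral_cmult) (simp_all add: \<pi>1)
    finally have "measure (quasi_posterior I A X \<pi> y) (space ?L - ?B) \<le> h / Z"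
      using Z0 by (simp add: Q.emeasure_eq_measure h_def)
    also have "\<dots> \<le> h / (z * q)" using Zz z q0 Z0 by (intro divide_left_mono mult_pos_pos) (simp_all add: h_def)
    also have "h / (z * q) = exp ((1 / 2) * (L2_set e I + 1)\<^sup>2 - (1 / 2) * (R - L2_set e I)\<^sup>2) / z"
    proof -
      have "h / q = exp (- (1 / 2) * (R - L2_set e I)\<^sup>2 - - (1 / 2) * (L2_set e I + 1)\<^sup>2)"
        unfolding h_def q_def by (simp only: exp_diff)
      also have "\<dots> = exp ((1 / 2) * (L2_set e I + 1)\<^sup>2 - (1 / 2) * (R - L2_set e I)\<^sup>2)" by simp
      finally show ?thesis by (metis divide_divide_eq_left mult.commute)
    qed
    finally show ?thesis .
  qed
  have nuB: "measure N (space ?L - ?B) \<le> measure ?G {v \<in> space ?G. R - L2_set e I \<le> L2_set v I}"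
  proof -
    have u_bk: "u (bk v) = v" if v: "v \<in> space ?L" for v
    proof
      fix i
      show "u (bk v) i = v i"
      proof (cases "i \<in> I")
        case True
        have "mat_vec I X (bk v) i = mat_vec I X (\<lambda>i. b0 i + mat_vec I V (\<lambda>j. v j + e j) i) i"
          by (rule mat_vec_cong) (simp add: bk_def)
        also have "\<dots> = mat_vec I X b0 i + (v i + e i)"
          by (simp add: mat_vec_add[of I X b0] XV[OF True])
        finally show ?thesis using True by (simp add: u_def s_def)
      qed (use v in \<open>simp add: u_def space_leb_on_idx extensional_def\<close>)
    qed
    have "bk -` (space ?L - ?B) \<inter> space ?G \<subseteq> {v \<in> space ?G. R - L2_set e I \<le> L2_set v I}"
    proof
      fix v assume v: "v \<in> bk -` (space ?L - ?B) \<inter> space ?G"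
      then have "v \<in> space ?L" by (simp add: space_std_gauss space_leb_on_idx)
      then show "v \<in> {v \<in> space ?G. R - L2_set e I \<le> L2_set v I}"
        using v out[of "bk v"] u_bk by auto
    qed
    moreover have "{v \<in> space ?G. R - L2_set e I \<le> L2_set v I} \<in> sets ?G"
    proof -
      have "(\<lambda>v. L2_set v I) \<in> borel_measurable ?G"
        by (intro measurable_L2_set[OF I] measurable_coordinate[where f="\<lambda>x. x"]) simp_all
      then show ?thesis by measurable
    qed
    ultimately show ?thesis using mN[of "space ?L - ?B"] by (simp add: G.finite_measure_mono)
  qed
  have "\<bar>measure (quasi_posterior I A X \<pi> y) S - measure N S\<bar>
      \<le> \<phi> + measure (quasi_posterior I A X \<pi> y) (space N - ?B) + measure N (space N - ?B)"
    unfolding post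
  proof (rule tilted_measure_close[OF N _ _ _ _ \<phi>])
    show "(1 - \<phi>) * (K * \<pi> y) \<le> K * \<pi> x" if "x \<in> ?B" "y \<in> ?B" for x y
      using mult_left_mono[OF ratio[OF that] K0] by (simp add: mult_ac)
    show "prob_space (density N (\<lambda>x. ennreal (K * \<pi> x)))" using Q post by simp
  qed (use \<pi>0 K0 sN Bs S in \<open>auto simp: measurable_cong_sets[OF sN(1) refl]\<close>)
  moreover have "bk -` S \<inter> space ?G = {v \<in> space ?G. bk v \<in> S}" by auto
  ultimately show "\<bar>measure (quasi_posterior I A X \<pi> y) S
        - measure ?G {v \<in> space ?G. (\<lambda>i\<in>I. b0 i + mat_vec I V (\<lambda>j. v j + e j) i) \<in> S}\<bar>
      \<le> \<phi> + exp ((1 / 2) * (L2_set e I + 1)\<^sup>2 - (1 / 2) * (R - L2_set e I)\<^sup>2) / z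
        + measure ?G {v \<in> space ?G. R - L2_set e I \<le> L2_set v I}"
    using muB nuB mN[OF S] sN by (simp add: bk_def)
qed

section \<open>White noise\<close>

lemma L2_integrable_mult:
  assumes "f \<in> L2" "g \<in> L2"
  shows "integrable leb01 (\<lambda>x. f x * g x)"
proof (rule Bochner_Integration.integrable_bound)
  show "integrable leb01 (\<lambda>x. (f x)\<^sup>2 + (g x)\<^sup>2)" using assms by (auto simp: L2_def)
  show "(\<lambda>x. f x * g x) \<in> borel_measurable leb01" using assms by (auto simp: L2_def)
  have "\<bar>a * b\<bar> \<le> a\<^sup>2 + b\<^sup>2" for a b :: real
  proof -
    have "0 \<le> \<bar>a\<bar> * \<bar>b\<bar>" by simp
    moreover have "2 * (\<bar>a\<bar> * \<bar>b\<bar>) \<le> a\<^sup>2 + b\<^sup>2" using sum_squares_bound[of "\<bar>a\<bar>" "\<bar>b\<bar>"] by simp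
    ultimately show ?thesis unfolding abs_mult by linarith
  qed
  then show "AE x in leb01. norm (f x * g x) \<le> norm ((f x)\<^sup>2 + (g x)\<^sup>2)" by auto
qed

lemma L2_lincomb:
  assumes "f \<in> L2" "g \<in> L2"
  shows "(\<lambda>x. a * f x + b * g x) \<in> L2"
proof -
  have "integrable leb01 (\<lambda>x. a\<^sup>2 * (f x * f x) + (2 * a * b) * (f x * g x) + b\<^sup>2 * (g x * g x))"
    using assms by (intro Bochner_Integration.integrable_add integrable_mult_right L2_integrable_mult)
  also have "(\<lambda>x. a\<^sup>2 * (f x * f x) + (2 * a * b) * (f x * g x) + b\<^sup>2 * (g x * g x)) = (\<lambda>x. (a * f x + b * g x)\<^sup>2)"
    by (simp add: fun_eq_iff power2_eq_square algebra_simps)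
  finally show ?thesis using assms by (auto simp: L2_def)
qed

lemma L2_zero: "(\<lambda>x. 0) \<in> L2" by (simp add: L2_def)

lemma L2_scale: "f \<in> L2 \<Longrightarrow> (\<lambda>x. a * f x) \<in> L2"
  using L2_lincomb[of f f a 0] by simp

lemma L2_sum:
  assumes "finite F" "\<And>i. i \<in> F \<Longrightarrow> g i \<in> L2"
  shows "(\<lambda>x. \<Sum>i\<in>F. c i * g i x) \<in> L2"
  using assms
proof (induction F rule: finite_induct)
  case (insert j F)
  then show ?case using L2_lincomb[of "g j" "\<lambda>x. \<Sum>i\<in>F. c i * g i x" "c j" 1] by simp
qed (simp add: L2_zero)

lemma L2_diff: "f \<in> L2 \<Longrightarrow> g \<in> L2 \<Longrightarrow> (\<lambda>x. f x - g x) \<in> L2"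
  using L2_lincomb[of f g 1 "-1"] by simp

lemma ip_commute: "ip f g = ip g f"
  by (simp add: ip_def mult.commute)

lemma ip_lincomb:
  assumes "f \<in> L2" "g \<in> L2" "h \<in> L2"
  shows "ip (\<lambda>x. a * f x + b * g x) h = a * ip f h + b * ip g h"
proof -
  have "ip (\<lambda>x. a * f x + b * g x) h = (LINT x|leb01. a * (f x * h x) + b * (g x * h x))"
    by (simp add: ip_def algebra_simps)
  also have "\<dots> = (LINT x|leb01. a * (f x * h x)) + (LINT x|leb01. b * (g x * h x))"
    using assms by (intro Bochner_Integration.integral_add integrable_mult_right L2_integrable_mult)
  finally show ?thesis by (simp add: ip_def)
qed

lemma ip_zero [simp]: "ip (\<lambda>x. 0) h = 0" by (simp add: ip_def)

lemma ip_scale: "ip (\<lambda>x. a * f x) h = a * ip f h"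
  by (simp add: ip_def mult.assoc)

lemma ip_diff: "f \<in> L2 \<Longrightarrow> g \<in> L2 \<Longrightarrow> h \<in> L2 \<Longrightarrow> ip (\<lambda>x. f x - g x) h = ip f h - ip g h"
  using ip_lincomb[of f g h 1 "-1"] by simp

lemma ip_sum:
  assumes "finite F" "\<And>i. i \<in> F \<Longrightarrow> g i \<in> L2" "h \<in> L2"
  shows "ip (\<lambda>x. \<Sum>i\<in>F. c i * g i x) h = (\<Sum>i\<in>F. c i * ip (g i) h)"
  using assms
proof (induction F rule: finite_induct)
  case (insert j F)
  then have "ip (\<lambda>x. c j * g j x + 1 * (\<Sum>i\<in>F. c i * g i x)) h
      = c j * ip (g j) h + 1 * ip (\<lambda>x. \<Sum>i\<in>F. c i * g i x) h"
    by (intro ip_lincomb L2_sum) auto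
  then show ?case using insert by simp
qed simp

lemma ip_self_nonneg: "0 \<le> ip f f"
  by (simp add: ip_def)

lemma l2norm_nonneg [simp]: "0 \<le> l2norm f" by (simp add: l2norm_def ip_self_nonneg)

lemma l2norm_square: "(l2norm f)\<^sup>2 = ip f f"
  by (simp add: l2norm_def ip_self_nonneg)

lemma ip_lincomb_self:
  assumes "f \<in> L2" "g \<in> L2"
  shows "ip (\<lambda>x. a * f x + b * g x) (\<lambda>x. a * f x + b * g x) = a\<^sup>2 * ip f f + 2 * a * b * ip f g + b\<^sup>2 * ip g g"
proof -
  note L = L2_lincomb[OF assms, of a b]
  have "ip f (\<lambda>x. a * f x + b * g x) = a * ip f f + b * ip f g" "ip g (\<lambda>x. a * f x + b * g x) = a * ip f g + b * ip g g"
    using ip_lincomb[OF assms, of _ a b] assms by (simp_all add: ip_commute[of _ "\<lambda>x. a * f x + b * g x"] ip_commute[of g f])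
  then show ?thesis using ip_lincomb[OF assms L, of a b] by (simp add: power2_eq_square algebra_simps)
qed

lemma ip_Cauchy_Schwarz:
  assumes "f \<in> L2" "g \<in> L2"
  shows "\<bar>ip f g\<bar> \<le> l2norm f * l2norm g"
proof -
  let ?p = "ip f f" and ?q = "ip g g" and ?r = "ip f g"
  have pq: "0 \<le> ?p" "0 \<le> ?q" by (simp_all add: ip_self_nonneg)
  have *: "0 \<le> a\<^sup>2 * ?p + 2 * a * b * ?r + b\<^sup>2 * ?q" for a b
    using ip_self_nonneg[of "\<lambda>x. a * f x + b * g x"] ip_lincomb_self[OF assms, of a b] by simp
  have "?r\<^sup>2 \<le> ?p * ?q"
  proof (cases "?q = 0")
    case True
    have "0 \<le> ?p - 2 * ((?p + 1) / (2 * ?r)) * ?r" using *[of 1 "- ((?p + 1) / (2 * ?r))"] True by simp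
    have "?r = 0"
    proof (rule ccontr)
      assume "?r \<noteq> 0"
      then have "2 * ((?p + 1) / (2 * ?r)) * ?r = ?p + 1" by simp
      with \<open>0 \<le> ?p - 2 * ((?p + 1) / (2 * ?r)) * ?r\<close> show False by linarith
    qed
    then show ?thesis using True by simp
  next
    case False
    have "0 \<le> ?q * (?p * ?q - ?r\<^sup>2)" using *[of ?q "- ?r"] by (simp add: power2_eq_square algebra_simps)
    then show ?thesis using False pq by (simp add: zero_le_mult_iff)
  qed
  then have "\<bar>?r\<bar> \<le> sqrt (?p * ?q)" by (simp add: real_le_rsqrt)
  then show ?thesis by (simp add: l2norm_def real_sqrt_mult)
qed

lemma normal_law_moments:
  assumes "0 \<le> \<sigma>"
  shows "integrable (normal_law 0 \<sigma>) (\<lambda>x. x)" "(LINT x|normal_law 0 \<sigma>. x) = 0"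
    "integrable (normal_law 0 \<sigma>) (\<lambda>x. x\<^sup>2)" "(LINT x|normal_law 0 \<sigma>. x\<^sup>2) = \<sigma>\<^sup>2"
proof -
  have "integrable (normal_law 0 \<sigma>) (\<lambda>x. x) \<and> (LINT x|normal_law 0 \<sigma>. x) = 0
    \<and> integrable (normal_law 0 \<sigma>) (\<lambda>x. x\<^sup>2) \<and> (LINT x|normal_law 0 \<sigma>. x\<^sup>2) = \<sigma>\<^sup>2"
  proof (cases "\<sigma> = 0")
    case True
    interpret prob_space "return borel (0::real)" by (rule prob_space_return) simp
    have "integrable (return borel (0::real)) (\<lambda>x. x)"
      by (rule integrable_const_bound[of _ 1], subst AE_return) simp_all
    moreover have "integrable (return borel (0::real)) (\<lambda>x. x\<^sup>2)"
      by (rule integrable_const_bound[of _ 1], subst AE_return) simp_all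
    moreover have "(LINT x|return borel (0::real). x) = 0" "(LINT x|return borel (0::real). x\<^sup>2) = 0"
      by (subst integral_return; simp)+
    moreover have "normal_law 0 \<sigma> = return borel 0" using True by (simp add: normal_law_def)
    ultimately show ?thesis using True by simp
  next
    case False
    with assms have s: "0 < \<sigma>" by simp
    have n: "normal_law 0 \<sigma> = density lborel (normal_density 0 \<sigma>)" using False by (simp add: normal_law_def)
    have "integrable (normal_law 0 \<sigma>) (\<lambda>x. x)"
      unfolding n by (subst integrable_density) (use integrable_normal_moment_nz_1[OF s, of 0] in auto)
    moreover have "(LINT x|normal_law 0 \<sigma>. x) = 0"
      unfolding n by (subst integral_density) (use integral_normal_moment_nz_1[OF s, of 0] in auto)
    moreover have "integrable (normal_law 0 \<sigma>) (\<lambda>x. x\<^sup>2)"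
      unfolding n by (subst integrable_density) (use integrable_normal_moment[OF s, of 0 2] in auto)
    moreover have "(LINT x|normal_law 0 \<sigma>. x\<^sup>2) = (LINT x|lborel. normal_density 0 \<sigma> x * x\<^sup>2)"
      unfolding n by (subst integral_density) auto
    moreover have "\<dots> = \<sigma>\<^sup>2"
    proof -
      have "(LINT x|lborel. normal_density 0 \<sigma> x * (x - 0) ^ (2 * 1)) = fact (2 * 1) / ((2 / \<sigma>\<^sup>2) ^ 1 * fact 1)"
        by (rule integral_normal_moment_even[OF s])
      then show ?thesis using s by simp
    qed
    ultimately show ?thesis by simp
  qed
  then show "integrable (normal_law 0 \<sigma>) (\<lambda>x. x)" "(LINT x|normal_law 0 \<sigma>. x) = 0"
    "integrable (normal_law 0 \<sigma>) (\<lambda>x. x\<^sup>2)" "(LINT x|normal_law 0 \<sigma>. x\<^sup>2) = \<sigma>\<^sup>2" by auto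
qed

lemma white_noise_prob_space: "white_noise M W \<Longrightarrow> prob_space M"
  and white_noise_measurable: "white_noise M W \<Longrightarrow> h \<in> L2 \<Longrightarrow> W h \<in> borel_measurable M"
  and white_noise_distr: "white_noise M W \<Longrightarrow> h \<in> L2 \<Longrightarrow> distr M borel (W h) = normal_law 0 (l2norm h)"
  and white_noise_linear: "white_noise M W \<Longrightarrow> h \<in> L2 \<Longrightarrow> g \<in> L2 \<Longrightarrow>
    AE \<omega> in M. W (\<lambda>x. a * h x + b * g x) \<omega> = a * W h \<omega> + b * W g \<omega>"
  unfolding white_noise_def by auto

lemma white_noise_sum:
  assumes wn: "white_noise M W" and F: "finite F" and g: "\<And>i. i \<in> F \<Longrightarrow> g i \<in> L2"
  shows "AE \<omega> in M. W (\<lambda>x. \<Sum>i\<in>F. c i * g i x) \<omega> = (\<Sum>i\<in>F. c i * W (g i) \<omega>)"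
  using F g
proof (induction F rule: finite_induct)
  case empty
  then show ?case using white_noise_linear[OF wn L2_zero L2_zero, of 0 0] by simp
next
  case (insert j F)
  have "AE \<omega> in M. W (\<lambda>x. c j * g j x + 1 * (\<Sum>i\<in>F. c i * g i x)) \<omega>
      = c j * W (g j) \<omega> + 1 * W (\<lambda>x. \<Sum>i\<in>F. c i * g i x) \<omega>"
    using insert by (intro white_noise_linear[OF wn] L2_sum) auto
  moreover have "AE \<omega> in M. W (\<lambda>x. \<Sum>i\<in>F. c i * g i x) \<omega> = (\<Sum>i\<in>F. c i * W (g i) \<omega>)"
    using insert by auto
  ultimately show ?case
  proof eventually_elim
    case (elim \<omega>)
    then show ?case using insert.hyps by simp
  qed
qed

lemma white_noise_char:
  assumes wn: "white_noise M W" and h: "h \<in> L2"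
  shows "(\<integral>\<omega>. iexp (t * W h \<omega>) \<partial>M) = complex_of_real (exp (- t\<^sup>2 * ip h h / 2))"
proof -
  have "(\<integral>\<omega>. iexp (t * W h \<omega>) \<partial>M) = (\<integral>x. iexp (t * x) \<partial>distr M borel (W h))"
    using white_noise_measurable[OF wn h] by (subst integral_distr) auto
  also have "\<dots> = char (normal_law 0 (l2norm h)) t"
    unfolding white_noise_distr[OF wn h] char_def ..
  also have "\<dots> = complex_of_real (exp (- t\<^sup>2 * ip h h / 2))"
    by (simp add: char_normal_law power_mult_distrib l2norm_square mult.commute)
  finally show ?thesis .
qed

text \<open>By linearity a combination of coordinates of \<open>W\<close> is \<open>W\<close> at a single function, whose law is the prescribed normal one.
  All joint laws of the noise are read off from this identity.\<close>

lemma white_noise_joint_char: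
  assumes wn: "white_noise M W" and F: "finite F" and g: "\<And>i. i \<in> F \<Longrightarrow> g i \<in> L2"
  shows "(\<integral>\<omega>. iexp (\<Sum>i\<in>F. c i * W (g i) \<omega>) \<partial>M)
    = complex_of_real (exp (- ip (\<lambda>x. \<Sum>i\<in>F. c i * g i x) (\<lambda>x. \<Sum>i\<in>F. c i * g i x) / 2))"
proof -
  let ?h = "\<lambda>x. \<Sum>i\<in>F. c i * g i x"
  have h: "?h \<in> L2" by (rule L2_sum[OF F g])
  have lin: "AE \<omega> in M. W ?h \<omega> = (\<Sum>i\<in>F. c i * W (g i) \<omega>)" by (rule white_noise_sum[OF wn F]) (rule g)
  have "(\<integral>\<omega>. iexp (\<Sum>i\<in>F. c i * W (g i) \<omega>) \<partial>M) = (\<integral>\<omega>. iexp (1 * W ?h \<omega>) \<partial>M)"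
  proof (rule integral_cong_AE)
    have "(\<lambda>\<omega>. \<Sum>i\<in>F. c i * W (g i) \<omega>) \<in> borel_measurable M"
      using white_noise_measurable[OF wn g] by (intro borel_measurable_sum) auto
    from measurable_compose[OF this, of iexp borel]
    show "(\<lambda>\<omega>. iexp (\<Sum>i\<in>F. c i * W (g i) \<omega>)) \<in> borel_measurable M" by measurable
    show "(\<lambda>\<omega>. iexp (1 * W ?h \<omega>)) \<in> borel_measurable M" using white_noise_measurable[OF wn h] by measurable
    show "AE \<omega> in M. iexp (\<Sum>i\<in>F. c i * W (g i) \<omega>) = iexp (1 * W ?h \<omega>)"
      using lin
    proof eventually_elim
      case (elim \<omega>)
      then show ?case by (simp only: mult_1)
    qed
  qed
  then show ?thesis using white_noise_char[OF wn h, of 1] by simp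
qed

lemma white_noise_moments:
  assumes wn: "white_noise M W" and h: "h \<in> L2"
  shows "integrable M (W h)" "(LINT \<omega>|M. W h \<omega>) = 0" "integrable M (\<lambda>\<omega>. (W h \<omega>)\<^sup>2)" "(LINT \<omega>|M. (W h \<omega>)\<^sup>2) = ip h h"
proof -
  note m = white_noise_measurable[OF wn h] and d = white_noise_distr[OF wn h]
  note nm = normal_law_moments[OF l2norm_nonneg[of h], folded d]
  show "integrable M (W h)" using nm(1) integrable_distr_eq[OF m, of "\<lambda>x. x"] by simp
  show "(LINT \<omega>|M. W h \<omega>) = 0" using nm(2) integral_distr[OF m, of "\<lambda>x. x"] by simp
  show "integrable M (\<lambda>\<omega>. (W h \<omega>)\<^sup>2)" using nm(3) integrable_distr_eq[OF m, of "\<lambda>x. x\<^sup>2"] by simp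
  show "(LINT \<omega>|M. (W h \<omega>)\<^sup>2) = ip h h" using nm(4) integral_distr[OF m, of "\<lambda>x. x\<^sup>2"] by (simp add: l2norm_square)
qed

lemma white_noise_covariance:
  assumes wn: "white_noise M W" and h: "h \<in> L2" and g: "g \<in> L2"
  shows "integrable M (\<lambda>\<omega>. W h \<omega> * W g \<omega>)" "(LINT \<omega>|M. W h \<omega> * W g \<omega>) = ip h g"
proof -
  let ?s = "\<lambda>x. 1 * h x + 1 * g x"
  have s: "?s \<in> L2" by (rule L2_lincomb[OF h g])
  have ae: "AE \<omega> in M. ((W ?s \<omega>)\<^sup>2 - (W h \<omega>)\<^sup>2 - (W g \<omega>)\<^sup>2) / 2 = W h \<omega> * W g \<omega>"
    using white_noise_linear[OF wn h g, of 1 1]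
  proof eventually_elim
    case (elim \<omega>)
    then show ?case by (simp add: power2_sum)
  qed
  have i: "integrable M (\<lambda>\<omega>. ((W ?s \<omega>)\<^sup>2 - (W h \<omega>)\<^sup>2 - (W g \<omega>)\<^sup>2) / 2)"
    using white_noise_moments(3)[OF wn] h g s by auto
  have m: "(\<lambda>\<omega>. W h \<omega> * W g \<omega>) \<in> borel_measurable M"
    using white_noise_measurable[OF wn] h g by auto
  show "integrable M (\<lambda>\<omega>. W h \<omega> * W g \<omega>)"
    using integrable_cong_AE[OF borel_measurable_integrable[OF i] m ae] i by simp
  have "(LINT \<omega>|M. W h \<omega> * W g \<omega>) = (LINT \<omega>|M. ((W ?s \<omega>)\<^sup>2 - (W h \<omega>)\<^sup>2 - (W g \<omega>)\<^sup>2) / 2)"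
    using integral_cong_AE[OF borel_measurable_integrable[OF i] m ae] by simp
  also have "\<dots> = (ip ?s ?s - ip h h - ip g g) / 2"
    using white_noise_moments(3,4)[OF wn] h g s by (simp add: Bochner_Integration.integral_diff)
  also have "\<dots> = ip h g" by (subst ip_lincomb_self[OF h g]) simp
  finally show "(LINT \<omega>|M. W h \<omega> * W g \<omega>) = ip h g" .
qed

lemma white_noise_tail:
  assumes wn: "white_noise M W" and h: "h \<in> L2" and b: "ip h h \<le> b" "0 < b" and x: "0 \<le> x"
  shows "measure M {\<omega> \<in> space M. x \<le> \<bar>W h \<omega>\<bar>} \<le> sqrt 2 * exp (- x\<^sup>2 / (4 * b))"
proof -
  have "measure M {\<omega> \<in> space M. x \<le> \<bar>W h \<omega>\<bar>} = measure (distr M borel (W h)) {y. x \<le> \<bar>y\<bar>}"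
    using white_noise_measurable[OF wn h]
    by (subst measure_distr) (auto intro!: arg_cong[where f="measure M"])
  also have "\<dots> \<le> sqrt 2 * exp (- x\<^sup>2 / (4 * b))"
    unfolding white_noise_distr[OF wn h] using b x by (intro normal_law_tail) (simp_all add: l2norm_square)
  finally show ?thesis .
qed

lemma cov_mat_Ytilde:
  assumes wn: "white_noise M W" and v: "v1 i \<in> L2" "v1 j \<in> L2" and n: "0 < n"
  shows "cov_mat M (Ytilde K v1 f0 n W) i j = ip (v1 i) (v1 j) / real n"
proof -
  interpret prob_space M by (rule white_noise_prob_space[OF wn])
  have E: "(LINT \<omega>|M. Ytilde K v1 f0 n W k \<omega>) = ip (K f0) (v1 k)" if "v1 k \<in> L2" for k
    using white_noise_moments(1,2)[OF wn that] by (simp add: Ytilde_def obs_def prob_space)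
  have "cov_mat M (Ytilde K v1 f0 n W) i j
      = (LINT \<omega>|M. (real n powr (- 1 / 2))\<^sup>2 * (W (v1 i) \<omega> * W (v1 j) \<omega>))"
    unfolding cov_mat_def E[OF v(1)] E[OF v(2)]
    by (intro Bochner_Integration.integral_cong refl) (simp add: Ytilde_def obs_def power2_eq_square)
  also have "\<dots> = (real n powr (- 1 / 2))\<^sup>2 * ip (v1 i) (v1 j)"
    using white_noise_covariance[OF wn v] by simp
  also have "(real n powr (- 1 / 2))\<^sup>2 = 1 / real n"
    using n by (simp add: power2_eq_square powr_add[symmetric] powr_minus_divide)
  finally show ?thesis by simp
qed

text \<open>Although the coordinates \<open>W (v1 i)\<close> are dependent, the probability that all of them are small is at most
  exponentially small in their number.  The dual function \<open>v2 i\<close> is orthogonal to every \<open>v1 j\<close> with \<open>j \<noteq> i\<close>.  The component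
  of \<open>v1 i\<close> along it therefore contributes to \<open>W (v1 i)\<close> a Gaussian part of variance \<open>1 / \<parallel>v2 i\<parallel>\<^sup>2\<close> that is independent
  of all the rest.  If \<open>W (v1 i)\<close> is small, this part cannot be large with the sign of the remaining part of \<open>W (v1 i)\<close>, an event
  whose conditional probability is at most the \<open>q\<close> below; the bound follows by induction on the number of coordinates.\<close>

lemma white_noise_small_ball:
  assumes wn: "white_noise M W" and F: "finite F"
    and v: "\<And>i. i \<in> F \<Longrightarrow> v1 i \<in> L2 \<and> v2 i \<in> L2"
    and bi: "\<And>i j. i \<in> F \<Longrightarrow> j \<in> F \<Longrightarrow> ip (v1 i) (v2 j) = (if i = j then 1 else 0)"
    and b: "\<And>i. i \<in> F \<Longrightarrow> ip (v2 i) (v2 i) \<le> b" and x: "0 \<le> x"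
  shows "measure M {\<omega> \<in> space M. \<forall>i\<in>F. \<bar>W (v1 i) \<omega>\<bar> \<le> x} \<le> measure std_normal_distribution {..x * sqrt b} ^ card F"
  using F v bi b
proof (induction F rule: finite_induct)
  case empty
  interpret prob_space M by (rule white_noise_prob_space[OF wn])
  show ?case by (simp add: prob_space)
next
  case (insert i F)
  interpret prob_space M by (rule white_noise_prob_space[OF wn])
  let ?N = std_normal_distribution
  have vi: "v1 i \<in> L2" "v2 i \<in> L2" and b11: "ip (v1 i) (v2 i) = 1" using insert.prems by auto
  define m where "m = ip (v2 i) (v2 i)"
  have m0: "0 < m"
  proof -
    have "1 \<le> l2norm (v1 i) * l2norm (v2 i)" using ip_Cauchy_Schwarz[OF vi] b11 by simp
    then have "l2norm (v2 i) \<noteq> 0" by auto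
    then show ?thesis using l2norm_square[of "v2 i"] ip_self_nonneg[of "v2 i"] by (auto simp: m_def less_le)
  qed
  \<comment> \<open>Split \<open>v1 i\<close> into \<open>p + h / sqrt m\<close> with \<open>h\<close> the unit vector along \<open>v2 i\<close>.\<close>
  define p where "p = (\<lambda>x. 1 * v1 i x + (- 1 / m) * v2 i x)"
  define h where "h = (\<lambda>x. (1 / sqrt m) * v2 i x)"
  have p: "p \<in> L2" and h: "h \<in> L2" unfolding p_def h_def by (rule L2_lincomb L2_scale; fact vi)+
  have hh: "ip h h = 1"
  proof -
    have "ip h h = (1 / sqrt m) * ip (v2 i) h" unfolding h_def by (rule ip_scale)
    also have "ip (v2 i) h = (1 / sqrt m) * m" unfolding h_def m_def by (subst ip_commute) (rule ip_scale)
    finally show ?thesis using m0 by simp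
  qed
  have hp: "ip p h = 0"
  proof -
    have "ip p h = (1 / sqrt m) * ip (v2 i) p" unfolding h_def by (subst ip_commute) (rule ip_scale)
    also have "ip (v2 i) p = 1 * ip (v1 i) (v2 i) + (- 1 / m) * m"
      unfolding p_def m_def by (subst ip_commute) (rule ip_lincomb[OF vi vi(2)])
    finally show ?thesis using m0 b11 by simp
  qed
  define g where "g j = (if j = i then p else v1 j)" for j
  let ?I = "insert i F"
  have g: "g j \<in> L2" if "j \<in> ?I" for j using that p insert.prems(1) by (auto simp: g_def)
  have gh: "ip (g j) h = 0" if "j \<in> ?I" for j
  proof (cases "j = i")
    case False
    then have "ip (v1 j) (v2 i) = 0" using insert.prems(2)[of j i] that by simp
    have "ip (v1 j) h = (1 / sqrt m) * ip (v2 i) (v1 j)" unfolding h_def by (subst ip_commute) (rule ip_scale)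
    then have "ip (v1 j) h = 0" using \<open>ip (v1 j) (v2 i) = 0\<close> by (simp add: ip_commute[of "v2 i"])
    then show ?thesis using False by (simp add: g_def)
  qed (simp add: g_def hp)
  have fin: "finite ?I" using insert.hyps by simp
  have char: "(\<integral>\<omega>. iexp ((\<Sum>j\<in>?I. t j * W (g j) \<omega>) + z * (c * W h \<omega>)) \<partial>M)
      = (\<integral>\<omega>. iexp (\<Sum>j\<in>?I. t j * W (g j) \<omega>) \<partial>M) * complex_of_real (exp (- z\<^sup>2 / 2))" if c: "c\<^sup>2 = 1" for t z c
  proof -
    let ?s = "\<lambda>x. \<Sum>j\<in>?I. t j * g j x"
    have s: "?s \<in> L2" by (rule L2_sum[OF fin g])
    have lin: "AE \<omega> in M. W ?s \<omega> = (\<Sum>j\<in>?I. t j * W (g j) \<omega>)" by (rule white_noise_sum[OF wn fin]) (rule g)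
    have sh: "ip ?s h = 0" using ip_sum[OF fin g h] gh by simp
    let ?k = "\<lambda>x. 1 * ?s x + (z * c) * h x"
    have k: "?k \<in> L2" by (rule L2_lincomb[OF s h])
    have ms: "(\<lambda>\<omega>. \<Sum>j\<in>?I. t j * W (g j) \<omega>) \<in> borel_measurable M"
      using white_noise_measurable[OF wn g] by (intro borel_measurable_sum) auto
    have "(\<integral>\<omega>. iexp ((\<Sum>j\<in>?I. t j * W (g j) \<omega>) + z * (c * W h \<omega>)) \<partial>M) = (\<integral>\<omega>. iexp (1 * W ?k \<omega>) \<partial>M)"
    proof (rule integral_cong_AE)
      show "(\<lambda>\<omega>. iexp ((\<Sum>j\<in>?I. t j * W (g j) \<omega>) + z * (c * W h \<omega>))) \<in> borel_measurable M"
        using white_noise_measurable[OF wn h] measurable_compose[OF borel_measurable_add[OF ms], of "\<lambda>\<omega>. z * (c * W h \<omega>)" iexp borel]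
        by measurable
      show "(\<lambda>\<omega>. iexp (1 * W ?k \<omega>)) \<in> borel_measurable M" using white_noise_measurable[OF wn k] by measurable
      show "AE \<omega> in M. iexp ((\<Sum>j\<in>?I. t j * W (g j) \<omega>) + z * (c * W h \<omega>)) = iexp (1 * W ?k \<omega>)"
        using lin white_noise_linear[OF wn s h, of 1 "z * c"]
      proof eventually_elim
        case (elim \<omega>)
        then show ?case by (simp only: mult_1 mult.assoc)
      qed
    qed
    also have "\<dots> = complex_of_real (exp (- (ip ?s ?s + z\<^sup>2) / 2))"
      unfolding white_noise_char[OF wn k] ip_lincomb_self[OF s h] using c by (simp add: sh hh power_mult_distrib)
    also have "\<dots> = complex_of_real (exp (- ip ?s ?s / 2)) * complex_of_real (exp (- z\<^sup>2 / 2))"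
      by (simp flip: of_real_mult exp_add add: field_simps)
    also have "complex_of_real (exp (- ip ?s ?s / 2)) = (\<integral>\<omega>. iexp (\<Sum>j\<in>?I. t j * W (g j) \<omega>) \<partial>M)"
      by (rule white_noise_joint_char[OF wn fin g, symmetric])
    finally show ?thesis .
  qed
  \<comment> \<open>Used with \<open>c = 1\<close> where \<open>W p\<close> is nonnegative and with \<open>c = - 1\<close> where it is negative.\<close>
  define q where "q = measure ?N {..x * sqrt b}"
  let ?A = "\<lambda>C j. if j = i then C else {- x..x}"
  have prodE: "measure M {\<omega> \<in> space M. (\<forall>j\<in>?I. W (g j) \<omega> \<in> ?A C j) \<and> c * W h \<omega> \<in> {..x * sqrt b}}
      = measure M {\<omega> \<in> space M. \<forall>j\<in>?I. W (g j) \<omega> \<in> ?A C j} * q" if "C \<in> sets borel" "c\<^sup>2 = 1" for C and c :: real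
    unfolding q_def
    by (rule independent_std_normal[OF prob_space_axioms fin white_noise_measurable[OF wn g] _ char])
      (use that white_noise_measurable[OF wn h] in auto)
  have meas: "{\<omega> \<in> space M. \<forall>j\<in>?I. W (g j) \<omega> \<in> ?A C j} \<in> sets M" if C: "C \<in> sets borel" for C
  proof (rule sets.sets_Collect_finite_All[OF _ fin])
    fix j assume j: "j \<in> ?I"
    show "{\<omega> \<in> space M. W (g j) \<omega> \<in> ?A C j} \<in> sets M"
      using measurable_sets[OF white_noise_measurable[OF wn g[OF j]], of "?A C j"] C
      by (simp add: vimage_def Int_def conj_commute)
  qed
  have measZ: "{\<omega> \<in> space M. (\<forall>j\<in>?I. W (g j) \<omega> \<in> ?A C j) \<and> c * W h \<omega> \<in> {..x * sqrt b}} \<in> sets M" if C: "C \<in> sets borel" for C and c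
    using meas[OF C] white_noise_measurable[OF wn h] by measurable
  let ?E = "\<lambda>C. {\<omega> \<in> space M. \<forall>j\<in>?I. W (g j) \<omega> \<in> ?A C j}"
  let ?Z = "\<lambda>C c. {\<omega> \<in> space M. (\<forall>j\<in>?I. W (g j) \<omega> \<in> ?A C j) \<and> c * W h \<omega> \<in> {..x * sqrt b}}"
  \<comment> \<open>If \<open>W h / sqrt m\<close> exceeded \<open>x\<close> in the direction of the sign of \<open>W p\<close>, then so would \<open>W (v1 i)\<close>.\<close>
  have "AE \<omega> in M. \<omega> \<in> {\<omega> \<in> space M. \<forall>j\<in>?I. \<bar>W (v1 j) \<omega>\<bar> \<le> x} \<longrightarrow> \<omega> \<in> ?Z {0..} 1 \<union> ?Z {..<0} (-1)"
  proof -
    have "AE \<omega> in M. W (v1 i) \<omega> = W p \<omega> + (1 / sqrt m) * W h \<omega>"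
    proof -
      have "(\<lambda>x. 1 * p x + (1 / sqrt m) * h x) = v1 i"
        using m0 by (simp add: p_def h_def fun_eq_iff)
      then show ?thesis using white_noise_linear[OF wn p h, of 1 "1 / sqrt m"] by simp
    qed
    then show ?thesis
    proof eventually_elim
      case (elim \<omega>)
      show ?case
      proof
        assume \<omega>: "\<omega> \<in> {\<omega> \<in> space M. \<forall>j\<in>?I. \<bar>W (v1 j) \<omega>\<bar> \<le> x}"
        have rest: "W (g j) \<omega> \<in> {- x..x}" if "j \<in> F" for j
        proof -
          have "\<bar>W (v1 j) \<omega>\<bar> \<le> x" "j \<noteq> i" using \<omega> that insert.hyps by auto
          moreover from \<open>j \<noteq> i\<close> have "g j = v1 j" by (simp add: g_def)
          ultimately show ?thesis by (simp add: abs_le_iff)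
        qed
        have mb: "x * sqrt m \<le> x * sqrt b"
          using insert.prems(3)[of i] x by (intro mult_left_mono) (auto simp: m_def)
        have up: "c * W h \<omega> \<le> x * sqrt b" if "c * (W h \<omega> / sqrt m) \<le> x" for c
        proof -
          have "c * W h \<omega> \<le> x * sqrt m" using that m0 by (simp add: field_simps)
          then show ?thesis using mb by simp
        qed
        have "\<bar>W p \<omega> + W h \<omega> / sqrt m\<bar> \<le> x" using \<omega> elim by auto
        then have ab: "W p \<omega> + W h \<omega> / sqrt m \<le> x" "- x \<le> W p \<omega> + W h \<omega> / sqrt m" by (simp_all add: abs_le_iff)
        have all: "\<forall>j\<in>?I. W (g j) \<omega> \<in> ?A C j" if "W p \<omega> \<in> C" for C
        proof
          fix j assume j: "j \<in> ?I"
          show "W (g j) \<omega> \<in> ?A C j"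
            using j that rest[of j] by (cases "j = i") (simp_all add: g_def del: atLeastAtMost_iff)
        qed
        show "\<omega> \<in> ?Z {0..} 1 \<union> ?Z {..<0} (-1)"
        proof (cases "0 \<le> W p \<omega>")
          case True
          then have "1 * W h \<omega> \<le> x * sqrt b" using ab by (intro up) simp
          then have "\<omega> \<in> ?Z {0..} 1" using all[of "{0..}"] True \<omega> by simp
          then show ?thesis by blast
        next
          case False
          then have "- 1 * W h \<omega> \<le> x * sqrt b" using ab by (intro up) simp
          then have "\<omega> \<in> ?Z {..<0} (-1)" using all[of "{..<0}"] False \<omega> by simp
          then show ?thesis by blast
        qed
      qed
    qed
  qed
  then have "measure M {\<omega> \<in> space M. \<forall>j\<in>?I. \<bar>W (v1 j) \<omega>\<bar> \<le> x} \<le> measure M (?Z {0..} 1 \<union> ?Z {..<0} (-1))"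
    by (intro finite_measure_mono_AE sets.Un measZ) auto
  also have "\<dots> \<le> measure M (?Z {0..} 1) + measure M (?Z {..<0} (-1))"
    by (intro measure_Un_le measZ) auto
  also have "\<dots> = (measure M (?E {0..}) + measure M (?E {..<0})) * q"
    using prodE[of "{0..}" 1] prodE[of "{..<0}" "-1"] by (simp add: ring_distribs)
  also have "measure M (?E {0..}) + measure M (?E {..<0}) = measure M (?E {0..} \<union> ?E {..<0})"
    by (intro finite_measure_Union[symmetric] meas) auto
  also have "?E {0..} \<union> ?E {..<0} = {\<omega> \<in> space M. \<forall>j\<in>F. \<bar>W (v1 j) \<omega>\<bar> \<le> x}"
  proof -
    have "(\<forall>j\<in>?I. W (g j) \<omega> \<in> ?A C j) \<longleftrightarrow> W p \<omega> \<in> C \<and> (\<forall>j\<in>F. \<bar>W (v1 j) \<omega>\<bar> \<le> x)" for C \<omega>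
    proof -
      have "(\<forall>j\<in>F. W (g j) \<omega> \<in> ?A C j) \<longleftrightarrow> (\<forall>j\<in>F. \<bar>W (v1 j) \<omega>\<bar> \<le> x)"
      proof (rule ball_cong[OF refl])
        fix j assume "j \<in> F"
        then have "j \<noteq> i" using insert.hyps by auto
        moreover from this have "g j = v1 j" by (simp add: g_def)
        ultimately show "W (g j) \<omega> \<in> ?A C j \<longleftrightarrow> \<bar>W (v1 j) \<omega>\<bar> \<le> x" by (simp add: abs_le_iff) linarith
      qed
      moreover have "(\<forall>j\<in>?I. W (g j) \<omega> \<in> ?A C j) \<longleftrightarrow> W (g i) \<omega> \<in> C \<and> (\<forall>j\<in>F. W (g j) \<omega> \<in> ?A C j)"
        by simp
      moreover have "g i = p" by (simp add: g_def)
      ultimately show ?thesis by (simp only:)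
    qed
    then have "?E {0..} \<union> ?E {..<0} = {\<omega> \<in> space M. W p \<omega> \<in> {0..} \<and> (\<forall>j\<in>F. \<bar>W (v1 j) \<omega>\<bar> \<le> x)}
      \<union> {\<omega> \<in> space M. W p \<omega> \<in> {..<0} \<and> (\<forall>j\<in>F. \<bar>W (v1 j) \<omega>\<bar> \<le> x)}"
      by (simp only:)
    also have "\<dots> = {\<omega> \<in> space M. \<forall>j\<in>F. \<bar>W (v1 j) \<omega>\<bar> \<le> x}" by auto
    finally show ?thesis .
  qed
  also have "measure M \<dots> \<le> q ^ card F"
    unfolding q_def using insert.prems by (intro insert.IH) auto
  finally have "measure M {\<omega> \<in> space M. \<forall>j\<in>?I. \<bar>W (v1 j) \<omega>\<bar> \<le> x} \<le> q ^ card F * q"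
    by (simp add: q_def mult_right_mono)
  then show ?case using insert.hyps by (simp add: q_def mult.commute)
qed

section \<open>Whitening and the design matrix\<close>

lemma mat_vec_mat_mul: "finite I \<Longrightarrow> mat_vec I (mat_mul I A B) b i = mat_vec I A (mat_vec I B b) i"
proof -
  have "mat_vec I (mat_mul I A B) b i = (\<Sum>j\<in>I. \<Sum>k\<in>I. A i k * (B k j * b j))"
    by (simp add: mat_vec_def mat_mul_def sum_distrib_right mult.assoc)
  also have "\<dots> = (\<Sum>k\<in>I. \<Sum>j\<in>I. A i k * (B k j * b j))" by (rule sum.swap)
  finally show ?thesis by (simp add: mat_vec_def sum_distrib_left)
qed

lemma mat_vec_symmetric:
  assumes "\<forall>i\<in>I. \<forall>j\<in>I. A i j = A j i"
  shows "(\<Sum>i\<in>I. x i * mat_vec I A y i) = (\<Sum>i\<in>I. mat_vec I A x i * y i)"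
proof -
  have "(\<Sum>i\<in>I. x i * mat_vec I A y i) = (\<Sum>i\<in>I. \<Sum>j\<in>I. A j i * x i * y j)"
    unfolding mat_vec_def sum_distrib_left using assms by (intro sum.cong refl) (simp add: mult_ac)
  also have "\<dots> = (\<Sum>j\<in>I. \<Sum>i\<in>I. A j i * x i * y j)" by (rule sum.swap)
  also have "\<dots> = (\<Sum>i\<in>I. mat_vec I A x i * y i)" by (simp add: mat_vec_def sum_distrib_right)
  finally show ?thesis .
qed

lemma eq_of_dot_eq:
  assumes "finite I" "\<And>y. (\<Sum>i\<in>I. x i * y i) = (\<Sum>i\<in>I. x' i * y i)" "i \<in> I"
  shows "x i = (x' i :: real)"
  using assms(2)[of "\<lambda>j. if j = i then 1 else 0"] assms(1,3) by (simp add: if_distrib cong: if_cong)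

lemma dot_le_L2_set: "(\<Sum>i\<in>I. x i * y i) \<le> L2_set x I * L2_set y I"
proof -
  have "(\<Sum>i\<in>I. x i * y i) \<le> (\<Sum>i\<in>I. \<bar>x i\<bar> * \<bar>y i\<bar>)"
    by (intro sum_mono) (metis abs_ge_self abs_mult)
  then show ?thesis using L2_set_mult_ineq[of x y I] by linarith
qed

text \<open>From \<open>A A Sig = 1\<close> the other two orders follow by transposing, as both matrices are symmetric, and by
  multiplying with inverses.\<close>

lemma inv_sqrt_inverse:
  assumes I: "finite I" and A: "is_inv_sqrt I Sig A"
    and Ss: "\<forall>i\<in>I. \<forall>j\<in>I. Sig i j = Sig j i" and i: "i \<in> I"
  shows "mat_vec I A (mat_vec I A (mat_vec I Sig b)) i = b i"
    and "mat_vec I Sig (mat_vec I A (mat_vec I A b)) i = b i"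
    and "mat_vec I A (mat_vec I Sig (mat_vec I A b)) i = b i"
proof -
  have As: "\<forall>i\<in>I. \<forall>j\<in>I. A i j = A j i" using A by (auto simp: is_inv_sqrt_def)
  have AAS: "mat_mul I (mat_mul I A A) Sig i j = (if i = j then 1 else 0)" if "i \<in> I" "j \<in> I" for i j
    using A that by (auto simp: is_inv_sqrt_def)
  have 1: "mat_vec I A (mat_vec I A (mat_vec I Sig b)) i = b i" if i: "i \<in> I" for i b
  proof -
    have "mat_vec I A (mat_vec I A (mat_vec I Sig b)) i = mat_vec I (mat_mul I (mat_mul I A A) Sig) b i"
      by (simp add: mat_vec_mat_mul[OF I])
    also have "\<dots> = (\<Sum>j\<in>I. (if i = j then 1 else 0) * b j)"
      unfolding mat_vec_def by (intro sum.cong refl) (simp add: AAS i)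
    also have "\<dots> = b i" using I i by (simp add: if_distrib[of "\<lambda>x. x * _"] cong: if_cong)
    finally show ?thesis .
  qed
  have 2: "mat_vec I Sig (mat_vec I A (mat_vec I A b)) i = b i" if i: "i \<in> I" for i b
  proof (rule eq_of_dot_eq[OF I _ i])
    fix y
    have "(\<Sum>i\<in>I. mat_vec I Sig (mat_vec I A (mat_vec I A b)) i * y i)
        = (\<Sum>i\<in>I. mat_vec I A (mat_vec I A b) i * mat_vec I Sig y i)"
      by (rule mat_vec_symmetric[OF Ss, symmetric])
    also have "\<dots> = (\<Sum>i\<in>I. mat_vec I A b i * mat_vec I A (mat_vec I Sig y) i)"
      by (rule mat_vec_symmetric[OF As, symmetric])
    also have "\<dots> = (\<Sum>i\<in>I. b i * mat_vec I A (mat_vec I A (mat_vec I Sig y)) i)"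
      by (rule mat_vec_symmetric[OF As, symmetric])
    also have "\<dots> = (\<Sum>i\<in>I. b i * y i)" by (simp add: 1)
    finally show "(\<Sum>i\<in>I. mat_vec I Sig (mat_vec I A (mat_vec I A b)) i * y i) = (\<Sum>i\<in>I. b i * y i)" .
  qed
  show "mat_vec I A (mat_vec I A (mat_vec I Sig b)) i = b i" by (rule 1[OF i])
  show "mat_vec I Sig (mat_vec I A (mat_vec I A b)) i = b i" by (rule 2[OF i])
  let ?z = "mat_vec I A (mat_vec I Sig (mat_vec I A b))"
  have "?z i = mat_vec I Sig (mat_vec I A (mat_vec I A ?z)) i" using 2[OF i] by simp
  also have "\<dots> = mat_vec I Sig (mat_vec I A (mat_vec I A b)) i"
    by (rule mat_vec_cong, rule mat_vec_cong) (rule 1)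
  also have "\<dots> = b i" by (rule 2[OF i])
  finally show "?z i = b i" .
qed

text \<open>With \<open>y = A A x\<close>, the lower bound on \<open>Sig\<close> gives \<open>a \<parallel>y\<parallel>\<^sup>2 \<le> \<langle>y, Sig y\<rangle> = \<langle>y, x\<rangle> \<le> \<parallel>y\<parallel> \<parallel>x\<parallel>\<close>,
  and \<open>\<parallel>A x\<parallel>\<^sup>2 = \<langle>x, y\<rangle>\<close>; no spectral decomposition is involved.\<close>

lemma inv_sqrt_norm_le:
  assumes I: "finite I" and A: "is_inv_sqrt I Sig A"
    and Sig: "\<forall>i\<in>I. \<forall>j\<in>I. Sig i j = Sig j i"
    and a: "0 < a" and lower: "\<And>c. a * (\<Sum>i\<in>I. (c i)\<^sup>2) \<le> (\<Sum>i\<in>I. c i * mat_vec I Sig c i)"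
  shows "L2_set (mat_vec I A x) I \<le> sqrt (1 / a) * L2_set x I"
proof -
  have As: "\<forall>i\<in>I. \<forall>j\<in>I. A i j = A j i" using A by (auto simp: is_inv_sqrt_def)
  let ?y = "mat_vec I A (mat_vec I A x)"
  have "a * (L2_set ?y I)\<^sup>2 \<le> (\<Sum>i\<in>I. ?y i * mat_vec I Sig ?y i)" using lower[of ?y] by (simp add: L2_set_square)
  also have "\<dots> = (\<Sum>i\<in>I. ?y i * x i)" using inv_sqrt_inverse(2)[OF I A Sig] by simp
  also have "\<dots> \<le> L2_set ?y I * L2_set x I" by (rule dot_le_L2_set)
  finally have "a * L2_set ?y I * L2_set ?y I \<le> L2_set x I * L2_set ?y I" by (simp add: power2_eq_square mult_ac)
  then have y: "L2_set ?y I \<le> L2_set x I / a"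
  proof (cases "L2_set ?y I = 0")
    case False
    then have "0 < L2_set ?y I" by (simp add: less_le)
    then have "a * L2_set ?y I \<le> L2_set x I"
      using \<open>a * L2_set ?y I * L2_set ?y I \<le> L2_set x I * L2_set ?y I\<close> by (rule mult_right_le_imp_le[rotated])
    then show ?thesis using a by (simp add: pos_le_divide_eq mult.commute)
  qed (use a in simp)
  have "(L2_set (mat_vec I A x) I)\<^sup>2 = (\<Sum>i\<in>I. (mat_vec I A x i)\<^sup>2)" by (rule L2_set_square)
  also have "\<dots> = (\<Sum>i\<in>I. x i * ?y i)"
    using mat_vec_symmetric[OF As, where x=x and y="mat_vec I A x"] by (simp add: power2_eq_square)
  also have "\<dots> \<le> L2_set x I * L2_set ?y I" by (rule dot_le_L2_set)
  also have "\<dots> \<le> L2_set x I * (L2_set x I / a)" by (intro mult_left_mono y) simp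
  also have "\<dots> = (1 / a) * (L2_set x I)\<^sup>2" by (simp add: power2_eq_square)
  also have "\<dots> = (sqrt (1 / a) * L2_set x I)\<^sup>2" using a by (simp add: power_mult_distrib)
  finally show ?thesis by (rule power2_le_imp_le) (use a in simp)
qed

text \<open>The determinant is \<open>((\<Prod> \<kappa>) det A)\<^sup>2\<close> with \<open>(det A)\<^sup>2 = 1 / det Sig\<close>, and \<open>det Sig \<le> b ^ card I\<close> because the factor
  \<open>fact (card I)\<close> of the crude determinant bound is absorbed by entries of order \<open>1 / card I\<close>.\<close>

lemma sqrt_det_design_ge:
  assumes I: "finite I" and A: "is_inv_sqrt I Sig A" and \<kappa>: "\<And>i. i \<in> I \<Longrightarrow> 0 < \<kappa> i"
    and b: "0 < b" and Sig: "\<And>i j. i \<in> I \<Longrightarrow> j \<in> I \<Longrightarrow> \<bar>Sig i j\<bar> \<le> b / real (card I)"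
    and I0: "I \<noteq> {}"
  shows "(\<Prod>i\<in>I. \<kappa> i) * (1 / sqrt b) ^ card I \<le> sqrt (mat_det I (mat_mul I (mat_transpose (design A \<kappa>)) (design A \<kappa>)))"
proof -
  have As: "A i j = A j i" if "i \<in> I" "j \<in> I" for i j
    using A that by (auto simp: is_inv_sqrt_def)
  have d0: "0 < card I" using I I0 by (simp add: card_gt_0_iff)
  have "mat_det I (mat_mul I (mat_mul I A A) Sig) = mat_det I (\<lambda>i j. if i = j then 1 else 0)"
    using A by (intro mat_det_cong) (auto simp: is_inv_sqrt_def)
  then have one: "(mat_det I A)\<^sup>2 * mat_det I Sig = 1"
    by (simp add: mat_det_mul[OF I] mat_det_identity[OF I] power2_eq_square)
  have "\<bar>mat_det I Sig\<bar> \<le> fact (card I) * (b / real (card I)) ^ card I"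
    by (rule mat_det_bound[OF I Sig])
  also have "\<dots> \<le> real (card I) ^ card I * (b / real (card I)) ^ card I"
    using b fact_le_power[of "card I", where 'a=real] by (intro mult_right_mono) auto
  also have "\<dots> = b ^ card I" using d0 by (simp flip: power_mult_distrib)
  finally have S: "mat_det I Sig \<le> b ^ card I" by simp
  have "1 \<le> (mat_det I A)\<^sup>2 * b ^ card I"
    using mult_left_mono[OF S, of "(mat_det I A)\<^sup>2"] one by simp
  then have "(1 / b) ^ card I \<le> (mat_det I A)\<^sup>2"
    using b by (simp add: power_one_over field_simps)
  then have detA: "(1 / sqrt b) ^ card I \<le> \<bar>mat_det I A\<bar>"
    using b by (intro power2_le_imp_le[of "(1 / sqrt b) ^ card I" "\<bar>mat_det I A\<bar>"])
      (auto simp: power_mult[symmetric] mult.commute[of _ 2] power_mult power_divide)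
  have "mat_det I (mat_mul I (mat_transpose (design A \<kappa>)) (design A \<kappa>)) = mat_det I (\<lambda>i j. \<kappa> i * mat_mul I A A i j * \<kappa> j)"
  proof (rule mat_det_cong)
    fix i j assume ij: "i \<in> I" "j \<in> I"
    show "mat_mul I (mat_transpose (design A \<kappa>)) (design A \<kappa>) i j = \<kappa> i * mat_mul I A A i j * \<kappa> j"
      unfolding mat_mul_def mat_transpose_def design_def sum_distrib_left sum_distrib_right
      using ij As by (intro sum.cong refl) simp
  qed
  also have "\<dots> = ((\<Prod>i\<in>I. \<kappa> i) * mat_det I A)\<^sup>2"
    unfolding mat_det_scale[OF I] mat_det_mul[OF I] by (simp add: power2_eq_square mult_ac)
  finally have "sqrt (mat_det I (mat_mul I (mat_transpose (design A \<kappa>)) (design A \<kappa>))) = (\<Prod>i\<in>I. \<kappa> i) * \<bar>mat_det I A\<bar>"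
    using \<kappa> by (simp add: real_sqrt_abs abs_mult abs_of_nonneg prod_nonneg less_imp_le)
  then show ?thesis using detA \<kappa> by (simp add: mult_left_mono prod_nonneg less_imp_le)
qed

text \<open>The ball contains a box whose side in direction \<open>i\<close> is proportional to \<open>1 / \<kappa> i\<close>.  In the evidence bound
  the product of the \<open>\<kappa> i\<close> cancels against the one in the determinant of the design.\<close>

lemma emeasure_Bset_ge:
  assumes I: "finite I" "I \<noteq> {}" and \<kappa>: "\<And>i. i \<in> I \<Longrightarrow> 0 < \<kappa> i" and g: "0 < g"
    and A: "\<And>x. L2_set (mat_vec I A x) I \<le> g * L2_set x I" and r: "0 < r"
  shows "ennreal (\<Prod>i\<in>I. r / (g * sqrt (real (card I)) * \<kappa> i)) \<le> emeasure (leb_on_idx I) (Bset I (design A \<kappa>) b0 r)"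
proof -
  define d where "d = real (card I)"
  have d: "0 < d" using I by (simp add: d_def card_gt_0_iff)
  define h where "h i = r / (g * sqrt d * \<kappa> i)" for i
  have h: "0 < h i" if "i \<in> I" for i using \<kappa>[OF that] g r d by (simp add: h_def)
  let ?Q = "\<Pi>\<^sub>E i\<in>I. {b0 i - h i..b0 i + h i}"
  have sub: "?Q \<subseteq> Bset I (design A \<kappa>) b0 r"
  proof
    fix \<beta> assume \<beta>: "\<beta> \<in> ?Q"
    let ?u = "\<lambda>i. \<kappa> i * (\<beta> i - b0 i)"
    have "mat_vec I (design A \<kappa>) (\<lambda>i. \<beta> i - b0 i) = mat_vec I A ?u"
      by (simp add: mat_vec_def design_def fun_eq_iff mult.assoc)
    then have "L2_set (mat_vec I (design A \<kappa>) (\<lambda>i. \<beta> i - b0 i)) I \<le> g * L2_set ?u I" using A by simp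
    also have "L2_set ?u I \<le> L2_set (\<lambda>i. r / (g * sqrt d)) I"
      unfolding L2_set_def
    proof (intro real_sqrt_le_mono sum_mono)
      fix i assume i: "i \<in> I"
      have "\<bar>\<beta> i - b0 i\<bar> \<le> h i" using \<beta> i by (auto simp: PiE_iff abs_le_iff)
      then have "\<bar>?u i\<bar> \<le> \<kappa> i * h i" using \<kappa>[OF i] by (simp add: abs_mult)
      also have "\<dots> = r / (g * sqrt d)" using \<kappa>[OF i] by (simp add: h_def)
      finally show "(?u i)\<^sup>2 \<le> (r / (g * sqrt d))\<^sup>2" by (metis abs_ge_zero power2_abs power_mono)
    qed
    also have "L2_set (\<lambda>i. r / (g * sqrt d)) I = r / g" using r g d by (simp add: L2_set_constant d_def[symmetric])
    finally show "\<beta> \<in> Bset I (design A \<kappa>) b0 r"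
      using \<beta> g by (auto simp: Bset_def space_leb_on_idx PiE_iff)
  qed
  have "ennreal (\<Prod>i\<in>I. h i) \<le> ennreal (\<Prod>i\<in>I. 2 * h i)"
    using h by (intro ennreal_leI prod_mono) (auto simp: less_imp_le)
  also have "\<dots> = (\<Prod>i\<in>I. ennreal (2 * h i))" using h by (intro prod_ennreal[symmetric]) (auto simp: less_imp_le)
  also have "\<dots> = emeasure (leb_on_idx I) ?Q"
    using h by (subst emeasure_leb_on_idx[OF I(1)]) (auto intro!: prod.cong simp: less_imp_le)
  also have "\<dots> \<le> emeasure (leb_on_idx I) (Bset I (design A \<kappa>) b0 r)"
  proof (rule emeasure_mono[OF sub])
    have "(\<lambda>\<beta>. L2_set (mat_vec I (design A \<kappa>) (\<lambda>i. \<beta> i - b0 i)) I) \<in> borel_measurable (leb_on_idx I)"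
      unfolding mat_vec_diff[abs_def]
      by (intro measurable_L2_set I borel_measurable_diff[OF measurable_mat_vec borel_measurable_const]) simp_all
    then show "Bset I (design A \<kappa>) b0 r \<in> sets (leb_on_idx I)" unfolding Bset_def by measurable
  qed
  finally show ?thesis by (simp add: h_def d_def)
qed

section \<open>The wavelet basis\<close>

lemma idx_inf_iff: "(l, k) \<in> idx_inf J0 \<longleftrightarrow> (J0 \<le> l \<and> k < 2 ^ l) \<or> (l = J0 - 1 \<and> k < 2 ^ J0)"
  by (auto simp: idx_inf_def idx_def intro: exI[of _ "Suc l"])

lemma idx_subset_idx_inf: "idx J0 J \<subseteq> idx_inf J0"
  by (auto simp: idx_inf_def)

lemma idx_inf_split: "J0 \<le> J \<Longrightarrow> idx_inf J0 = idx J0 J \<union> {(l, k). J \<le> l \<and> k < 2 ^ l}"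
  by (auto simp: idx_inf_iff idx_def)

lemma idx_eq: "idx J0 J = Sigma {J0..<J} (\<lambda>l. {..<2 ^ l}) \<union> {J0 - 1} \<times> {..<2 ^ J0}"
  by (auto simp: idx_def)

lemma finite_idx [simp]: "finite (idx J0 J)"
  by (simp add: idx_eq)

lemma sum_idx:
  assumes "1 \<le> J0"
  shows "(\<Sum>i\<in>idx J0 J. f i) = (\<Sum>l\<in>{J0..<J}. \<Sum>k<2 ^ l. f (l, k)) + (\<Sum>k<2 ^ J0. f (J0 - 1, k))"
proof -
  have "(\<Sum>i\<in>idx J0 J. f i) = (\<Sum>i\<in>Sigma {J0..<J} (\<lambda>l. {..<2 ^ l}). f i) + (\<Sum>i\<in>{J0 - 1} \<times> {..<2 ^ J0}. f i)"
    unfolding idx_eq using assms by (intro sum.union_disjoint) auto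
  also have "(\<Sum>i\<in>Sigma {J0..<J} (\<lambda>l. {..<2 ^ l}). f i) = (\<Sum>l\<in>{J0..<J}. \<Sum>k<2 ^ l. f (l, k))"
    using sum.Sigma[of "{J0..<J}" "\<lambda>l. {..<2 ^ l}" "\<lambda>l k. f (l, k)"] by simp
  also have "(\<Sum>i\<in>{J0 - 1} \<times> {..<2 ^ J0}. f i) = (\<Sum>k<2 ^ J0. f (J0 - 1, k))"
    using sum.Sigma[of "{J0 - 1}" "\<lambda>l. {..<2 ^ J0}" "\<lambda>l k. f (l, k)"] by simp
  finally show ?thesis .
qed

lemma card_idx:
  assumes "1 \<le> J0" "J0 \<le> J"
  shows "card (idx J0 J) = 2 ^ J"
proof -
  have "card (idx J0 J) = (\<Sum>l\<in>{J0..<J}. 2 ^ l) + 2 ^ J0"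
    using sum_idx[OF assms(1), of "\<lambda>_. 1::nat" J] by simp
  also have "\<dots> = 2 ^ J"
    using assms(2) by (induction J rule: dec_induct) auto
  finally show ?thesis .
qed

lemma bounded_of_continuous_vanishing:
  fixes \<eta> :: "real \<Rightarrow> real"
  assumes c: "continuous_on {0..} \<eta>" and z: "\<forall>x>T. \<eta> x = 0"
  obtains B where "0 \<le> B" "\<And>x. 0 \<le> x \<Longrightarrow> \<bar>\<eta> x\<bar> \<le> B"
proof -
  have "compact (\<eta> ` {0..max 0 T})"
    by (intro compact_continuous_image continuous_on_subset[OF c]) auto
  then have "bounded (\<eta> ` {0..max 0 T})" by (rule compact_imp_bounded)
  then obtain B where B: "\<And>y. y \<in> \<eta> ` {0..max 0 T} \<Longrightarrow> \<bar>y\<bar> \<le> B"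
    unfolding bounded_iff by auto
  have "\<bar>\<eta> x\<bar> \<le> max 0 B" if "0 \<le> x" for x
  proof (cases "x \<le> T")
    case True
    then have "\<eta> x \<in> \<eta> ` {0..max 0 T}" using that by simp
    then show ?thesis using B[of "\<eta> x"] by simp
  next
    case False then show ?thesis using z by simp
  qed
  then show ?thesis by (intro that[of "max 0 B"]) auto
qed

lemma card_nat_in_real_interval:
  "card {k::nat. k < m \<and> a \<le> real k \<and> real k \<le> a + c} \<le> nat \<lceil>c\<rceil> + 1" if c: "0 \<le> c"
proof -
  let ?S = "{k::nat. k < m \<and> a \<le> real k \<and> real k \<le> a + c}"
  show ?thesis
  proof (cases "?S = {}")
    case True
    show ?thesis unfolding True by simp
  next
    case False
    have fin: "finite ?S" by simp
    define k0 where "k0 = Min ?S"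
    have k0: "k0 \<in> ?S" unfolding k0_def using fin False by (rule Min_in)
    have "?S \<subseteq> {k0..k0 + nat \<lceil>c\<rceil>}"
    proof
      fix k assume k: "k \<in> ?S"
      then have "k0 \<le> k" unfolding k0_def using fin by simp
      have "real k - real k0 \<le> c" using k k0 by auto
      also have "\<dots> \<le> real (nat \<lceil>c\<rceil>)" using c by linarith
      finally have "k \<le> k0 + nat \<lceil>c\<rceil>" by linarith
      then show "k \<in> {k0..k0 + nat \<lceil>c\<rceil>}" using \<open>k0 \<le> k\<close> by simp
    qed
    then have "card ?S \<le> card {k0..k0 + nat \<lceil>c\<rceil>}" by (intro card_mono) auto
    then show ?thesis by simp
  qed
qed

text \<open>At each point of the unit interval at most a fixed number of functions of one level do not vanish: the \<open>N\<close> functions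
  at either edge, and the interior translates whose support covers the point.  Each of them is bounded by a constant times the
  dilation factor.\<close>

lemma edge_dilate_sum_bound:
  assumes \<phi>: "continuous_on UNIV \<phi>" "\<And>x. x \<notin> {1 - real N..real N} \<Longrightarrow> \<phi> x = 0" and N: "1 \<le> N"
    and L: "\<And>k. k < N \<Longrightarrow> continuous_on {0..} (\<phi>L k) \<and> (\<forall>x>T. \<phi>L k x = 0)"
    and R: "\<And>k. k < N \<Longrightarrow> continuous_on {0..} (\<phi>R k) \<and> (\<forall>x>T. \<phi>R k x = 0)"
  shows "\<exists>C\<ge>0. \<forall>l x. x \<in> {0..1} \<longrightarrow> (\<Sum>k<2 ^ l. \<bar>edge_dilate N \<phi> \<phi>L \<phi>R l k x\<bar>) \<le> C * 2 powr (real l / 2)"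
proof -
  have "compact (\<phi> ` {1 - real N..real N})"
    by (intro compact_continuous_image continuous_on_subset[OF \<phi>(1)]) auto
  then have "bounded (\<phi> ` {1 - real N..real N})" by (rule compact_imp_bounded)
  then obtain B where B: "\<And>y. y \<in> \<phi> ` {1 - real N..real N} \<Longrightarrow> \<bar>y\<bar> \<le> B"
    unfolding bounded_iff by auto
  have "\<exists>b. 0 \<le> b \<and> (\<forall>x\<ge>0. \<bar>\<phi>L k x\<bar> \<le> b)" if "k < N" for k
    using bounded_of_continuous_vanishing[of "\<phi>L k" T] L[OF that] by metis
  then obtain bL where bL: "\<And>k. k < N \<Longrightarrow> 0 \<le> bL k \<and> (\<forall>x\<ge>0. \<bar>\<phi>L k x\<bar> \<le> bL k)" by metis
  have "\<exists>b. 0 \<le> b \<and> (\<forall>x\<ge>0. \<bar>\<phi>R k x\<bar> \<le> b)" if "k < N" for k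
    using bounded_of_continuous_vanishing[of "\<phi>R k" T] R[OF that] by metis
  then obtain bR where bR: "\<And>k. k < N \<Longrightarrow> 0 \<le> bR k \<and> (\<forall>x\<ge>0. \<bar>\<phi>R k x\<bar> \<le> bR k)" by metis
  define BL where "BL = (\<Sum>k<N. bL k)"
  define BR where "BR = (\<Sum>k<N. bR k)"
  define B' where "B' = max 0 B"
  have BL: "\<bar>\<phi>L k x\<bar> \<le> BL" if "k < N" "0 \<le> x" for k x
    using bL[OF that(1)] that member_le_sum[of k "{..<N}" bL] bL unfolding BL_def by fastforce
  have BR: "\<bar>\<phi>R k x\<bar> \<le> BR" if "k < N" "0 \<le> x" for k x
    using bR[OF that(1)] that member_le_sum[of k "{..<N}" bR] bR unfolding BR_def by fastforce
  have BLR: "0 \<le> BL" "0 \<le> BR" unfolding BL_def BR_def using bL bR by (auto intro!: sum_nonneg)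
  have B': "\<bar>\<phi> y\<bar> \<le> B'" for y using B[of "\<phi> y"] \<phi>(2)[of y] by (cases "y \<in> {1 - real N..real N}") (auto simp: B'_def)
  define c where "c = real (nat \<lceil>2 * real N - 1\<rceil> + 1)"
  define C where "C = real N * BL + c * B' + real N * BR"
  have "(\<Sum>k<2 ^ l. \<bar>edge_dilate N \<phi> \<phi>L \<phi>R l k x\<bar>) \<le> C * 2 powr (real l / 2)" if x: "x \<in> {0..1}" for l x
  proof -
    let ?y = "2 ^ l * x"
    let ?S1 = "{k::nat. k < N}"
    let ?S2 = "{k::nat. k < 2 ^ l \<and> ?y - real N \<le> real k \<and> real k \<le> ?y - real N + (2 * real N - 1)}"
    let ?S3 = "{k::nat. k < 2 ^ l \<and> 2 ^ l - 1 - k < N}"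
    have y: "0 \<le> ?y" "0 \<le> 2 ^ l * (1 - x)" using x by auto
    have pt: "\<bar>edge_dilate N \<phi> \<phi>L \<phi>R l k x\<bar>
        \<le> 2 powr (real l / 2) * (indicator ?S1 k * BL + indicator ?S2 k * B' + indicator ?S3 k * BR)" if k: "k < 2 ^ l" for k
    proof -
      consider "k < N" | "\<not> k < N" "k < 2 ^ l - N" | "\<not> k < N" "\<not> k < 2 ^ l - N" by blast
      then have "\<bar>if k < N then \<phi>L k ?y else if k < 2 ^ l - N then \<phi> (?y - real k) else \<phi>R (2 ^ l - 1 - k) (2 ^ l * (1 - x))\<bar>
          \<le> indicator ?S1 k * BL + indicator ?S2 k * B' + indicator ?S3 k * BR"
      proof cases
        case 1
        then show ?thesis using BL[OF 1 y(1)] BLR by (auto simp: B'_def indicator_def)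
      next
        case 2
        show ?thesis
        proof (cases "?y - real k \<in> {1 - real N..real N}")
          case True
          then have "k \<in> ?S2" using k by auto
          then show ?thesis using 2 B'[of "?y - real k"] BLR by (auto simp: indicator_def)
        next
          case False
          then show ?thesis using 2 \<phi>(2)[OF False] BLR by (auto simp: indicator_def B'_def)
        qed
      next
        case 3
        have "2 ^ l - 1 - k < N" using 3 k N by linarith
        then show ?thesis using 3 BR[OF _ y(2), of "2 ^ l - 1 - k"] BLR k by (auto simp: indicator_def B'_def)
      qed
      then show ?thesis unfolding edge_dilate_def abs_mult by (intro mult_mono) auto
    qed
    have cS: "(\<Sum>k<2 ^ l. indicator S k * b) \<le> real m * b" if "S \<inter> {..<2 ^ l} \<subseteq> S'" "finite S'" "card S' \<le> m" "0 \<le> b" for S S' :: "nat set" and m and b :: real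
    proof -
      have "(\<Sum>k<2 ^ l. indicator S k * b) = (\<Sum>k\<in>S \<inter> {..<2 ^ l}. b)"
        by (rule sum.mono_neutral_cong_right) (auto simp: indicator_def)
      also have "\<dots> = real (card (S \<inter> {..<2 ^ l})) * b" by simp
      also have "real (card (S \<inter> {..<2 ^ l})) * b \<le> real m * b"
      proof -
        have "card (S \<inter> {..<2 ^ l}) \<le> m" using card_mono[OF that(2,1)] that(3) by linarith
        then show ?thesis using that(4) by (intro mult_right_mono) auto
      qed
      finally show ?thesis .
    qed
    have "(\<Sum>k<2 ^ l. \<bar>edge_dilate N \<phi> \<phi>L \<phi>R l k x\<bar>)
        \<le> (\<Sum>k<2 ^ l. 2 powr (real l / 2) * (indicator ?S1 k * BL + indicator ?S2 k * B' + indicator ?S3 k * BR))"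
      by (intro sum_mono pt) simp
    also have "\<dots> = 2 powr (real l / 2) * ((\<Sum>k<2 ^ l. indicator ?S1 k * BL) + (\<Sum>k<2 ^ l. indicator ?S2 k * B') + (\<Sum>k<2 ^ l. indicator ?S3 k * BR))"
      by (simp only: sum_distrib_left sum.distrib ring_distribs)
    also have "\<dots> \<le> 2 powr (real l / 2) * (real N * BL + real (nat \<lceil>2 * real N - 1\<rceil> + 1) * B' + real N * BR)"
    proof (intro mult_left_mono add_mono)
      show "(\<Sum>k<2 ^ l. indicator ?S1 k * BL) \<le> real N * BL" by (rule cS[of _ "{..<N}"]) (use BLR in auto)
      show "(\<Sum>k<2 ^ l. indicator ?S2 k * B') \<le> real (nat \<lceil>2 * real N - 1\<rceil> + 1) * B'"
        by (rule cS[of _ ?S2]) (use card_nat_in_real_interval[of "2 * real N - 1" "2 ^ l" "?y - real N"] N in \<open>auto simp: B'_def\<close>)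
      have "card ?S3 \<le> card {..<N}"
        by (rule card_inj_on_le[of "\<lambda>k. 2 ^ l - 1 - k"]) (auto simp: inj_on_def)
      then show "(\<Sum>k<2 ^ l. indicator ?S3 k * BR) \<le> real N * BR"
        by (intro cS[of _ ?S3]) (use BLR in auto)
    qed simp
    finally show ?thesis by (simp add: C_def c_def mult.commute)
  qed
  moreover have "0 \<le> C" using BLR by (simp add: C_def B'_def c_def)
  ultimately show ?thesis by blast
qed

lemma continuous_edge_dilate:
  assumes \<phi>: "continuous_on UNIV \<phi>" and N: "2 * N \<le> 2 ^ l" and k: "k < 2 ^ l"
    and L: "\<And>k. k < N \<Longrightarrow> continuous_on {0..} (\<phi>L k)"
    and R: "\<And>k. k < N \<Longrightarrow> continuous_on {0..} (\<phi>R k)"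
  shows "continuous_on {0..1} (edge_dilate N \<phi> \<phi>L \<phi>R l k)"
proof -
  consider "k < N" | "\<not> k < N" "k < 2 ^ l - N" | "\<not> k < N" "\<not> k < 2 ^ l - N" by blast
  then show ?thesis
  proof cases
    case 1
    have "continuous_on {0..1} (\<lambda>x. \<phi>L k (2 ^ l * x))"
      by (rule continuous_on_compose2[OF L[OF 1]]) (auto intro!: continuous_intros)
    then show ?thesis using 1 by (auto simp: edge_dilate_def[abs_def] intro!: continuous_intros)
  next
    case 2
    have "continuous_on {0..1} (\<lambda>x. \<phi> (2 ^ l * x - real k))"
      by (rule continuous_on_compose2[OF \<phi>]) (auto intro!: continuous_intros)
    then show ?thesis using 2 by (auto simp: edge_dilate_def[abs_def] intro!: continuous_intros)
  next
    case 3
    have "2 ^ l - 1 - k < N" using 3 k N by linarith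
    then have "continuous_on {0..1} (\<lambda>x. \<phi>R (2 ^ l - 1 - k) (2 ^ l * (1 - x)))"
      by (intro continuous_on_compose2[OF R]) (auto intro!: continuous_intros)
    then show ?thesis using 3 by (auto simp: edge_dilate_def[abs_def] intro!: continuous_intros)
  qed
qed

lemma L2_of_continuous:
  assumes c: "continuous_on {0..1} g" and e: "\<And>x. x \<in> {0..1} \<Longrightarrow> f x = g x"
  shows "f \<in> L2"
proof -
  have cf: "continuous_on {0..1} f" by (rule continuous_on_eq[OF c]) (simp add: e)
  have m: "f \<in> borel_measurable leb01"
    by (rule continuous_imp_measurable_on_sets_lebesgue[OF cf]) simp
  interpret finite_measure leb01 by (rule finite_measure_lebesgue_on) simp
  have "compact (f ` {0..1})" by (intro compact_continuous_image cf) auto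
  then have "bounded (f ` {0..1})" by (rule compact_imp_bounded)
  then obtain B where B: "\<And>y. y \<in> f ` {0..1} \<Longrightarrow> \<bar>y\<bar> \<le> B"
    unfolding bounded_iff by auto
  have "integrable leb01 (\<lambda>x. (f x)\<^sup>2)"
  proof (rule integrable_const_bound[of _ "B\<^sup>2"])
    show "AE x in leb01. norm ((f x)\<^sup>2) \<le> B\<^sup>2"
    proof (rule AE_I2)
      fix x assume "x \<in> space leb01"
      then have "\<bar>f x\<bar> \<le> B" using B by auto
      then show "norm ((f x)\<^sup>2) \<le> B\<^sup>2" by (metis abs_ge_zero norm_power power2_abs power_mono real_norm_def)
    qed
  qed (use m in measurable)
  then show ?thesis using m by (simp add: L2_def)
qed

lemma CDV_functions:
  assumes dp: "daubechies_pair S N \<phi> \<theta>" and NJ: "2 * N \<le> 2 ^ J0"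
    and edge0: "\<forall>k<N. \<forall>\<eta>\<in>{\<phi>L k, \<phi>R k, \<theta>L k, \<theta>R k}. Ck_on S {0..} \<eta> \<and> (\<forall>x>T. \<eta> x = 0)"
    and sc0: "\<forall>k<2 ^ J0. \<forall>x\<in>{0..1}. \<psi> (J0 - 1, k) x = edge_dilate N \<phi> \<phi>L \<phi>R J0 k x"
    and wv0: "\<forall>l\<ge>J0. \<forall>k<2 ^ l. \<forall>x\<in>{0..1}. \<psi> (l, k) x = edge_dilate N \<theta> \<theta>L \<theta>R l k x"
  shows "\<forall>i\<in>idx_inf J0. \<psi> i \<in> L2"
    and "\<exists>C>0. (\<forall>l\<ge>J0. \<forall>x\<in>{0..1}. (\<Sum>k<2 ^ l. \<bar>\<psi> (l, k) x\<bar>) \<le> C * 2 powr (real l / 2)) \<and>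
      (\<forall>x\<in>{0..1}. (\<Sum>k<2 ^ J0. \<bar>\<psi> (J0 - 1, k) x\<bar>) \<le> C * 2 powr (real J0 / 2))"
proof -
  note sc = sc0[rule_format] and wv = wv0[rule_format]
  have cont: "continuous_on A f" if "Ck_on S A f" for A f
    using that unfolding Ck_on_def by auto
  have d: "1 \<le> N" "continuous_on UNIV \<phi>" "continuous_on UNIV \<theta>"
    "\<And>x. x \<notin> {1 - real N..real N} \<Longrightarrow> \<phi> x = 0" "\<And>x. x \<notin> {1 - real N..real N} \<Longrightarrow> \<theta> x = 0"
    using dp cont unfolding daubechies_pair_def by auto
  have e: "continuous_on {0..} \<eta> \<and> (\<forall>x>T. \<eta> x = 0)" if "k < N" "\<eta> \<in> {\<phi>L k, \<phi>R k, \<theta>L k, \<theta>R k}" for k \<eta>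
    using edge0 that cont by blast
  have e1: "continuous_on {0..} (\<phi>L k) \<and> (\<forall>x>T. \<phi>L k x = 0)" if "k < N" for k by (rule e[OF that]) simp
  have e2: "continuous_on {0..} (\<phi>R k) \<and> (\<forall>x>T. \<phi>R k x = 0)" if "k < N" for k by (rule e[OF that]) simp
  have e3: "continuous_on {0..} (\<theta>L k) \<and> (\<forall>x>T. \<theta>L k x = 0)" if "k < N" for k by (rule e[OF that]) simp
  have e4: "continuous_on {0..} (\<theta>R k) \<and> (\<forall>x>T. \<theta>R k x = 0)" if "k < N" for k by (rule e[OF that]) simp
  have Nl: "2 * N \<le> 2 ^ l" if "J0 \<le> l" for l
    using NJ power_increasing[OF that, of "2::nat"] by linarith
  show "\<forall>i\<in>idx_inf J0. \<psi> i \<in> L2"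
  proof
  fix i assume "i \<in> idx_inf J0"
  show "\<psi> i \<in> L2"
  proof (cases i)
    case (Pair l k)
    then consider "J0 \<le> l" "k < 2 ^ l" | "l = J0 - 1" "k < 2 ^ J0" using \<open>i \<in> idx_inf J0\<close> idx_inf_iff by auto
    then show ?thesis
    proof cases
      case 1
      have "continuous_on {0..1} (edge_dilate N \<theta> \<theta>L \<theta>R l k)"
        by (rule continuous_edge_dilate[OF d(3) Nl[OF 1(1)] 1(2)]) (simp_all add: e3 e4)
      then show ?thesis unfolding Pair by (rule L2_of_continuous) (rule wv[OF 1])
    next
      case 2
      have "continuous_on {0..1} (edge_dilate N \<phi> \<phi>L \<phi>R J0 k)"
        by (rule continuous_edge_dilate[OF d(2) NJ 2(2)]) (simp_all add: e1 e2)
      then show ?thesis unfolding Pair 2(1) by (rule L2_of_continuous) (rule sc[OF 2(2)])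
    qed
  qed
  qed
  have "\<exists>C\<ge>0. \<forall>l x. x \<in> {0..1} \<longrightarrow> (\<Sum>k<2 ^ l. \<bar>edge_dilate N \<phi> \<phi>L \<phi>R l k x\<bar>) \<le> C * 2 powr (real l / 2)"
    by (rule edge_dilate_sum_bound[where T=T, OF d(2,4,1) e1 e2])
  then obtain C1 where C1: "0 \<le> C1" "\<And>l x. x \<in> {0..1} \<Longrightarrow> (\<Sum>k<2 ^ l. \<bar>edge_dilate N \<phi> \<phi>L \<phi>R l k x\<bar>) \<le> C1 * 2 powr (real l / 2)"
    by blast
  have "\<exists>C\<ge>0. \<forall>l x. x \<in> {0..1} \<longrightarrow> (\<Sum>k<2 ^ l. \<bar>edge_dilate N \<theta> \<theta>L \<theta>R l k x\<bar>) \<le> C * 2 powr (real l / 2)"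
    by (rule edge_dilate_sum_bound[where T=T, OF d(3,5,1) e3 e4])
  then obtain C2 where C2: "0 \<le> C2" "\<And>l x. x \<in> {0..1} \<Longrightarrow> (\<Sum>k<2 ^ l. \<bar>edge_dilate N \<theta> \<theta>L \<theta>R l k x\<bar>) \<le> C2 * 2 powr (real l / 2)"
    by blast
  show "\<exists>C>0. (\<forall>l\<ge>J0. \<forall>x\<in>{0..1}. (\<Sum>k<2 ^ l. \<bar>\<psi> (l, k) x\<bar>) \<le> C * 2 powr (real l / 2)) \<and>
      (\<forall>x\<in>{0..1}. (\<Sum>k<2 ^ J0. \<bar>\<psi> (J0 - 1, k) x\<bar>) \<le> C * 2 powr (real J0 / 2))"
  proof (intro exI[of _ "C1 + C2 + 1"] conjI allI impI ballI)
    fix l x assume "J0 \<le> l" and x: "x \<in> {0..1::real}"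
    then have "(\<Sum>k<2 ^ l. \<bar>\<psi> (l, k) x\<bar>) = (\<Sum>k<2 ^ l. \<bar>edge_dilate N \<theta> \<theta>L \<theta>R l k x\<bar>)"
      using wv by (intro sum.cong refl) auto
    also have "\<dots> \<le> C2 * 2 powr (real l / 2)" by (rule C2(2)[OF x])
    also have "\<dots> \<le> (C1 + C2 + 1) * 2 powr (real l / 2)" using C1 C2 by (intro mult_right_mono) auto
    finally show "(\<Sum>k<2 ^ l. \<bar>\<psi> (l, k) x\<bar>) \<le> (C1 + C2 + 1) * 2 powr (real l / 2)" .
  next
    fix x assume x: "x \<in> {0..1::real}"
    then have "(\<Sum>k<2 ^ J0. \<bar>\<psi> (J0 - 1, k) x\<bar>) = (\<Sum>k<2 ^ J0. \<bar>edge_dilate N \<phi> \<phi>L \<phi>R J0 k x\<bar>)"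
      using sc by (intro sum.cong refl) auto
    also have "\<dots> \<le> C1 * 2 powr (real J0 / 2)" by (rule C1(2)[OF x])
    also have "\<dots> \<le> (C1 + C2 + 1) * 2 powr (real J0 / 2)" using C1 C2 by (intro mult_right_mono) auto
    finally show "(\<Sum>k<2 ^ J0. \<bar>\<psi> (J0 - 1, k) x\<bar>) \<le> (C1 + C2 + 1) * 2 powr (real J0 / 2)" .
  qed (use C1 C2 in simp)
qed

lemma CDV_basisD:
  assumes "CDV_basis S J0 \<psi>"
  shows "2 \<le> J0"
    and "\<And>i j. i \<in> idx_inf J0 \<Longrightarrow> j \<in> idx_inf J0 \<Longrightarrow> ip (\<psi> i) (\<psi> j) = (if i = j then 1 else 0)"
    and "\<And>f. f \<in> L2 \<Longrightarrow> (\<lambda>J. l2norm (\<lambda>x. f x - (\<Sum>i\<in>idx J0 J. ip f (\<psi> i) * \<psi> i x))) \<longlonglongrightarrow> 0"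
    and "\<forall>i\<in>idx_inf J0. \<psi> i \<in> L2"
    and "\<exists>C>0. (\<forall>l\<ge>J0. \<forall>x\<in>{0..1}. (\<Sum>k<2 ^ l. \<bar>\<psi> (l, k) x\<bar>) \<le> C * 2 powr (real l / 2)) \<and>
      (\<forall>x\<in>{0..1}. (\<Sum>k<2 ^ J0. \<bar>\<psi> (J0 - 1, k) x\<bar>) \<le> C * 2 powr (real J0 / 2))"
proof -
  show J0: "2 \<le> J0" using assms unfolding CDV_basis_def by (elim conjE)
  show "\<And>i j. i \<in> idx_inf J0 \<Longrightarrow> j \<in> idx_inf J0 \<Longrightarrow> ip (\<psi> i) (\<psi> j) = (if i = j then 1 else 0)"
    using assms unfolding CDV_basis_def by blast
  show "\<And>f. f \<in> L2 \<Longrightarrow> (\<lambda>J. l2norm (\<lambda>x. f x - (\<Sum>i\<in>idx J0 J. ip f (\<psi> i) * \<psi> i x))) \<longlonglongrightarrow> 0"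
    using assms unfolding CDV_basis_def by blast
  show "\<forall>i\<in>idx_inf J0. \<psi> i \<in> L2"
    using assms unfolding CDV_basis_def by (elim conjE exE) (rule CDV_functions(1), assumption+)
  show "\<exists>C>0. (\<forall>l\<ge>J0. \<forall>x\<in>{0..1}. (\<Sum>k<2 ^ l. \<bar>\<psi> (l, k) x\<bar>) \<le> C * 2 powr (real l / 2)) \<and>
      (\<forall>x\<in>{0..1}. (\<Sum>k<2 ^ J0. \<bar>\<psi> (J0 - 1, k) x\<bar>) \<le> C * 2 powr (real J0 / 2))"
    using assms unfolding CDV_basis_def by (elim conjE exE) (rule CDV_functions(2), assumption+)
qed

section \<open>Coverage at a random quantile\<close>

text \<open>The threshold \<open>Q\<close> may depend on \<open>T\<close> in any way: on the event in question \<open>T\<close> does not exceed the random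
  point \<open>Q\<close>, which lies in the down-set \<open>D\<close> of points with distribution function at most \<open>p\<close>.  So \<open>T\<close> itself lies in
  \<open>D\<close>, whose probability is at most \<open>p\<close>, by left limits if the supremum of \<open>D\<close> is not attained.\<close>

lemma prob_below_quantile:
  fixes T Q :: "'a \<Rightarrow> real"
  assumes M: "prob_space M" and T[measurable]: "T \<in> borel_measurable M" and Q[measurable]: "Q \<in> borel_measurable M" and p: "0 \<le> p"
  shows "measure M {\<omega> \<in> space M. T \<omega> \<le> Q \<omega> \<and> cdf (distr M borel T) (Q \<omega>) \<le> p} \<le> p"
proof -
  interpret M: prob_space M by fact
  let ?N = "distr M borel T"
  interpret N: real_distribution ?N by (rule M.real_distribution_distr[OF T])
  define D where "D = {r. cdf ?N r \<le> p}"
  let ?E = "{\<omega> \<in> space M. T \<omega> \<le> Q \<omega> \<and> cdf ?N (Q \<omega>) \<le> p}"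
  have cm[measurable]: "cdf ?N \<in> borel_measurable borel"
    by (intro borel_measurable_mono monoI N.cdf_nondecreasing)
  have down: "r \<in> D" if "r \<le> r'" "r' \<in> D" for r r'
    using N.cdf_nondecreasing[OF that(1)] that(2) unfolding D_def mem_Collect_eq by linarith
  have PT: "measure ?N A = measure M (T -` A \<inter> space M)" if "A \<in> sets borel" for A
    using that by (simp add: measure_distr)
  consider "D = {}" | "D \<noteq> {}" "\<not> bdd_above D" | "D \<noteq> {}" "bdd_above D" by metis
  then show ?thesis
  proof cases
    case 1
    then have E0: "?E = {}" by (auto simp: D_def)
    show ?thesis unfolding E0 using p by simp
  next
    case 2
    have "cdf ?N r \<le> p" for r
    proof -
      obtain r' where "r' \<in> D" "\<not> r' \<le> r" using 2(2) unfolding bdd_above_def by blast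
      then show ?thesis using down[of r r'] by (simp add: D_def)
    qed
    then have "1 \<le> p" by (intro tendsto_upperbound[OF N.cdf_lim_at_top_prob] always_eventually allI) simp_all
    then show ?thesis using M.prob_le_1[of ?E] by linarith
  next
    case 3
    define q where "q = Sup D"
    have le_q: "r \<le> q" if "r \<in> D" for r unfolding q_def by (rule cSup_upper[OF that 3(2)])
    have lt_q: "r \<in> D" if "r < q" for r
    proof -
      have "r < Sup D" using that by (simp add: q_def)
      then obtain d where "d \<in> D" "r < d" using less_cSup_iff[OF 3, of r] by blast
      then show ?thesis using down[of r d] by simp
    qed
    show ?thesis
    proof (cases "q \<in> D")
      case True
      have "measure M ?E \<le> measure M (T -` {..q} \<inter> space M)"
      proof (intro M.finite_measure_mono)
        show "?E \<subseteq> T -` {..q} \<inter> space M"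
        proof
          fix \<omega> assume \<omega>: "\<omega> \<in> ?E"
          then have "Q \<omega> \<le> q" by (intro le_q) (simp add: D_def)
          then show "\<omega> \<in> T -` {..q} \<inter> space M" using \<omega> by auto
        qed
      qed simp
      also have "\<dots> = cdf ?N q" by (simp add: cdf_def PT)
      finally show ?thesis using True by (simp add: D_def)
    next
      case False
      have "measure M ?E \<le> measure M (T -` {..<q} \<inter> space M)"
      proof (intro M.finite_measure_mono)
        show "?E \<subseteq> T -` {..<q} \<inter> space M"
        proof
          fix \<omega> assume \<omega>: "\<omega> \<in> ?E"
          then have "Q \<omega> \<in> D" by (simp add: D_def)
          then have "Q \<omega> < q" using le_q[of "Q \<omega>"] False by (cases "Q \<omega> = q") auto
          then show "\<omega> \<in> T -` {..<q} \<inter> space M" using \<omega> by auto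
        qed
      qed simp
      also have "\<dots> = measure ?N {..<q}" by (simp add: PT)
      also have "\<dots> \<le> p"
      proof (rule tendsto_upperbound[OF N.cdf_at_left])
        show "\<forall>\<^sub>F r in at_left q. cdf ?N r \<le> p"
        proof (rule eventually_at_leftI[of "q - 1"])
          fix r assume "r \<in> {q - 1<..<q}"
          then show "cdf ?N r \<le> p" using lt_q[of r] by (simp add: D_def)
        qed simp
      qed simp
      finally show ?thesis .
    qed
  qed
qed

lemma prob_above_quantile:
  fixes T Q :: "'a \<Rightarrow> real"
  assumes M: "prob_space M" and T[measurable]: "T \<in> borel_measurable M" and Q[measurable]: "Q \<in> borel_measurable M" and p: "p \<le> 1"
  shows "measure M {\<omega> \<in> space M. Q \<omega> < T \<omega> \<and> p \<le> cdf (distr M borel T) (Q \<omega>)} \<le> 1 - p"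
proof -
  interpret M: prob_space M by fact
  let ?N = "distr M borel T"
  interpret N: real_distribution ?N by (rule M.real_distribution_distr[OF T])
  define U where "U = {r. p \<le> cdf ?N r}"
  let ?E = "{\<omega> \<in> space M. Q \<omega> < T \<omega> \<and> p \<le> cdf ?N (Q \<omega>)}"
  have up: "r' \<in> U" if "r \<le> r'" "r \<in> U" for r r'
    using N.cdf_nondecreasing[OF that(1)] that(2) unfolding U_def mem_Collect_eq by linarith
  consider "U = {}" | "U \<noteq> {}" "\<not> bdd_below U" | "U \<noteq> {}" "bdd_below U" by metis
  then show ?thesis
  proof cases
    case 1
    then have E0: "?E = {}" by (auto simp: U_def)
    show ?thesis unfolding E0 using p by simp
  next
    case 2
    have "p \<le> cdf ?N r" for r
    proof -
      obtain r' where "r' \<in> U" "\<not> r \<le> r'" using 2(2) unfolding bdd_below_def by blast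
      then show ?thesis using up[of r' r] by (simp add: U_def)
    qed
    then have "p \<le> 0" by (intro tendsto_lowerbound[OF N.cdf_lim_at_bot] always_eventually allI) simp_all
    then show ?thesis using M.prob_le_1[of ?E] by linarith
  next
    case 3
    define q where "q = Inf U"
    have ge_q: "q \<le> r" if "r \<in> U" for r unfolding q_def by (rule cInf_lower[OF that 3(2)])
    have gt_q: "r \<in> U" if "q < r" for r
    proof -
      have "Inf U < r" using that by (simp add: q_def)
      then obtain d where "d \<in> U" "d < r" using cInf_less_iff[OF 3, of r] by blast
      then show ?thesis using up[of d r] by simp
    qed
    have "p \<le> cdf ?N q"
    proof (rule tendsto_lowerbound)
      show "(cdf ?N \<longlongrightarrow> cdf ?N q) (at_right q)"
        using N.cdf_is_right_cont[of q] by (simp add: continuous_within)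
      show "\<forall>\<^sub>F r in at_right q. p \<le> cdf ?N r"
      proof (rule eventually_at_rightI[of q "q + 1"])
        fix r assume "r \<in> {q<..<q + 1}"
        then show "p \<le> cdf ?N r" using gt_q[of r] by (simp add: U_def)
      qed simp
    qed simp
    have "measure M ?E \<le> measure M (space M - (T -` {..q} \<inter> space M))"
    proof (intro M.finite_measure_mono)
      show "?E \<subseteq> space M - (T -` {..q} \<inter> space M)"
      proof
        fix \<omega> assume \<omega>: "\<omega> \<in> ?E"
        then have "q \<le> Q \<omega>" by (intro ge_q) (simp add: U_def)
        then show "\<omega> \<in> space M - (T -` {..q} \<inter> space M)" using \<omega> by auto
      qed
    qed simp
    also have "\<dots> = 1 - cdf ?N q"
      by (subst M.prob_compl) (simp_all add: cdf_def measure_distr)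
    finally show ?thesis using \<open>p \<le> cdf ?N q\<close> by linarith
  qed
qed

text \<open>A data-dependent radius covers with nearly the right probability as soon as it is nearly a quantile of the
  law of \<open>T\<close>, although it is computed from the same data as \<open>T\<close>.\<close>

lemma coverage_of_approximate_quantile:
  fixes T Q :: "'a \<Rightarrow> real"
  assumes M: "prob_space M" and T[measurable]: "T \<in> borel_measurable M" and Q[measurable]: "Q \<in> borel_measurable M"
    and E[measurable]: "E \<in> sets M" and \<eta>: "measure M (space M - E) \<le> \<eta>"
    and c: "0 \<le> c" "c \<le> 1" and \<delta>: "0 \<le> \<delta>"
    and close: "\<And>\<omega>. \<omega> \<in> E \<Longrightarrow> \<bar>measure M {\<omega>' \<in> space M. T \<omega>' \<le> Q \<omega>} - c\<bar> \<le> \<delta>"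
  shows "\<bar>measure M {\<omega> \<in> space M. T \<omega> \<le> Q \<omega>} - c\<bar> \<le> \<delta> + \<eta>"
proof -
  interpret M: prob_space M by fact
  let ?F = "cdf (distr M borel T)"
  interpret N: real_distribution "distr M borel T" by (rule M.real_distribution_distr[OF T])
  have cm[measurable]: "?F \<in> borel_measurable borel"
    by (intro borel_measurable_mono monoI N.cdf_nondecreasing)
  have F: "?F r = measure M {\<omega>' \<in> space M. T \<omega>' \<le> r}" for r
    unfolding cdf_def by (subst measure_distr) (auto intro!: arg_cong[where f="measure M"])
  have close': "?F (Q \<omega>) \<le> c + \<delta>" "c - \<delta> \<le> ?F (Q \<omega>)" if "\<omega> \<in> E" for \<omega>
    using close[OF that] unfolding F by linarith+
  let ?A = "{\<omega> \<in> space M. T \<omega> \<le> Q \<omega>}" and ?B = "{\<omega> \<in> space M. Q \<omega> < T \<omega>}"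
  have "measure M ?A \<le> measure M ((space M - E) \<union> {\<omega> \<in> space M. T \<omega> \<le> Q \<omega> \<and> ?F (Q \<omega>) \<le> c + \<delta>})"
    using close' by (intro M.finite_measure_mono) auto
  also have "\<dots> \<le> measure M (space M - E) + measure M {\<omega> \<in> space M. T \<omega> \<le> Q \<omega> \<and> ?F (Q \<omega>) \<le> c + \<delta>}"
    by (intro measure_Un_le) auto
  finally have up: "measure M ?A \<le> \<eta> + (c + \<delta>)"
    using \<eta> prob_below_quantile[OF M T Q, of "c + \<delta>"] c \<delta> by linarith
  have "measure M ?B \<le> measure M ((space M - E) \<union> {\<omega> \<in> space M. Q \<omega> < T \<omega> \<and> c - \<delta> \<le> ?F (Q \<omega>)})"
    using close' by (intro M.finite_measure_mono) auto
  also have "\<dots> \<le> measure M (space M - E) + measure M {\<omega> \<in> space M. Q \<omega> < T \<omega> \<and> c - \<delta> \<le> ?F (Q \<omega>)}"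
    by (intro measure_Un_le) auto
  finally have "measure M ?B \<le> \<eta> + (1 - (c - \<delta>))"
    using \<eta> prob_above_quantile[OF M T Q, of "c - \<delta>"] c \<delta> by linarith
  moreover have "?B = space M - ?A" by auto
  ultimately have "1 - measure M ?A \<le> \<eta> + (1 - (c - \<delta>))" by (simp add: M.prob_compl)
  then show ?thesis using up by (simp add: abs_le_iff)
qed

section \<open>Wavelet coefficients, the operator and the supremum norm\<close>

lemma ip_cong_AE:
  assumes "f \<in> L2" "g \<in> L2" "h \<in> L2" "AE x in leb01. f x = g x"
  shows "ip f h = ip g h"
  unfolding ip_def
  by (rule integral_cong_AE) (use assms in \<open>auto simp: L2_def\<close>)

lemma operator_sum_AE:
  assumes K: "L2_operator K" and F: "finite F" and g: "\<And>i. i \<in> F \<Longrightarrow> g i \<in> L2"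
  shows "AE x in leb01. K (\<lambda>x. \<Sum>i\<in>F. c i * g i x) x = (\<Sum>i\<in>F. c i * K (g i) x)"
proof -
  have lin: "\<And>f g a b. f \<in> L2 \<Longrightarrow> g \<in> L2 \<Longrightarrow> AE x in leb01. K (\<lambda>y. a * f y + b * g y) x = a * K f x + b * K g x"
    using K unfolding L2_operator_def by blast
  show ?thesis using F g
  proof (induction F rule: finite_induct)
    case empty
    then show ?case using lin[OF L2_zero L2_zero, of 0 0] by simp
  next
    case (insert j F)
    have "AE x in leb01. K (\<lambda>x. c j * g j x + 1 * (\<Sum>i\<in>F. c i * g i x)) x
        = c j * K (g j) x + 1 * K (\<lambda>x. \<Sum>i\<in>F. c i * g i x) x"
      using insert by (intro lin L2_sum) auto
    moreover have "AE x in leb01. K (\<lambda>x. \<Sum>i\<in>F. c i * g i x) x = (\<Sum>i\<in>F. c i * K (g i) x)"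
      using insert by auto
    ultimately show ?case
    proof eventually_elim
      case (elim x)
      then show ?case using insert.hyps by simp
    qed
  qed
qed

text \<open>The signal part of the observed coefficients.  The identity holds for finite wavelet sums by biorthogonality and passes
  to the limit by continuity of \<open>K\<close>.\<close>

lemma operator_coefficient:
  assumes K: "L2_operator K" and \<psi>: "CDV_basis S J0 \<psi>" and V: "WVD J0 \<psi> K v1 v2 \<kappa>"
    and f: "f \<in> L2" and i: "i \<in> idx_inf J0"
  shows "ip (K f) (v1 i) = \<kappa> i * ip f (\<psi> i)"
proof -
  have KL: "K g \<in> L2" if "g \<in> L2" for g using K that unfolding L2_operator_def by blast
  have lin: "\<And>f g a b. f \<in> L2 \<Longrightarrow> g \<in> L2 \<Longrightarrow> AE x in leb01. K (\<lambda>y. a * f y + b * g y) x = a * K f x + b * K g x"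
    using K unfolding L2_operator_def by blast
  obtain C where C: "\<And>g. g \<in> L2 \<Longrightarrow> l2norm (K g) \<le> C * l2norm g"
    using K unfolding L2_operator_def by blast
  have v: "v1 j \<in> L2" "v2 j \<in> L2" "AE x in leb01. K (\<psi> j) x = \<kappa> j * v2 j x" if "j \<in> idx_inf J0" for j
    using V that unfolding WVD_def by blast+
  have bi: "ip (v1 i) (v2 j) = (if i = j then 1 else 0)" if "j \<in> idx_inf J0" for j
    using V that i unfolding WVD_def by blast
  have psi: "\<psi> j \<in> L2" if "j \<in> idx_inf J0" for j using CDV_basisD(4)[OF \<psi>] that by blast
  have sub: "j \<in> idx_inf J0" if "j \<in> idx J0 J" for j J using idx_subset_idx_inf that by blast
  define c where "c j = ip f (\<psi> j)" for j
  define p where "p J = (\<lambda>x. \<Sum>j\<in>idx J0 J. c j * \<psi> j x)" for J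
  define u where "u J = (\<lambda>x. f x - p J x)" for J
  have p: "p J \<in> L2" for J unfolding p_def by (rule L2_sum) (auto intro: psi sub)
  have u: "u J \<in> L2" for J unfolding u_def by (rule L2_diff[OF f p])
  have lim: "(\<lambda>J. l2norm (u J)) \<longlonglongrightarrow> 0"
    using CDV_basisD(3)[OF \<psi> f] unfolding u_def p_def c_def .
  have pi: "ip (K (p J)) (v1 i) = \<kappa> i * c i" if iJ: "i \<in> idx J0 J" for J
  proof -
    have "AE x in leb01. K (p J) x = (\<Sum>j\<in>idx J0 J. c j * K (\<psi> j) x)"
      unfolding p_def by (rule operator_sum_AE[OF K finite_idx]) (auto intro: psi sub)
    then have "ip (K (p J)) (v1 i) = ip (\<lambda>x. \<Sum>j\<in>idx J0 J. c j * K (\<psi> j) x) (v1 i)"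
      by (intro ip_cong_AE KL p L2_sum v(1)[OF i]) (auto intro: KL psi sub)
    also have "\<dots> = (\<Sum>j\<in>idx J0 J. c j * ip (K (\<psi> j)) (v1 i))"
      by (rule ip_sum) (auto intro: KL psi sub v(1)[OF i])
    also have "\<dots> = (\<Sum>j\<in>idx J0 J. if i = j then \<kappa> i * c i else 0)"
    proof (rule sum.cong[OF refl])
      fix j assume j: "j \<in> idx J0 J"
      have "ip (K (\<psi> j)) (v1 i) = ip (\<lambda>x. \<kappa> j * v2 j x) (v1 i)"
        using v[OF sub[OF j]] by (intro ip_cong_AE KL psi sub[OF j] L2_scale v(1)[OF i])
      also have "\<dots> = \<kappa> j * ip (v1 i) (v2 j)" by (subst ip_scale) (simp add: ip_commute)
      finally show "c j * ip (K (\<psi> j)) (v1 i) = (if i = j then \<kappa> i * c i else 0)"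
        using bi[OF sub[OF j]] by simp
    qed
    also have "\<dots> = \<kappa> i * c i" using iJ by simp
    finally show ?thesis .
  qed
  obtain J1 where J1: "i \<in> idx J0 J1" using i by (auto simp: idx_inf_def)
  have mono: "i \<in> idx J0 J" if "J1 \<le> J" for J using J1 that by (auto simp: idx_def)
  have bd: "\<bar>ip (K f) (v1 i) - \<kappa> i * c i\<bar> \<le> C * l2norm (u J) * l2norm (v1 i)" if J: "J1 \<le> J" for J
  proof -
    have "(\<lambda>y. 1 * p J y + 1 * u J y) = f" by (simp add: u_def)
    then have "AE x in leb01. K f x = 1 * K (p J) x + 1 * K (u J) x" using lin[OF p u, of 1 J 1 J] by simp
    then have "ip (K f) (v1 i) = ip (\<lambda>x. 1 * K (p J) x + 1 * K (u J) x) (v1 i)"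
      by (intro ip_cong_AE KL f L2_lincomb p u v(1)[OF i])
    also have "\<dots> = \<kappa> i * c i + ip (K (u J)) (v1 i)"
      by (subst ip_lincomb) (auto intro: KL p u v(1)[OF i] simp: pi[OF mono[OF J]])
    finally have "\<bar>ip (K f) (v1 i) - \<kappa> i * c i\<bar> = \<bar>ip (K (u J)) (v1 i)\<bar>" by simp
    also have "\<dots> \<le> l2norm (K (u J)) * l2norm (v1 i)" by (rule ip_Cauchy_Schwarz[OF KL[OF u] v(1)[OF i]])
    also have "\<dots> \<le> C * l2norm (u J) * l2norm (v1 i)" by (intro mult_right_mono C u) simp
    finally show ?thesis .
  qed
  have "(\<lambda>J. C * l2norm (u J) * l2norm (v1 i)) \<longlonglongrightarrow> C * 0 * l2norm (v1 i)"
    by (intro tendsto_intros lim)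
  then have "\<bar>ip (K f) (v1 i) - \<kappa> i * c i\<bar> \<le> C * 0 * l2norm (v1 i)"
    by (rule LIMSEQ_le_const) (use bd in blast)
  then show ?thesis by (simp add: c_def)
qed

text \<open>The excess \<open>max 0 (\<bar>h\<bar> - D)\<close> is dominated by \<open>\<bar>h - g J\<bar>\<close>, so its \<open>L\<^sup>2\<close> norm vanishes.\<close>

lemma linfnorm_le_of_L2_limit:
  assumes h: "h \<in> L2" and g: "\<And>J. g J \<in> L2" and lim: "(\<lambda>J. l2norm (\<lambda>x. h x - g J x)) \<longlonglongrightarrow> 0"
    and D: "\<And>J x. J1 \<le> J \<Longrightarrow> x \<in> {0..1} \<Longrightarrow> \<bar>g J x\<bar> \<le> D"
  shows "linfnorm h \<le> ereal D"
proof -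
  let ?p = "\<lambda>x. max 0 (\<bar>h x\<bar> - D)"
  have hm[measurable]: "h \<in> borel_measurable leb01" using h by (simp add: L2_def)
  have le: "(?p x)\<^sup>2 \<le> (h x - g J x)\<^sup>2" if "J1 \<le> J" "x \<in> {0..1}" for J x
  proof -
    have "?p x \<le> \<bar>h x - g J x\<bar>" using D[OF that] by linarith
    then have "(?p x)\<^sup>2 \<le> \<bar>h x - g J x\<bar>\<^sup>2" by (intro power_mono) auto
    then show ?thesis by simp
  qed
  have u2: "integrable leb01 (\<lambda>x. (h x - g J x)\<^sup>2)" for J
    using L2_diff[OF h g, of J] by (simp add: L2_def)
  have ip2: "integrable leb01 (\<lambda>x. (?p x)\<^sup>2)"
  proof (rule Bochner_Integration.integrable_bound[OF u2[of J1]])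
    show "AE x in leb01. norm ((?p x)\<^sup>2) \<le> norm ((h x - g J1 x)\<^sup>2)" using le[of J1] by (intro AE_I2) auto
  qed measurable
  have bd: "(LINT x|leb01. (?p x)\<^sup>2) \<le> (l2norm (\<lambda>x. h x - g J x))\<^sup>2" if "J1 \<le> J" for J
  proof -
    have "(LINT x|leb01. (?p x)\<^sup>2) \<le> (LINT x|leb01. (h x - g J x)\<^sup>2)"
      using le[OF that] by (intro integral_mono ip2 u2) auto
    also have "\<dots> = (l2norm (\<lambda>x. h x - g J x))\<^sup>2" unfolding l2norm_square ip_def by (simp add: power2_eq_square)
    finally show ?thesis .
  qed
  have "(\<lambda>J. (l2norm (\<lambda>x. h x - g J x))\<^sup>2) \<longlonglongrightarrow> 0\<^sup>2" by (intro tendsto_intros lim)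
  then have "(LINT x|leb01. (?p x)\<^sup>2) \<le> 0\<^sup>2" by (rule LIMSEQ_le_const) (use bd in blast)
  moreover have "0 \<le> (LINT x|leb01. (?p x)\<^sup>2)" by simp
  ultimately have "(LINT x|leb01. (?p x)\<^sup>2) = 0" by simp
  then have "AE x in leb01. (?p x)\<^sup>2 = 0"
    using integral_nonneg_eq_0_iff_AE[OF ip2] by simp
  then have "AE x in leb01. ereal \<bar>h x\<bar> \<le> ereal D"
  proof eventually_elim
    case (elim x)
    then show ?case by (auto simp: max_def split: if_splits)
  qed
  then show ?thesis unfolding linfnorm_def by (intro esssup_I) measurable
qed

lemma besov_norm_coefficient:
  assumes b: "besov_norm s J0 \<psi> f \<le> ereal B" and l: "J0 \<le> l" "k < 2 ^ l"
  shows "\<bar>ip f (\<psi> (l, k))\<bar> \<le> 2 powr (- real l * (s + 1 / 2)) * B"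
proof -
  let ?S = "SUP (l, k)\<in>{(l, k). J0 \<le> l \<and> k < 2 ^ l}. ereal (2 powr (real l * (s + 1 / 2)) * \<bar>ip (\<psi> (l, k)) f\<bar>)"
  have m: "0 \<le> (MAX k\<in>{..<2 ^ J0}. \<bar>ip (\<psi> (J0 - 1, k)) f\<bar>)"
  proof -
    have "\<bar>ip (\<psi> (J0 - 1, 0)) f\<bar> \<le> (MAX k\<in>{..<2 ^ J0}. \<bar>ip (\<psi> (J0 - 1, k)) f\<bar>)"
      by (intro Max_ge) auto
    then show ?thesis by linarith
  qed
  have "ereal (2 powr (real l * (s + 1 / 2)) * \<bar>ip (\<psi> (l, k)) f\<bar>) \<le> ?S"
    by (rule SUP_upper2[of "(l, k)"]) (use l in auto)
  also have "?S \<le> besov_norm s J0 \<psi> f"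
    unfolding besov_norm_def using m by (simp add: add_increasing)
  finally have "2 powr (real l * (s + 1 / 2)) * \<bar>ip (\<psi> (l, k)) f\<bar> \<le> B" using b order_trans by fastforce
  then have "\<bar>ip (\<psi> (l, k)) f\<bar> \<le> B / 2 powr (real l * (s + 1 / 2))" by (simp add: field_simps)
  also have "\<dots> = 2 powr (- real l * (s + 1 / 2)) * B" by (simp only: mult_minus_left powr_minus divide_inverse mult.commute)
  finally show ?thesis by (simp add: ip_commute)
qed

lemma bandD:
  assumes "f \<in> band J0 \<psi> w c R" and i: "(l, k) \<in> idx_inf J0" and w: "0 < w l"
  shows "f \<in> L2" and "\<bar>ip f (\<psi> (l, k)) - c (l, k)\<bar> \<le> R * w l"
proof -
  show "f \<in> L2" using assms by (simp add: band_def)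
  have "ereal (\<bar>ip f (\<psi> (l, k)) - c (l, k)\<bar> / w l) \<le> (SUP (l, k)\<in>idx_inf J0. ereal (\<bar>ip f (\<psi> (l, k)) - c (l, k)\<bar> / w l))"
    by (rule SUP_upper2[OF i]) simp
  also have "\<dots> \<le> ereal R" using assms by (simp add: band_def)
  finally show "\<bar>ip f (\<psi> (l, k)) - c (l, k)\<bar> \<le> R * w l" using w by (simp add: field_simps)
qed

lemma sum_powr_half: "(\<Sum>l<m. 2 powr (real l / 2)) \<le> 3 * 2 powr (real m / 2)"
proof (induction m)
  case (Suc m)
  have "sqrt (16 / 9) \<le> sqrt (2::real)" by (intro real_sqrt_le_mono) simp
  then have "4 \<le> 3 * sqrt (2::real)" by (simp add: real_sqrt_divide)
  then have "4 * 2 powr (real m / 2) \<le> 3 * (2 powr (real m / 2) * sqrt 2)" by simp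
  moreover have "2 powr (real (Suc m) / 2) = 2 powr (real m / 2) * sqrt 2"
  proof -
    have "real (Suc m) / 2 = real m / 2 + 1 / 2" by simp
    then show ?thesis by (simp only: powr_add powr_half_sqrt)
  qed
  ultimately show ?case using Suc by (simp only: sum.lessThan_Suc)
qed simp

lemma sum_geometric_tail:
  fixes y :: real
  assumes "0 \<le> y" "y < 1"
  shows "(\<Sum>l\<in>{m..<m'}. y ^ l) \<le> y ^ m / (1 - y)"
proof (cases "m \<le> m'")
  case True
  have "(\<Sum>l\<in>{m..<m'}. y ^ l) * (1 - y) = y ^ m - y ^ m'"
    using True
  proof (induction m' rule: dec_induct)
    case (step n)
    have "(\<Sum>l\<in>{m..<Suc n}. y ^ l) * (1 - y) = (\<Sum>l\<in>{m..<n}. y ^ l) * (1 - y) + y ^ n * (1 - y)"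
      using step.hyps by (simp add: distrib_right)
    then show ?case using step.IH by (simp add: right_diff_distrib)
  qed simp
  also have "\<dots> \<le> y ^ m" using assms by simp
  finally show ?thesis using assms by (simp add: field_simps)
qed (use assms in simp)

text \<open>Levels up to \<open>J - 2\<close> are controlled by the band and the finer levels by the Besov ball.  The level \<open>J - 1\<close> is
  counted with the latter, so that only \<open>wbar J0 w (J - 1)\<close> enters; the price is the factor \<open>2 powr s\<close>.\<close>

lemma band_besov_diameter:
  assumes \<psi>: "CDV_basis S J0 \<psi>" and s: "0 < s" and J: "J0 < J"
    and C: "0 < C" "\<forall>l\<ge>J0. \<forall>x\<in>{0..1}. (\<Sum>k<2 ^ l. \<bar>\<psi> (l, k) x\<bar>) \<le> C * 2 powr (real l / 2)"
      "\<forall>x\<in>{0..1}. (\<Sum>k<2 ^ J0. \<bar>\<psi> (J0 - 1, k) x\<bar>) \<le> C * 2 powr (real J0 / 2)"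
    and w: "\<forall>l\<ge>1. 0 < w l" and R: "0 \<le> R" and B: "0 \<le> B"
    and f: "f \<in> band J0 \<psi> w c R" "besov_norm s J0 \<psi> f \<le> ereal B"
    and g: "g \<in> band J0 \<psi> w c R" "besov_norm s J0 \<psi> g \<le> ereal B"
  shows "linfnorm (\<lambda>x. f x - g x)
    \<le> ereal (8 * C * R * wbar J0 w (J - 1) * 2 powr (real J / 2)
        + 2 * C * 2 powr s / (1 - 2 powr (- s)) * (2 powr (- real J * s) * B))"
proof -
  have J0: "2 \<le> J0" by (rule CDV_basisD(1)[OF \<psi>])
  have JJ: "J0 - 1 \<le> J - 2" and JJ': "J - 1 \<le> l \<Longrightarrow> \<not> l \<le> J - 2" for l using J J0 by arith+
  have fL: "f \<in> L2" "g \<in> L2" using f g by (simp_all add: band_def)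
  define h where "h = (\<lambda>x. f x - g x)"
  have h: "h \<in> L2" unfolding h_def by (rule L2_diff[OF fL])
  define W where "W = wbar J0 w (J - 1)"
  have wW: "w l \<le> W" if "J0 - 1 \<le> l" "l \<le> J - 2" for l
    unfolding W_def wbar_def using that J by (intro Max_ge) auto
  \<comment> \<open>The scaling level \<open>J0 - 1\<close> satisfies \<open>J0 - 1 \<le> J - 2\<close> and is therefore always controlled by the band.\<close>
  define e where "e l = (if l \<le> J - 2 then 2 * R * W else 2 * (2 powr (- real l * (s + 1 / 2)) * B))" for l
  have psi: "\<psi> i \<in> L2" if "i \<in> idx_inf J0" for i using CDV_basisD(4)[OF \<psi>] that by blast
  have coef: "\<bar>ip h (\<psi> (l, k))\<bar> \<le> e l" if i: "(l, k) \<in> idx_inf J0" for l k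
  proof -
    have hh: "ip h (\<psi> (l, k)) = ip f (\<psi> (l, k)) - ip g (\<psi> (l, k))"
      unfolding h_def by (rule ip_diff[OF fL psi[OF i]])
    have l: "J0 - 1 \<le> l" using i by (auto simp: idx_inf_iff)
    then have w0: "0 < w l" using w J0 by auto
    show ?thesis
    proof (cases "l \<le> J - 2")
      case True
      have "\<bar>ip h (\<psi> (l, k))\<bar> \<le> R * w l + R * w l"
        unfolding hh using bandD(2)[OF f(1) i w0] bandD(2)[OF g(1) i w0] by linarith
      also have "\<dots> \<le> 2 * R * W" using mult_left_mono[OF wW[OF l True] R] by simp
      finally show ?thesis using True by (simp add: e_def)
    next
      case False
      then have "J0 \<le> l" "k < 2 ^ l" using i J by (auto simp: idx_inf_iff)
      then show ?thesis
        unfolding hh e_def using besov_norm_coefficient[OF f(2)] besov_norm_coefficient[OF g(2)] False by fastforce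
    qed
  qed
  have e0: "0 \<le> e l" for l
  proof -
    have "0 < w (J0 - 1)" using w J0 by simp
    then have "0 \<le> W" using wW[OF order_refl JJ] by linarith
    then show ?thesis using R B by (simp add: e_def)
  qed
  define p where "p J' = (\<lambda>x. \<Sum>i\<in>idx J0 J'. ip h (\<psi> i) * \<psi> i x)" for J'
  let ?y = "2 powr (- s)"
  have y: "0 \<le> ?y" "?y < 1" using s by (simp_all add: powr_less_one)
  let ?D1 = "8 * C * R * W * 2 powr (real J / 2)"
  let ?D2 = "2 * C * 2 powr s / (1 - ?y) * (2 powr (- real J * s) * B)"
  have W0: "0 \<le> 2 * R * W" using e0[of 0] by (simp add: e_def)
  have bound: "\<bar>p J' x\<bar> \<le> ?D1 + ?D2" if J': "J \<le> J'" and x: "x \<in> {0..1}" for J' x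
  proof -
    have "\<bar>p J' x\<bar> \<le> (\<Sum>i\<in>idx J0 J'. \<bar>ip h (\<psi> i)\<bar> * \<bar>\<psi> i x\<bar>)"
      unfolding p_def by (rule order_trans[OF sum_abs]) (simp add: abs_mult)
    also have "\<dots> \<le> (\<Sum>i\<in>idx J0 J'. e (fst i) * \<bar>\<psi> i x\<bar>)"
    proof (intro sum_mono mult_right_mono)
      fix i assume "i \<in> idx J0 J'"
      then have "i \<in> idx_inf J0" using idx_subset_idx_inf by blast
      then show "\<bar>ip h (\<psi> i)\<bar> \<le> e (fst i)" using coef[of "fst i" "snd i"] by simp
    qed simp
    also have "\<dots> = (\<Sum>l\<in>{J0..<J'}. e l * (\<Sum>k<2 ^ l. \<bar>\<psi> (l, k) x\<bar>)) + e (J0 - 1) * (\<Sum>k<2 ^ J0. \<bar>\<psi> (J0 - 1, k) x\<bar>)"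
      using J0 by (simp add: sum_idx sum_distrib_left)
    also have "\<dots> \<le> (\<Sum>l\<in>{J0..<J'}. e l * (C * 2 powr (real l / 2))) + e (J0 - 1) * (C * 2 powr (real J0 / 2))"
      using C x e0 by (intro add_mono sum_mono mult_left_mono) auto
    also have "(\<Sum>l\<in>{J0..<J'}. e l * (C * 2 powr (real l / 2)))
        = (\<Sum>l\<in>{J0..<J - 1}. e l * (C * 2 powr (real l / 2))) + (\<Sum>l\<in>{J - 1..<J'}. e l * (C * 2 powr (real l / 2)))"
      using J J' by (intro sum.atLeastLessThan_concat[symmetric]) auto
    also have "(\<Sum>l\<in>{J0..<J - 1}. e l * (C * 2 powr (real l / 2))) \<le> 2 * R * W * C * (3 * 2 powr (real J / 2))"
    proof -
      have "(\<Sum>l\<in>{J0..<J - 1}. e l * (C * 2 powr (real l / 2))) = 2 * R * W * C * (\<Sum>l\<in>{J0..<J - 1}. 2 powr (real l / 2))"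
        unfolding sum_distrib_left by (intro sum.cong refl) (auto simp: e_def)
      also have "(\<Sum>l\<in>{J0..<J - 1}. 2 powr (real l / 2)) \<le> (\<Sum>l<J. 2 powr (real l / 2))"
        by (intro sum_mono2) auto
      also have "\<dots> \<le> 3 * 2 powr (real J / 2)" by (rule sum_powr_half)
      finally show ?thesis using W0 C by (simp add: mult_left_mono)
    qed
    also have "(\<Sum>l\<in>{J - 1..<J'}. e l * (C * 2 powr (real l / 2))) \<le> ?D2"
    proof -
      have "(\<Sum>l\<in>{J - 1..<J'}. e l * (C * 2 powr (real l / 2))) = (\<Sum>l\<in>{J - 1..<J'}. 2 * C * B * ?y ^ l)"
      proof (rule sum.cong[OF refl])
        fix l assume l: "l \<in> {J - 1..<J'}"
        have "2 powr (- real l * (s + 1 / 2)) * 2 powr (real l / 2) = 2 powr (- s * real l)"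
          unfolding powr_add[symmetric] by (simp add: algebra_simps)
        also have "\<dots> = ?y ^ l" by (simp add: powr_power mult.commute)
        finally have "2 * C * B * (2 powr (- real l * (s + 1 / 2)) * 2 powr (real l / 2)) = 2 * C * B * ?y ^ l" by (simp only:)
        moreover have "e l = 2 * (2 powr (- real l * (s + 1 / 2)) * B)" using l JJ'[of l] by (simp add: e_def)
        ultimately show "e l * (C * 2 powr (real l / 2)) = 2 * C * B * ?y ^ l" by (simp only: mult_ac)
      qed
      also have "\<dots> = 2 * C * B * (\<Sum>l\<in>{J - 1..<J'}. ?y ^ l)" by (simp add: sum_distrib_left)
      also have "\<dots> \<le> 2 * C * B * (?y ^ (J - 1) / (1 - ?y))"
        using C B by (intro mult_left_mono sum_geometric_tail y) auto
      also have "?y ^ (J - 1) = 2 powr s * 2 powr (- real J * s)"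
      proof -
        have "?y ^ (J - 1) = 2 powr (- s * real (J - 1))" by (simp add: powr_power mult.commute)
        also have "\<dots> = 2 powr (s + - real J * s)" using J by (simp add: of_nat_diff algebra_simps)
        finally show ?thesis by (simp only: powr_add)
      qed
      finally show ?thesis by (simp add: mult_ac)
    qed
    also have "e (J0 - 1) * (C * 2 powr (real J0 / 2)) \<le> 2 * R * W * C * 2 powr (real J / 2)"
    proof -
      have "e (J0 - 1) = 2 * R * W" using JJ by (simp only: e_def if_True)
      moreover have "2 * R * W * C * 2 powr (real J0 / 2) \<le> 2 * R * W * C * 2 powr (real J / 2)"
        using W0 C J by (intro mult_left_mono) auto
      ultimately show ?thesis by (simp only: mult.assoc)
    qed
    finally show ?thesis by simp
  qed
  have "linfnorm h \<le> ereal (?D1 + ?D2)"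
  proof (rule linfnorm_le_of_L2_limit[OF h _ _ bound])
    show "p J' \<in> L2" for J' unfolding p_def by (rule L2_sum[OF finite_idx]) (use psi idx_subset_idx_inf in blast)
    show "(\<lambda>J. l2norm (\<lambda>x. h x - p J x)) \<longlonglongrightarrow> 0" unfolding p_def by (rule CDV_basisD(3)[OF \<psi> h])
  qed
  then show ?thesis by (simp add: h_def W_def)
qed

section \<open>The truncated sequence model\<close>

lemma near_orthogonalE:
  assumes "near_orthogonal J0 v"
  obtains a b where "0 < a" "0 < b" "\<forall>F c. finite F \<and> F \<subseteq> idx_inf J0 \<longrightarrow>
      a * (\<Sum>i\<in>F. (c i)\<^sup>2) \<le> (l2norm (\<lambda>x. \<Sum>i\<in>F. c i * v i x))\<^sup>2 \<and>
      (l2norm (\<lambda>x. \<Sum>i\<in>F. c i * v i x))\<^sup>2 \<le> b * (\<Sum>i\<in>F. (c i)\<^sup>2)"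
  using assms unfolding near_orthogonal_def by (elim exE conjE) (rule that, assumption+)

text \<open>The constants \<open>a\<close>, \<open>b\<close> and \<open>b2\<close> stem from near-orthogonality and are fixed before the sample size, the
  truncation level and the weights; all constants of the theorem are functions of them.\<close>

locale vaguelette_frame =
  fixes S J0 :: nat and \<psi> v1 v2 :: "nat \<times> nat \<Rightarrow> real \<Rightarrow> real"
    and K :: "(real \<Rightarrow> real) \<Rightarrow> real \<Rightarrow> real" and \<kappa> :: "nat \<times> nat \<Rightarrow> real" and a b b2 :: real
  assumes CDV: "CDV_basis S J0 \<psi>" and oper: "L2_operator K" and wvd: "WVD J0 \<psi> K v1 v2 \<kappa>"
    and a: "0 < a" and b: "0 < b" and b2: "0 < b2"
    and v1_bounds: "\<And>F c. finite F \<Longrightarrow> F \<subseteq> idx_inf J0 \<Longrightarrow>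
      a * (\<Sum>i\<in>F. (c i)\<^sup>2) \<le> (l2norm (\<lambda>x. \<Sum>i\<in>F. c i * v1 i x))\<^sup>2 \<and>
      (l2norm (\<lambda>x. \<Sum>i\<in>F. c i * v1 i x))\<^sup>2 \<le> b * (\<Sum>i\<in>F. (c i)\<^sup>2)"
    and v2_le: "\<And>i. i \<in> idx_inf J0 \<Longrightarrow> ip (v2 i) (v2 i) \<le> b2"
begin

lemma J0_ge: "2 \<le> J0" by (rule CDV_basisD(1)[OF CDV])

lemma frame_L2: "i \<in> idx_inf J0 \<Longrightarrow> v1 i \<in> L2" "i \<in> idx_inf J0 \<Longrightarrow> v2 i \<in> L2"
  and \<kappa>_pos: "i \<in> idx_inf J0 \<Longrightarrow> 0 < \<kappa> i"
  and biorthogonal: "i \<in> idx_inf J0 \<Longrightarrow> j \<in> idx_inf J0 \<Longrightarrow> ip (v1 i) (v2 j) = (if i = j then 1 else 0)"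
  using wvd unfolding WVD_def by blast+

lemma v1_le: "i \<in> idx_inf J0 \<Longrightarrow> ip (v1 i) (v1 i) \<le> b"
  using v1_bounds[of "{i}" "\<lambda>_. 1"] by (simp add: l2norm_square)

end

locale sieve_model = vaguelette_frame +
  fixes M :: "'w measure" and W :: "(real \<Rightarrow> real) \<Rightarrow> 'w \<Rightarrow> real" and f0 :: "real \<Rightarrow> real" and n J :: nat
    and A :: "nat \<times> nat \<Rightarrow> nat \<times> nat \<Rightarrow> real" and w :: "nat \<Rightarrow> real"
  assumes wn: "white_noise M W" and f0: "f0 \<in> L2" and J: "J0 \<le> J" and n: "2 ^ J \<le> n"
    and A: "is_inv_sqrt (idx J0 J) (cov_mat M (Ytilde K v1 f0 n W)) A"
    and w: "\<And>l. 1 \<le> l \<Longrightarrow> 0 < w l"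
begin

abbreviation "I \<equiv> idx J0 J"
abbreviation "Y \<equiv> Ytilde K v1 f0 n W"
abbreviation "Sig \<equiv> cov_mat M Y"
abbreviation "X \<equiv> design A \<kappa>"
abbreviation "b0 \<equiv> beta0 J0 \<psi> J f0"

text \<open>The observation error of a single coefficient, and the vector of all these errors after multiplication by
  \<open>A\<close>.\<close>

definition noise :: "nat \<times> nat \<Rightarrow> 'w \<Rightarrow> real" where
  "noise i \<omega> = real n powr (- 1 / 2) * W (v1 i) \<omega>"

definition eps :: "'w \<Rightarrow> nat \<times> nat \<Rightarrow> real" where
  "eps \<omega> = mat_vec I A (\<lambda>i. noise i \<omega>)"

text \<open>The inverse of \<open>X\<close>.\<close>

definition V :: "nat \<times> nat \<Rightarrow> nat \<times> nat \<Rightarrow> real" where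
  "V i j = mat_mul I Sig A i j / \<kappa> i"

sublocale M: prob_space M by (rule white_noise_prob_space[OF wn])

lemma n_ge: "4 \<le> n" "0 < real n"
proof -
  have "(2::nat) ^ 2 \<le> 2 ^ J" using J0_ge J by (intro power_increasing) auto
  then show "4 \<le> n" using n by simp
  then show "0 < real n" by simp
qed

lemma idx_mem: "i \<in> I \<Longrightarrow> i \<in> idx_inf J0"
  using idx_subset_idx_inf by blast

lemma card_I: "card I = 2 ^ J"
  by (rule card_idx) (use J0_ge J in auto)

lemma I_ne: "I \<noteq> {}" using card_I by (metis card.empty power_not_zero zero_neq_numeral)

lemma w_pos: "(l, k) \<in> idx_inf J0 \<Longrightarrow> 0 < w l"
  using J0_ge by (intro w) (auto simp: idx_inf_iff)

lemma Y_eq: "i \<in> idx_inf J0 \<Longrightarrow> Y i \<omega> = \<kappa> i * ip f0 (\<psi> i) + noise i \<omega>"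
  using operator_coefficient[OF oper CDV wvd f0] by (simp add: Ytilde_def obs_def noise_def)

lemma fhat_eq: "i \<in> idx_inf J0 \<Longrightarrow> fhat \<kappa> (\<lambda>i. Y i \<omega>) i = ip f0 (\<psi> i) + noise i \<omega> / \<kappa> i"
  using \<kappa>_pos[of i] by (simp add: fhat_def Y_eq field_simps)

lemma noise_measurable: "i \<in> idx_inf J0 \<Longrightarrow> noise i \<in> borel_measurable M"
  unfolding noise_def[abs_def] using white_noise_measurable[OF wn frame_L2(1)] by auto

lemma Sig_eq: "i \<in> I \<Longrightarrow> j \<in> I \<Longrightarrow> Sig i j = ip (v1 i) (v1 j) / real n"
  using n_ge by (intro cov_mat_Ytilde[OF wn]) (auto intro: frame_L2 idx_mem)

lemma Sig_sym: "\<forall>i\<in>I. \<forall>j\<in>I. Sig i j = Sig j i"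
  by (simp add: Sig_eq ip_commute)

lemma Sig_form: "(\<Sum>i\<in>I. c i * mat_vec I Sig c i) = (l2norm (\<lambda>x. \<Sum>i\<in>I. c i * v1 i x))\<^sup>2 / real n"
proof -
  let ?s = "\<lambda>x. \<Sum>i\<in>I. c i * v1 i x"
  have v: "v1 i \<in> L2" if "i \<in> I" for i using that frame_L2 idx_mem by blast
  have s: "?s \<in> L2" by (rule L2_sum[OF finite_idx v])
  have "(l2norm ?s)\<^sup>2 = (\<Sum>i\<in>I. c i * ip (v1 i) ?s)" unfolding l2norm_square by (rule ip_sum[OF finite_idx v s])
  also have "\<dots> = (\<Sum>i\<in>I. c i * (\<Sum>j\<in>I. c j * ip (v1 j) (v1 i)))"
    by (intro sum.cong refl arg_cong2[where f="(*)"]) (subst ip_commute, rule ip_sum[OF finite_idx v v])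
  finally show ?thesis
    by (simp add: mat_vec_def Sig_eq sum_divide_distrib sum_distrib_left ip_commute mult_ac cong: sum.cong)
qed

lemma Sig_lower: "a / real n * (\<Sum>i\<in>I. (c i)\<^sup>2) \<le> (\<Sum>i\<in>I. c i * mat_vec I Sig c i)"
  using v1_bounds[OF finite_idx[of J0 J] idx_subset_idx_inf, of c] n_ge unfolding Sig_form by (simp add: divide_right_mono)

lemma Sig_entry: "i \<in> I \<Longrightarrow> j \<in> I \<Longrightarrow> \<bar>Sig i j\<bar> \<le> b / real (card I)"
proof -
  assume ij: "i \<in> I" "j \<in> I"
  have "\<bar>ip (v1 i) (v1 j)\<bar> \<le> l2norm (v1 i) * l2norm (v1 j)"
    using ij by (intro ip_Cauchy_Schwarz frame_L2 idx_mem)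
  also have "\<dots> \<le> sqrt b * sqrt b"
    using ij v1_le idx_mem b by (intro mult_mono) (auto simp: l2norm_def ip_self_nonneg)
  also have "\<dots> = b" using b by simp
  finally have "\<bar>Sig i j\<bar> \<le> b / real n" using ij n_ge by (simp add: Sig_eq divide_right_mono)
  also have "\<dots> \<le> b / real (card I)"
  proof (rule divide_left_mono)
    show "real (card I) \<le> real n" using n card_I by (simp only: of_nat_le_iff)
    show "0 < real n * real (card I)" using n_ge card_I by simp
  qed (use b in simp)
  finally show ?thesis .
qed

lemma A_norm: "L2_set (mat_vec I A x) I \<le> sqrt (real n / a) * L2_set x I"
  using inv_sqrt_norm_le[OF finite_idx A Sig_sym _ Sig_lower, of x] a n_ge by simp

lemma V_apply: "mat_vec I V u i = mat_vec I Sig (mat_vec I A u) i / \<kappa> i"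
proof -
  have "mat_vec I V u i = mat_vec I (mat_mul I Sig A) u i / \<kappa> i"
    by (simp add: mat_vec_def V_def sum_divide_distrib)
  then show ?thesis by (simp add: mat_vec_mat_mul)
qed

lemma X_apply: "mat_vec I X u = mat_vec I A (\<lambda>i. \<kappa> i * u i)"
  by (simp add: mat_vec_def design_def fun_eq_iff mult.assoc)

lemma XV: "i \<in> I \<Longrightarrow> mat_vec I X (mat_vec I V u) i = u i"
proof -
  assume i: "i \<in> I"
  have "mat_vec I X (mat_vec I V u) i = mat_vec I A (mat_vec I Sig (mat_vec I A u)) i"
    unfolding X_apply
  proof (rule mat_vec_cong)
    fix j assume "j \<in> I"
    then have "\<kappa> j \<noteq> 0" using \<kappa>_pos[OF idx_mem, of j] by simp
    then show "\<kappa> j * mat_vec I V u j = mat_vec I Sig (mat_vec I A u) j" by (simp add: V_apply)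
  qed
  then show ?thesis using inv_sqrt_inverse(3)[OF finite_idx A Sig_sym i] by simp
qed

lemma VX: "i \<in> I \<Longrightarrow> mat_vec I V (mat_vec I X u) i = u i"
  unfolding V_apply X_apply using inv_sqrt_inverse(2)[OF finite_idx A Sig_sym] \<kappa>_pos[OF idx_mem, of i] by simp

lemma V_eps: "i \<in> I \<Longrightarrow> mat_vec I V (eps \<omega>) i = noise i \<omega> / \<kappa> i"
  unfolding V_apply eps_def using inv_sqrt_inverse(2)[OF finite_idx A Sig_sym] by simp

lemma model_equation:
  assumes i: "i \<in> I"
  shows "mat_vec I A (\<lambda>i. Y i \<omega>) i - mat_vec I X \<beta> i = eps \<omega> i - mat_vec I X (\<lambda>i. \<beta> i - b0 i) i"
proof -
  have "mat_vec I A (\<lambda>i. Y i \<omega>) i = mat_vec I A (\<lambda>i. \<kappa> i * b0 i + noise i \<omega>) i"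
    by (rule mat_vec_cong) (simp add: Y_eq[OF idx_mem] beta0_def)
  then show ?thesis by (simp add: X_apply mat_vec_add eps_def mat_vec_diff right_diff_distrib)
qed

lemma eps_measurable: "i \<in> I \<Longrightarrow> (\<lambda>\<omega>. eps \<omega> i) \<in> borel_measurable M"
  unfolding eps_def mat_vec_def
  by (intro borel_measurable_sum borel_measurable_times borel_measurable_const noise_measurable idx_mem)

text \<open>Every linear combination of the whitened noise is \<open>W\<close> evaluated at one function, whose squared norm is
  \<open>t\<^sup>T A Sig A t = \<parallel>t\<parallel>\<^sup>2\<close>.\<close>

lemma distr_eps: "distr M (std_gauss I) (\<lambda>\<omega>. \<lambda>i\<in>I. eps \<omega> i) = std_gauss I"
proof (rule distr_eq_std_gauss[OF M.prob_space_axioms finite_idx eps_measurable])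
  fix t :: "nat \<times> nat \<Rightarrow> real"
  let ?r = "real n powr (- 1 / 2)"
  let ?c = "\<lambda>j. ?r * mat_vec I A t j"
  have As: "\<forall>i\<in>I. \<forall>j\<in>I. A i j = A j i" using A by (auto simp: is_inv_sqrt_def)
  have r2: "?r\<^sup>2 * real n = 1"
  proof -
    have "?r\<^sup>2 = real n powr (- 1)" unfolding power2_eq_square powr_add[symmetric] by simp
    then show ?thesis using n_ge by (simp add: powr_minus)
  qed
  have "(\<Sum>i\<in>I. t i * eps \<omega> i) = (\<Sum>j\<in>I. ?c j * W (v1 j) \<omega>)" for \<omega>
    unfolding eps_def mat_vec_symmetric[OF As] by (simp add: noise_def mult_ac)
  then have "(\<integral>\<omega>. iexp (\<Sum>i\<in>I. t i * eps \<omega> i) \<partial>M) = (\<integral>\<omega>. iexp (\<Sum>j\<in>I. ?c j * W (v1 j) \<omega>) \<partial>M)" by simp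
  also have "\<dots> = complex_of_real (exp (- ip (\<lambda>x. \<Sum>j\<in>I. ?c j * v1 j x) (\<lambda>x. \<Sum>j\<in>I. ?c j * v1 j x) / 2))"
    by (rule white_noise_joint_char[OF wn finite_idx frame_L2(1)[OF idx_mem]])
  also have "ip (\<lambda>x. \<Sum>j\<in>I. ?c j * v1 j x) (\<lambda>x. \<Sum>j\<in>I. ?c j * v1 j x) = real n * (\<Sum>i\<in>I. ?c i * mat_vec I Sig ?c i)"
    using n_ge by (simp add: Sig_form l2norm_square)
  also have "(\<Sum>i\<in>I. ?c i * mat_vec I Sig ?c i) = ?r\<^sup>2 * (\<Sum>i\<in>I. mat_vec I A t i * mat_vec I Sig (mat_vec I A t) i)"
  proof -
    have "mat_vec I Sig ?c i = ?r * mat_vec I Sig (mat_vec I A t) i" for i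
      by (simp add: mat_vec_def[of I Sig] sum_distrib_left mult_ac)
    then show ?thesis by (simp add: sum_distrib_left power2_eq_square mult_ac)
  qed
  also have "(\<Sum>i\<in>I. mat_vec I A t i * mat_vec I Sig (mat_vec I A t) i) = (\<Sum>i\<in>I. t i * mat_vec I A (mat_vec I Sig (mat_vec I A t)) i)"
    by (rule mat_vec_symmetric[OF As, symmetric])
  also have "\<dots> = (\<Sum>i\<in>I. (t i)\<^sup>2)"
    using inv_sqrt_inverse(3)[OF finite_idx A Sig_sym] by (simp add: power2_eq_square)
  also have "real n * (?r\<^sup>2 * (\<Sum>i\<in>I. (t i)\<^sup>2)) = (\<Sum>i\<in>I. (t i)\<^sup>2)"
    using r2 by (simp add: mult.assoc[symmetric] mult.commute)
  finally show "(\<integral>\<omega>. iexp (\<Sum>i\<in>I. t i * eps \<omega> i) \<partial>M) = complex_of_real (exp (- (\<Sum>i\<in>I. (t i)\<^sup>2) / 2))" .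
qed

lemma measure_eps:
  assumes B: "{u \<in> space (std_gauss I). P u} \<in> sets (std_gauss I)"
    and P: "\<And>u u'. (\<And>i. i \<in> I \<Longrightarrow> u i = u' i) \<Longrightarrow> P u = P u'"
  shows "measure (std_gauss I) {u \<in> space (std_gauss I). P u} = measure M {\<omega> \<in> space M. P (eps \<omega>)}"
proof -
  let ?f = "\<lambda>\<omega>. \<lambda>i\<in>I. eps \<omega> i"
  have f: "?f \<in> measurable M (std_gauss I)"
    unfolding measurable_cong_sets[OF refl sets_std_gauss] by (rule measurable_into_leb_on_idx[OF eps_measurable])
  have "measure (std_gauss I) {u \<in> space (std_gauss I). P u} = measure (distr M (std_gauss I) ?f) {u \<in> space (std_gauss I). P u}"
    by (simp only: distr_eps)
  also have "\<dots> = measure M (?f -` {u \<in> space (std_gauss I). P u} \<inter> space M)"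
    by (rule measure_distr[OF f B])
  also have "?f -` {u \<in> space (std_gauss I). P u} \<inter> space M = {\<omega> \<in> space M. P (eps \<omega>)}"
  proof -
    have "P (?f \<omega>) = P (eps \<omega>)" for \<omega> by (rule P) simp
    then show ?thesis using measurable_space[OF f] by auto
  qed
  finally show ?thesis .
qed

text \<open>The weighted supremum error of the unregularised estimator over the resolved levels.  For fixed radius,
  \<open>T \<omega> \<le> r\<close> is the part of the coverage event that the posterior can see.\<close>

definition T :: "'w \<Rightarrow> real" where
  "T \<omega> = (MAX i\<in>I. \<bar>noise i \<omega> / \<kappa> i\<bar> / w (fst i))"

lemma T_le_iff: "T \<omega> \<le> r \<longleftrightarrow> (\<forall>i\<in>I. \<bar>noise i \<omega> / \<kappa> i\<bar> \<le> r * w (fst i))"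
proof -
  have wp: "0 < w (fst i)" if "i \<in> I" for i using w_pos[of "fst i" "snd i"] idx_mem[OF that] by simp
  have "T \<omega> \<le> r \<longleftrightarrow> (\<forall>i\<in>I. \<bar>noise i \<omega> / \<kappa> i\<bar> / w (fst i) \<le> r)"
    unfolding T_def using I_ne by (simp del: abs_divide)
  also have "\<dots> \<longleftrightarrow> (\<forall>i\<in>I. \<bar>noise i \<omega> / \<kappa> i\<bar> \<le> r * w (fst i))"
    by (rule ball_cong[OF refl], rule pos_divide_le_eq, rule wp)
  finally show ?thesis .
qed

lemma T_measurable: "T \<in> borel_measurable M"
proof (rule borel_measurable_iff_le[THEN iffD2], rule allI)
  fix r
  show "{\<omega> \<in> space M. T \<omega> \<le> r} \<in> sets M"
    unfolding T_le_iff
  proof (rule sets.sets_Collect_finite_All[OF _ finite_idx])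
    fix i assume "i \<in> I"
    then have [measurable]: "noise i \<in> borel_measurable M" by (intro noise_measurable idx_mem)
    show "{\<omega> \<in> space M. \<bar>noise i \<omega> / \<kappa> i\<bar> \<le> r * w (fst i)} \<in> sets M" by measurable
  qed
qed

lemma eps_tail: "0 \<le> t \<Longrightarrow> measure M {\<omega> \<in> space M. t \<le> L2_set (eps \<omega>) I} \<le> sqrt 2 ^ card I * exp (- t\<^sup>2 / 4)"
proof -
  assume t: "0 \<le> t"
  have "(\<lambda>u. L2_set u I) \<in> borel_measurable (std_gauss I)"
    by (intro measurable_L2_set finite_idx measurable_coordinate[where f="\<lambda>x. x"]) simp_all
  then have "{u \<in> space (std_gauss I). t \<le> L2_set u I} \<in> sets (std_gauss I)" by measurable
  then have "measure (std_gauss I) {u \<in> space (std_gauss I). t \<le> L2_set u I} = measure M {\<omega> \<in> space M. t \<le> L2_set (eps \<omega>) I}"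
  proof (rule measure_eps)
    fix u u' :: "nat \<times> nat \<Rightarrow> real" assume "\<And>i. i \<in> I \<Longrightarrow> u i = u' i"
    then have "L2_set u I = L2_set u' I" by (rule L2_set_cong[OF refl])
    then show "(t \<le> L2_set u I) = (t \<le> L2_set u' I)" by simp
  qed
  then show ?thesis using std_gauss_norm_tail[OF finite_idx t, of J0 J] by simp
qed

lemma credible_set_eq:
  "{\<beta> \<in> space (leb_on_idx I). wav_sum \<psi> I \<beta> \<in> band J0 \<psi> w (\<lambda>i. ip (wav_sum \<psi> I y) (\<psi> i)) R}
    = {\<beta> \<in> space (leb_on_idx I). \<forall>i\<in>I. \<bar>\<beta> i - y i\<bar> \<le> R * w (fst i)}"
proof -
  have psi: "\<psi> i \<in> L2" if "i \<in> idx_inf J0" for i using CDV_basisD(4)[OF CDV] that by blast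
  have L: "wav_sum \<psi> I \<beta> \<in> L2" for \<beta>
    unfolding wav_sum_def[abs_def] by (rule L2_sum[OF finite_idx psi[OF idx_mem]])
  have co: "ip (wav_sum \<psi> I \<beta>) (\<psi> i) = (if i \<in> I then \<beta> i else 0)" if i: "i \<in> idx_inf J0" for \<beta> i
  proof -
    have "ip (wav_sum \<psi> I \<beta>) (\<psi> i) = (\<Sum>j\<in>I. \<beta> j * ip (\<psi> j) (\<psi> i))"
      unfolding wav_sum_def[abs_def] by (rule ip_sum[OF finite_idx psi[OF idx_mem] psi[OF i]])
    also have "\<dots> = (\<Sum>j\<in>I. if j = i then \<beta> i else 0)"
      by (intro sum.cong refl) (simp add: CDV_basisD(2)[OF CDV idx_mem i])
    finally show ?thesis by simp
  qed
  obtain i0 where i0: "i0 \<in> I" using I_ne by auto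
  have "wav_sum \<psi> I \<beta> \<in> band J0 \<psi> w (\<lambda>i. ip (wav_sum \<psi> I y) (\<psi> i)) R \<longleftrightarrow> (\<forall>i\<in>I. \<bar>\<beta> i - y i\<bar> \<le> R * w (fst i))" for \<beta>
  proof -
    let ?d = "\<lambda>i. \<bar>ip (wav_sum \<psi> I \<beta>) (\<psi> i) - ip (wav_sum \<psi> I y) (\<psi> i)\<bar> / w (fst i)"
    have "wav_sum \<psi> I \<beta> \<in> band J0 \<psi> w (\<lambda>i. ip (wav_sum \<psi> I y) (\<psi> i)) R \<longleftrightarrow> (\<forall>i\<in>idx_inf J0. ?d i \<le> R)"
      by (auto simp: band_def L SUP_le_iff split_beta)
    also have "\<dots> \<longleftrightarrow> (\<forall>i\<in>I. \<bar>\<beta> i - y i\<bar> \<le> R * w (fst i))"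
    proof
      assume H: "\<forall>i\<in>idx_inf J0. ?d i \<le> R"
      show "\<forall>i\<in>I. \<bar>\<beta> i - y i\<bar> \<le> R * w (fst i)"
      proof
        fix i assume i: "i \<in> I"
        have "0 < w (fst i)" using w_pos[of "fst i" "snd i"] idx_mem[OF i] by simp
        moreover have "?d i \<le> R" using H idx_mem[OF i] by blast
        ultimately show "\<bar>\<beta> i - y i\<bar> \<le> R * w (fst i)" using i by (simp add: co[OF idx_mem[OF i]] pos_divide_le_eq)
      qed
    next
      assume H: "\<forall>i\<in>I. \<bar>\<beta> i - y i\<bar> \<le> R * w (fst i)"
      show "\<forall>i\<in>idx_inf J0. ?d i \<le> R"
      proof
        fix i assume i: "i \<in> idx_inf J0"
        have wi: "0 < w (fst i)" using w_pos[of "fst i" "snd i"] i by simp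
        show "?d i \<le> R"
        proof (cases "i \<in> I")
          case True
          then show ?thesis using H wi by (simp add: co[OF i] pos_divide_le_eq)
        next
          case False
          have "0 \<le> R * w (fst i0)" using H i0 abs_ge_zero order_trans by blast
          moreover have "0 < w (fst i0)" using w_pos[of "fst i0" "snd i0"] idx_mem[OF i0] by simp
          ultimately have "0 \<le> R" by (simp add: zero_le_mult_iff)
          then show ?thesis using False by (simp add: co[OF i])
        qed
      qed
    qed
    finally show ?thesis .
  qed
  then show ?thesis by simp
qed

lemma flatness_facts:
  assumes \<pi>: "prior_density I \<pi>" and R: "0 \<le> R" and p: "0 < \<pi> b0"
  shows "0 \<le> flatness I X b0 \<pi> R" "flatness I X b0 \<pi> R \<le> 1"
    "\<And>\<beta> \<beta>'. \<beta> \<in> Bset I X b0 R \<Longrightarrow> \<beta>' \<in> Bset I X b0 R \<Longrightarrow> (1 - flatness I X b0 \<pi> R) * \<pi> \<beta>' \<le> \<pi> \<beta>"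
    "b0 \<in> Bset I X b0 R"
proof -
  let ?B = "Bset I X b0 R"
  have \<pi>0: "0 \<le> \<pi> \<beta>" if "\<beta> \<in> ?B" for \<beta> using that \<pi> by (auto simp: prior_density_def Bset_def)
  show b0B: "b0 \<in> ?B" using R by (simp add: Bset_def space_leb_on_idx beta0_def mat_vec_def L2_set_def)
  let ?f = "\<lambda>(\<beta>, \<beta>'). \<pi> \<beta>' / \<pi> \<beta>"
  have nn: "0 \<le> ?f p" if "p \<in> ?B \<times> ?B" for p using that \<pi>0 by auto
  have bdd: "bdd_below (?f ` (?B \<times> ?B))" using nn by (intro bdd_belowI2[of _ 0])
  have low: "Inf (?f ` (?B \<times> ?B)) \<le> \<pi> \<beta>' / \<pi> \<beta>" if "\<beta> \<in> ?B" "\<beta>' \<in> ?B" for \<beta> \<beta>'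
    using cINF_lower[OF bdd, of "(\<beta>, \<beta>')"] that by simp
  show "0 \<le> flatness I X b0 \<pi> R" using low[OF b0B b0B] p by (simp add: flatness_def)
  have "0 \<le> Inf (?f ` (?B \<times> ?B))" using nn b0B by (intro cINF_greatest) auto
  then show "flatness I X b0 \<pi> R \<le> 1" by (simp add: flatness_def)
  fix \<beta> \<beta>' assume *: "\<beta> \<in> ?B" "\<beta>' \<in> ?B"
  show "(1 - flatness I X b0 \<pi> R) * \<pi> \<beta>' \<le> \<pi> \<beta>"
  proof (cases "\<pi> \<beta>' = 0")
    case False
    then have "0 < \<pi> \<beta>'" using \<pi>0[OF *(2)] by simp
    then show ?thesis using low[OF *(2,1)] by (simp add: flatness_def pos_le_divide_eq)
  qed (use \<pi>0[OF *(1)] in simp)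
qed

end

section \<open>The credible radius as a quantile\<close>

text \<open>The radius is chosen so that \<open>R\<^sup>2 / 64\<close> equals \<open>Q D ln n\<close>.  With noise at most \<open>R / 4\<close>, the exponent is at most
  \<open>(R / 2)\<^sup>2 / 2 - (3 R / 4)\<^sup>2 / 2 = - 5 R\<^sup>2 / 32\<close>, which beats any evidence of order \<open>n powr (- Q D)\<close>.\<close>

lemma posterior_radius_numerics:
  fixes Q R :: real and n D :: nat
  assumes Q: "2 \<le> Q" and n: "2 \<le> n" and D: "4 \<le> D" and R: "R = 8 * sqrt Q * sqrt (real D * ln (real n))"
  shows "4 \<le> R" and "sqrt 2 ^ D * exp (- (R / 4)\<^sup>2 / 4) \<le> real n powr (- real D)"
    and "0 \<le> e \<Longrightarrow> e \<le> R / 4 \<Longrightarrow> exp ((1 / 2) * (e + 1)\<^sup>2 - (1 / 2) * (R - e)\<^sup>2) \<le> real n powr (- 10 * Q * real D)"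
proof -
  have ln2: "1 / 2 \<le> ln (real n)"
  proof -
    have "ln (2::real) \<le> ln (real n)" using n by simp
    moreover have "1 / 2 \<le> ln (2::real)" using ln_2_less_1 ln_le_minus_one[of "1/2::real"] by (simp add: ln_div)
    ultimately show ?thesis by linarith
  qed
  have L: "0 \<le> real D * ln (real n)" using ln2 D by simp
  have R2: "R\<^sup>2 = 64 * Q * (real D * ln (real n))" using Q L by (simp add: R power_mult_distrib)
  have R0: "0 \<le> R" using Q L by (simp add: R)
  have "2 \<le> real D * ln (real n)" using mult_mono[of 4 "real D" "1/2" "ln (real n)"] D ln2 by simp
  then have "16 \<le> R\<^sup>2" unfolding R2 using mult_mono[of 2 Q 2 "real D * ln (real n)"] Q by simp
  then have "4\<^sup>2 \<le> R\<^sup>2" by simp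
  then show R4: "4 \<le> R" using R0 by (rule power2_le_imp_le)
  have npow: "exp (- c * (real D * ln (real n))) = real n powr (- c * real D)" for c
    using n by (simp add: powr_def mult_ac)
  have "sqrt 2 ^ D = 2 powr (real D / 2)" by (simp add: powr_half_sqrt[symmetric] powr_power)
  also have "\<dots> \<le> real n powr (real D / 2)" using n by (intro powr_mono2) auto
  finally have s2: "sqrt 2 ^ D \<le> real n powr (real D / 2)" .
  have "- (R / 4)\<^sup>2 / 4 = - Q * (real D * ln (real n))" by (simp add: power_divide R2)
  then have "sqrt 2 ^ D * exp (- (R / 4)\<^sup>2 / 4) \<le> real n powr (real D / 2) * real n powr (- Q * real D)"
    using s2 by (simp only: npow) (rule mult_right_mono, auto)
  also have "\<dots> = real n powr (real D / 2 - Q * real D)" by (simp flip: powr_add)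
  also have "\<dots> \<le> real n powr (- real D)"
    using n mult_right_mono[OF Q, of "real D"] by (intro powr_mono) auto
  finally show "sqrt 2 ^ D * exp (- (R / 4)\<^sup>2 / 4) \<le> real n powr (- real D)" .
  assume e: "0 \<le> e" "e \<le> R / 4"
  have "(e + 1)\<^sup>2 \<le> (R / 2)\<^sup>2" using e R4 by (intro power_mono) auto
  moreover have "(3 * R / 4)\<^sup>2 \<le> (R - e)\<^sup>2" using e R4 by (intro power_mono) auto
  ultimately have "(1 / 2) * (e + 1)\<^sup>2 - (1 / 2) * (R - e)\<^sup>2 \<le> (1 / 2) * (R / 2)\<^sup>2 - (1 / 2) * (3 * R / 4)\<^sup>2" by linarith
  also have "\<dots> = - (10 * Q) * (real D * ln (real n))"
    by (simp add: power_divide power_mult_distrib R2)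
  finally have "exp ((1 / 2) * (e + 1)\<^sup>2 - (1 / 2) * (R - e)\<^sup>2) \<le> exp (- (10 * Q) * (real D * ln (real n)))" by simp
  then have "exp ((1 / 2) * (e + 1)\<^sup>2 - (1 / 2) * (R - e)\<^sup>2) \<le> real n powr (- (10 * Q) * real D)" unfolding npow .
  then show "exp ((1 / 2) * (e + 1)\<^sup>2 - (1 / 2) * (R - e)\<^sup>2) \<le> real n powr (- 10 * Q * real D)" by simp
qed

context sieve_model
begin

text \<open>The prior mass of a small ball, up to flatness.  The determinant in the hypothesis contributes
  \<open>(\<Prod> \<kappa>) / sqrt b ^ D\<close> and the box inside the ball \<open>(sqrt a / (n sqrt D)) ^ D / (\<Prod> \<kappa>)\<close> with \<open>D = 2 ^ J\<close>.  Since \<open>D \<le> n\<close> and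
  \<open>2 \<le> n\<close>, each of the \<open>D\<close> coordinates costs at most \<open>sqrt (b / a) n powr (3 / 2) \<le> n powr C0\<close>.\<close>

lemma evidence_lower_bound:
  assumes ab: "a \<le> b" and C0: "C0 = 3 / 2 + log 2 (b / a) / 2"
    and p: "sqrt (mat_det I (mat_mul I (mat_transpose X) X)) * real n powr (- C1 * 2 ^ J) \<le> p"
  shows "0 < p" and "ennreal (real n powr (- (C1 + C0) * 2 ^ J) / 2) \<le> ennreal (p / 2) * emeasure (leb_on_idx I) (Bset I X b0 (1 / sqrt (real n)))"
proof -
  define D where "D = card I"
  have D: "real D = 2 ^ J" "0 < D" "D \<le> n" using card_I n by (simp_all add: D_def)
  have \<kappa>I: "0 < \<kappa> i" if "i \<in> I" for i using \<kappa>_pos idx_mem that by blast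
  define P where "P = (\<Prod>i\<in>I. \<kappa> i)"
  have P: "0 < P" unfolding P_def by (intro prod_pos \<kappa>I)
  let ?g = "sqrt (real n / a)" and ?r = "1 / sqrt (real n)"
  have n0: "0 < real n" by (rule n_ge)
  have g: "0 < ?g" using a n0 by simp
  have "P * (1 / sqrt b) ^ D \<le> sqrt (mat_det I (mat_mul I (mat_transpose X) X))"
    unfolding P_def D_def by (rule sqrt_det_design_ge[OF finite_idx A \<kappa>I b Sig_entry I_ne])
  then have "P * (1 / sqrt b) ^ D * real n powr (- C1 * 2 ^ J) \<le> sqrt (mat_det I (mat_mul I (mat_transpose X) X)) * real n powr (- C1 * 2 ^ J)"
    by (intro mult_right_mono) auto
  then have pP: "P * (1 / sqrt b) ^ D * real n powr (- C1 * 2 ^ J) \<le> p" using p by linarith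
  moreover have "0 < P * (1 / sqrt b) ^ D * real n powr (- C1 * 2 ^ J)" using P b n0 by simp
  ultimately show p0: "0 < p" by linarith
  have vol: "ennreal (\<Prod>i\<in>I. ?r / (?g * sqrt (real D) * \<kappa> i)) \<le> emeasure (leb_on_idx I) (Bset I X b0 ?r)"
    unfolding D_def using n0 by (intro emeasure_Bset_ge[OF finite_idx I_ne \<kappa>I g A_norm]) auto
  have prod: "(\<Prod>i\<in>I. ?r / (?g * sqrt (real D) * \<kappa> i)) = (?r / (?g * sqrt (real D))) ^ D / P"
  proof -
    have "(\<Prod>i\<in>I. ?r / (?g * sqrt (real D) * \<kappa> i)) = (\<Prod>i\<in>I. ?r / (?g * sqrt (real D)) / \<kappa> i)" by (simp add: mult.assoc)
    also have "\<dots> = (\<Prod>i\<in>I. ?r / (?g * sqrt (real D))) / P" unfolding P_def by (rule prod_dividef)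
    finally show ?thesis by (simp add: D_def)
  qed
  have key: "real n powr (- C0) \<le> (1 / sqrt b) * (?r / (?g * sqrt (real D)))"
  proof -
    have l0: "0 \<le> log 2 (b / a)" using ab a by simp
    have ba: "0 < b / a" using a b by simp
    have "sqrt (b / a) = (b / a) powr (1 / 2)" using ba by (simp only: powr_half_sqrt less_imp_le)
    also have "\<dots> = (2 powr log 2 (b / a)) powr (1 / 2)" using ba by simp
    also have "\<dots> = 2 powr (log 2 (b / a) / 2)" by (simp add: powr_powr)
    also have "\<dots> \<le> real n powr (log 2 (b / a) / 2)" using l0 n_ge by (intro powr_mono2) auto
    finally have 1: "sqrt (b / a) \<le> real n powr (log 2 (b / a) / 2)" .
    have "sqrt (real n) * sqrt (real n) * sqrt (real D) \<le> sqrt (real n) * sqrt (real n) * sqrt (real n)"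
      using D n0 by (intro mult_left_mono) auto
    also have "\<dots> = real n powr (1 / 2) * real n powr (1 / 2) * real n powr (1 / 2)"
      using n0 by (simp only: powr_half_sqrt)
    also have "\<dots> = real n powr (3 / 2)" by (simp only: powr_add[symmetric]) simp
    finally have 2: "sqrt (real n) * sqrt (real n) * sqrt (real D) \<le> real n powr (3 / 2)" .
    have "sqrt (b / a) * (sqrt (real n) * sqrt (real n) * sqrt (real D)) \<le> real n powr (log 2 (b / a) / 2) * real n powr (3 / 2)"
      using 1 2 a b n0 by (intro mult_mono) auto
    also have "\<dots> = real n powr C0" unfolding C0 powr_add[symmetric] by (simp add: add.commute)
    finally have 3: "sqrt (b / a) * (sqrt (real n) * sqrt (real n) * sqrt (real D)) \<le> real n powr C0" .
    have pos: "0 < sqrt (b / a) * (sqrt (real n) * sqrt (real n) * sqrt (real D))"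
      using ba n0 D(2) by (intro mult_pos_pos) (simp_all only: real_sqrt_gt_zero of_nat_0_less_iff)
    have "real n powr (- C0) = 1 / real n powr C0" by (simp add: powr_minus_divide)
    also have "\<dots> \<le> 1 / (sqrt (b / a) * (sqrt (real n) * sqrt (real n) * sqrt (real D)))"
      using 3 n0 by (intro divide_left_mono mult_pos_pos[OF _ pos]) simp_all
    also have "\<dots> = (1 / sqrt b) * (?r / (?g * sqrt (real D)))"
      using a b n0 D by (simp add: real_sqrt_divide field_simps)
    finally show ?thesis .
  qed
  have "real n powr (- (C1 + C0) * 2 ^ J) = real n powr (- C1 * 2 ^ J) * real n powr (- C0 * real D)"
    unfolding D(1) powr_add[symmetric] by (simp add: algebra_simps)
  also have "real n powr (- C0 * real D) = (real n powr (- C0)) ^ D"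
    using n0 by (simp add: powr_power mult.commute)
  also have "\<dots> \<le> ((1 / sqrt b) * (?r / (?g * sqrt (real D)))) ^ D"
    by (intro power_mono key) simp
  also have "\<dots> = (1 / sqrt b) ^ D * (?r / (?g * sqrt (real D))) ^ D" by (rule power_mult_distrib)
  finally have "real n powr (- (C1 + C0) * 2 ^ J) \<le> real n powr (- C1 * 2 ^ J) * ((1 / sqrt b) ^ D * (?r / (?g * sqrt (real D))) ^ D)"
    by (simp add: mult_left_mono)
  also have "\<dots> = (P * (1 / sqrt b) ^ D * real n powr (- C1 * 2 ^ J)) * ((?r / (?g * sqrt (real D))) ^ D / P)"
    using P by simp
  also have "\<dots> \<le> p * ((?r / (?g * sqrt (real D))) ^ D / P)"
    using P g D n0 by (intro mult_right_mono pP divide_nonneg_nonneg zero_le_power) auto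
  finally have "real n powr (- (C1 + C0) * 2 ^ J) / 2 \<le> p / 2 * (\<Prod>i\<in>I. ?r / (?g * sqrt (real D) * \<kappa> i))"
    unfolding prod by simp
  then have "ennreal (real n powr (- (C1 + C0) * 2 ^ J) / 2) \<le> ennreal (p / 2 * (\<Prod>i\<in>I. ?r / (?g * sqrt (real D) * \<kappa> i)))"
    by (rule ennreal_leI)
  also have "\<dots> = ennreal (p / 2) * ennreal (\<Prod>i\<in>I. ?r / (?g * sqrt (real D) * \<kappa> i))"
    using p0 g n0 D \<kappa>I by (intro ennreal_mult prod_nonneg) (auto simp: less_imp_le)
  also have "\<dots> \<le> ennreal (p / 2) * emeasure (leb_on_idx I) (Bset I X b0 ?r)"
    by (rule mult_left_mono[OF vol]) simp
  finally show "ennreal (real n powr (- (C1 + C0) * 2 ^ J) / 2) \<le> ennreal (p / 2) * emeasure (leb_on_idx I) (Bset I X b0 ?r)" .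
qed

text \<open>In the limiting Gaussian law \<open>\<beta> - fhat = V v\<close> with a standard Gaussian \<open>v\<close>, because the centre \<open>b0 + V e\<close> is
  exactly \<open>fhat\<close> on the resolved levels.  Since \<open>V (eps \<omega>') = noise / \<kappa>\<close> and \<open>eps\<close> is standard Gaussian as well, the weighted
  supremum of \<open>V v\<close> has the law of \<open>T\<close>.  The credible radius is therefore a quantile of \<open>T\<close> up to the error of the
  Gaussian approximation.\<close>

lemma credible_radius_quantile:
  assumes ab: "a \<le> b" and C0: "C0 = 3 / 2 + log 2 (b / a) / 2" and C1: "0 < C1"
    and \<pi>: "prior_density I \<pi>"
    and p: "sqrt (mat_det I (mat_mul I (mat_transpose X) X)) * real n powr (- C1 * 2 ^ J) \<le> \<pi> b0"
    and flat: "flatness I X b0 \<pi> (1 / sqrt (real n)) \<le> 1 / 2"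
    and R: "R = 8 * sqrt (C1 + C0 + 2) * sqrt (2 ^ J * ln (real n))"
    and e: "L2_set (eps \<omega>) I \<le> R / 4"
    and cred: "credible_radius J0 \<psi> \<kappa> w J A \<pi> \<alpha> (\<lambda>i. Y i \<omega>) r"
  shows "\<bar>measure M {\<omega>' \<in> space M. T \<omega>' \<le> r} - (1 - \<alpha>)\<bar> \<le> flatness I X b0 \<pi> R + 3 * real n powr (- (2 ^ J))"
proof -
  let ?Q = "C1 + C0 + 2"
  have C00: "0 \<le> C0" using ab a by (simp add: C0)
  have D4: "4 \<le> (2::nat) ^ J"
  proof -
    have "(2::nat) ^ 2 \<le> 2 ^ J" using J0_ge J by (intro power_increasing) auto
    then show ?thesis by simp
  qed
  have n2: "2 \<le> n" using n_ge by simp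
  have R': "R = 8 * sqrt ?Q * sqrt (real (2 ^ J) * ln (real n))" using R by simp
  have Q2: "2 \<le> ?Q" using C1 C00 by simp
  note num = posterior_radius_numerics[OF Q2 n2 D4 R']
  note p0 = evidence_lower_bound(1)[OF ab C0 p] and ev = evidence_lower_bound(2)[OF ab C0 p]
  have R0: "0 \<le> R" using num(1) by simp
  note ff = flatness_facts[where \<pi>=\<pi>, OF \<pi> R0 p0]
  have rn: "0 \<le> 1 / sqrt (real n)" "1 / sqrt (real n) \<le> 1" using n_ge by auto
  note fn = flatness_facts[where \<pi>=\<pi>, OF \<pi> rn(1) p0]
  have half: "\<pi> b0 / 2 \<le> \<pi> \<beta>" if "\<beta> \<in> Bset I X b0 (1 / sqrt (real n))" for \<beta>
  proof -
    have "(1 / 2) * \<pi> b0 \<le> (1 - flatness I X b0 \<pi> (1 / sqrt (real n))) * \<pi> b0"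
      using flat p0 by (intro mult_right_mono) auto
    also have "\<dots> \<le> \<pi> \<beta>" by (rule fn(3)[OF that fn(4)])
    finally show ?thesis by simp
  qed
  define z where "z = real n powr (- (C1 + C0) * 2 ^ J) / 2"
  have z0: "0 < z" using n_ge by (simp add: z_def)
  define S where "S = {\<beta> \<in> space (leb_on_idx I). \<forall>i\<in>I. \<bar>\<beta> i - fhat \<kappa> (\<lambda>i. Y i \<omega>) i\<bar> \<le> r * w (fst i)}"
  have S: "S \<in> sets (leb_on_idx I)" unfolding S_def
  proof (rule sets.sets_Collect_finite_All[OF _ finite_idx])
    fix i assume i: "i \<in> I"
    have "(\<lambda>\<beta>. \<beta> i) \<in> borel_measurable (leb_on_idx I)" by (rule measurable_coordinate[OF _ i]) simp
    then show "{\<beta> \<in> space (leb_on_idx I). \<bar>\<beta> i - fhat \<kappa> (\<lambda>i. Y i \<omega>) i\<bar> \<le> r * w (fst i)} \<in> sets (leb_on_idx I)" by measurable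
  qed
  have cr: "measure (quasi_posterior I A X \<pi> (\<lambda>i. Y i \<omega>)) S = 1 - \<alpha>"
    using cred unfolding credible_radius_def credible_set_eq S_def .
  have eR: "L2_set (eps \<omega>) I \<le> R" using e num(1) by linarith
  let ?t = "exp ((1 / 2) * (L2_set (eps \<omega>) I + 1)\<^sup>2 - (1 / 2) * (R - L2_set (eps \<omega>) I)\<^sup>2) / z"
  have close: "\<bar>measure (quasi_posterior I A X \<pi> (\<lambda>i. Y i \<omega>)) S
        - measure (std_gauss I) {v \<in> space (std_gauss I). (\<lambda>i\<in>I. b0 i + mat_vec I V (\<lambda>j. v j + eps \<omega> j) i) \<in> S}\<bar>
      \<le> flatness I X b0 \<pi> R + ?t
        + measure (std_gauss I) {v \<in> space (std_gauss I). R - L2_set (eps \<omega>) I \<le> L2_set v I}"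
    by (rule quasi_posterior_close(2)[OF finite_idx XV VX \<pi> model_equation eR ff(1,2) ff(3) rn(2) half z0 _ S])
      (use ev in \<open>simp_all add: z_def\<close>)
  have t: "?t \<le> 2 * real n powr (- (2 ^ J))"
  proof -
    have "?t \<le> real n powr (- 10 * ?Q * real (2 ^ J)) / z"
      using z0 num(3)[of "L2_set (eps \<omega>) I"] e by (intro divide_right_mono) auto
    also have "\<dots> = 2 * real n powr (- 10 * ?Q * 2 ^ J + (C1 + C0) * 2 ^ J)"
    proof -
      have iz: "1 / z = 2 * real n powr ((C1 + C0) * 2 ^ J)"
        unfolding z_def mult_minus_left powr_minus_divide by simp
      have "real n powr (- 10 * ?Q * real (2 ^ J)) / z = real n powr (- 10 * ?Q * 2 ^ J) * (1 / z)" by simp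
      also have "\<dots> = 2 * (real n powr (- 10 * ?Q * 2 ^ J) * real n powr ((C1 + C0) * 2 ^ J))" unfolding iz by simp
      finally show ?thesis by (simp only: powr_add)
    qed
    also have "\<dots> \<le> 2 * real n powr (- (2 ^ J))"
    proof -
      have "(- 10 * ?Q + (C1 + C0)) * 2 ^ J \<le> - 1 * 2 ^ J"
        using C1 C00 by (intro mult_right_mono) auto
      then show ?thesis using n_ge by (intro mult_left_mono powr_mono) (auto simp: algebra_simps)
    qed
    finally show ?thesis .
  qed
  have g: "measure (std_gauss I) {v \<in> space (std_gauss I). R - L2_set (eps \<omega>) I \<le> L2_set v I} \<le> real n powr (- (2 ^ J))"
  proof -
    interpret G: prob_space "std_gauss I" by (rule prob_space_std_gauss)
    have mL: "(\<lambda>u. L2_set u I) \<in> borel_measurable (std_gauss I)"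
      by (intro measurable_L2_set finite_idx measurable_coordinate[where f="\<lambda>x. x"]) simp_all
    have "measure (std_gauss I) {v \<in> space (std_gauss I). R - L2_set (eps \<omega>) I \<le> L2_set v I}
        \<le> measure (std_gauss I) {v \<in> space (std_gauss I). R / 4 \<le> L2_set v I}"
    proof (rule G.finite_measure_mono)
      show "{v \<in> space (std_gauss I). R - L2_set (eps \<omega>) I \<le> L2_set v I} \<subseteq> {v \<in> space (std_gauss I). R / 4 \<le> L2_set v I}"
        using e R0 by auto
      show "{v \<in> space (std_gauss I). R / 4 \<le> L2_set v I} \<in> sets (std_gauss I)" using mL by measurable
    qed
    also have "\<dots> \<le> sqrt 2 ^ card I * exp (- (R / 4)\<^sup>2 / 4)"
      using R0 by (intro std_gauss_norm_tail finite_idx) simp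
    finally show ?thesis using num(2) by (simp add: card_I)
  qed
  have "measure (std_gauss I) {v \<in> space (std_gauss I). (\<lambda>i\<in>I. b0 i + mat_vec I V (\<lambda>j. v j + eps \<omega> j) i) \<in> S}
      = measure (std_gauss I) {v \<in> space (std_gauss I). \<forall>i\<in>I. \<bar>mat_vec I V v i\<bar> \<le> r * w (fst i)}"
  proof (intro arg_cong2[where f=measure] refl Collect_cong conj_cong)
    fix v
    have "b0 i + mat_vec I V (\<lambda>j. v j + eps \<omega> j) i - fhat \<kappa> (\<lambda>i. Y i \<omega>) i = mat_vec I V v i" if i: "i \<in> I" for i
      using i by (simp add: mat_vec_add V_eps fhat_eq[OF idx_mem[OF i]] beta0_def)
    then show "((\<lambda>i\<in>I. b0 i + mat_vec I V (\<lambda>j. v j + eps \<omega> j) i) \<in> S) = (\<forall>i\<in>I. \<bar>mat_vec I V v i\<bar> \<le> r * w (fst i))"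
      by (simp add: S_def space_leb_on_idx)
  qed
  also have "\<dots> = measure M {\<omega>' \<in> space M. \<forall>i\<in>I. \<bar>mat_vec I V (eps \<omega>') i\<bar> \<le> r * w (fst i)}"
  proof (rule measure_eps)
    show "{u \<in> space (std_gauss I). \<forall>i\<in>I. \<bar>mat_vec I V u i\<bar> \<le> r * w (fst i)} \<in> sets (std_gauss I)"
    proof (rule sets.sets_Collect_finite_All[OF _ finite_idx])
      fix i
      have "(\<lambda>u. mat_vec I V u i) \<in> borel_measurable (std_gauss I)"
        by (rule measurable_mat_vec[where f="\<lambda>x. x"]) simp
      then show "{u \<in> space (std_gauss I). \<bar>mat_vec I V u i\<bar> \<le> r * w (fst i)} \<in> sets (std_gauss I)" by measurable
    qed
    fix u u' :: "nat \<times> nat \<Rightarrow> real" assume "\<And>i. i \<in> I \<Longrightarrow> u i = u' i"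
    then have "mat_vec I V u i = mat_vec I V u' i" for i by (rule mat_vec_cong)
    then show "(\<forall>i\<in>I. \<bar>mat_vec I V u i\<bar> \<le> r * w (fst i)) = (\<forall>i\<in>I. \<bar>mat_vec I V u' i\<bar> \<le> r * w (fst i))" by simp
  qed
  also have "{\<omega>' \<in> space M. \<forall>i\<in>I. \<bar>mat_vec I V (eps \<omega>') i\<bar> \<le> r * w (fst i)} = {\<omega>' \<in> space M. T \<omega>' \<le> r}"
    unfolding T_le_iff by (simp add: V_eps cong: ball_cong)
  finally show ?thesis using close t g unfolding cr by linarith
qed

lemma prob_large_eps:
  assumes ab: "a \<le> b" and C0: "C0 = 3 / 2 + log 2 (b / a) / 2" and C1: "0 < C1"
    and R: "R = 8 * sqrt (C1 + C0 + 2) * sqrt (2 ^ J * ln (real n))"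
  shows "0 \<le> R" and "measure M (space M - {\<omega> \<in> space M. L2_set (eps \<omega>) I \<le> R / 4}) \<le> real n powr (- (2 ^ J))"
    and "{\<omega> \<in> space M. L2_set (eps \<omega>) I \<le> R / 4} \<in> sets M"
proof -
  have C00: "0 \<le> C0" using ab a by (simp add: C0)
  have "(2::nat) ^ 2 \<le> 2 ^ J" using J0_ge J by (intro power_increasing) auto
  then have D4: "4 \<le> (2::nat) ^ J" by simp
  have n2: "2 \<le> n" using n_ge by simp
  have R': "R = 8 * sqrt (C1 + C0 + 2) * sqrt (real (2 ^ J) * ln (real n))" using R by simp
  have Q2: "2 \<le> C1 + C0 + 2" using C1 C00 by simp
  note num = posterior_radius_numerics[OF Q2 n2 D4 R']
  show R0: "0 \<le> R" using num(1) by simp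
  have [measurable]: "(\<lambda>\<omega>. L2_set (eps \<omega>) I) \<in> borel_measurable M"
    by (intro measurable_L2_set finite_idx eps_measurable)
  show "{\<omega> \<in> space M. L2_set (eps \<omega>) I \<le> R / 4} \<in> sets M" by measurable
  have "measure M (space M - {\<omega> \<in> space M. L2_set (eps \<omega>) I \<le> R / 4}) \<le> measure M {\<omega> \<in> space M. R / 4 \<le> L2_set (eps \<omega>) I}"
    by (intro M.finite_measure_mono) auto
  also have "\<dots> \<le> sqrt 2 ^ card I * exp (- (R / 4)\<^sup>2 / 4)" using R0 by (intro eps_tail) simp
  finally show "measure M (space M - {\<omega> \<in> space M. L2_set (eps \<omega>) I \<le> R / 4}) \<le> real n powr (- (2 ^ J))"
    using num(2) by (simp add: card_I)
qed

end

section \<open>Noise beyond the truncation level\<close>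

lemma admissible_weightsD:
  assumes w: "admissible_weights J0 \<kappa> w" and J0: "2 \<le> J0" and \<kappa>': "\<forall>i\<in>idx_inf J0. 0 < \<kappa> i" and J: "J0 \<le> J"
  shows "\<And>l. 1 \<le> l \<Longrightarrow> 0 < w l"
    and "\<And>l k. J \<le> l \<Longrightarrow> k < 2 ^ l \<Longrightarrow> uJ \<kappa> w J * sqrt (real l) \<le> \<kappa> (l, k) * w l"
    and "\<And>i. i \<in> idx J0 J \<Longrightarrow> \<kappa> i \<le> kmax J0 \<kappa> J"
    and "\<And>i. i \<in> idx J0 J \<Longrightarrow> w (fst i) \<le> wbar J0 w J"
    and "0 < kmax J0 \<kappa> J" "0 < wbar J0 w J" "0 < uJ \<kappa> w J"
proof -
  note \<kappa> = bspec[OF \<kappa>']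
  show w0: "0 < w l" if "1 \<le> l" for l using w that unfolding admissible_weights_def by blast
  let ?f = "\<lambda>(l, k). \<kappa> (l, k) * w l / sqrt (real l)"
  let ?S = "{(l, k). J \<le> l \<and> k < 2 ^ l}"
  have pos: "0 \<le> ?f p" if "p \<in> ?S" for p
  proof -
    obtain l k where p: "p = (l, k)" by (cases p)
    have "0 < \<kappa> (l, k)" using that p J by (intro \<kappa>) (auto simp: idx_inf_iff)
    moreover have "0 < w l" using that p J J0 by (intro w0) auto
    ultimately show ?thesis by (simp add: p)
  qed
  have bdd: "bdd_below (?f ` ?S)" using pos by (intro bdd_belowI2[of _ 0])
  show "uJ \<kappa> w J * sqrt (real l) \<le> \<kappa> (l, k) * w l" if "J \<le> l" "k < 2 ^ l" for l k
  proof -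
    have "uJ \<kappa> w J \<le> ?f (l, k)" unfolding uJ_def by (rule cINF_lower[OF bdd]) (use that in simp)
    moreover have "0 < sqrt (real l)" using that J J0 by simp
    ultimately show ?thesis by (simp add: pos_le_divide_eq)
  qed
  show kI: "\<kappa> i \<le> kmax J0 \<kappa> J" if "i \<in> idx J0 J" for i
    unfolding kmax_def using that by (intro Max_ge) auto
  show wI: "w (fst i) \<le> wbar J0 w J" if "i \<in> idx J0 J" for i
    unfolding wbar_def
  proof (rule Max_ge[OF finite_imageI imageI])
    show "fst i \<in> {J0 - 1..J - 1}" using that J J0 by (auto simp: idx_def)
  qed simp
  have i0: "(J0 - 1, 0) \<in> idx J0 J" by (simp add: idx_def)
  then have "0 < \<kappa> (J0 - 1, 0)" using idx_subset_idx_inf by (intro \<kappa>) blast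
  then show k0: "0 < kmax J0 \<kappa> J" using kI[OF i0] by linarith
  have "0 < w (J0 - 1)" using J0 by (intro w0) simp
  then show wb0: "0 < wbar J0 w J" using wI[OF i0] by simp
  have "1 \<le> sqrt (real J) / (kmax J0 \<kappa> J * wbar J0 w J) * uJ \<kappa> w J"
    using w J unfolding admissible_weights_def by blast
  moreover have "0 < sqrt (real J) / (kmax J0 \<kappa> J * wbar J0 w J)" using k0 wb0 J J0 by simp
  ultimately show "0 < uJ \<kappa> w J" by (metis less_le_trans zero_less_mult_pos zero_less_one)
qed

text \<open>The rate that the admissibility of the weights lets grow to infinity: it compares the radius of the band, at least of order
  \<open>sqrt J / (sqrt n kmax wbar)\<close>, with the size of the noise beyond level \<open>J\<close>.\<close>

definition weight_rate :: "nat \<Rightarrow> (nat \<times> nat \<Rightarrow> real) \<Rightarrow> (nat \<Rightarrow> real) \<Rightarrow> nat \<Rightarrow> real" where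
  "weight_rate J0 \<kappa> w J = sqrt (real J) / (kmax J0 \<kappa> J * wbar J0 w J) * uJ \<kappa> w J"

lemma (in vaguelette_frame) \<kappa>_pos_all: "\<forall>i\<in>idx_inf J0. 0 < \<kappa> i"
  using \<kappa>_pos by blast

context sieve_model
begin

lemma noise_tail:
  assumes i: "i \<in> idx_inf J0" and t: "0 \<le> t"
  shows "measure M {\<omega> \<in> space M. t \<le> \<bar>noise i \<omega>\<bar>} \<le> sqrt 2 * exp (- (real n * t\<^sup>2) / (4 * b))"
proof -
  have r: "real n powr (- 1 / 2) = 1 / sqrt (real n)"
    using n_ge by (simp add: powr_minus_divide powr_half_sqrt[symmetric])
  have "t \<le> \<bar>noise i \<omega>\<bar> \<longleftrightarrow> sqrt (real n) * t \<le> \<bar>W (v1 i) \<omega>\<bar>" for \<omega>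
    unfolding noise_def r using n_ge by (simp add: abs_mult pos_le_divide_eq mult.commute)
  then have "measure M {\<omega> \<in> space M. t \<le> \<bar>noise i \<omega>\<bar>} = measure M {\<omega> \<in> space M. sqrt (real n) * t \<le> \<bar>W (v1 i) \<omega>\<bar>}" by simp
  also have "\<dots> \<le> sqrt 2 * exp (- (sqrt (real n) * t)\<^sup>2 / (4 * b))"
    using t by (intro white_noise_tail[OF wn frame_L2(1)[OF i] v1_le[OF i] b]) simp
  finally show ?thesis using n_ge by (simp add: power_mult_distrib)
qed

lemma T_upper_tail:
  assumes D: "0 \<le> D"
  shows "measure M {\<omega> \<in> space M. D / sqrt (real n) < T \<omega>} \<le> (\<Sum>i\<in>I. sqrt 2 * exp (- (D * \<kappa> i * w (fst i))\<^sup>2 / (4 * b)))"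
proof -
  let ?t = "\<lambda>i. D / sqrt (real n) * \<kappa> i * w (fst i)"
  have wp: "0 < w (fst i)" "0 < \<kappa> i" if "i \<in> I" for i
    using w_pos[of "fst i" "snd i"] \<kappa>_pos idx_mem[OF that] by auto
  have m: "{\<omega> \<in> space M. ?t i \<le> \<bar>noise i \<omega>\<bar>} \<in> sets M" if "i \<in> I" for i
    using noise_measurable[OF idx_mem[OF that]] by measurable
  have "{\<omega> \<in> space M. D / sqrt (real n) < T \<omega>} \<subseteq> (\<Union>i\<in>I. {\<omega> \<in> space M. ?t i \<le> \<bar>noise i \<omega>\<bar>})"
  proof
    fix \<omega> assume "\<omega> \<in> {\<omega> \<in> space M. D / sqrt (real n) < T \<omega>}"
    then have \<omega>: "\<omega> \<in> space M" "\<not> T \<omega> \<le> D / sqrt (real n)" by auto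
    then obtain i where i: "i \<in> I" "\<not> \<bar>noise i \<omega> / \<kappa> i\<bar> \<le> D / sqrt (real n) * w (fst i)" unfolding T_le_iff by blast
    then have "?t i \<le> \<bar>noise i \<omega>\<bar>" using wp[OF i(1)] by (simp add: not_le abs_divide pos_less_divide_eq mult_ac less_imp_le)
    then show "\<omega> \<in> (\<Union>i\<in>I. {\<omega> \<in> space M. ?t i \<le> \<bar>noise i \<omega>\<bar>})" using i \<omega> by blast
  qed
  then have "measure M {\<omega> \<in> space M. D / sqrt (real n) < T \<omega>} \<le> measure M (\<Union>i\<in>I. {\<omega> \<in> space M. ?t i \<le> \<bar>noise i \<omega>\<bar>})"
    using m by (intro M.finite_measure_mono) auto
  also have "\<dots> \<le> (\<Sum>i\<in>I. measure M {\<omega> \<in> space M. ?t i \<le> \<bar>noise i \<omega>\<bar>})"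
    by (rule measure_UNION_le[OF finite_idx m])
  also have "\<dots> \<le> (\<Sum>i\<in>I. sqrt 2 * exp (- (D * \<kappa> i * w (fst i))\<^sup>2 / (4 * b)))"
  proof (rule sum_mono)
    fix i assume i: "i \<in> I"
    have "measure M {\<omega> \<in> space M. ?t i \<le> \<bar>noise i \<omega>\<bar>} \<le> sqrt 2 * exp (- (real n * (?t i)\<^sup>2) / (4 * b))"
      using D wp[OF i] by (intro noise_tail idx_mem[OF i]) simp
    also have "real n * (?t i)\<^sup>2 = (D * \<kappa> i * w (fst i))\<^sup>2" using n_ge by (simp add: power_mult_distrib power_divide)
    finally show "measure M {\<omega> \<in> space M. ?t i \<le> \<bar>noise i \<omega>\<bar>} \<le> sqrt 2 * exp (- (D * \<kappa> i * w (fst i))\<^sup>2 / (4 * b))" .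
  qed
  finally show ?thesis .
qed

text \<open>If \<open>T\<close> is small, then so is every noise coordinate, uniformly over the resolved levels after bounding \<open>\<kappa>\<close> and \<open>w\<close> by
  their maxima.\<close>

lemma T_small_ball:
  assumes x: "0 \<le> x" and adm: "admissible_weights J0 \<kappa> w"
  shows "measure M {\<omega> \<in> space M. T \<omega> \<le> x / (sqrt (real n) * (kmax J0 \<kappa> J * wbar J0 w J))} \<le> measure std_normal_distribution {..x * sqrt b2} ^ 2 ^ J"
proof -
  note W = admissible_weightsD[OF adm J0_ge \<kappa>_pos_all J]
  let ?r = "x / (sqrt (real n) * (kmax J0 \<kappa> J * wbar J0 w J))"
  have r: "real n powr (- 1 / 2) = 1 / sqrt (real n)"
    using n_ge by (simp add: powr_minus_divide powr_half_sqrt[symmetric])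
  have m: "{\<omega> \<in> space M. \<forall>i\<in>I. \<bar>W (v1 i) \<omega>\<bar> \<le> x} \<in> sets M"
  proof (rule sets.sets_Collect_finite_All[OF _ finite_idx])
    fix i assume "i \<in> I"
    then have [measurable]: "W (v1 i) \<in> borel_measurable M" using white_noise_measurable[OF wn frame_L2(1)[OF idx_mem]] by blast
    show "{\<omega> \<in> space M. \<bar>W (v1 i) \<omega>\<bar> \<le> x} \<in> sets M" by measurable
  qed
  have "{\<omega> \<in> space M. T \<omega> \<le> ?r} \<subseteq> {\<omega> \<in> space M. \<forall>i\<in>I. \<bar>W (v1 i) \<omega>\<bar> \<le> x}"
  proof
    fix \<omega> assume \<omega>: "\<omega> \<in> {\<omega> \<in> space M. T \<omega> \<le> ?r}"
    have "\<bar>W (v1 i) \<omega>\<bar> \<le> x" if i: "i \<in> I" for i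
    proof -
      have k: "0 < \<kappa> i" "0 < w (fst i)" using \<kappa>_pos w_pos[of "fst i" "snd i"] idx_mem[OF i] by auto
      have "\<bar>noise i \<omega> / \<kappa> i\<bar> \<le> ?r * w (fst i)" using \<omega> i unfolding T_le_iff mem_Collect_eq by blast
      then have "\<bar>noise i \<omega>\<bar> \<le> ?r * (\<kappa> i * w (fst i))" using k by (simp add: abs_divide pos_divide_le_eq mult_ac)
      also have "\<dots> \<le> ?r * (kmax J0 \<kappa> J * wbar J0 w J)"
        using W(3,4)[OF i] W(5,6) k x by (intro mult_left_mono mult_mono) auto
      also have "\<dots> = x / sqrt (real n)" using W(5,6) by simp
      finally show ?thesis unfolding noise_def r using n_ge by (simp add: abs_mult divide_le_cancel)
    qed
    then show "\<omega> \<in> {\<omega> \<in> space M. \<forall>i\<in>I. \<bar>W (v1 i) \<omega>\<bar> \<le> x}" using \<omega> by auto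
  qed
  then have "measure M {\<omega> \<in> space M. T \<omega> \<le> ?r} \<le> measure M {\<omega> \<in> space M. \<forall>i\<in>I. \<bar>W (v1 i) \<omega>\<bar> \<le> x}"
    by (rule M.finite_measure_mono[OF _ m])
  also have "\<dots> \<le> measure std_normal_distribution {..x * sqrt b2} ^ card I"
    by (rule white_noise_small_ball[OF wn finite_idx _ _ _ x, where ?v2.0=v2])
      (auto intro!: frame_L2 v2_le idx_mem simp del: split_paired_All simp: biorthogonal[OF idx_mem idx_mem])
  finally show ?thesis by (simp add: card_I)
qed

lemma H3_eq: "H3 J \<psi> \<kappa> w f0 M Y R
    = {\<omega> \<in> space M. \<forall>i\<in>{(l, k). J \<le> l \<and> k < 2 ^ l}. \<bar>noise i \<omega> / \<kappa> i\<bar> \<le> R \<omega> * w (fst i)}"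
proof -
  have "(SUP (l, k)\<in>{(l, k). J \<le> l \<and> k < 2 ^ l}. ereal (\<bar>ip f0 (\<psi> (l, k)) - fhat \<kappa> (\<lambda>i. Y i \<omega>) (l, k)\<bar> / w l)) \<le> ereal (R \<omega>)
      \<longleftrightarrow> (\<forall>i\<in>{(l, k). J \<le> l \<and> k < 2 ^ l}. \<bar>noise i \<omega> / \<kappa> i\<bar> \<le> R \<omega> * w (fst i))" for \<omega>
    unfolding SUP_le_iff
  proof (rule ball_cong[OF refl])
    fix i :: "nat \<times> nat" assume i: "i \<in> {(l, k). J \<le> l \<and> k < 2 ^ l}"
    then have ii: "i \<in> idx_inf J0" using J idx_inf_split[OF J] by blast
    then have "0 < w (fst i)" using w_pos[of "fst i" "snd i"] by simp
    then show "((case i of (l, k) \<Rightarrow> ereal (\<bar>ip f0 (\<psi> (l, k)) - fhat \<kappa> (\<lambda>i. Y i \<omega>) (l, k)\<bar> / w l)) \<le> ereal (R \<omega>))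
        = (\<bar>noise i \<omega> / \<kappa> i\<bar> \<le> R \<omega> * w (fst i))"
      using fhat_eq[OF ii, of \<omega>] by (simp add: split_beta pos_divide_le_eq del: abs_divide)
  qed
  then show ?thesis unfolding H3_def by simp
qed

lemma H3_measurable:
  assumes R: "R \<in> borel_measurable M"
  shows "H3 J \<psi> \<kappa> w f0 M Y R \<in> sets M"
  unfolding H3_eq
proof (rule sets.sets_Collect_countable_All')
  fix i :: "nat \<times> nat" assume i: "i \<in> {(l, k). J \<le> l \<and> k < 2 ^ l}"
  then have "i \<in> idx_inf J0" using J idx_inf_split[OF J] by blast
  from noise_measurable[OF this] R
  show "{\<omega> \<in> space M. \<bar>noise i \<omega> / \<kappa> i\<bar> \<le> R \<omega> * w (fst i)} \<in> sets M" by measurable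
qed simp

lemma band_event_eq:
  "{\<omega> \<in> space M. f0 \<in> band J0 \<psi> w (fhat \<kappa> (\<lambda>i. Y i \<omega>)) (R \<omega>)}
    = {\<omega> \<in> space M. T \<omega> \<le> R \<omega>} \<inter> H3 J \<psi> \<kappa> w f0 M Y R"
proof -
  have "f0 \<in> band J0 \<psi> w (fhat \<kappa> (\<lambda>i. Y i \<omega>)) (R \<omega>) \<longleftrightarrow> (\<forall>i\<in>idx_inf J0. \<bar>noise i \<omega> / \<kappa> i\<bar> \<le> R \<omega> * w (fst i))" for \<omega>
  proof -
    have "f0 \<in> band J0 \<psi> w (fhat \<kappa> (\<lambda>i. Y i \<omega>)) (R \<omega>)
        \<longleftrightarrow> (\<forall>i\<in>idx_inf J0. (case i of (l, k) \<Rightarrow> ereal (\<bar>ip f0 (\<psi> (l, k)) - fhat \<kappa> (\<lambda>i. Y i \<omega>) (l, k)\<bar> / w l)) \<le> ereal (R \<omega>))"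
      using f0 by (simp add: band_def SUP_le_iff)
    also have "\<dots> \<longleftrightarrow> (\<forall>i\<in>idx_inf J0. \<bar>noise i \<omega> / \<kappa> i\<bar> \<le> R \<omega> * w (fst i))"
    proof (rule ball_cong[OF refl])
      fix i assume ii: "i \<in> idx_inf J0"
      then have "0 < w (fst i)" using w_pos[of "fst i" "snd i"] by simp
      then show "((case i of (l, k) \<Rightarrow> ereal (\<bar>ip f0 (\<psi> (l, k)) - fhat \<kappa> (\<lambda>i. Y i \<omega>) (l, k)\<bar> / w l)) \<le> ereal (R \<omega>))
          = (\<bar>noise i \<omega> / \<kappa> i\<bar> \<le> R \<omega> * w (fst i))"
        using fhat_eq[OF ii, of \<omega>] by (simp add: split_beta pos_divide_le_eq del: abs_divide)
    qed
    finally show ?thesis .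
  qed
  then show ?thesis unfolding T_le_iff H3_eq idx_inf_split[OF J] by (simp add: set_eq_iff ball_Un) blast
qed

text \<open>Under the assumed lower bound on the radius, a coefficient at level \<open>l \<ge> J\<close> exceeds its bound with probability at most
  \<open>sqrt 2 exp (- \<theta> \<rho>\<^sup>2 l)\<close> with \<open>\<rho>\<close> the weight rate.  The union over the \<open>2 ^ l\<close> positions costs \<open>exp (l ln 2)\<close>, which is absorbed by
  half of the exponent when \<open>\<theta> \<rho>\<^sup>2 \<ge> 2 ln 2\<close>; the rest is a geometric series.\<close>

lemma H3_complement_bound:
  assumes adm: "admissible_weights J0 \<kappa> w" and \<theta>: "\<theta> = ln 2 / (8 * b * b2)"
    and large: "2 * ln 2 \<le> \<theta> * (weight_rate J0 \<kappa> w J)\<^sup>2"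
    and R: "R \<in> borel_measurable M" and E: "E \<in> sets M"
    and RE: "\<And>\<omega>. \<omega> \<in> E \<Longrightarrow> sqrt (real J * ln 2 / 2) / sqrt b2 / (sqrt (real n) * (kmax J0 \<kappa> J * wbar J0 w J)) \<le> R \<omega>"
  shows "measure M (E - H3 J \<psi> \<kappa> w f0 M Y R) \<le> 3 * exp (- (\<theta> / 2) * real J * (weight_rate J0 \<kappa> w J)\<^sup>2)"
proof -
  note Wt = admissible_weightsD[OF adm J0_ge \<kappa>_pos_all J]
  define r where "r = sqrt (real J * ln 2 / 2) / sqrt b2 / (sqrt (real n) * (kmax J0 \<kappa> J * wbar J0 w J))"
  have r0: "0 \<le> r" unfolding r_def using Wt(5,6) b2 by simp
  let ?\<rho> = "weight_rate J0 \<kappa> w J"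
  define y where "y = exp (- (\<theta> / 2) * ?\<rho>\<^sup>2)"
  have "ln 2 \<le> \<theta> / 2 * ?\<rho>\<^sup>2" using large by simp
  then have "y \<le> exp (- ln 2)" unfolding y_def by simp
  then have y: "0 < y" "y \<le> 1 / 2" by (simp_all add: y_def exp_minus)
  have idx: "(l, k) \<in> idx_inf J0" if "J \<le> l" "k < 2 ^ l" for l k using that J by (auto simp: idx_inf_iff)
  let ?A = "\<lambda>l k. {\<omega> \<in> space M. r * (\<kappa> (l, k) * w l) \<le> \<bar>noise (l, k) \<omega>\<bar>}"
  have mA: "?A l k \<in> sets M" if "J \<le> l" "k < 2 ^ l" for l k
    using noise_measurable[OF idx[OF that]] by measurable
  have tail: "measure M (?A l k) \<le> sqrt 2 * exp (- \<theta> * ?\<rho>\<^sup>2) ^ l" if l: "J \<le> l" "k < 2 ^ l" for l k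
  proof -
    have u: "uJ \<kappa> w J * sqrt (real l) \<le> \<kappa> (l, k) * w l" by (rule Wt(2)[OF l])
    have u0: "0 \<le> uJ \<kappa> w J * sqrt (real l)" using Wt(7) by simp
    have "measure M (?A l k) \<le> sqrt 2 * exp (- (real n * (r * (\<kappa> (l, k) * w l))\<^sup>2) / (4 * b))"
      using u u0 r0 by (intro noise_tail idx[OF l]) simp
    also have "\<dots> \<le> sqrt 2 * exp (- (real n * (r * (uJ \<kappa> w J * sqrt (real l)))\<^sup>2) / (4 * b))"
      using u u0 r0 b by (intro mult_left_mono exp_le_cancel_iff[THEN iffD2] divide_right_mono le_imp_neg_le power_mono) auto
    also have "- (real n * (r * (uJ \<kappa> w J * sqrt (real l)))\<^sup>2) / (4 * b) = real l * (- \<theta> * ?\<rho>\<^sup>2)"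
      using b b2 n_ge Wt(5,6) unfolding r_def \<theta> weight_rate_def
      by (simp add: power_mult_distrib power_divide field_simps)
    also have "exp (real l * (- \<theta> * ?\<rho>\<^sup>2)) = exp (- \<theta> * ?\<rho>\<^sup>2) ^ l" by (rule exp_of_nat_mult)
    finally show ?thesis .
  qed
  define B where "B m = (\<Union>k\<in>{..<2 ^ (J + m)}. ?A (J + m) k)" for m
  have mB: "B m \<in> sets M" for m unfolding B_def using mA by (intro sets.finite_UN) auto
  have two: "2 * exp (- \<theta> * ?\<rho>\<^sup>2) \<le> y"
  proof -
    have "exp (- \<theta> * ?\<rho>\<^sup>2) = y * y" unfolding y_def exp_add[symmetric] by simp
    then show ?thesis using y by simp
  qed
  have Bb: "measure M (B m) \<le> sqrt 2 * y ^ J * y ^ m" for m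
  proof -
    have "measure M (B m) \<le> (\<Sum>k<2 ^ (J + m). measure M (?A (J + m) k))"
      unfolding B_def by (rule measure_UNION_le) (use mA in auto)
    also have "\<dots> \<le> (\<Sum>k<(2::nat) ^ (J + m). sqrt 2 * exp (- \<theta> * ?\<rho>\<^sup>2) ^ (J + m))"
      by (intro sum_mono tail) auto
    also have "\<dots> = sqrt 2 * (2 * exp (- \<theta> * ?\<rho>\<^sup>2)) ^ (J + m)" by (simp add: power_mult_distrib)
    also have "\<dots> \<le> sqrt 2 * y ^ (J + m)" using two by (intro mult_left_mono power_mono) auto
    finally show ?thesis by (simp add: power_add mult.assoc)
  qed
  have sumy: "(\<lambda>m. sqrt 2 * y ^ J * y ^ m) sums (sqrt 2 * y ^ J * (1 / (1 - y)))"
    using y by (intro sums_mult geometric_sums) auto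
  have summ: "summable (\<lambda>m. measure M (B m))"
    by (rule summable_comparison_test'[OF sums_summable[OF sumy]]) (use Bb in simp)
  have "E - H3 J \<psi> \<kappa> w f0 M Y R \<subseteq> (\<Union>m. B m)"
  proof
    fix \<omega> assume \<omega>: "\<omega> \<in> E - H3 J \<psi> \<kappa> w f0 M Y R"
    then have s: "\<omega> \<in> space M" using sets.sets_into_space[OF E] by blast
    then obtain i where i: "i \<in> {(l, k). J \<le> l \<and> k < 2 ^ l}" "\<not> \<bar>noise i \<omega> / \<kappa> i\<bar> \<le> R \<omega> * w (fst i)"
      using \<omega> unfolding H3_eq by blast
    obtain l k where lk: "i = (l, k)" by (cases i)
    then have l: "J \<le> l" "k < 2 ^ l" using i by auto
    have kp: "0 < \<kappa> (l, k)" "0 < w l" using \<kappa>_pos[OF idx[OF l]] w_pos[OF idx[OF l]] by auto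
    have "r \<le> R \<omega>" using RE \<omega> unfolding r_def by blast
    then have "r * w l \<le> R \<omega> * w l" using kp by simp
    also have "\<dots> < \<bar>noise (l, k) \<omega> / \<kappa> (l, k)\<bar>" using i lk by simp
    finally have "r * (\<kappa> (l, k) * w l) \<le> \<bar>noise (l, k) \<omega>\<bar>" using kp by (simp add: abs_divide pos_less_divide_eq mult_ac)
    then have "\<omega> \<in> B (l - J)" using s l by (auto simp: B_def)
    then show "\<omega> \<in> (\<Union>m. B m)" by blast
  qed
  then have "measure M (E - H3 J \<psi> \<kappa> w f0 M Y R) \<le> measure M (\<Union>m. B m)"
    using mB by (intro M.finite_measure_mono) auto
  also have "\<dots> \<le> (\<Sum>m. measure M (B m))"
    using mB summ by (intro M.finite_measure_subadditive_countably) auto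
  also have "\<dots> \<le> sqrt 2 * y ^ J * (1 / (1 - y))"
    using suminf_le[OF Bb summ sums_summable[OF sumy]] sums_unique[OF sumy] by simp
  also have "\<dots> \<le> 3 / 2 * y ^ J * 2"
  proof -
    have "sqrt 2 \<le> (3 / 2 :: real)" by (rule real_le_lsqrt) (simp_all add: power2_eq_square)
    moreover have "1 / (1 - y) \<le> 2" using y by (simp add: pos_divide_le_eq)
    ultimately show ?thesis using y by (intro mult_mono) auto
  qed
  also have "y ^ J = exp (- (\<theta> / 2) * real J * ?\<rho>\<^sup>2)"
    unfolding y_def by (simp add: exp_of_nat_mult[symmetric] mult_ac)
  finally show ?thesis by simp
qed

end

section \<open>Large truncation levels\<close>

context vaguelette_frame
begin

text \<open>What "sufficiently large \<open>J\<close>" has to provide, in terms that do not involve the sample size, the prior or the truth: the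
  small ball probability of \<open>T\<close> stays below \<open>(1 - \<alpha>) / 2\<close>, the union bound beyond level \<open>J\<close> is effective, and \<open>T\<close> exceeds \<open>D / sqrt n\<close> with
  probability at most \<open>\<alpha> / 2\<close> for some \<open>D\<close> that the weight rate at \<open>J - 1\<close> dominates.\<close>

definition large_level :: "real \<Rightarrow> (nat \<Rightarrow> real) \<Rightarrow> nat \<Rightarrow> bool" where
  "large_level \<alpha> w J \<longleftrightarrow> J0 < J
    \<and> measure std_normal_distribution {..sqrt (real J * ln 2 / 2)} ^ 2 ^ J < (1 - \<alpha>) / 2
    \<and> 2 * ln 2 \<le> ln 2 / (8 * b * b2) * (weight_rate J0 \<kappa> w J)\<^sup>2
    \<and> (\<exists>D>0. D \<le> weight_rate J0 \<kappa> w (J - 1)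
        \<and> (\<Sum>i\<in>idx J0 J. sqrt 2 * exp (- (D * \<kappa> i * w (fst i))\<^sup>2 / (4 * b))) \<le> \<alpha> / 2)"

text \<open>By admissibility \<open>\<kappa> w \<ge> u sqrt l\<close> at level \<open>l\<close>, so the \<open>2 ^ l\<close> terms of that level are geometrically small once
  \<open>D\<close> is large; the scaling level contributes \<open>2 ^ J0\<close> further terms.\<close>

lemma uniform_tail_radius:
  assumes adm: "admissible_weights J0 \<kappa> w" and \<alpha>: "0 < \<alpha>" "\<alpha> < 1"
  shows "\<exists>D>0. \<forall>J\<ge>J0. (\<Sum>i\<in>idx J0 J. sqrt 2 * exp (- (D * \<kappa> i * w (fst i))\<^sup>2 / (4 * b))) \<le> \<alpha> / 2"
proof -
  note Wt = admissible_weightsD[OF adm J0_ge \<kappa>_pos_all order_refl]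
  define u where "u = uJ \<kappa> w J0"
  have u: "0 < u" unfolding u_def by (rule Wt(7))
  define g where "g = (MIN k\<in>{..<(2::nat) ^ J0}. \<kappa> (J0 - 1, k) * w (J0 - 1))"
  have wJ: "0 < w (J0 - 1)" using J0_ge by (intro Wt(1)) simp
  have kp: "0 < \<kappa> (J0 - 1, k)" if "k < 2 ^ J0" for k using that by (intro \<kappa>_pos) (simp add: idx_inf_iff)
  have ne: "{..<(2::nat) ^ J0} \<noteq> {}" by (metis lessThan_empty_iff power_eq_0_iff zero_neq_numeral)
  have g: "0 < g" unfolding g_def using kp wJ ne by (subst Min_gr_iff) auto
  have gle: "g \<le> \<kappa> (J0 - 1, k) * w (J0 - 1)" if "k < 2 ^ J0" for k
    unfolding g_def using that by (intro Min_le) auto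
  define m where "m = min (u\<^sup>2) (g\<^sup>2)"
  have m: "0 < m" using u g by (simp add: m_def)
  \<comment> \<open>The wavelet levels sum to at most \<open>4 q sqrt 2\<close> and the scaling level to \<open>2 ^ J0 q sqrt 2\<close>.\<close>
  define q where "q = \<alpha> / (4 * (4 + 2 ^ J0))"
  have q: "0 < q" using \<alpha> by (simp add: q_def add_pos_pos)
  have q8: "q \<le> 1 / 8"
  proof -
    have "q \<le> 1 / (4 * (4 + 2 ^ J0))" unfolding q_def using \<alpha> by (intro divide_right_mono) auto
    also have "\<dots> \<le> 1 / 8"
    proof (rule frac_le)
      have "(0::real) < 2 ^ J0" by simp
      then have "0 < 128 + 32 * (2::real) ^ J0" by linarith
      then show "(8::real) \<le> 4 * (4 + 2 ^ J0)" by simp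
    qed auto
    finally show ?thesis .
  qed
  define L where "L = - ln q"
  have L: "0 < L" using q q8 by (simp add: L_def)
  have eL: "exp (- L) = q" using q by (simp add: L_def)
  \<comment> \<open>Chosen such that \<open>exp (- D\<^sup>2 m / (4 b)) = q\<close>.\<close>
  define D where "D = sqrt (4 * b * L / m)"
  have D: "0 < D" "D\<^sup>2 = 4 * b * L / m" using b L m by (simp_all add: D_def)
  have ex: "exp (- (D * c)\<^sup>2 / (4 * b)) \<le> exp (- L * t)" if "m * t \<le> c\<^sup>2" for c t
  proof -
    have "L * t = D\<^sup>2 * (m * t) / (4 * b)" using b m by (simp add: D)
    also have "\<dots> \<le> D\<^sup>2 * c\<^sup>2 / (4 * b)" using that b by (intro divide_right_mono mult_left_mono) auto
    finally show ?thesis by (simp add: power_mult_distrib)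
  qed
  have "(\<Sum>i\<in>idx J0 J. sqrt 2 * exp (- (D * \<kappa> i * w (fst i))\<^sup>2 / (4 * b))) \<le> \<alpha> / 2" if J: "J0 \<le> J" for J
  proof -
    have lvl: "sqrt 2 * exp (- (D * \<kappa> (l, k) * w l)\<^sup>2 / (4 * b)) \<le> sqrt 2 * q ^ l" if l: "J0 \<le> l" "k < 2 ^ l" for l k
    proof -
      have "u * sqrt (real l) \<le> \<kappa> (l, k) * w l" unfolding u_def by (rule Wt(2)[OF l])
      then have "(u * sqrt (real l))\<^sup>2 \<le> (\<kappa> (l, k) * w l)\<^sup>2" using u by (intro power_mono) auto
      moreover have "m * real l \<le> (u * sqrt (real l))\<^sup>2" by (simp add: power_mult_distrib m_def mult_right_mono)
      ultimately have "exp (- (D * (\<kappa> (l, k) * w l))\<^sup>2 / (4 * b)) \<le> exp (- L * real l)" by (intro ex) simp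
      also have "\<dots> = q ^ l" unfolding eL[symmetric] by (simp add: exp_of_nat_mult[symmetric] mult.commute)
      finally show ?thesis by (simp add: mult.assoc)
    qed
    have lv0: "sqrt 2 * exp (- (D * \<kappa> (J0 - 1, k) * w (J0 - 1))\<^sup>2 / (4 * b)) \<le> sqrt 2 * q" if k: "k < 2 ^ J0" for k
    proof -
      have "g\<^sup>2 \<le> (\<kappa> (J0 - 1, k) * w (J0 - 1))\<^sup>2" using gle[OF k] g by (intro power_mono) auto
      then have "exp (- (D * (\<kappa> (J0 - 1, k) * w (J0 - 1)))\<^sup>2 / (4 * b)) \<le> exp (- L * 1)" by (intro ex) (simp add: m_def)
      then show ?thesis by (simp add: eL mult.assoc)
    qed
    have "(\<Sum>i\<in>idx J0 J. sqrt 2 * exp (- (D * \<kappa> i * w (fst i))\<^sup>2 / (4 * b)))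
        = (\<Sum>l\<in>{J0..<J}. \<Sum>k<2 ^ l. sqrt 2 * exp (- (D * \<kappa> (l, k) * w l)\<^sup>2 / (4 * b)))
          + (\<Sum>k<2 ^ J0. sqrt 2 * exp (- (D * \<kappa> (J0 - 1, k) * w (J0 - 1))\<^sup>2 / (4 * b)))"
      using J0_ge by (subst sum_idx) auto
    also have "\<dots> \<le> (\<Sum>l\<in>{J0..<J}. \<Sum>k<(2::nat) ^ l. sqrt 2 * q ^ l) + (\<Sum>k<(2::nat) ^ J0. sqrt 2 * q)"
      using lvl lv0 by (intro add_mono sum_mono) auto
    also have "\<dots> = sqrt 2 * (\<Sum>l\<in>{J0..<J}. (2 * q) ^ l) + sqrt 2 * (2 ^ J0 * q)"
      by (simp add: sum_distrib_left power_mult_distrib mult_ac)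
    also have "(\<Sum>l\<in>{J0..<J}. (2 * q) ^ l) \<le> 4 * q"
    proof -
      have "(\<Sum>l\<in>{J0..<J}. (2 * q) ^ l) \<le> (2 * q) ^ J0 / (1 - 2 * q)" using q q8 by (intro sum_geometric_tail) auto
      also have "\<dots> \<le> (2 * q) / (1 / 2)"
      proof (rule frac_le)
        show "(2 * q) ^ J0 \<le> 2 * q" using power_decreasing[of 1 J0 "2 * q"] q q8 J0_ge by simp
      qed (use q q8 in auto)
      finally show ?thesis by simp
    qed
    also have "sqrt 2 * (4 * q) + sqrt 2 * (2 ^ J0 * q) = sqrt 2 * ((4 + 2 ^ J0) * q)" by (simp add: algebra_simps)
    also have "\<dots> \<le> 2 * ((4 + 2 ^ J0) * q)"
      using q by (intro mult_right_mono real_le_lsqrt mult_nonneg_nonneg) auto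
    also have "\<dots> = \<alpha> / 2"
    proof -
      have "(4 + 2 ^ J0 :: real) \<noteq> 0" using add_pos_pos[of 4 "2 ^ J0 :: real"] by simp
      then show ?thesis by (simp add: q_def field_simps)
    qed
    finally show ?thesis by simp
  qed
  then show ?thesis using D by blast
qed

text \<open>The upper tail of the normal law at this point is at least of order \<open>2 powr (- J / 2)\<close>, and the power \<open>2 ^ J\<close>
  overcomes it.\<close>

lemma small_ball_power_tendsto: "(\<lambda>J. measure std_normal_distribution {..sqrt (real J * ln 2 / 2)} ^ 2 ^ J) \<longlonglongrightarrow> 0"
proof -
  interpret N: prob_space std_normal_distribution by (rule prob_space_std_normal)
  define c where "c = exp (- 1) / sqrt (2 * pi)"
  have c: "0 < c" by (simp add: c_def)
  have bound: "measure std_normal_distribution {..sqrt (real J * ln 2 / 2)} ^ 2 ^ J \<le> exp (- (c * sqrt 2 ^ J))" for J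
  proof -
    let ?t = "sqrt (real J * ln 2 / 2)"
    let ?x = "exp (- ?t\<^sup>2 - 1) / sqrt (2 * pi)"
    have s2: "exp (- ?t\<^sup>2) * 2 ^ J = sqrt 2 ^ J"
    proof -
      have "exp (- ?t\<^sup>2) = exp (real J * (- (ln 2 / 2)))" by simp
      also have "\<dots> = exp (- (ln 2 / 2)) ^ J" by (rule exp_of_nat_mult)
      also have "\<dots> * 2 ^ J = (exp (- (ln 2 / 2)) * 2) ^ J" by (simp add: power_mult_distrib)
      also have "exp (- (ln 2 / 2)) * 2 = sqrt 2"
      proof -
        have "exp (- (ln 2 / 2)) * 2 = exp (- (ln 2 / 2)) * exp (ln (2::real))" by simp
        also have "\<dots> = exp (ln 2 / 2)" unfolding exp_add[symmetric] by simp
        also have "\<dots> = sqrt 2" by (simp add: powr_half_sqrt[symmetric] powr_def)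
        finally show ?thesis .
      qed
      finally show ?thesis .
    qed
    have "{..?t} = space std_normal_distribution - {?t<..}" by auto
    then have "measure std_normal_distribution {..?t} = 1 - measure std_normal_distribution {?t<..}"
      by (simp only:) (subst N.prob_compl, simp_all)
    also have "\<dots> \<le> 1 - ?x" using std_normal_upper_tail[of ?t] by simp
    also have "\<dots> \<le> exp (- ?x)" using exp_ge_add_one_self[of "- ?x"] by simp
    finally have "measure std_normal_distribution {..?t} ^ 2 ^ J \<le> exp (- ?x) ^ 2 ^ J"
      by (intro power_mono) auto
    also have "\<dots> = exp (real (2 ^ J) * - ?x)" by (rule exp_of_nat_mult[symmetric])
    also have "real (2 ^ J) * - ?x = - (c * (exp (- ?t\<^sup>2) * 2 ^ J))"
      unfolding c_def diff_conv_add_uminus exp_add of_nat_power of_nat_numeral by simp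
    finally show ?thesis unfolding s2 .
  qed
  have "filterlim (\<lambda>J. sqrt 2 ^ J :: real) at_top sequentially"
    using filterlim_at_infinity_imp_filterlim_at_top[OF filterlim_realpow_sequentially_gt1[of "sqrt 2"]] by simp
  then have "filterlim (\<lambda>J. c * sqrt 2 ^ J) at_top sequentially"
    using c by (intro filterlim_tendsto_pos_mult_at_top[OF tendsto_const])
  then have "filterlim (\<lambda>J. - (c * sqrt 2 ^ J)) at_bot sequentially" by (simp add: filterlim_uminus_at_top)
  then have lim: "(\<lambda>J. exp (- (c * sqrt 2 ^ J))) \<longlonglongrightarrow> 0" by (rule filterlim_compose[OF exp_at_bot])
  show ?thesis
    by (rule tendsto_sandwich[OF _ _ tendsto_const lim]) (auto intro!: always_eventually bound)
qed

lemma eventually_large_level: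
  assumes adm: "admissible_weights J0 \<kappa> w" and \<alpha>: "0 < \<alpha>" "\<alpha> < 1"
  shows "\<exists>J1. \<forall>J\<ge>J1. large_level \<alpha> w J"
proof -
  obtain D where D: "0 < D" "\<And>J. J0 \<le> J \<Longrightarrow> (\<Sum>i\<in>idx J0 J. sqrt 2 * exp (- (D * \<kappa> i * w (fst i))\<^sup>2 / (4 * b))) \<le> \<alpha> / 2"
    using uniform_tail_radius[OF adm \<alpha>] by blast
  have rate: "filterlim (weight_rate J0 \<kappa> w) at_top sequentially"
    using adm unfolding admissible_weights_def increases_to_infinity_def weight_rate_def[abs_def] by blast
  define \<theta> where "\<theta> = ln 2 / (8 * b * b2)"
  have \<theta>: "0 < \<theta>" using b b2 by (simp add: \<theta>_def)
  define r where "r = max 1 (max D (2 * ln 2 / \<theta>))"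
  obtain N1 where N1: "\<And>J. N1 \<le> J \<Longrightarrow> r \<le> weight_rate J0 \<kappa> w J"
    using rate unfolding filterlim_at_top eventually_sequentially by blast
  have "\<forall>\<^sub>F J in sequentially. measure std_normal_distribution {..sqrt (real J * ln 2 / 2)} ^ 2 ^ J < (1 - \<alpha>) / 2"
    using \<alpha> by (intro order_tendstoD(2)[OF small_ball_power_tendsto]) simp
  then obtain N2 where N2: "\<And>J. N2 \<le> J \<Longrightarrow> measure std_normal_distribution {..sqrt (real J * ln 2 / 2)} ^ 2 ^ J < (1 - \<alpha>) / 2"
    unfolding eventually_sequentially by blast
  have "large_level \<alpha> w J" if J: "Suc (max J0 (max N1 N2)) \<le> J" for J
    unfolding large_level_def
  proof (intro conjI exI[of _ D])
    show "J0 < J" using J by simp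
    show "measure std_normal_distribution {..sqrt (real J * ln 2 / 2)} ^ 2 ^ J < (1 - \<alpha>) / 2" using J by (intro N2) simp
    have "r \<le> weight_rate J0 \<kappa> w J" using J by (intro N1) simp
    then have ge: "1 \<le> weight_rate J0 \<kappa> w J" "2 * ln 2 / \<theta> \<le> weight_rate J0 \<kappa> w J" by (simp_all add: r_def)
    have "weight_rate J0 \<kappa> w J \<le> (weight_rate J0 \<kappa> w J)\<^sup>2" using ge(1) by (simp add: power2_eq_square)
    then have "2 * ln 2 / \<theta> \<le> (weight_rate J0 \<kappa> w J)\<^sup>2" using ge by linarith
    then show "2 * ln 2 \<le> ln 2 / (8 * b * b2) * (weight_rate J0 \<kappa> w J)\<^sup>2"
      unfolding \<theta>_def[symmetric] using \<theta> by (simp add: pos_divide_le_eq mult.commute)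
    have "r \<le> weight_rate J0 \<kappa> w (J - 1)" using J by (intro N1) simp
    then show "D \<le> weight_rate J0 \<kappa> w (J - 1)" by (simp add: r_def)
    show "(\<Sum>i\<in>idx J0 J. sqrt 2 * exp (- (D * \<kappa> i * w (fst i))\<^sup>2 / (4 * b))) \<le> \<alpha> / 2" using J by (intro D) simp
  qed (rule D)
  then show ?thesis by blast
qed

end

section \<open>Coverage and diameter of the band\<close>

text \<open>The radius \<open>R\<close> is the constant \<open>c1\<close> of the theorem times \<open>sqrt (2 ^ J ln n)\<close>; \<open>C0\<close> is the price of the
  evidence bound in excess of \<open>C1\<close>.\<close>

locale credible_band = sieve_model S J0 \<psi> v1 v2 K \<kappa> a b b2 M W f0 n J A w
  for S J0 \<psi> v1 v2 K \<kappa> a b b2 and M :: "'w measure" and W f0 n J A w +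
  fixes \<pi> :: "(nat \<times> nat \<Rightarrow> real) \<Rightarrow> real" and Rhat :: "'w \<Rightarrow> real" and \<alpha> C1 C0 R :: real
  assumes ab: "a \<le> b" and C0: "C0 = 3 / 2 + log 2 (b / a) / 2" and C1: "0 < C1"
    and R: "R = 8 * sqrt (C1 + C0 + 2) * sqrt (2 ^ J * ln (real n))"
    and \<alpha>: "0 < \<alpha>" "\<alpha> < 1" and \<pi>: "prior_density I \<pi>"
    and mass: "sqrt (mat_det I (mat_mul I (mat_transpose X) X)) * real n powr (- C1 * 2 ^ J) \<le> \<pi> b0"
    and flat: "flatness I X b0 \<pi> (1 / sqrt (real n)) \<le> 1 / 2"
    and Rhat: "Rhat \<in> borel_measurable M"
    and cred: "\<And>\<omega>. \<omega> \<in> space M \<Longrightarrow> credible_radius J0 \<psi> \<kappa> w J A \<pi> \<alpha> (\<lambda>i. Y i \<omega>) (Rhat \<omega>)"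
begin

text \<open>The event of moderate noise, on which the Gaussian approximation of the posterior is valid.\<close>

abbreviation "E \<equiv> {\<omega> \<in> space M. L2_set (eps \<omega>) I \<le> R / 4}"

lemmas E_prob = prob_large_eps(2)[OF ab C0 C1 R] and E_sets = prob_large_eps(3)[OF ab C0 C1 R]

lemma quantile_on_E:
  "\<omega> \<in> E \<Longrightarrow> \<bar>measure M {\<omega>' \<in> space M. T \<omega>' \<le> Rhat \<omega>} - (1 - \<alpha>)\<bar> \<le> flatness I X b0 \<pi> R + 3 * real n powr (- (2 ^ J))"
  using credible_radius_quantile[OF ab C0 C1 \<pi> mass flat R _ cred] by simp

text \<open>The truth lies in the band iff \<open>T \<le> Rhat\<close> and the event \<open>H3\<close> occurs; only the former has probability near \<open>1 - \<alpha>\<close>.\<close>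

lemma band_coverage:
  "\<bar>measure M {\<omega> \<in> space M. f0 \<in> band J0 \<psi> w (fhat \<kappa> (\<lambda>i. Y i \<omega>)) (Rhat \<omega>)} - (1 - \<alpha>)\<bar>
    \<le> flatness I X b0 \<pi> R + 4 * real n powr (- (2 ^ J)) + measure M (space M - H3 J \<psi> \<kappa> w f0 M Y Rhat)"
proof -
  let ?H = "H3 J \<psi> \<kappa> w f0 M Y Rhat" and ?T = "{\<omega> \<in> space M. T \<omega> \<le> Rhat \<omega>}"
  have p0: "0 < \<pi> b0" by (rule evidence_lower_bound(1)[OF ab C0 mass])
  have fl: "0 \<le> flatness I X b0 \<pi> R"
    by (rule flatness_facts(1)[where \<pi>=\<pi>, OF \<pi> prob_large_eps(1)[OF ab C0 C1 R] p0])
  note [measurable] = T_measurable Rhat E_sets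
  have Hs[measurable]: "?H \<in> sets M" by (rule H3_measurable[OF Rhat])
  have Ts[measurable]: "?T \<in> sets M" by measurable
  have "\<bar>measure M ?T - (1 - \<alpha>)\<bar> \<le> flatness I X b0 \<pi> R + 3 * real n powr (- (2 ^ J)) + real n powr (- (2 ^ J))"
    using \<alpha> fl by (intro coverage_of_approximate_quantile[OF M.prob_space_axioms T_measurable Rhat E_sets E_prob _ _ _ quantile_on_E]) auto
  moreover have "measure M (?T \<inter> ?H) \<le> measure M ?T" by (intro M.finite_measure_mono) auto
  moreover have "measure M ?T \<le> measure M (?T \<inter> ?H) + measure M (space M - ?H)"
  proof -
    have "measure M ?T \<le> measure M ((?T \<inter> ?H) \<union> (space M - ?H))" by (intro M.finite_measure_mono) auto
    also have "\<dots> \<le> measure M (?T \<inter> ?H) + measure M (space M - ?H)" by (intro measure_Un_le) auto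
    finally show ?thesis .
  qed
  ultimately show ?thesis unfolding band_event_eq by (simp add: abs_le_iff)
qed

text \<open>On \<open>E\<close> the radius is a quantile of \<open>T\<close> of order strictly between \<open>(1 - \<alpha>) / 2\<close> and \<open>1 - \<alpha> / 2\<close>.  It therefore lies
  above every point where the distribution function of \<open>T\<close> is below \<open>(1 - \<alpha>) / 2\<close>, and below every point where it is at least \<open>1 - \<alpha> / 2\<close>.\<close>

lemma radius_bounds:
  assumes adm: "admissible_weights J0 \<kappa> w" and large: "large_level \<alpha> w J"
    and small: "flatness I X b0 \<pi> R + 3 * real n powr (- (2 ^ J)) < min (\<alpha> / 2) ((1 - \<alpha>) / 2)" and \<omega>: "\<omega> \<in> E"
  shows "sqrt (real J * ln 2 / 2) / sqrt b2 / (sqrt (real n) * (kmax J0 \<kappa> J * wbar J0 w J)) \<le> Rhat \<omega>"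
    and "\<exists>D>0. D \<le> weight_rate J0 \<kappa> w (J - 1) \<and> Rhat \<omega> \<le> D / sqrt (real n)"
proof -
  let ?F = "\<lambda>r. measure M {\<omega>' \<in> space M. T \<omega>' \<le> r}"
  have [measurable]: "T \<in> borel_measurable M" by (rule T_measurable)
  have mono: "?F r \<le> ?F r'" if "r \<le> r'" for r r' using that by (intro M.finite_measure_mono) auto
  have F: "(1 - \<alpha>) / 2 < ?F (Rhat \<omega>)" "?F (Rhat \<omega>) < 1 - \<alpha> / 2"
    using quantile_on_E[OF \<omega>] small by (auto simp: abs_le_iff min_def field_simps split: if_splits)
  let ?x = "sqrt (real J * ln 2 / 2) / sqrt b2"
  let ?r = "?x / (sqrt (real n) * (kmax J0 \<kappa> J * wbar J0 w J))"
  have "?F ?r \<le> measure std_normal_distribution {..?x * sqrt b2} ^ 2 ^ J"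
    using b2 by (intro T_small_ball adm) simp
  also have "?x * sqrt b2 = sqrt (real J * ln 2 / 2)" using b2 by simp
  finally have "?F ?r < (1 - \<alpha>) / 2" using large unfolding large_level_def by linarith
  then show "?r \<le> Rhat \<omega>" using F(1) mono[of "Rhat \<omega>" ?r] by (cases "Rhat \<omega> \<le> ?r") auto
  obtain D where D: "0 < D" "D \<le> weight_rate J0 \<kappa> w (J - 1)"
    "(\<Sum>i\<in>I. sqrt 2 * exp (- (D * \<kappa> i * w (fst i))\<^sup>2 / (4 * b))) \<le> \<alpha> / 2"
    using large unfolding large_level_def by blast
  have "measure M {\<omega> \<in> space M. D / sqrt (real n) < T \<omega>} \<le> \<alpha> / 2"
    using T_upper_tail[of D] D by linarith
  moreover have "{\<omega> \<in> space M. D / sqrt (real n) < T \<omega>} = space M - {\<omega>' \<in> space M. T \<omega>' \<le> D / sqrt (real n)}" by auto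
  ultimately have "1 - ?F (D / sqrt (real n)) \<le> \<alpha> / 2" by (simp add: M.prob_compl)
  then have "Rhat \<omega> \<le> D / sqrt (real n)"
    using F(2) mono[of "D / sqrt (real n)" "Rhat \<omega>"] by (cases "Rhat \<omega> \<le> D / sqrt (real n)") auto
  then show "\<exists>D>0. D \<le> weight_rate J0 \<kappa> w (J - 1) \<and> Rhat \<omega> \<le> D / sqrt (real n)" using D by blast
qed

lemma H3_probability:
  assumes adm: "admissible_weights J0 \<kappa> w" and large: "large_level \<alpha> w J"
    and small: "flatness I X b0 \<pi> R + 3 * real n powr (- (2 ^ J)) < min (\<alpha> / 2) ((1 - \<alpha>) / 2)"
  shows "measure M (space M - H3 J \<psi> \<kappa> w f0 M Y Rhat)
    \<le> 3 * exp (- (ln 2 / (8 * b * b2) / 2) * real J * (real J / (kmax J0 \<kappa> J * wbar J0 w J)\<^sup>2) * (uJ \<kappa> w J)\<^sup>2)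
      + real n powr (- (2 ^ J))"
proof -
  let ?H = "H3 J \<psi> \<kappa> w f0 M Y Rhat"
  have Hs: "?H \<in> sets M" by (rule H3_measurable[OF Rhat])
  have rate: "(weight_rate J0 \<kappa> w J)\<^sup>2 = real J / (kmax J0 \<kappa> J * wbar J0 w J)\<^sup>2 * (uJ \<kappa> w J)\<^sup>2"
    by (simp add: weight_rate_def power_mult_distrib power_divide)
  have "measure M (E - ?H) \<le> 3 * exp (- (ln 2 / (8 * b * b2) / 2) * real J * (weight_rate J0 \<kappa> w J)\<^sup>2)"
  proof (rule H3_complement_bound[OF adm refl _ Rhat E_sets radius_bounds(1)[OF adm large small]])
    show "2 * ln 2 \<le> ln 2 / (8 * b * b2) * (weight_rate J0 \<kappa> w J)\<^sup>2" using large unfolding large_level_def by blast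
  qed
  moreover have "measure M (space M - ?H) \<le> measure M ((E - ?H) \<union> (space M - E))"
    using Hs E_sets by (intro M.finite_measure_mono) auto
  moreover have "measure M ((E - ?H) \<union> (space M - E)) \<le> measure M (E - ?H) + measure M (space M - E)"
    using Hs E_sets by (intro measure_Un_le) auto
  ultimately show ?thesis using E_prob unfolding rate by (simp only: mult.assoc)
qed

text \<open>The upper bound \<open>D / sqrt n\<close> on the radius is turned into the stated rate by \<open>D \<le> weight_rate (J - 1)\<close>: this
  trades \<open>D wbar (J - 1)\<close> for \<open>sqrt J vJ / kmin\<close>, because \<open>uJ (J - 1)\<close> is at most the ratio at level \<open>J - 1\<close>, which is one of those
  whose supremum is \<open>vJ J\<close>, and \<open>kmin \<le> kmax\<close>.  In this way the constant does not depend on the weights.\<close>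

lemma diameter_bound:
  assumes adm: "admissible_weights J0 \<kappa> w" and large: "large_level \<alpha> w J"
    and small: "flatness I X b0 \<pi> R + 3 * real n powr (- (2 ^ J)) < min (\<alpha> / 2) ((1 - \<alpha>) / 2)"
    and s: "0 < s" and C: "0 < C" "\<forall>l\<ge>J0. \<forall>x\<in>{0..1}. (\<Sum>k<2 ^ l. \<bar>\<psi> (l, k) x\<bar>) \<le> C * 2 powr (real l / 2)"
      "\<forall>x\<in>{0..1}. (\<Sum>k<2 ^ J0. \<bar>\<psi> (J0 - 1, k) x\<bar>) \<le> C * 2 powr (real J0 / 2)"
    and c: "8 * C \<le> c" "2 * C * 2 powr s / (1 - 2 powr (- s)) \<le> c"
    and B: "0 < B" and \<omega>: "\<omega> \<in> E"
    and f: "f \<in> band J0 \<psi> w (fhat \<kappa> (\<lambda>i. Y i \<omega>)) (Rhat \<omega>)" "besov_norm s J0 \<psi> f \<le> ereal B"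
    and g: "g \<in> band J0 \<psi> w (fhat \<kappa> (\<lambda>i. Y i \<omega>)) (Rhat \<omega>)" "besov_norm s J0 \<psi> g \<le> ereal B"
  shows "linfnorm (\<lambda>x. f x - g x)
    \<le> ereal (c * (vJ J0 \<kappa> w J * sqrt (2 ^ J * real J / ((kmin J0 \<kappa> J)\<^sup>2 * real n)) + 2 powr (- real J * s) * B))"
proof -
  have JJ: "J0 < J" using large unfolding large_level_def by blast
  then have J1: "J0 \<le> J - 1" by simp
  note Wt = admissible_weightsD[OF adm J0_ge \<kappa>_pos_all J]
  note W1 = admissible_weightsD[OF adm J0_ge \<kappa>_pos_all J1]
  have "0 \<le> sqrt (real J * ln 2 / 2) / sqrt b2 / (sqrt (real n) * (kmax J0 \<kappa> J * wbar J0 w J))"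
    using Wt(5,6) b2 by simp
  then have R0: "0 \<le> Rhat \<omega>" using radius_bounds(1)[OF adm large small \<omega>] by linarith
  obtain D where D: "0 < D" "D \<le> weight_rate J0 \<kappa> w (J - 1)" "Rhat \<omega> \<le> D / sqrt (real n)"
    using radius_bounds(2)[OF adm large small \<omega>] by blast
  let ?k = "kmax J0 \<kappa> (J - 1)" and ?W = "wbar J0 w (J - 1)" and ?u = "uJ \<kappa> w (J - 1)" and ?m = "kmin J0 \<kappa> J" and ?v = "vJ J0 \<kappa> w J"
  have m0: "0 < ?m"
    unfolding kmin_def using I_ne \<kappa>_pos idx_mem by (subst Min_gr_iff) auto
  have i0: "(J0 - 1, 0) \<in> I" "(J0 - 1, 0) \<in> idx J0 (J - 1)" by (simp_all add: idx_def)
  have "?m \<le> \<kappa> (J0 - 1, 0)" unfolding kmin_def using i0 by (intro Min_le) auto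
  also have "\<dots> \<le> ?k" by (rule W1(3)[OF i0(2)])
  finally have mk: "?m \<le> ?k" .
  have v: "?u * sqrt (real (J - 1)) \<le> sqrt (real (J - 1)) * ?v" and v0: "0 \<le> ?v"
  proof -
    let ?S = "{(l, k). J0 \<le> l \<and> l < J \<and> k < (2::nat) ^ l}"
    let ?f = "\<lambda>(l, k). \<kappa> (l, k) * w l / sqrt (real l)"
    have "?S = Sigma {J0..<J} (\<lambda>l. {..<2 ^ l})" by auto
    moreover have "finite (Sigma {J0..<J} (\<lambda>l. {..<(2::nat) ^ l}))" by (intro finite_SigmaI) auto
    ultimately have fin: "finite ?S" by (simp only:)
    have "?f (J - 1, 0) \<le> ?v" unfolding vJ_def using fin JJ by (intro cSUP_upper bdd_above_finite) auto
    moreover have u: "?u * sqrt (real (J - 1)) \<le> \<kappa> (J - 1, 0) * w (J - 1)" by (rule W1(2)) auto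
    moreover have sq: "0 < sqrt (real (J - 1))" using JJ J0_ge by simp
    ultimately have "\<kappa> (J - 1, 0) * w (J - 1) \<le> ?v * sqrt (real (J - 1))" by (simp add: pos_divide_le_eq)
    then show "?u * sqrt (real (J - 1)) \<le> sqrt (real (J - 1)) * ?v" using u by (simp add: mult.commute)
    then have "0 < sqrt (real (J - 1)) * ?v" using W1(7) sq by (meson less_le_trans mult_pos_pos)
    then show "0 \<le> ?v" using sq by (simp add: zero_less_mult_iff)
  qed
  have "D * (?k * ?W) \<le> sqrt (real (J - 1)) * ?u"
    using D(2) W1(5,6) unfolding weight_rate_def by (simp add: field_simps)
  also have "\<dots> \<le> sqrt (real (J - 1)) * ?v" using v by (simp add: mult.commute)
  also have "\<dots> \<le> sqrt (real J) * ?v" using v0 by (intro mult_right_mono) auto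
  finally have DkW: "D * (?k * ?W) \<le> sqrt (real J) * ?v" .
  have "D * ?W * ?m \<le> D * ?W * ?k" using mk D W1(6) by (intro mult_left_mono) auto
  then have "D * ?W * ?m \<le> sqrt (real J) * ?v" using DkW by (simp only: mult_ac)
  then have DW: "D * ?W \<le> sqrt (real J) * ?v / ?m" using m0 by (simp add: pos_le_divide_eq)
  have "Rhat \<omega> * ?W \<le> D / sqrt (real n) * ?W" using D(3) W1(6) by (intro mult_right_mono) auto
  also have "\<dots> \<le> sqrt (real J) * ?v / ?m / sqrt (real n)" unfolding times_divide_eq_left by (rule divide_right_mono[OF DW]) simp
  finally have "Rhat \<omega> * ?W * 2 powr (real J / 2) \<le> sqrt (real J) * ?v / ?m / sqrt (real n) * 2 powr (real J / 2)"
    by (intro mult_right_mono) auto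
  also have "\<dots> = ?v * sqrt (2 ^ J * real J / (?m\<^sup>2 * real n))"
  proof -
    have "2 powr (real J / 2) = sqrt (2 ^ J)" by (simp add: powr_half_sqrt[symmetric] powr_realpow[symmetric] powr_powr)
    then show ?thesis using m0 by (simp add: real_sqrt_mult real_sqrt_divide)
  qed
  finally have key: "Rhat \<omega> * ?W * 2 powr (real J / 2) \<le> ?v * sqrt (2 ^ J * real J / (?m\<^sup>2 * real n))" .
  have W0: "0 \<le> Rhat \<omega> * ?W * 2 powr (real J / 2)" using R0 W1(6) by simp
  have "linfnorm (\<lambda>x. f x - g x) \<le> ereal (8 * C * Rhat \<omega> * ?W * 2 powr (real J / 2)
        + 2 * C * 2 powr s / (1 - 2 powr (- s)) * (2 powr (- real J * s) * B))"
    using w B by (intro band_besov_diameter[OF CDV s JJ C _ R0 _ f g]) auto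
  also have "\<dots> \<le> ereal (c * (?v * sqrt (2 ^ J * real J / (?m\<^sup>2 * real n)) + 2 powr (- real J * s) * B))"
  proof -
    have "8 * C * Rhat \<omega> * ?W * 2 powr (real J / 2) = 8 * C * (Rhat \<omega> * ?W * 2 powr (real J / 2))" by simp
    also have "\<dots> \<le> c * (?v * sqrt (2 ^ J * real J / (?m\<^sup>2 * real n)))"
      by (rule mult_mono[OF c(1) key _ W0]) (use c(1) C(1) in linarith)
    finally have 1: "8 * C * Rhat \<omega> * ?W * 2 powr (real J / 2) \<le> c * (?v * sqrt (2 ^ J * real J / (?m\<^sup>2 * real n)))" .
    have 2: "2 * C * 2 powr s / (1 - 2 powr (- s)) * (2 powr (- real J * s) * B) \<le> c * (2 powr (- real J * s) * B)"
      using c(2) B by (intro mult_right_mono) auto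
    show ?thesis using add_mono[OF 1 2] by (simp only: ereal_less_eq distrib_left)
  qed
  finally show ?thesis .
qed

end

theorem proposition3p3:
  fixes s :: real and S J0 :: nat
    and \<psi> v1 v2 :: "nat \<times> nat \<Rightarrow> real \<Rightarrow> real"
    and K :: "(real \<Rightarrow> real) \<Rightarrow> real \<Rightarrow> real"
    and \<kappa> :: "nat \<times> nat \<Rightarrow> real"
  assumes "0 < s" "s < real S"
    and "CDV_basis S J0 \<psi>"
    and "L2_operator K"
    and "WVD J0 \<psi> K v1 v2 \<kappa>"
    and "mildly_ill_posed J0 \<kappa> \<or> severely_ill_posed J0 \<kappa>"
  shows "\<exists>(c1 :: real \<Rightarrow> real) (c2 :: real \<Rightarrow> real) (c3 :: real \<Rightarrow> real) (c4 :: real \<Rightarrow> real)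
            (Jmin :: real \<Rightarrow> (nat \<Rightarrow> real) \<Rightarrow> nat).
    (\<forall>C1>0. 0 < c1 C1 \<and> 0 < c2 C1) \<and>
    (\<forall>\<alpha>\<in>{0<..<1}. 0 < c3 \<alpha> \<and> 0 < c4 \<alpha>) \<and>
    (\<forall>(C1 :: real) (\<alpha> :: real) (J :: nat) (n :: nat) (f0 :: real \<Rightarrow> real) (w :: nat \<Rightarrow> real)
      (M :: 'w measure) (W :: (real \<Rightarrow> real) \<Rightarrow> 'w \<Rightarrow> real) (Y :: nat \<times> nat \<Rightarrow> 'w \<Rightarrow> real)
      (A :: nat \<times> nat \<Rightarrow> nat \<times> nat \<Rightarrow> real) (X :: nat \<times> nat \<Rightarrow> nat \<times> nat \<Rightarrow> real)
      (\<pi> :: (nat \<times> nat \<Rightarrow> real) \<Rightarrow> real) (Rhat :: 'w \<Rightarrow> real) (I :: (nat \<times> nat) set)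
      (b0 :: nat \<times> nat \<Rightarrow> real).
      0 < C1 \<longrightarrow> 0 < \<alpha> \<longrightarrow> \<alpha> < 1 \<longrightarrow> J0 \<le> J \<longrightarrow> 2 ^ J \<le> n \<longrightarrow> 2 \<le> n \<longrightarrow>
      f0 \<in> besov_space s J0 \<psi> \<longrightarrow>
      admissible_weights J0 \<kappa> w \<longrightarrow>
      white_noise M W \<longrightarrow>
      Y = Ytilde K v1 f0 n W \<longrightarrow>
      I = idx J0 J \<longrightarrow>
      is_inv_sqrt I (cov_mat M Y) A \<longrightarrow>
      X = design A \<kappa> \<longrightarrow>
      b0 = beta0 J0 \<psi> J f0 \<longrightarrow>
      prior_density I \<pi> \<longrightarrow>
      Rhat \<in> borel_measurable M \<longrightarrow>
      (\<forall>\<omega>\<in>space M. credible_radius J0 \<psi> \<kappa> w J A \<pi> \<alpha> (\<lambda>i. Y i \<omega>) (Rhat \<omega>)) \<longrightarrow>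
      \<pi> b0 \<ge> sqrt (mat_det I (mat_mul I (mat_transpose X) X)) * real n powr (- C1 * 2 ^ J) \<longrightarrow>
      flatness I X b0 \<pi> (1 / sqrt (real n)) \<le> 1 / 2 \<longrightarrow>
      \<bar>measure M {\<omega> \<in> space M. f0 \<in> band J0 \<psi> w (fhat \<kappa> (\<lambda>i. Y i \<omega>)) (Rhat \<omega>)} - (1 - \<alpha>)\<bar>
        \<le> flatness I X b0 \<pi> (c1 C1 * sqrt (2 ^ J * ln (real n))) + c1 C1 * real n powr (- c2 C1 * 2 ^ J)
          + measure M (space M - H3 J \<psi> \<kappa> w f0 M Y Rhat)
      \<and>
      (flatness I X b0 \<pi> (c1 C1 * sqrt (2 ^ J * ln (real n))) + c1 C1 * real n powr (- c2 C1 * 2 ^ J)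
          < min (\<alpha> / 2) ((1 - \<alpha>) / 2) \<longrightarrow>
       Jmin \<alpha> w \<le> J \<longrightarrow>
       measure M (space M - H3 J \<psi> \<kappa> w f0 M Y Rhat)
         \<le> c3 \<alpha> * (exp (- c4 \<alpha> * real J * (real J / (kmax J0 \<kappa> J * wbar J0 w J)\<^sup>2) * (uJ \<kappa> w J)\<^sup>2)
                   + real n powr (- c2 C1 * 2 ^ J))
       \<and>
       (\<forall>B>0. \<exists>E\<in>sets M. measure M E \<ge> 1 - c1 C1 * real n powr (- c2 C1 * 2 ^ J) \<and>
          (\<forall>\<omega>\<in>E. let C = band J0 \<psi> w (fhat \<kappa> (\<lambda>i. Y i \<omega>)) (Rhat \<omega>) \<inter> {f. besov_norm s J0 \<psi> f \<le> ereal B} in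
             (SUP (f, g)\<in>C \<times> C. linfnorm (\<lambda>x. f x - g x))
               \<le> ereal (c3 \<alpha> * (vJ J0 \<kappa> w J * sqrt (2 ^ J * real J / ((kmin J0 \<kappa> J)\<^sup>2 * real n))
                               + 2 powr (- real J * s) * B))))))"
proof -
  note s = assms(1) and CDV = assms(3) and oper = assms(4) and wvd = assms(5)
  have no: "near_orthogonal J0 v1" "near_orthogonal J0 v2" using wvd unfolding WVD_def by simp_all
  obtain a b where a: "0 < a" and b: "0 < b" and ab_bounds: "\<forall>F c. finite F \<and> F \<subseteq> idx_inf J0 \<longrightarrow>
      a * (\<Sum>i\<in>F. (c i)\<^sup>2) \<le> (l2norm (\<lambda>x. \<Sum>i\<in>F. c i * v1 i x))\<^sup>2 \<and>
      (l2norm (\<lambda>x. \<Sum>i\<in>F. c i * v1 i x))\<^sup>2 \<le> b * (\<Sum>i\<in>F. (c i)\<^sup>2)"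
    by (rule near_orthogonalE[OF no(1)])
  obtain a2 b2 where b2: "0 < b2" and v2_bounds: "\<forall>F c. finite F \<and> F \<subseteq> idx_inf J0 \<longrightarrow>
      a2 * (\<Sum>i\<in>F. (c i)\<^sup>2) \<le> (l2norm (\<lambda>x. \<Sum>i\<in>F. c i * v2 i x))\<^sup>2 \<and>
      (l2norm (\<lambda>x. \<Sum>i\<in>F. c i * v2 i x))\<^sup>2 \<le> b2 * (\<Sum>i\<in>F. (c i)\<^sup>2)"
    by (rule near_orthogonalE[OF no(2)])
  have frame: "vaguelette_frame S J0 \<psi> v1 v2 K \<kappa> a b b2"
  proof (rule vaguelette_frame.intro[OF CDV oper wvd a b b2])
    fix i assume "i \<in> idx_inf J0"
    then show "ip (v2 i) (v2 i) \<le> b2"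
      using v2_bounds[rule_format, of "{i}" "\<lambda>_. 1"] by (simp add: l2norm_square)
  qed (use ab_bounds in \<open>blast+\<close>)
  then interpret vaguelette_frame S J0 \<psi> v1 v2 K \<kappa> a b b2 .
  have ab: "a \<le> b"
    using ab_bounds[rule_format, of "{(J0, 0)}" "\<lambda>_. 1"] by (simp add: idx_inf_iff)
  obtain C where C: "0 < C" "\<forall>l\<ge>J0. \<forall>x\<in>{0..1}. (\<Sum>k<2 ^ l. \<bar>\<psi> (l, k) x\<bar>) \<le> C * 2 powr (real l / 2)"
      "\<forall>x\<in>{0..1}. (\<Sum>k<2 ^ J0. \<bar>\<psi> (J0 - 1, k) x\<bar>) \<le> C * 2 powr (real J0 / 2)"
    using CDV_basisD(5)[OF CDV] by blast
  define C0 where "C0 = 3 / 2 + log 2 (b / a) / 2"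
  have C0: "0 \<le> C0" using ab a by (simp add: C0_def)
  define c1 where "c1 C1 = 8 * sqrt (C1 + C0 + 2)" for C1
  define d where "d = 2 * C * 2 powr s / (1 - 2 powr (- s))"
  define c2 :: "real \<Rightarrow> real" where "c2 C1 = 1" for C1
  \<comment> \<open>The three summands dominate the factor in front of the tail bound, the band part and the Besov part of the diameter.\<close>
  define c3 where "c3 \<alpha> = 4 + 8 * C + d" for \<alpha> :: real
  define c4 where "c4 \<alpha> = ln 2 / (8 * b * b2) / 2" for \<alpha> :: real
  \<comment> \<open>The property \<open>large_level\<close> involves neither the sample size nor the prior, so \<open>Jmin\<close> is a function of \<open>\<alpha>\<close> and the weights.\<close>
  define Jmin where "Jmin \<alpha> w = (SOME J1. \<forall>J\<ge>J1. large_level \<alpha> w J)" for \<alpha> w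
  have d0: "0 \<le> d" using C(1) s powr_less_one[of 2 "- s"] by (simp add: d_def)
  have c1: "4 \<le> c1 C1" if "0 < C1" for C1
  proof -
    have "1 \<le> sqrt (C1 + C0 + 2)" using that C0 by simp
    then show ?thesis unfolding c1_def by linarith
  qed
  have c34: "4 \<le> c3 \<alpha>" "8 * C \<le> c3 \<alpha>" "d \<le> c3 \<alpha>" "0 < c4 \<alpha>" for \<alpha> using C(1) d0 b b2 by (simp_all add: c3_def c4_def)
  have Jmin: "large_level \<alpha> w J" if "admissible_weights J0 \<kappa> w" "0 < \<alpha>" "\<alpha> < 1" "Jmin \<alpha> w \<le> J" for \<alpha> w J
    by (rule someI_ex[OF eventually_large_level[OF that(1-3)], rule_format]) (use that(4) in \<open>simp only: Jmin_def\<close>)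
  show ?thesis
  proof (rule exI[of _ c1], rule exI[of _ c2], rule exI[of _ c3], rule exI[of _ c4], rule exI[of _ Jmin], intro conjI allI impI ballI)
    show "0 < c1 C1" if "0 < C1" for C1 using c1[OF that] by simp
    show "0 < c2 C1" for C1 by (simp add: c2_def)
    show "0 < c3 \<alpha>" for \<alpha> using c34(1)[of \<alpha>] by linarith
    show "0 < c4 \<alpha>" for \<alpha> by (rule c34)
  next
    fix C1 \<alpha> :: real and J n :: nat and f0 :: "real \<Rightarrow> real" and w :: "nat \<Rightarrow> real" and M :: "'w measure"
      and W :: "(real \<Rightarrow> real) \<Rightarrow> 'w \<Rightarrow> real" and Y :: "nat \<times> nat \<Rightarrow> 'w \<Rightarrow> real"
      and A X :: "nat \<times> nat \<Rightarrow> nat \<times> nat \<Rightarrow> real" and \<pi> :: "(nat \<times> nat \<Rightarrow> real) \<Rightarrow> real"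
      and Rhat :: "'w \<Rightarrow> real" and I :: "(nat \<times> nat) set" and b0 :: "nat \<times> nat \<Rightarrow> real"
    assume C1: "0 < C1" and \<alpha>: "0 < \<alpha>" "\<alpha> < 1" and J: "J0 \<le> J" and n: "2 ^ J \<le> n" "2 \<le> n"
      and f0: "f0 \<in> besov_space s J0 \<psi>" and adm: "admissible_weights J0 \<kappa> w" and wn: "white_noise M W"
      and Y: "Y = Ytilde K v1 f0 n W" and I: "I = idx J0 J" and A: "is_inv_sqrt I (cov_mat M Y) A"
      and X: "X = design A \<kappa>" and b0: "b0 = beta0 J0 \<psi> J f0" and \<pi>: "prior_density I \<pi>"
      and Rhat: "Rhat \<in> borel_measurable M"
      and cred: "\<forall>\<omega>\<in>space M. credible_radius J0 \<psi> \<kappa> w J A \<pi> \<alpha> (\<lambda>i. Y i \<omega>) (Rhat \<omega>)"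
      and mass: "\<pi> b0 \<ge> sqrt (mat_det I (mat_mul I (mat_transpose X) X)) * real n powr (- C1 * 2 ^ J)"
      and flat: "flatness I X b0 \<pi> (1 / sqrt (real n)) \<le> 1 / 2"
    have f0L: "f0 \<in> L2" using f0 by (simp add: besov_space_def)
    have w: "0 < w l" if "1 \<le> l" for l using adm that unfolding admissible_weights_def by blast
    interpret sieve_model S J0 \<psi> v1 v2 K \<kappa> a b b2 M W f0 n J A w
      by unfold_locales (use wn f0L J n A w in \<open>simp_all add: I Y\<close>)
    let ?R = "c1 C1 * sqrt (2 ^ J * ln (real n))"
    interpret credible_band S J0 \<psi> v1 v2 K \<kappa> a b b2 M W f0 n J A w \<pi> Rhat \<alpha> C1 C0 ?R
      by unfold_locales (use ab C0_def C1 c1_def \<alpha> \<pi> mass flat Rhat cred in \<open>simp_all add: I Y X b0\<close>)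
    let ?q = "real n powr (- (2 ^ J))"
    have q0: "0 \<le> ?q" by simp
    have e: "real n powr (- c2 C1 * 2 ^ J) = ?q" by (simp add: c2_def)
    have c1q: "4 * ?q \<le> c1 C1 * ?q" using c1[OF C1] q0 by (intro mult_right_mono)
    show "\<bar>measure M {\<omega> \<in> space M. f0 \<in> band J0 \<psi> w (fhat \<kappa> (\<lambda>i. Y i \<omega>)) (Rhat \<omega>)} - (1 - \<alpha>)\<bar>
        \<le> flatness I X b0 \<pi> (c1 C1 * sqrt (2 ^ J * ln (real n))) + c1 C1 * real n powr (- c2 C1 * 2 ^ J)
          + measure M (space M - H3 J \<psi> \<kappa> w f0 M Y Rhat)"
      using band_coverage c1q unfolding e I X b0 Y by linarith
    assume small0: "flatness I X b0 \<pi> (c1 C1 * sqrt (2 ^ J * ln (real n))) + c1 C1 * real n powr (- c2 C1 * 2 ^ J)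
        < min (\<alpha> / 2) ((1 - \<alpha>) / 2)" and JJ: "Jmin \<alpha> w \<le> J"
    have small: "flatness (idx J0 J) (design A \<kappa>) (beta0 J0 \<psi> J f0) \<pi> ?R + 3 * ?q < min (\<alpha> / 2) ((1 - \<alpha>) / 2)"
      using small0 c1q q0 unfolding e I X b0 by linarith
    have large: "large_level \<alpha> w J" by (rule Jmin[OF adm \<alpha> JJ])
    show "measure M (space M - H3 J \<psi> \<kappa> w f0 M Y Rhat)
        \<le> c3 \<alpha> * (exp (- c4 \<alpha> * real J * (real J / (kmax J0 \<kappa> J * wbar J0 w J)\<^sup>2) * (uJ \<kappa> w J)\<^sup>2)
                   + real n powr (- c2 C1 * 2 ^ J))"
    proof -
      let ?x = "exp (- c4 \<alpha> * real J * (real J / (kmax J0 \<kappa> J * wbar J0 w J)\<^sup>2) * (uJ \<kappa> w J)\<^sup>2)"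
      have "measure M (space M - H3 J \<psi> \<kappa> w f0 M Y Rhat) \<le> 3 * ?x + ?q"
        using H3_probability[OF adm large small] unfolding c4_def Y .
      also have "\<dots> \<le> c3 \<alpha> * ?x + c3 \<alpha> * ?q"
      proof -
        have "3 * ?x \<le> c3 \<alpha> * ?x" using c34(1)[of \<alpha>] by (intro mult_right_mono) auto
        moreover have "1 * ?q \<le> c3 \<alpha> * ?q" using c34(1)[of \<alpha>] by (intro mult_right_mono) auto
        ultimately show ?thesis by linarith
      qed
      finally show ?thesis unfolding e by (simp add: ring_distribs)
    qed
    fix B :: real assume B: "0 < B"
    let ?C = "\<lambda>\<omega>. band J0 \<psi> w (fhat \<kappa> (\<lambda>i. Y i \<omega>)) (Rhat \<omega>) \<inter> {f. besov_norm s J0 \<psi> f \<le> ereal B}"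
    show "\<exists>E\<in>sets M. measure M E \<ge> 1 - c1 C1 * real n powr (- c2 C1 * 2 ^ J) \<and>
          (\<forall>\<omega>\<in>E. let C = band J0 \<psi> w (fhat \<kappa> (\<lambda>i. Y i \<omega>)) (Rhat \<omega>) \<inter> {f. besov_norm s J0 \<psi> f \<le> ereal B} in
             (SUP (f, g)\<in>C \<times> C. linfnorm (\<lambda>x. f x - g x))
               \<le> ereal (c3 \<alpha> * (vJ J0 \<kappa> w J * sqrt (2 ^ J * real J / ((kmin J0 \<kappa> J)\<^sup>2 * real n))
                               + 2 powr (- real J * s) * B)))"
    proof (intro bexI[of _ "{\<omega> \<in> space M. L2_set (eps \<omega>) (idx J0 J) \<le> ?R / 4}"] conjI ballI)
      let ?E = "{\<omega> \<in> space M. L2_set (eps \<omega>) (idx J0 J) \<le> ?R / 4}"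
      show "?E \<in> sets M" by (rule E_sets)
      have "1 - measure M ?E \<le> ?q" using E_prob unfolding M.prob_compl[OF E_sets] .
      then show "1 - c1 C1 * real n powr (- c2 C1 * 2 ^ J) \<le> measure M ?E" using c1q q0 unfolding e by linarith
      fix \<omega> assume \<omega>: "\<omega> \<in> ?E"
      show "let C = band J0 \<psi> w (fhat \<kappa> (\<lambda>i. Y i \<omega>)) (Rhat \<omega>) \<inter> {f. besov_norm s J0 \<psi> f \<le> ereal B} in
             (SUP (f, g)\<in>C \<times> C. linfnorm (\<lambda>x. f x - g x))
               \<le> ereal (c3 \<alpha> * (vJ J0 \<kappa> w J * sqrt (2 ^ J * real J / ((kmin J0 \<kappa> J)\<^sup>2 * real n))
                               + 2 powr (- real J * s) * B))"
        unfolding Let_def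
      proof (rule SUP_least)
        fix p assume "p \<in> ?C \<omega> \<times> ?C \<omega>"
        then obtain f g where p: "p = (f, g)" and fg: "f \<in> ?C \<omega>" "g \<in> ?C \<omega>" by blast
        show "(case p of (f, g) \<Rightarrow> linfnorm (\<lambda>x. f x - g x))
            \<le> ereal (c3 \<alpha> * (vJ J0 \<kappa> w J * sqrt (2 ^ J * real J / ((kmin J0 \<kappa> J)\<^sup>2 * real n)) + 2 powr (- real J * s) * B))"
          unfolding p prod.case
          by (rule diameter_bound[OF adm large small s C c34(2) c34(3)[unfolded d_def] B \<omega>])
            (use fg in \<open>simp_all add: Y\<close>)
      qed
    qed
  qed
qed

end
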